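(* Let $\phi:[0,1]\to\mathbb{R}$ be a smooth function and let $g$ be a local function of configurations with dependence set $\{1,\dots,k\}$, $k\ge1$, such that $$\mathbb{E}\Big[\big((\tau_n g)[\eta]-\mathbb{E}((\tau_n g)[\eta]\mid\Theta=\theta)\big)^4\,\Big|\,\Theta=\theta\Big]<\infty$$ and $$\mathrm{Cov}\Big((\tau_n g)[\eta]-\mathbb{E}((\tau_n g)[\eta]\mid\Theta=\theta),\ (\tau_m g)[\eta]-\mathbb{E}((\tau_m g)[\eta]\mid\Theta=\theta)\,\Big|\,\Theta=\theta\Big)<\infty$$ for all $N\ge k$, all $n,m\in\{0,1,\dots,N-k\}$ and all $\theta\in[\theta_L,\theta_R]^N$. Then, in distribution as $N\to\infty$, $$\frac{1}{\sqrt N}\sum_{n=0}^{N-k}\big((\tau_n g)[\eta]-\mathbb{E}((\tau_n g)[\eta])\big)\,\phi\Big(\frac{n}{N+1}\Big)\ \longrightarrow\ \mathcal{N}(0,\sigma_T^2+\sigma_E^2),$$ where $$\sigma_T^2=(\theta_R-\theta_L)^2\int_0^1\int_0^1[s\wedge t-st]\,\phi(s)\phi(t)\,h'(\rho_{\theta_L,\theta_R}(s))\,h'(\rho_{\theta_L,\theta_R}(t))\,ds\,dt,$$ $$\sigma_E^2=\int_0^1V(\rho_{\theta_L,\theta_R}(x))\,\phi^2(x)\,dx,$$ and the functions $h,V:[\theta_L,\theta_R]\to\mathbb{R}$ are defined by $$h(\theta)=\mathbb{E}_{\theta}[g(\eta_1,\dots,\eta_k)],\qquad V(\theta)=\sum_{m=1}^{2k-1}\mathrm{Cov}_{\theta}\big(g(\eta_k,\dots,\eta_{2k-1}),\,g(\eta_m,\dots,\eta_{m+k-1})\big),$$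 where $\mathbb{E}_\theta,\mathrm{Cov}_\theta$ denote expectation and covariance when $\eta_1,\eta_2,\dots$ are i.i.d. with law $\nu_\theta$ (i.e. conditionally on all the corresponding random parameters being equal to $\theta$). In particular, for $g(\eta)=\eta_1$, in distribution as $N\to\infty$, $$\frac{1}{\sqrt N}\sum_{n=1}^{N}\big(\eta_{n,N}-\mathbb{E}(\eta_{n,N})\big)\,\phi\Big(\frac{n}{N+1}\Big)\ \longrightarrow\ (\theta_R-\theta_L)\int_0^1\phi(s)\,\overline{B}(s)\,ds+\mathcal{W}(\phi),$$ where $\{\overline{B}(s):0\le s\le1\}$ is a Brownian bridge and $\mathcal{W}(\phi)$ is an independent white noise (centered Gaussian) with variance $$\sigma_E^2=\int_0^1\mathrm{Var}\big(\eta_1\mid\Theta_{1,N}=\rho_{\theta_L,\theta_R}(x)\big)\,\phi^2(x)\,dx.$$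
   Context: $\mathbb{N}=\{0,1,2,\dots\}$. For $\theta\in[0,\infty)$, $\nu_\theta$ is the geometric distribution on $\mathbb{N}$ with mean $\theta$: $\nu_\theta(n)=\frac{1}{1+\theta}\big(\frac{\theta}{1+\theta}\big)^n$. Fix $0\le\theta_L<\theta_R$ and set $\rho_{\theta_L,\theta_R}(x)=\theta_L+(\theta_R-\theta_L)x$ for $x\in[0,1]$. For each $N\ge1$, let $\Theta=(\Theta_{1,N},\dots,\Theta_{N,N})$ be the order statistics (in non-decreasing order) of $N$ independent random variables uniformly distributed on $[\theta_L,\theta_R]$. The random configuration $\eta=(\eta_{1,N},\dots,\eta_{N,N})\in\mathbb{N}^N$ is such that, conditionally on $\Theta=(\theta_1,\dots,\theta_N)$, its law is $\otimes_{i=1}^N\nu_{\theta_i}$; quantities conditional on $\Theta=\theta$ are computed under $\otimes_{i=1}^N\nu_{\theta_i}$ (for any $\theta\in[\theta_L,\theta_R]^N$), and quantities conditional on $\Theta_{1,N}=\theta$ concerning $\eta_1$ alone are computed under $\nu_\theta$. A local function with dependence set $\{1,\dots,k\}$ is a function $g:\mathbb{N}^N\to\mathbb{R}$ ($N\ge k$) depending only on the first $k$ coordinates, i.e. a fixed function $g(\eta)=g(\eta_1,\dots,\eta_k)$, the same for all $N\ge k$. The shift is $(\tau_n g)[\eta]=g(\eta_{n+1},\dots,\eta_{n+k})$. $s\wedge t=\min(s,t)$; $h'$ is the derivative of $h$; $\mathcal{N}(0,\sigma^2)$ is the centered normal law with variance $\sigma^2$. *)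

theory Defs
  imports "HOL-Probability.Probability"
begin

text \<open>The library's geometric law is parametrised by its success probability, not by its mean.
  \<^term>\<open>geometric_pmf p\<close> is unspecified unless \<open>0 < p \<le> 1\<close>, so \<open>nu \<theta>\<close> is only meaningful for
  \<open>\<theta> \<ge> 0\<close>.\<close>

definition nu :: "real \<Rightarrow> nat pmf" where
  "nu \<theta> = geometric_pmf (1 / (1 + \<theta>))"

lemma pmf_nu:
  assumes "0 \<le> \<theta>"
  shows "pmf (nu \<theta>) n = 1 / (1 + \<theta>) * (\<theta> / (1 + \<theta>)) ^ n"
proof -
  have "1 - 1 / (1 + \<theta>) = \<theta> / (1 + \<theta>)"
    using assms by (simp add: field_simps)
  then show ?thesis
    using assms by (simp add: nu_def)
qed

text \<open>Configurations are functions on the index set \<open>{1..N}\<close>; sequences \<open>\<eta>\<^sub>1, \<eta>\<^sub>2, \<dots>\<close> are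
  functions on \<open>{1..}\<close>.\<close>

definition nu_prod :: "nat set \<Rightarrow> (nat \<Rightarrow> real) \<Rightarrow> (nat \<Rightarrow> nat) measure" where
  "nu_prod I \<theta> = (\<Pi>\<^sub>M i\<in>I. measure_pmf (nu (\<theta> i)))"

definition rho :: "real \<Rightarrow> real \<Rightarrow> real \<Rightarrow> real" where
  "rho \<theta>L \<theta>R x = \<theta>L + (\<theta>R - \<theta>L) * x"

text \<open>The underlying space is the interval itself rather than the real line, so that \<open>nu\<close> is
  never applied to a negative parameter and \<open>nu_prod\<close> is a measurable kernel on it.\<close>

definition uniform_law :: "real \<Rightarrow> real \<Rightarrow> real measure" where
  "uniform_law a b = restrict_space (uniform_measure lborel {a..b}) {a..b}"

definition order_stats :: "nat \<Rightarrow> (nat \<Rightarrow> real) \<Rightarrow> nat \<Rightarrow> real" where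
  "order_stats N u = (\<lambda>i\<in>{1..N}. sort (map u [1..<Suc N]) ! (i - 1))"

definition Theta_law :: "real \<Rightarrow> real \<Rightarrow> nat \<Rightarrow> (nat \<Rightarrow> real) measure" where
  "Theta_law \<theta>L \<theta>R N =
     distr (\<Pi>\<^sub>M i\<in>{1..N}. uniform_law \<theta>L \<theta>R) (\<Pi>\<^sub>M i\<in>{1..N}. uniform_law \<theta>L \<theta>R) (order_stats N)"

text \<open>The law of \<open>\<eta>\<close>, whose conditional law given \<open>\<Theta> = \<theta>\<close> is \<open>nu_prod {1..N} \<theta>\<close>.\<close>

definition config_law :: "real \<Rightarrow> real \<Rightarrow> nat \<Rightarrow> (nat \<Rightarrow> nat) measure" where
  "config_law \<theta>L \<theta>R N = Theta_law \<theta>L \<theta>R N \<bind> nu_prod {1..N}"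

definition local_function :: "nat \<Rightarrow> ((nat \<Rightarrow> nat) \<Rightarrow> real) \<Rightarrow> bool" where
  "local_function k g \<longleftrightarrow> (\<forall>\<eta> \<eta>'. (\<forall>i\<in>{1..k}. \<eta> i = \<eta>' i) \<longrightarrow> g \<eta> = g \<eta>')"

definition shift :: "nat \<Rightarrow> ((nat \<Rightarrow> nat) \<Rightarrow> real) \<Rightarrow> (nat \<Rightarrow> nat) \<Rightarrow> real" where
  "shift n g \<eta> = g (\<lambda>i. \<eta> (n + i))"

definition Cov :: "'a measure \<Rightarrow> ('a \<Rightarrow> real) \<Rightarrow> ('a \<Rightarrow> real) \<Rightarrow> real" where
  "Cov M X Y = (\<integral>\<omega>. (X \<omega> - (\<integral>\<omega>'. X \<omega>' \<partial>M)) * (Y \<omega> - (\<integral>\<omega>'. Y \<omega>' \<partial>M)) \<partial>M)"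

text \<open>Being total, \<open>Cov\<close> is always a real number, so its finiteness has to be expressed by
  integrability.\<close>

definition finite_Cov :: "'a measure \<Rightarrow> ('a \<Rightarrow> real) \<Rightarrow> ('a \<Rightarrow> real) \<Rightarrow> bool" where
  "finite_Cov M X Y \<longleftrightarrow> integrable M X \<and> integrable M Y \<and>
     integrable M (\<lambda>\<omega>. (X \<omega> - (\<integral>\<omega>'. X \<omega>' \<partial>M)) * (Y \<omega> - (\<integral>\<omega>'. Y \<omega>' \<partial>M)))"

definition h_fun :: "((nat \<Rightarrow> nat) \<Rightarrow> real) \<Rightarrow> real \<Rightarrow> real" where
  "h_fun g \<theta> = (\<integral>\<eta>. g \<eta> \<partial>nu_prod {1..} (\<lambda>_. \<theta>))"

text \<open>\<open>shift (k - 1) g\<close> reads the coordinates \<open>k, \<dots>, 2k - 1\<close> and \<open>shift (m - 1) g\<close> reads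
  \<open>m, \<dots>, m + k - 1\<close>.\<close>

definition V_fun :: "nat \<Rightarrow> ((nat \<Rightarrow> nat) \<Rightarrow> real) \<Rightarrow> real \<Rightarrow> real" where
  "V_fun k g \<theta> =
     (\<Sum>m = 1..2 * k - 1. Cov (nu_prod {1..} (\<lambda>_. \<theta>)) (shift (k - 1) g) (shift (m - 1) g))"

text \<open>Derivatives within \<open>{0..1}\<close> are one-sided at the endpoints.\<close>

definition smooth_on_unit :: "(real \<Rightarrow> real) \<Rightarrow> bool" where
  "smooth_on_unit f \<longleftrightarrow> (\<exists>D :: nat \<Rightarrow> real \<Rightarrow> real. (\<forall>x\<in>{0..1}. D 0 x = f x) \<and>
     (\<forall>n. \<forall>x\<in>{0..1}. (D n has_real_derivative D (Suc n) x) (at x within {0..1})))"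

text \<open>The case distinction is needed because \<^term>\<open>normal_density 0 0\<close> vanishes identically, so
  that its density is the null measure instead of the Dirac mass at 0.\<close>

definition normal_law :: "real \<Rightarrow> real measure" where
  "normal_law v =
     (if v = 0 then return borel 0 else density lborel (normal_density 0 (sqrt v)))"

definition sigma_T2 ::
    "real \<Rightarrow> real \<Rightarrow> (real \<Rightarrow> real) \<Rightarrow> ((nat \<Rightarrow> nat) \<Rightarrow> real) \<Rightarrow> real" where
  "sigma_T2 \<theta>L \<theta>R \<phi> g =
     (let h' = (\<lambda>\<theta>. vector_derivative (h_fun g) (at \<theta> within {\<theta>L..\<theta>R})) in
      (\<theta>R - \<theta>L)\<^sup>2 * (LBINT s:{0..1}. (LBINT t:{0..1}.
         (min s t - s * t) * \<phi> s * \<phi> t * h' (rho \<theta>L \<theta>R s) * h' (rho \<theta>L \<theta>R t))))"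

definition sigma_E2 ::
    "real \<Rightarrow> real \<Rightarrow> (real \<Rightarrow> real) \<Rightarrow> nat \<Rightarrow> ((nat \<Rightarrow> nat) \<Rightarrow> real) \<Rightarrow> real" where
  "sigma_E2 \<theta>L \<theta>R \<phi> k g = (LBINT x:{0..1}. V_fun k g (rho \<theta>L \<theta>R x) * (\<phi> x)\<^sup>2)"

text \<open>Joint Gaussianity is expressed through finite linear combinations.\<close>

definition centered_gaussian_process ::
    "'a measure \<Rightarrow> 'i set \<Rightarrow> ('i \<Rightarrow> 'i \<Rightarrow> real) \<Rightarrow> ('i \<Rightarrow> 'a \<Rightarrow> real) \<Rightarrow> bool" where
  "centered_gaussian_process P I C X \<longleftrightarrow>
     prob_space P \<and> (\<forall>i\<in>I. X i \<in> borel_measurable P) \<and>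
     (\<forall>F a. finite F \<and> F \<subseteq> I \<longrightarrow>
        distr P borel (\<lambda>\<omega>. \<Sum>i\<in>F. a i * X i \<omega>) =
        normal_law (\<Sum>i\<in>F. \<Sum>j\<in>F. a i * a j * C i j))"

definition brownian_bridge :: "'a measure \<Rightarrow> (real \<Rightarrow> 'a \<Rightarrow> real) \<Rightarrow> bool" where
  "brownian_bridge P B \<longleftrightarrow>
     centered_gaussian_process P {0..1} (\<lambda>s t. min s t - s * t) B \<and>
     (\<forall>\<omega>\<in>space P. continuous_on {0..1} (\<lambda>s. B s \<omega>))"

text \<open>White noise on \<open>[0,1]\<close> with variance density \<open>v\<close>, indexed by smooth test functions.\<close>

definition white_noise ::
    "'a measure \<Rightarrow> (real \<Rightarrow> real) \<Rightarrow> ((real \<Rightarrow> real) \<Rightarrow> 'a \<Rightarrow> real) \<Rightarrow> bool" where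
  "white_noise P v W \<longleftrightarrow>
     centered_gaussian_process P (Collect smooth_on_unit)
       (\<lambda>\<phi> \<psi>. LBINT x:{0..1}. v x * (\<phi> x * \<psi> x)) W"

definition independent_processes ::
    "'a measure \<Rightarrow> 'i set \<Rightarrow> ('i \<Rightarrow> 'a \<Rightarrow> real) \<Rightarrow> 'j set \<Rightarrow> ('j \<Rightarrow> 'a \<Rightarrow> real) \<Rightarrow> bool" where
  "independent_processes P I X J Y \<longleftrightarrow>
     prob_space.indep_set P
       (sets (vimage_algebra (space P) (\<lambda>\<omega>. \<lambda>i\<in>I. X i \<omega>) (\<Pi>\<^sub>M i\<in>I. borel)))
       (sets (vimage_algebra (space P) (\<lambda>\<omega>. \<lambda>j\<in>J. Y j \<omega>) (\<Pi>\<^sub>M j\<in>J. borel)))"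

text \<open>For the finitely many \<open>N < k\<close> the upper summation bound is truncated to 0; this does not
  affect limits.\<close>

definition fluctuation ::
    "real \<Rightarrow> real \<Rightarrow> (real \<Rightarrow> real) \<Rightarrow> nat \<Rightarrow> ((nat \<Rightarrow> nat) \<Rightarrow> real) \<Rightarrow> nat \<Rightarrow> (nat \<Rightarrow> nat) \<Rightarrow> real" where
  "fluctuation \<theta>L \<theta>R \<phi> k g N \<eta> =
     1 / sqrt (real N) * (\<Sum>n = 0..N - k.
       (shift n g \<eta> - (\<integral>\<zeta>. shift n g \<zeta> \<partial>config_law \<theta>L \<theta>R N)) * \<phi> (real n / real (N + 1)))"

end

(* Conditionally on the order statistics the coordinates of eta are independent, so the
   fluctuation splits into a sum of k-dependent terms, conditionally centred, and the fluctuation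
   of the conditional means.

   Up to O(1), the conditional mean is the L-statistic sum_i phi(i/N) h(Theta_i): consecutive
   order statistics inside a window may be identified, since the errors telescope.  Writing h as an
   integral of its derivative turns this L-statistic into an integral of the empirical bridge, hence
   into an i.i.d. sum with variance sigma_T^2, up to the mean square of the empirical discrepancy.

   The conditional variance is in the same way an L-statistic for V and concentrates at
   N sigma_E^2, so that the conditional characteristic function of the k-dependent sum is
   asymptotically the constant exp(-sigma_E^2 t^2/2), by the Stein-Tikhomirov method.  Both h and V
   are differentiable because all laws nu_theta with theta in [0, theta_R] have bounded densities
   with respect to nu_{theta_R}.  Multiplying the two limits gives the characteristic function of
   the fluctuation, and Levy's theorem concludes. *)

theory Submission
  imports Defs
begin

section \<open>Integrals and characteristic exponents\<close>

text \<open>Order statistics are dependent, so no limit theorem for independent variables applies to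
  them directly. The way out is that \<open>order_stats N u i \<le> x\<close> is equivalent to
  \<open>i \<le> count_le N u x\<close>, and the count is a symmetric sum of independent indicators.
  Conditioning is handled without conditional expectations: \<open>config_law\<close> is a
  \<open>bind\<close>, so every expectation is an iterated integral, first over the configuration
  given the parameters and then over the parameters. It therefore suffices that the inner
  characteristic function is close in L1 to a deterministic phase times a constant. Fourth moments
  of \<open>g\<close> enter because differentiating a geometric weight brings down a factor
  \<open>1 + n\<close>. Paired with an observable this asks for square integrability, and the
  observables behind \<open>V\<close> are products of two shifts of \<open>g\<close>. Each
  replacement inside a sum of N terms costs O(1), or O(sqrt N) in the conditional variance, whose
  scale is N. After normalisation every error is O(1 / sqrt N) for fixed argument of the
  characteristic function.\<close>

lemma has_vector_derivative_iff_slope: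
  "(f has_vector_derivative D) (at x within S) \<longleftrightarrow>
    ((\<lambda>y. (1 / (y - x)) *\<^sub>R (f y - f x)) \<longlongrightarrow> D) (at x within S)"
proof -
  have "((\<lambda>y. (1 / (y - x)) *\<^sub>R (f y - f x)) \<longlongrightarrow> D) (at x within S) \<longleftrightarrow>
      ((\<lambda>y. norm ((1 / (y - x)) *\<^sub>R (f y - f x) - D)) \<longlongrightarrow> 0) (at x within S)"
    by (subst LIM_zero_iff[symmetric]) (rule tendsto_norm_zero_iff[symmetric])
  also have "\<dots> \<longleftrightarrow> ((\<lambda>y. norm ((1 / norm (y - x)) *\<^sub>R (f y - (f x + (y - x) *\<^sub>R D)))) \<longlongrightarrow> 0) (at x within S)"
  proof (rule tendsto_cong)
    have "norm ((1 / (y - x)) *\<^sub>R (f y - f x) - D) = norm ((1 / norm (y - x)) *\<^sub>R (f y - (f x + (y - x) *\<^sub>R D)))"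
      if "y \<noteq> x" for y
    proof -
      have "(1 / (y - x)) *\<^sub>R (f y - f x) - D = (1 / (y - x)) *\<^sub>R (f y - (f x + (y - x) *\<^sub>R D))"
        using that by (simp add: scaleR_right_diff_distrib scaleR_right_distrib)
      then show ?thesis by simp
    qed
    then show "\<forall>\<^sub>F y in at x within S. norm ((1 / (y - x)) *\<^sub>R (f y - f x) - D) =
        norm ((1 / norm (y - x)) *\<^sub>R (f y - (f x + (y - x) *\<^sub>R D)))"
      by (auto simp: eventually_at_filter)
  qed
  also have "\<dots> \<longleftrightarrow> (f has_vector_derivative D) (at x within S)"
    unfolding has_vector_derivative_def has_derivative_within tendsto_norm_zero_iff
    by (simp add: bounded_linear_scaleR_left)
  finally show ?thesis by simp
qed

text \<open>The mean value inequality on the convex set \<open>S\<close> bounds the difference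
  quotients by \<open>G\<close>, and dominated convergence along sequences gives the limit.
  Derivatives are taken within \<open>S\<close>, which allows the whole line for characteristic
  functions and a closed interval, with one-sided derivatives at its ends, for parameters.\<close>

lemma integral_has_vector_derivative_within:
  fixes F F' :: "real \<Rightarrow> 'a \<Rightarrow> 'b::{banach,second_countable_topology}"
  assumes S: "convex S" "x \<in> S"
    and int: "\<And>y. y \<in> S \<Longrightarrow> integrable M (F y)"
    and der: "\<And>y \<omega>. y \<in> S \<Longrightarrow> \<omega> \<in> space M \<Longrightarrow>
      ((\<lambda>y. F y \<omega>) has_vector_derivative F' y \<omega>) (at y within S)"
    and meas: "F' x \<in> borel_measurable M"
    and bound: "\<And>y \<omega>. y \<in> S \<Longrightarrow> \<omega> \<in> space M \<Longrightarrow> norm (F' y \<omega>) \<le> G \<omega>"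
    and G: "integrable M G"
  shows "((\<lambda>y. \<integral>\<omega>. F y \<omega> \<partial>M) has_vector_derivative (\<integral>\<omega>. F' x \<omega> \<partial>M)) (at x within S)"
proof -
  have lip: "norm (F y \<omega> - F x \<omega>) \<le> G \<omega> * \<bar>y - x\<bar>" if "y \<in> S" "\<omega> \<in> space M" for y \<omega>
  proof -
    have "norm (F y \<omega> - F x \<omega>) \<le> G \<omega> * norm (y - x)"
    proof (rule differentiable_bound[OF S(1)])
      fix z assume z: "z \<in> S"
      show "((\<lambda>y. F y \<omega>) has_derivative (\<lambda>h. h *\<^sub>R F' z \<omega>)) (at z within S)"
        using der[OF z that(2)] by (simp add: has_vector_derivative_def)
      show "onorm (\<lambda>h. h *\<^sub>R F' z \<omega>) \<le> G \<omega>"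
        using bound[OF z that(2)] by (intro onorm_le) (simp add: mult.commute[of _ "\<bar>_\<bar>"] mult_left_mono)
    qed (use that S in auto)
    then show ?thesis by simp
  qed
  have "((\<lambda>y. (1 / (y - x)) *\<^sub>R ((\<integral>\<omega>. F y \<omega> \<partial>M) - (\<integral>\<omega>. F x \<omega> \<partial>M)))
      \<longlongrightarrow> (\<integral>\<omega>. F' x \<omega> \<partial>M)) (at x within S)"
    unfolding tendsto_at_iff_sequentially
  proof (intro allI impI)
    fix X :: "nat \<Rightarrow> real" assume X: "\<forall>i. X i \<in> S - {x}" "X \<longlonglongrightarrow> x"
    have Xf: "filterlim X (at x within S) sequentially"
      using X by (auto simp: filterlim_at)
    have "(\<lambda>i. \<integral>\<omega>. (1 / (X i - x)) *\<^sub>R (F (X i) \<omega> - F x \<omega>) \<partial>M) \<longlonglongrightarrow> (\<integral>\<omega>. F' x \<omega> \<partial>M)"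
    proof (rule integral_dominated_convergence[OF meas _ G])
      show "(\<lambda>\<omega>. (1 / (X i - x)) *\<^sub>R (F (X i) \<omega> - F x \<omega>)) \<in> borel_measurable M" for i
        using int[of "X i"] int[OF S(2)] X by (auto dest!: borel_measurable_integrable)
      show "AE \<omega> in M. (\<lambda>i. (1 / (X i - x)) *\<^sub>R (F (X i) \<omega> - F x \<omega>)) \<longlonglongrightarrow> F' x \<omega>"
      proof (rule AE_I2)
        fix \<omega> assume \<omega>: "\<omega> \<in> space M"
        have "((\<lambda>y. (1 / (y - x)) *\<^sub>R (F y \<omega> - F x \<omega>)) \<longlongrightarrow> F' x \<omega>) (at x within S)"
          using der[OF S(2) \<omega>] by (simp add: has_vector_derivative_iff_slope)
        from filterlim_compose[OF this Xf]
        show "(\<lambda>i. (1 / (X i - x)) *\<^sub>R (F (X i) \<omega> - F x \<omega>)) \<longlonglongrightarrow> F' x \<omega>" .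
      qed
      show "AE \<omega> in M. norm ((1 / (X i - x)) *\<^sub>R (F (X i) \<omega> - F x \<omega>)) \<le> G \<omega>" for i
      proof (rule AE_I2)
        fix \<omega> assume \<omega>: "\<omega> \<in> space M"
        show "norm ((1 / (X i - x)) *\<^sub>R (F (X i) \<omega> - F x \<omega>)) \<le> G \<omega>"
          using lip[of "X i" \<omega>] X \<omega>
          by (simp add: pos_divide_le_eq divide_inverse_commute[symmetric] del: scaleR_right_diff_distrib)
      qed
    qed
    also have "(\<lambda>i. \<integral>\<omega>. (1 / (X i - x)) *\<^sub>R (F (X i) \<omega> - F x \<omega>) \<partial>M) =
       (\<lambda>y. (1 / (y - x)) *\<^sub>R ((\<integral>\<omega>. F y \<omega> \<partial>M) - (\<integral>\<omega>. F x \<omega> \<partial>M))) \<circ> X"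
      using int X S by (auto simp: fun_eq_iff)
    finally show "((\<lambda>y. (1 / (y - x)) *\<^sub>R ((\<integral>\<omega>. F y \<omega> \<partial>M) - (\<integral>\<omega>. F x \<omega> \<partial>M))) \<circ> X)
      \<longlonglongrightarrow> (\<integral>\<omega>. F' x \<omega> \<partial>M)" .
  qed
  then show ?thesis
    by (simp add: has_vector_derivative_iff_slope)
qed

text \<open>A non-integrable \<open>f\<close> has Bochner integral 0 by convention, and the majorant
  has a nonnegative integral. So integrability has to be checked for the majorant alone.\<close>

lemma norm_integral_le:
  fixes f :: "'a \<Rightarrow> 'b::{banach,second_countable_topology}"
  assumes g: "integrable M g" and le: "\<And>x. x \<in> space M \<Longrightarrow> norm (f x) \<le> g x"
  shows "norm (\<integral>x. f x \<partial>M) \<le> (\<integral>x. g x \<partial>M)"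
proof (cases "integrable M f")
  case True
  have "norm (\<integral>x. f x \<partial>M) \<le> (\<integral>x. norm (f x) \<partial>M)" by (rule integral_norm_bound)
  also have "\<dots> \<le> (\<integral>x. g x \<partial>M)"
    using True g le by (intro integral_mono) auto
  finally show ?thesis .
next
  case False
  have "0 \<le> (\<integral>x. g x \<partial>M)"
    by (rule Bochner_Integration.integral_nonneg) (metis le norm_ge_zero order_trans)
  then show ?thesis by (simp add: not_integrable_integral_eq[OF False])
qed

text \<open>The coordinates are independent under a product measure, hence so are functions of
  disjoint blocks of coordinates. Invariance under \<open>restrict\<close> says that a function
  defined on all of the space reads its own block only.\<close>

lemma integral_PiM_mult:
  fixes f g :: "('i \<Rightarrow> 'a) \<Rightarrow> 'b::{real_normed_field, banach, second_countable_topology}"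
  assumes M: "\<And>i. i \<in> I \<Longrightarrow> prob_space (M i)" and "I \<noteq> {}"
    and AB: "A \<inter> B = {}" "A \<subseteq> I" "B \<subseteq> I"
    and f: "f \<in> borel_measurable (PiM A M)" "\<And>\<omega>. f (restrict \<omega> A) = f \<omega>"
    and g: "g \<in> borel_measurable (PiM B M)" "\<And>\<omega>. g (restrict \<omega> B) = g \<omega>"
    and int: "integrable (PiM I M) f" "integrable (PiM I M) g"
  shows "(\<integral>\<omega>. f \<omega> * g \<omega> \<partial>PiM I M) = (\<integral>\<omega>. f \<omega> \<partial>PiM I M) * (\<integral>\<omega>. g \<omega> \<partial>PiM I M)"
proof -
  interpret P: prob_space "PiM I M" by (rule prob_space_PiM) (use M in auto)
  have "P.indep_vars M (\<lambda>i \<omega>. \<omega> i) I"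
  proof (subst P.indep_vars_iff_distr_eq_PiM'[OF \<open>I \<noteq> {}\<close>])
    have "distr (Pi\<^sub>M I M) (Pi\<^sub>M I M) (\<lambda>x. \<lambda>i\<in>I. x i) = distr (Pi\<^sub>M I M) (Pi\<^sub>M I M) (\<lambda>x. x)"
      by (rule distr_cong) (auto simp: space_PiM)
    also have "\<dots> = PiM I (\<lambda>i. distr (PiM I M) (M i) (\<lambda>\<omega>. \<omega> i))"
      by (simp add: distr_PiM_component M cong: PiM_cong)
    finally show "distr (Pi\<^sub>M I M) (Pi\<^sub>M I M) (\<lambda>x. \<lambda>i\<in>I. x i) =
       PiM I (\<lambda>i. distr (PiM I M) (M i) (\<lambda>\<omega>. \<omega> i))" .
  qed simp
  from P.indep_var_compose[OF P.indep_var_restrict[OF this AB] f(1) g(1)]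
  have "P.indep_var borel f borel g"
    by (simp add: comp_def f(2) g(2))
  then show ?thesis
    by (rule P.indep_var_lebesgue_integral) (fact int)+
qed

lemma cmod_iexp_diff_le: "cmod (iexp x - iexp y) \<le> \<bar>x - y\<bar>"
proof -
  have "iexp x - iexp y = iexp y * (iexp (x - y) - 1)"
    by (simp add: right_diff_distrib exp_diff)
  moreover have "cmod (iexp (x - y) - 1) \<le> \<bar>x - y\<bar>"
    using iexp_approx1[of "x - y" 0] by simp
  ultimately show ?thesis by (simp add: norm_mult)
qed

lemma cmod_iexp_diff_linear_le: "cmod (iexp x - iexp y - \<i> * (x - y) * iexp y) \<le> (x - y)\<^sup>2 / 2"
proof -
  have "iexp x - iexp y - \<i> * (x - y) * iexp y = iexp y * (iexp (x - y) - (1 + \<i> * (x - y)))"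
    by (simp add: right_diff_distrib exp_diff algebra_simps)
  moreover have "cmod (iexp (x - y) - (1 + \<i> * (x - y))) \<le> (x - y)\<^sup>2 / 2"
    using iexp_approx1[of "x - y" 1] by (simp add: power2_eq_square flip: power2_abs)
  ultimately show ?thesis by (simp add: norm_mult)
qed

text \<open>The product is at most the cube of its largest factor. This stands in for Hoelder's
  inequality when mixed moments are controlled by third absolute moments; setting factors to 1
  covers the lower orders.\<close>

lemma abs_mult3_le: "\<bar>a * b * c\<bar> \<le> \<bar>a\<bar>^3 + \<bar>b\<bar>^3 + \<bar>c\<bar>^3" for a b c :: real
proof -
  have "\<bar>a * b * c\<bar> \<le> (max (max \<bar>a\<bar> \<bar>b\<bar>) \<bar>c\<bar>) ^ 3"
    by (auto simp: abs_mult power3_eq_cube intro!: mult_mono)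
  also have "\<dots> \<le> \<bar>a\<bar>^3 + \<bar>b\<bar>^3 + \<bar>c\<bar>^3"
    by (auto simp: max_def)
  finally show ?thesis .
qed

section \<open>Sums of locally dependent variables\<close>

text \<open>The Stein--Tikhomirov method: removing the neighbourhoods \<open>N1 n\<close> and \<open>N2 n\<close> from the sum
  turns \<open>E (X n * iexp (s * A))\<close> into \<open>\<i> s E (X n * D) E (iexp (s * A))\<close> up to \<open>O(s\<^sup>2)\<close>, so that the
  characteristic function \<open>f\<close> of \<open>A\<close> nearly solves \<open>f' = - V s f\<close>.\<close>

locale local_dependence = prob_space M for M +
  fixes I :: "'i set" and X :: "'i \<Rightarrow> 'a \<Rightarrow> real" and N1 N2 :: "'i \<Rightarrow> 'i set" and K q :: real
  assumes fin: "finite I"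
    and N1: "\<And>n. n \<in> I \<Longrightarrow> N1 n \<subseteq> N2 n" and N2: "\<And>n. n \<in> I \<Longrightarrow> N2 n \<subseteq> I"
    and card: "\<And>n. n \<in> I \<Longrightarrow> real (card (N2 n)) \<le> q" and K: "1 \<le> K" and q: "0 \<le> q"
    and X [measurable]: "\<And>n. n \<in> I \<Longrightarrow> X n \<in> borel_measurable M"
    and int3: "\<And>n. n \<in> I \<Longrightarrow> integrable M (\<lambda>\<omega>. \<bar>X n \<omega>\<bar> ^ 3)"
    and bound3: "\<And>n. n \<in> I \<Longrightarrow> (\<integral>\<omega>. \<bar>X n \<omega>\<bar> ^ 3 \<partial>M) \<le> K"
    and indep1: "\<And>n s. n \<in> I \<Longrightarrow> (\<integral>\<omega>. X n \<omega> * iexp (s * (\<Sum>m\<in>I - N1 n. X m \<omega>)) \<partial>M) = 0"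
    and indep2: "\<And>n m s. n \<in> I \<Longrightarrow> m \<in> N1 n \<Longrightarrow>
      (\<integral>\<omega>. complex_of_real (X n \<omega> * X m \<omega>) * iexp (s * (\<Sum>m\<in>I - N2 n. X m \<omega>)) \<partial>M) =
      (\<integral>\<omega>. X n \<omega> * X m \<omega> \<partial>M) * (\<integral>\<omega>. iexp (s * (\<Sum>m\<in>I - N2 n. X m \<omega>)) \<partial>M)"
begin

lemma moment3:
  assumes "a \<in> I" "b \<in> I" "c \<in> I"
  shows integrable_mult3: "integrable M (\<lambda>\<omega>. X a \<omega> * X b \<omega> * X c \<omega>)"
    and expectation_mult3_le: "(\<integral>\<omega>. \<bar>X a \<omega> * X b \<omega> * X c \<omega>\<bar> \<partial>M) \<le> 3 * K"
proof -
  have i: "integrable M (\<lambda>\<omega>. \<bar>X a \<omega>\<bar>^3 + \<bar>X b \<omega>\<bar>^3 + \<bar>X c \<omega>\<bar>^3)"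
    using assms by (intro Bochner_Integration.integrable_add int3)
  show i': "integrable M (\<lambda>\<omega>. X a \<omega> * X b \<omega> * X c \<omega>)"
    using assms by (intro Bochner_Integration.integrable_bound[OF i]) (auto simp: abs_mult3_le intro: order_trans[OF abs_mult3_le])
  have "(\<integral>\<omega>. \<bar>X a \<omega> * X b \<omega> * X c \<omega>\<bar> \<partial>M) \<le> (\<integral>\<omega>. \<bar>X a \<omega>\<bar>^3 + \<bar>X b \<omega>\<bar>^3 + \<bar>X c \<omega>\<bar>^3 \<partial>M)"
    using i' i by (intro integral_mono integrable_abs abs_mult3_le)
  also have "\<dots> \<le> 3 * K"
    using bound3[of a] bound3[of b] bound3[of c] int3 assms by simp
  finally show "(\<integral>\<omega>. \<bar>X a \<omega> * X b \<omega> * X c \<omega>\<bar> \<partial>M) \<le> 3 * K" .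
qed

text \<open>The third factor of \<open>abs_mult3_le\<close> is set to 1, and
  \<open>K \<ge> 1\<close> absorbs its integral. In this way all moments up to order three share the
  bound \<open>3 * K\<close>.\<close>

lemma moment2:
  assumes "a \<in> I" "b \<in> I"
  shows integrable_mult2: "integrable M (\<lambda>\<omega>. X a \<omega> * X b \<omega>)"
    and expectation_mult2_le: "(\<integral>\<omega>. \<bar>X a \<omega> * X b \<omega>\<bar> \<partial>M) \<le> 3 * K"
proof -
  have i: "integrable M (\<lambda>\<omega>. \<bar>X a \<omega>\<bar>^3 + \<bar>X b \<omega>\<bar>^3 + 1)"
    using assms by (intro Bochner_Integration.integrable_add int3) auto
  have le: "\<bar>X a \<omega> * X b \<omega>\<bar> \<le> \<bar>X a \<omega>\<bar>^3 + \<bar>X b \<omega>\<bar>^3 + 1" for \<omega>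
    using abs_mult3_le[of "X a \<omega>" "X b \<omega>" 1] by simp
  show i': "integrable M (\<lambda>\<omega>. X a \<omega> * X b \<omega>)"
    using assms by (intro Bochner_Integration.integrable_bound[OF i]) (auto intro: order_trans[OF le])
  have "(\<integral>\<omega>. \<bar>X a \<omega> * X b \<omega>\<bar> \<partial>M) \<le> (\<integral>\<omega>. \<bar>X a \<omega>\<bar>^3 + \<bar>X b \<omega>\<bar>^3 + 1 \<partial>M)"
    using i' i by (intro integral_mono integrable_abs le)
  also have "\<dots> \<le> 3 * K"
    using bound3[of a] bound3[of b] int3 assms K by (simp add: prob_space)
  finally show "(\<integral>\<omega>. \<bar>X a \<omega> * X b \<omega>\<bar> \<partial>M) \<le> 3 * K" .
qed

lemma moment1:
  assumes "a \<in> I"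
  shows integrable_X: "integrable M (X a)"
    and expectation_abs_le: "(\<integral>\<omega>. \<bar>X a \<omega>\<bar> \<partial>M) \<le> 3 * K"
proof -
  have i: "integrable M (\<lambda>\<omega>. \<bar>X a \<omega>\<bar>^3 + 2)"
    using assms by (intro Bochner_Integration.integrable_add int3) auto
  have le: "\<bar>X a \<omega>\<bar> \<le> \<bar>X a \<omega>\<bar>^3 + 2" for \<omega>
    using abs_mult3_le[of "X a \<omega>" 1 1] by simp
  show i': "integrable M (X a)"
    using assms by (intro Bochner_Integration.integrable_bound[OF i]) (auto intro: order_trans[OF le])
  have "(\<integral>\<omega>. \<bar>X a \<omega>\<bar> \<partial>M) \<le> (\<integral>\<omega>. \<bar>X a \<omega>\<bar>^3 + 2 \<partial>M)"
    using i' i by (intro integral_mono integrable_abs le)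
  also have "\<dots> \<le> 3 * K"
    using bound3[of a] int3 assms K by (simp add: prob_space)
  finally show "(\<integral>\<omega>. \<bar>X a \<omega>\<bar> \<partial>M) \<le> 3 * K" .
qed

lemma integrable_iexp_sum:
  assumes "J \<subseteq> I"
  shows "integrable M (\<lambda>\<omega>. iexp (s * (\<Sum>m\<in>J. X m \<omega>)))"
  using assms by (intro integrable_const_bound[where B=1]) (auto simp: subset_eq)

text \<open>With \<open>A1\<close> the sum outside \<open>N1 n\<close> and
  \<open>D1 = A - A1\<close>, expand \<open>iexp (s * A)\<close> to first order around
  \<open>A1\<close>. The constant term vanishes by \<open>indep1\<close>. In the linear term
  \<open>A1\<close> is replaced by \<open>A2\<close>, which frees \<open>X n * X m\<close> from the
  exponential by \<open>indep2\<close>; finally \<open>A2\<close> gives way to \<open>A\<close> in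
  the factor that remains. Every error made on the way is of second order in
  \<open>s\<close>.\<close>

lemma stein_step:
  assumes n: "n \<in> I"
  shows "cmod ((\<integral>\<omega>. X n \<omega> * iexp (s * (\<Sum>m\<in>I. X m \<omega>)) \<partial>M) -
      \<i> * s * complex_of_real (\<Sum>m\<in>N1 n. \<integral>\<omega>. X n \<omega> * X m \<omega> \<partial>M) * (\<integral>\<omega>. iexp (s * (\<Sum>m\<in>I. X m \<omega>)) \<partial>M))
    \<le> 18 * (q * K)\<^sup>2 * s\<^sup>2"
proof -
  define A A1 A2 D1 D2 where "A \<omega> = (\<Sum>m\<in>I. X m \<omega>)" and "A1 \<omega> = (\<Sum>m\<in>I - N1 n. X m \<omega>)"
    and "A2 \<omega> = (\<Sum>m\<in>I - N2 n. X m \<omega>)" and "D1 \<omega> = (\<Sum>m\<in>N1 n. X m \<omega>)"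
    and "D2 \<omega> = (\<Sum>m\<in>N2 n. \<bar>X m \<omega>\<bar>)" for \<omega>
  have sub: "N1 n \<subseteq> N2 n" "N2 n \<subseteq> I" using N1[OF n] N2[OF n] .
  then have fin2: "finite (N2 n)" using fin by (simp add: finite_subset)
  have inI: "m \<in> I" if "m \<in> N1 n \<or> m \<in> N2 n" for m using that sub by auto
  have Xm: "m \<in> N1 n \<or> m \<in> N2 n \<Longrightarrow> X m \<in> borel_measurable M" for m using X inI by blast
  have [measurable]: "A \<in> borel_measurable M" unfolding A_def[abs_def] by (intro borel_measurable_sum X)
  have [measurable]: "A1 \<in> borel_measurable M" unfolding A1_def[abs_def] by (intro borel_measurable_sum X) simp
  have [measurable]: "A2 \<in> borel_measurable M" unfolding A2_def[abs_def] by (intro borel_measurable_sum X) simp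
  have [measurable]: "D1 \<in> borel_measurable M" unfolding D1_def[abs_def] by (intro borel_measurable_sum Xm) simp
  have [measurable]: "D2 \<in> borel_measurable M"
    unfolding D2_def[abs_def] by (intro borel_measurable_sum borel_measurable_abs Xm) simp
  have [measurable]: "X n \<in> borel_measurable M" using n by (rule X)
  have A1: "A \<omega> - A1 \<omega> = D1 \<omega>" for \<omega>
    unfolding A_def A1_def D1_def using sub fin by (subst sum_diff) auto
  have A2: "\<bar>A \<omega> - A2 \<omega>\<bar> \<le> D2 \<omega>" for \<omega>
    unfolding A_def A2_def D2_def using sub fin by (subst sum_diff) auto
  have A12: "\<bar>A1 \<omega> - A2 \<omega>\<bar> \<le> D2 \<omega>" for \<omega>
  proof -
    have "A1 \<omega> - A2 \<omega> = (\<Sum>m\<in>N2 n - N1 n. X m \<omega>)"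
      unfolding A1_def A2_def using sub fin fin2 by (subst (1 2 3) sum_diff) auto
    then have "\<bar>A1 \<omega> - A2 \<omega>\<bar> \<le> (\<Sum>m\<in>N2 n - N1 n. \<bar>X m \<omega>\<bar>)" by simp
    also have "\<dots> \<le> D2 \<omega>" unfolding D2_def using fin2 by (intro sum_mono2) auto
    finally show ?thesis .
  qed
  have D12: "\<bar>D1 \<omega>\<bar> \<le> D2 \<omega>" for \<omega>
  proof -
    have "\<bar>D1 \<omega>\<bar> \<le> (\<Sum>m\<in>N1 n. \<bar>X m \<omega>\<bar>)" unfolding D1_def by simp
    also have "\<dots> \<le> D2 \<omega>" unfolding D2_def using fin2 sub by (intro sum_mono2) auto
    finally show ?thesis .
  qed
  have D2nn: "0 \<le> D2 \<omega>" for \<omega> unfolding D2_def by (simp add: sum_nonneg)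
  \<comment> \<open>Up to a multiple of \<open>s\<^sup>2\<close> this dominates both remainders
    below. It has one factor from \<open>X n\<close> and two from the removed neighbourhood, so its
    mean is a sum of third-order moments.\<close>
  define W where "W \<omega> = \<bar>X n \<omega>\<bar> * (D2 \<omega>)\<^sup>2" for \<omega>
  have W_eq: "W = (\<lambda>\<omega>. \<Sum>a\<in>N2 n. \<Sum>b\<in>N2 n. \<bar>X n \<omega> * X a \<omega> * X b \<omega>\<bar>)"
  proof
    fix \<omega>
    have "(D2 \<omega>)\<^sup>2 = (\<Sum>a\<in>N2 n. \<Sum>b\<in>N2 n. \<bar>X a \<omega>\<bar> * \<bar>X b \<omega>\<bar>)"
      by (simp add: D2_def power2_eq_square sum_product)
    then show "W \<omega> = (\<Sum>a\<in>N2 n. \<Sum>b\<in>N2 n. \<bar>X n \<omega> * X a \<omega> * X b \<omega>\<bar>)"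
      by (simp add: W_def sum_distrib_left abs_mult mult.assoc)
  qed
  have W_int: "integrable M W"
    unfolding W_eq using inI n by (intro Bochner_Integration.integrable_sum integrable_abs integrable_mult3) auto
  have W_le: "(\<integral>\<omega>. W \<omega> \<partial>M) \<le> 3 * K * q\<^sup>2"
  proof -
    have "(\<integral>\<omega>. W \<omega> \<partial>M) = (\<Sum>a\<in>N2 n. \<Sum>b\<in>N2 n. \<integral>\<omega>. \<bar>X n \<omega> * X a \<omega> * X b \<omega>\<bar> \<partial>M)"
      unfolding W_eq using inI n
      by (simp add: integrable_mult3 Bochner_Integration.integral_sum Bochner_Integration.integrable_sum)
    also have "\<dots> \<le> (\<Sum>a\<in>N2 n. \<Sum>b\<in>N2 n. 3 * K)"
      using inI n by (intro sum_mono expectation_mult3_le) auto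
    also have "\<dots> = 3 * K * (real (card (N2 n)))\<^sup>2" by (simp add: power2_eq_square)
    also have "\<dots> \<le> 3 * K * q\<^sup>2"
      using K card[OF n] by (intro mult_left_mono power_mono) auto
    finally show ?thesis .
  qed
  have D2_int: "integrable M D2" and D2_le: "(\<integral>\<omega>. D2 \<omega> \<partial>M) \<le> 3 * K * q"
  proof -
    show "integrable M D2" unfolding D2_def using inI by (intro Bochner_Integration.integrable_sum integrable_abs integrable_X) auto
    have "(\<integral>\<omega>. D2 \<omega> \<partial>M) = (\<Sum>a\<in>N2 n. \<integral>\<omega>. \<bar>X a \<omega>\<bar> \<partial>M)"
      unfolding D2_def using inI
      by (subst Bochner_Integration.integral_sum) (auto intro: integrable_X)
    also have "\<dots> \<le> (\<Sum>a\<in>N2 n. 3 * K)"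
      using inI by (intro sum_mono expectation_abs_le) auto
    also have "\<dots> \<le> 3 * K * q" using card[OF n] K by simp
    finally show "(\<integral>\<omega>. D2 \<omega> \<partial>M) \<le> 3 * K * q" .
  qed
  define c where "c = (\<Sum>m\<in>N1 n. \<integral>\<omega>. X n \<omega> * X m \<omega> \<partial>M)"
  have c_le: "\<bar>c\<bar> \<le> 3 * K * q"
  proof -
    have "\<bar>c\<bar> \<le> (\<Sum>m\<in>N1 n. \<bar>\<integral>\<omega>. X n \<omega> * X m \<omega> \<partial>M\<bar>)" unfolding c_def by (rule sum_abs)
    also have "\<dots> \<le> (\<Sum>m\<in>N1 n. 3 * K)"
      using inI n by (intro sum_mono order_trans[OF integral_abs_bound] expectation_mult2_le) auto
    also have "\<dots> \<le> (\<Sum>m\<in>N2 n. 3 * K)" using fin2 sub K by (intro sum_mono2) auto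
    also have "\<dots> \<le> 3 * K * q" using card[OF n] K by simp
    finally show ?thesis .
  qed
  \<comment> \<open>\<open>R1\<close> is the Taylor remainder around \<open>A1\<close>;
    \<open>R2\<close> is the price of replacing \<open>A1\<close> by \<open>A2\<close> in the linear
    term.\<close>
  define R1 where "R1 \<omega> = X n \<omega> * (iexp (s * A \<omega>) - iexp (s * A1 \<omega>) - \<i> * (s * A \<omega> - s * A1 \<omega>) * iexp (s * A1 \<omega>))" for \<omega>
  define R2 where "R2 \<omega> = \<i> * s * (X n \<omega> * D1 \<omega>) * (iexp (s * A1 \<omega>) - iexp (s * A2 \<omega>))" for \<omega>
  have R1_le: "cmod (R1 \<omega>) \<le> s\<^sup>2 / 2 * W \<omega>" for \<omega>
  proof -
    have "cmod (R1 \<omega>) \<le> \<bar>X n \<omega>\<bar> * ((s * A \<omega> - s * A1 \<omega>)\<^sup>2 / 2)"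
      unfolding R1_def norm_mult norm_of_real
      by (intro mult_left_mono order_trans[OF _ cmod_iexp_diff_linear_le]) auto
    also have "(s * A \<omega> - s * A1 \<omega>)\<^sup>2 = s\<^sup>2 * (D1 \<omega>)\<^sup>2"
      by (simp add: A1 power_mult_distrib flip: right_diff_distrib)
    also have "\<bar>X n \<omega>\<bar> * (s\<^sup>2 * (D1 \<omega>)\<^sup>2 / 2) \<le> \<bar>X n \<omega>\<bar> * (s\<^sup>2 * (D2 \<omega>)\<^sup>2 / 2)"
      using D12[of \<omega>] D2nn[of \<omega>] by (intro mult_left_mono divide_right_mono) (auto simp: abs_le_square_iff[symmetric])
    finally show ?thesis by (simp add: W_def ac_simps)
  qed
  have R2_le: "cmod (R2 \<omega>) \<le> s\<^sup>2 * W \<omega>" for \<omega>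
  proof -
    have "cmod (R2 \<omega>) \<le> \<bar>s\<bar> * (\<bar>X n \<omega>\<bar> * \<bar>D1 \<omega>\<bar>) * \<bar>s * A1 \<omega> - s * A2 \<omega>\<bar>"
      unfolding R2_def norm_mult norm_of_real
      by (intro mult_mono cmod_iexp_diff_le) (auto simp: abs_mult)
    also have "\<dots> = \<bar>s\<bar> * (\<bar>X n \<omega>\<bar> * \<bar>D1 \<omega>\<bar>) * (\<bar>s\<bar> * \<bar>A1 \<omega> - A2 \<omega>\<bar>)"
      by (simp add: abs_mult flip: right_diff_distrib)
    also have "\<dots> \<le> \<bar>s\<bar> * (\<bar>X n \<omega>\<bar> * D2 \<omega>) * (\<bar>s\<bar> * D2 \<omega>)"
      using D12 A12 D2nn by (intro mult_mono) auto
    also have "\<dots> = (\<bar>s\<bar> * \<bar>s\<bar>) * W \<omega>" by (simp add: W_def power2_eq_square ac_simps del: abs_mult_self_eq)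
    also have "\<dots> = s\<^sup>2 * W \<omega>" by (simp add: power2_eq_square)
    finally show ?thesis .
  qed
  have R1_int: "integrable M R1"
  proof (rule Bochner_Integration.integrable_bound[OF integrable_mult_right[OF W_int, of "s\<^sup>2 / 2"]])
    show "R1 \<in> borel_measurable M" unfolding R1_def by measurable
    show "AE \<omega> in M. norm (R1 \<omega>) \<le> norm (s\<^sup>2 / 2 * W \<omega>)"
      by (rule AE_I2) (metis R1_le abs_ge_self order_trans real_norm_def)
  qed
  have R2_int: "integrable M R2"
  proof (rule Bochner_Integration.integrable_bound[OF integrable_mult_right[OF W_int, of "s\<^sup>2"]])
    show "R2 \<in> borel_measurable M" unfolding R2_def by measurable
    show "AE \<omega> in M. norm (R2 \<omega>) \<le> norm (s\<^sup>2 * W \<omega>)"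
      by (rule AE_I2) (metis R2_le abs_ge_self order_trans real_norm_def)
  qed
  have i1: "integrable M (\<lambda>\<omega>. X n \<omega> * iexp (s * A1 \<omega>))"
    by (rule Bochner_Integration.integrable_bound[OF integrable_X[OF n]]) (auto simp: norm_mult)
  have i2: "integrable M (\<lambda>\<omega>. complex_of_real (X n \<omega> * X m \<omega>) * iexp (s * A2 \<omega>))" if "m \<in> N1 n" for m
    using inI that n
    by (intro Bochner_Integration.integrable_bound[OF integrable_mult2[of n m]]) (auto simp: norm_mult abs_mult)
  have split: "X n \<omega> * iexp (s * A \<omega>) = X n \<omega> * iexp (s * A1 \<omega>) +
      \<i> * s * (\<Sum>m\<in>N1 n. complex_of_real (X n \<omega> * X m \<omega>) * iexp (s * A2 \<omega>)) + R1 \<omega> + R2 \<omega>" for \<omega>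
  proof -
    have "(\<Sum>m\<in>N1 n. complex_of_real (X n \<omega> * X m \<omega>) * iexp (s * A2 \<omega>)) =
        (X n \<omega> * D1 \<omega>) * iexp (s * A2 \<omega>)"
      by (simp add: D1_def sum_distrib_left sum_distrib_right)
    moreover have "R1 \<omega> = X n \<omega> * (iexp (s * A \<omega>) - iexp (s * A1 \<omega>) - \<i> * s * D1 \<omega> * iexp (s * A1 \<omega>))"
      unfolding R1_def by (simp add: A1[symmetric] algebra_simps)
    ultimately show ?thesis
      by (simp add: R2_def algebra_simps)
  qed
  define f where "f = (\<integral>\<omega>. iexp (s * A \<omega>) \<partial>M)"
  define f2 where "f2 = (\<integral>\<omega>. iexp (s * A2 \<omega>) \<partial>M)"
  have "(\<integral>\<omega>. X n \<omega> * iexp (s * A \<omega>) \<partial>M) = (\<integral>\<omega>. X n \<omega> * iexp (s * A1 \<omega>) \<partial>M) +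
      \<i> * s * (\<Sum>m\<in>N1 n. \<integral>\<omega>. complex_of_real (X n \<omega> * X m \<omega>) * iexp (s * A2 \<omega>) \<partial>M) +
      (\<integral>\<omega>. R1 \<omega> \<partial>M) + (\<integral>\<omega>. R2 \<omega> \<partial>M)"
    unfolding split using i1 i2 R1_int R2_int
    by (simp add: Bochner_Integration.integral_sum Bochner_Integration.integrable_sum)
  also have "\<dots> = \<i> * s * (c * f2) + (\<integral>\<omega>. R1 \<omega> \<partial>M) + (\<integral>\<omega>. R2 \<omega> \<partial>M)"
    using indep1[OF n, of s] indep2[OF n, of _ s]
    by (simp add: A1_def A2_def c_def f2_def sum_distrib_right)
  finally have "(\<integral>\<omega>. X n \<omega> * iexp (s * A \<omega>) \<partial>M) - \<i> * s * c * f =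
      \<i> * s * c * (f2 - f) + (\<integral>\<omega>. R1 \<omega> \<partial>M) + (\<integral>\<omega>. R2 \<omega> \<partial>M)"
    by (simp add: algebra_simps)
  moreover have "cmod (f2 - f) \<le> \<bar>s\<bar> * (3 * K * q)"
  proof -
    have "integrable M (\<lambda>\<omega>. iexp (s * A \<omega>))" "integrable M (\<lambda>\<omega>. iexp (s * A2 \<omega>))"
      unfolding A_def A2_def by (rule integrable_iexp_sum, simp)+
    then have "f2 - f = (\<integral>\<omega>. iexp (s * A2 \<omega>) - iexp (s * A \<omega>) \<partial>M)"
      unfolding f_def f2_def by simp
    also have "cmod \<dots> \<le> (\<integral>\<omega>. \<bar>s\<bar> * D2 \<omega> \<partial>M)"
    proof (rule norm_integral_le)
      fix \<omega>
      have "cmod (iexp (s * A2 \<omega>) - iexp (s * A \<omega>)) \<le> \<bar>s * A2 \<omega> - s * A \<omega>\<bar>"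
        by (rule cmod_iexp_diff_le)
      also have "\<dots> = \<bar>s\<bar> * \<bar>A \<omega> - A2 \<omega>\<bar>"
        by (simp add: abs_mult abs_minus_commute flip: right_diff_distrib)
      also have "\<dots> \<le> \<bar>s\<bar> * D2 \<omega>" by (intro mult_left_mono A2) auto
      finally show "cmod (iexp (s * A2 \<omega>) - iexp (s * A \<omega>)) \<le> \<bar>s\<bar> * D2 \<omega>" .
    qed (use D2_int in auto)
    also have "\<dots> \<le> \<bar>s\<bar> * (3 * K * q)" using D2_le by (simp add: mult_left_mono)
    finally show ?thesis .
  qed
  then have "cmod (\<i> * s * c * (f2 - f)) \<le> \<bar>s\<bar> * (3 * K * q) * (\<bar>s\<bar> * (3 * K * q))"
    unfolding norm_mult norm_of_real norm_ii mult_1 using c_le K q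
    by (intro mult_mono) auto
  moreover have "cmod (\<integral>\<omega>. R1 \<omega> \<partial>M) \<le> s\<^sup>2 / 2 * (3 * K * q\<^sup>2)"
  proof -
    have "cmod (\<integral>\<omega>. R1 \<omega> \<partial>M) \<le> (\<integral>\<omega>. s\<^sup>2 / 2 * W \<omega> \<partial>M)"
      by (rule norm_integral_le) (use R1_int W_int R1_le in auto)
    also have "\<dots> \<le> s\<^sup>2 / 2 * (3 * K * q\<^sup>2)" using W_le by (simp add: mult_left_mono)
    finally show ?thesis .
  qed
  moreover have "cmod (\<integral>\<omega>. R2 \<omega> \<partial>M) \<le> s\<^sup>2 * (3 * K * q\<^sup>2)"
  proof -
    have "cmod (\<integral>\<omega>. R2 \<omega> \<partial>M) \<le> (\<integral>\<omega>. s\<^sup>2 * W \<omega> \<partial>M)"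
      by (rule norm_integral_le) (use R2_int W_int R2_le in auto)
    also have "\<dots> \<le> s\<^sup>2 * (3 * K * q\<^sup>2)" using W_le by (simp add: mult_left_mono)
    finally show ?thesis .
  qed
  ultimately have "cmod ((\<integral>\<omega>. X n \<omega> * iexp (s * A \<omega>) \<partial>M) - \<i> * s * c * f) \<le>
      \<bar>s\<bar> * (3 * K * q) * (\<bar>s\<bar> * (3 * K * q)) + s\<^sup>2 / 2 * (3 * K * q\<^sup>2) + s\<^sup>2 * (3 * K * q\<^sup>2)"
    by (smt (verit) norm_triangle_ineq)
  also have "\<dots> = s\<^sup>2 * q\<^sup>2 * (9 * K\<^sup>2 + 9 / 2 * K)"
    by (simp add: power2_eq_square algebra_simps flip: abs_mult)
  \<comment> \<open>As \<open>K \<ge> 1\<close>, the linear term in \<open>K\<close> is absorbed by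
    the quadratic one; 18 is a rounded constant.\<close>
  also have "\<dots> \<le> s\<^sup>2 * q\<^sup>2 * (18 * K\<^sup>2)"
    using K by (intro mult_left_mono) (auto simp: power2_eq_square)
  finally show ?thesis
    by (simp add: c_def f_def A_def power_mult_distrib ac_simps)
qed

text \<open>The integrating factor \<open>exp (V * s\<^sup>2 / 2)\<close> turns the approximate
  equation \<open>f' = - V s f\<close> into a bound on the derivative of \<open>g\<close>. On the
  interval between \<open>-\<bar>t\<bar>\<close> and \<open>\<bar>t\<bar>\<close> the factor is
  largest at the ends because \<open>V \<ge> 0\<close>, so the mean value inequality bounds
  \<open>g t - 1\<close>, and dividing by the factor at \<open>t\<close> removes it again.\<close>

lemma char_sum_approx:
  fixes t :: real
  defines "V \<equiv> (\<Sum>n\<in>I. \<Sum>m\<in>N1 n. \<integral>\<omega>. X n \<omega> * X m \<omega> \<partial>M)"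
  assumes V: "0 \<le> V"
  shows "cmod ((\<integral>\<omega>. iexp (t * (\<Sum>m\<in>I. X m \<omega>)) \<partial>M) - exp (- V * t\<^sup>2 / 2))
    \<le> card I * (18 * (q * K)\<^sup>2) * \<bar>t\<bar> ^ 3"
proof -
  define C where "C = card I * (18 * (q * K)\<^sup>2)"
  define A where "A \<omega> = (\<Sum>m\<in>I. X m \<omega>)" for \<omega>
  have [measurable]: "A \<in> borel_measurable M" unfolding A_def[abs_def] by (intro borel_measurable_sum X)
  define f where "f s = (\<integral>\<omega>. iexp (s * A \<omega>) \<partial>M)" for s :: real
  define f' where "f' s = (\<integral>\<omega>. \<i> * A \<omega> * iexp (s * A \<omega>) \<partial>M)" for s :: real
  have A_int: "integrable M A" unfolding A_def by (auto intro: integrable_X)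
  have der: "(f has_vector_derivative f' s) (at s)" for s
    unfolding f_def f'_def
  proof (rule integral_has_vector_derivative_within[where S=UNIV and G="\<lambda>\<omega>. \<bar>A \<omega>\<bar>"])
    fix y \<omega>
    show "integrable M (\<lambda>\<omega>. iexp (y * A \<omega>))" unfolding A_def by (rule integrable_iexp_sum) simp
    show "((\<lambda>y. iexp (y * A \<omega>)) has_vector_derivative \<i> * A \<omega> * iexp (y * A \<omega>)) (at y)"
    proof -
      have "((\<lambda>z. exp (\<i> * (z * A \<omega>))) has_field_derivative \<i> * A \<omega> * exp (\<i> * (complex_of_real y * A \<omega>)))
          (at (complex_of_real y))"
        by (auto intro!: derivative_eq_intros)
      from has_vector_derivative_real_field[OF this] show ?thesis by simp
    qed
  qed (use A_int in \<open>auto simp: norm_mult\<close>)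
  have ode: "cmod (f' s + V * s * f s) \<le> C * s\<^sup>2" for s
  proof -
    have i: "integrable M (\<lambda>\<omega>. X n \<omega> * iexp (s * A \<omega>))" if "n \<in> I" for n
      using that by (intro Bochner_Integration.integrable_bound[OF integrable_X[OF that]]) (auto simp: norm_mult)
    have "f' s = (\<integral>\<omega>. \<i> * (\<Sum>n\<in>I. X n \<omega> * iexp (s * A \<omega>)) \<partial>M)"
      unfolding f'_def by (intro Bochner_Integration.integral_cong) (auto simp: A_def sum_distrib_right)
    also have "\<dots> = \<i> * (\<Sum>n\<in>I. \<integral>\<omega>. X n \<omega> * iexp (s * A \<omega>) \<partial>M)"
      using i by (simp add: Bochner_Integration.integral_sum Bochner_Integration.integrable_sum)
    finally have f': "f' s = \<i> * (\<Sum>n\<in>I. \<integral>\<omega>. X n \<omega> * iexp (s * A \<omega>) \<partial>M)" .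
    define c where "c n = (\<Sum>m\<in>N1 n. \<integral>\<omega>. X n \<omega> * X m \<omega> \<partial>M)" for n
    have "(\<Sum>n\<in>I. \<i> * s * complex_of_real (c n) * f s) = \<i> * s * V * f s"
      by (simp add: V_def c_def[symmetric] sum_distrib_left sum_distrib_right)
    then have "f' s + V * s * f s = \<i> * (\<Sum>n\<in>I. (\<integral>\<omega>. X n \<omega> * iexp (s * A \<omega>) \<partial>M) -
        \<i> * s * complex_of_real (c n) * f s)"
      unfolding f' sum_subtractf right_diff_distrib by (simp add: mult.commute mult.left_commute)
    also have "cmod \<dots> \<le> (\<Sum>n\<in>I. 18 * (q * K)\<^sup>2 * s\<^sup>2)"
      unfolding norm_mult norm_ii mult_1 f_def A_def c_def by (intro sum_norm_le stein_step)
    finally show ?thesis by (simp add: C_def)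
  qed
  define g where "g s = exp (V * s\<^sup>2 / 2) *\<^sub>R f s" for s
  have gder: "(g has_vector_derivative (exp (V * s\<^sup>2 / 2) *\<^sub>R (f' s + V * s * f s))) (at s)" for s
    unfolding g_def
    by (rule has_vector_derivative_eq_rhs[OF has_vector_derivative_scaleR[OF _ der]])
       (auto intro!: derivative_eq_intros simp: algebra_simps scaleR_conv_of_real)
  have "norm (g t - g 0) \<le> (exp (V * t\<^sup>2 / 2) * (C * t\<^sup>2)) * norm (t - 0)"
  proof (rule differentiable_bound[where S="{-\<bar>t\<bar>..\<bar>t\<bar>}"])
    fix s assume s: "s \<in> {-\<bar>t\<bar>..\<bar>t\<bar>}"
    then have s2: "s\<^sup>2 \<le> t\<^sup>2" by (auto simp: abs_le_square_iff[symmetric])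
    show "(g has_derivative (\<lambda>h. h *\<^sub>R (exp (V * s\<^sup>2 / 2) *\<^sub>R (f' s + V * s * f s)))) (at s within {-\<bar>t\<bar>..\<bar>t\<bar>})"
      using gder[of s] unfolding has_vector_derivative_def by (rule has_derivative_at_withinI)
    have C0: "0 \<le> C" by (simp add: C_def)
    have "norm (exp (V * s\<^sup>2 / 2) *\<^sub>R (f' s + V * s * f s)) \<le> exp (V * s\<^sup>2 / 2) * (C * s\<^sup>2)"
      using ode[of s] by simp
    also have "\<dots> \<le> exp (V * t\<^sup>2 / 2) * (C * t\<^sup>2)"
      using s2 V C0 by (intro mult_mono) (auto simp: mult_left_mono)
    finally show "onorm (\<lambda>h. h *\<^sub>R (exp (V * s\<^sup>2 / 2) *\<^sub>R (f' s + V * s * f s))) \<le> exp (V * t\<^sup>2 / 2) * (C * t\<^sup>2)"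
      by (intro onorm_le) (simp add: abs_mult mult.assoc mult.commute[of _ "\<bar>_\<bar>"] mult_left_mono)
  qed auto
  moreover have "g 0 = 1" by (simp add: g_def f_def prob_space)
  ultimately have "cmod (exp (V * t\<^sup>2 / 2) *\<^sub>R f t - 1) \<le> exp (V * t\<^sup>2 / 2) * (C * \<bar>t\<bar> ^ 3)"
    by (simp add: g_def power3_eq_cube power2_eq_square flip: abs_mult)
  moreover have "exp (V * t\<^sup>2 / 2) *\<^sub>R f t - 1 = exp (V * t\<^sup>2 / 2) *\<^sub>R (f t - exp (- V * t\<^sup>2 / 2))"
  proof -
    have "exp (V * t\<^sup>2 / 2) * exp (- V * t\<^sup>2 / 2) = 1" by (simp flip: exp_add)
    then have "complex_of_real (exp (V * t\<^sup>2 / 2)) * complex_of_real (exp (- V * t\<^sup>2 / 2)) = 1"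
      by (simp only: of_real_mult[symmetric] of_real_1)
    then show ?thesis by (simp only: scaleR_conv_of_real right_diff_distrib)
  qed
  ultimately have "cmod (f t - exp (- V * t\<^sup>2 / 2)) \<le> C * \<bar>t\<bar> ^ 3"
    by simp
  then show ?thesis by (simp add: f_def A_def C_def)
qed

end

section \<open>Products of geometric laws\<close>

text \<open>The density of \<open>nu \<theta>\<close> with respect to \<open>nu b\<close>. For \<open>\<theta> \<le> b\<close> it is at most \<open>1 + b\<close>, so
  that moments under \<open>nu b\<close> control those for all smaller parameters.\<close>

definition lratio :: "real \<Rightarrow> real \<Rightarrow> nat \<Rightarrow> real" where
  "lratio b \<theta> n = (1 + b) / (1 + \<theta>) * ((1 + b) / b * (\<theta> / (1 + \<theta>))) ^ n"

definition lratio' :: "real \<Rightarrow> real \<Rightarrow> nat \<Rightarrow> real" where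
  "lratio' b \<theta> n =
     (1 + b) / (1 + \<theta>) * (n * ((1 + b) / b * (\<theta> / (1 + \<theta>))) ^ (n - 1) * ((1 + b) / b * (1 / (1 + \<theta>)\<^sup>2)))
     - (1 + b) / (1 + \<theta>)\<^sup>2 * ((1 + b) / b * (\<theta> / (1 + \<theta>))) ^ n"

text \<open>The first summand bounds the derivative of the power in \<open>lratio\<close>, per unit
  of \<open>n\<close>; the second bounds the derivative of its prefactor.\<close>

definition lratio_const :: "real \<Rightarrow> real" where
  "lratio_const b = (1 + b) * ((1 + b) / b) + (1 + b)"

lemma pmf_nu_lratio:
  assumes "0 < b" "0 \<le> \<theta>"
  shows "pmf (nu \<theta>) n = pmf (nu b) n * lratio b \<theta> n"
proof -
  have "(\<theta> / (1 + \<theta>)) ^ n = (b / (1 + b)) ^ n * ((1 + b) / b * (\<theta> / (1 + \<theta>))) ^ n"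
    using assms by (simp flip: power_mult_distrib)
  then show ?thesis
    using assms by (simp add: pmf_nu lratio_def)
qed

text \<open>\<open>\<theta> / (1 + \<theta>)\<close> increases with \<open>\<theta>\<close>, and the
  base equals 1 at \<open>\<theta> = b\<close>. So its powers stay bounded: \<open>b\<close> is the
  parameter with the heaviest tail.\<close>

lemma lratio_base_bounds:
  fixes b \<theta> :: real
  assumes "0 < b" "0 \<le> \<theta>" "\<theta> \<le> b"
  shows "0 \<le> (1 + b) / b * (\<theta> / (1 + \<theta>))" "(1 + b) / b * (\<theta> / (1 + \<theta>)) \<le> 1"
proof -
  show "0 \<le> (1 + b) / b * (\<theta> / (1 + \<theta>))"
    using assms by (intro mult_nonneg_nonneg divide_nonneg_nonneg) auto
  show "(1 + b) / b * (\<theta> / (1 + \<theta>)) \<le> 1"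
    using assms by (auto simp: pos_divide_le_eq add_pos_nonneg algebra_simps)
qed

lemma lratio_bounds:
  assumes "0 < b" "0 \<le> \<theta>" "\<theta> \<le> b"
  shows "0 \<le> lratio b \<theta> n" "lratio b \<theta> n \<le> 1 + b"
proof -
  note * = lratio_base_bounds[OF assms]
  show "0 \<le> lratio b \<theta> n" unfolding lratio_def using assms * by (intro mult_nonneg_nonneg) auto
  have "lratio b \<theta> n \<le> (1 + b) * 1"
    unfolding lratio_def using assms *
    by (intro mult_mono power_le_one) (auto simp: field_simps)
  then show "lratio b \<theta> n \<le> 1 + b" by simp
qed

lemma lratio_deriv:
  assumes "0 < b" "0 \<le> \<theta>"
  shows "((\<lambda>\<theta>. lratio b \<theta> n) has_real_derivative lratio' b \<theta> n) (at \<theta> within S)"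
proof -
  have "((\<lambda>\<theta>. (1 + b) / b * (\<theta> / (1 + \<theta>))) has_real_derivative (1 + b) / b * (1 / (1 + \<theta>)\<^sup>2)) (at \<theta> within S)"
  proof (rule DERIV_cmult)
    show "((\<lambda>\<theta>. \<theta> / (1 + \<theta>)) has_real_derivative 1 / (1 + \<theta>)\<^sup>2) (at \<theta> within S)"
      using assms by (auto intro!: derivative_eq_intros simp: field_simps power2_eq_square)
  qed
  note 1 = DERIV_power[OF this, of n]
  have 2: "((\<lambda>\<theta>. (1 + b) / (1 + \<theta>)) has_real_derivative - ((1 + b) / (1 + \<theta>)\<^sup>2)) (at \<theta> within S)"
  proof -
    have "((\<lambda>\<theta>. 1 / (1 + \<theta>)) has_real_derivative - (1 / (1 + \<theta>)\<^sup>2)) (at \<theta> within S)"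
      using assms by (auto intro!: derivative_eq_intros simp: field_simps power2_eq_square)
    from DERIV_cmult[OF this, of "1 + b"] show ?thesis by simp
  qed
  show ?thesis
    unfolding lratio_def lratio'_def
    by (rule DERIV_cong[OF DERIV_mult[OF 2 1]]) (simp add: algebra_simps)
qed

text \<open>All factors but the exponent brought down by differentiation are bounded uniformly on
  \<open>{0..b}\<close>. The linear growth in \<open>n\<close> is the price of a derivative in the
  parameter.\<close>

lemma abs_lratio'_le:
  assumes "0 < b" "0 \<le> \<theta>" "\<theta> \<le> b"
  shows "\<bar>lratio' b \<theta> n\<bar> \<le> lratio_const b * (1 + real n)"
proof -
  note * = lratio_base_bounds[OF assms]
  define s where "s = (1 + b) / b * (\<theta> / (1 + \<theta>))"
  have s: "0 \<le> s" "s \<le> 1" using * by (auto simp: s_def)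
  have sq: "1 \<le> (1 + \<theta>)\<^sup>2" using assms by simp
  have "\<bar>lratio' b \<theta> n\<bar> \<le> \<bar>(1 + b) / (1 + \<theta>) * (n * s ^ (n - 1) * ((1 + b) / b * (1 / (1 + \<theta>)\<^sup>2)))\<bar>
      + \<bar>(1 + b) / (1 + \<theta>)\<^sup>2 * s ^ n\<bar>"
    unfolding lratio'_def s_def[symmetric] by (rule abs_triangle_ineq4)
  also have "\<bar>(1 + b) / (1 + \<theta>) * (n * s ^ (n - 1) * ((1 + b) / b * (1 / (1 + \<theta>)\<^sup>2)))\<bar>
      \<le> (1 + b) * (n * 1 * ((1 + b) / b * 1))"
    unfolding abs_mult using assms s sq
    by (intro mult_mono) (auto simp: power_abs divide_le_eq power_le_one mult_left_le)
  also have "\<bar>(1 + b) / (1 + \<theta>)\<^sup>2 * s ^ n\<bar> \<le> (1 + b) * 1"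
    unfolding abs_mult using assms s sq
    by (intro mult_mono) (auto simp: power_abs divide_le_eq power_le_one)
  also have "(1 + b) * (n * 1 * ((1 + b) / b * 1)) + (1 + b) * 1 \<le> lratio_const b * (1 + real n)"
    using assms by (simp add: lratio_const_def algebra_simps add_divide_distrib)
  finally show ?thesis by simp
qed

lemma lratio_const_nonneg: "0 < b \<Longrightarrow> 0 \<le> lratio_const b"
  by (simp add: lratio_const_def)

lemma lratio_lipschitz:
  assumes "0 < b" "x \<in> {0..b}" "y \<in> {0..b}"
  shows "\<bar>lratio b x n - lratio b y n\<bar> \<le> lratio_const b * (1 + real n) * \<bar>x - y\<bar>"
proof -
  have "norm (lratio b x n - lratio b y n) \<le> lratio_const b * (1 + real n) * norm (x - y)"
    by (rule field_differentiable_bound[where S="{0..b}" and f'="\<lambda>\<theta>. lratio' b \<theta> n"])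
       (use assms in \<open>auto intro!: lratio_deriv abs_lratio'_le\<close>)
  then show ?thesis by simp
qed

lemma measure_pmf_nu_density:
  assumes "0 < b" "0 \<le> \<theta>"
  shows "measure_pmf (nu \<theta>) = density (measure_pmf (nu b)) (\<lambda>n. ennreal (lratio b \<theta> n))"
  unfolding measure_pmf_eq_density
  by (subst density_density_eq) (auto simp: pmf_nu_lratio[OF assms] ennreal_mult' intro!: density_cong)

lemma prob_space_nu_prod [simp]: "prob_space (nu_prod I \<theta>)"
  unfolding nu_prod_def by (rule prob_space_PiM) (rule prob_space_measure_pmf)

abbreviation conf :: "nat set \<Rightarrow> (nat \<Rightarrow> nat) measure" where
  "conf I \<equiv> PiM I (\<lambda>_. count_space UNIV)"

lemma sets_nu_prod [measurable_cong, simp]: "sets (nu_prod I \<theta>) = sets (conf I)"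
  unfolding nu_prod_def by (rule sets_PiM_cong) auto

lemma measurable_nu_prod [simp]: "measurable (nu_prod I \<theta>) N = measurable (conf I) N"
  by (rule measurable_cong_sets) auto

lemma measurable_component_conf [measurable]:
  "i \<in> I \<Longrightarrow> (\<lambda>\<eta>. f (\<eta> i)) \<in> borel_measurable (conf I)"
  by (rule measurable_compose[OF measurable_component_singleton]) auto

text \<open>Both measures are compared on boxes, where density and indicator factorise over the
  coordinates. Finiteness of \<open>J\<close> is essential: infinite products with two different
  constant parameters are mutually singular. This is why expectations of local functions are first
  reduced to their finite windows.\<close>

lemma nu_prod_density:
  assumes b: "0 < b" and J: "finite J" and \<theta>: "\<theta> \<in> J \<rightarrow> {0..b}"
  shows "nu_prod J \<theta> = density (nu_prod J (\<lambda>_. b)) (\<lambda>\<eta>. ennreal (\<Prod>i\<in>J. lratio b (\<theta> i) (\<eta> i)))"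
proof -
  interpret P: product_sigma_finite "\<lambda>i. measure_pmf (nu (\<theta> i))"
    by standard
  interpret Q: product_sigma_finite "\<lambda>i::nat. measure_pmf (nu b)"
    by standard
  have nn: "0 \<le> lratio b (\<theta> i) n" if "i \<in> J" for i n
    using \<theta> that b by (intro lratio_bounds) (auto simp: Pi_iff)
  show ?thesis
    unfolding nu_prod_def
  proof (rule sym, rule P.PiM_eqI[OF J])
    show "sets (density (Pi\<^sub>M J (\<lambda>_. measure_pmf (nu b))) (\<lambda>\<eta>. ennreal (\<Prod>i\<in>J. lratio b (\<theta> i) (\<eta> i)))) =
       sets (PiM J (\<lambda>i. measure_pmf (nu (\<theta> i))))"
      unfolding sets_density by (rule sets_PiM_cong) auto
    fix A :: "nat \<Rightarrow> nat set"
    have [measurable]: "(\<lambda>\<eta>. ennreal (\<Prod>i\<in>J. lratio b (\<theta> i) (\<eta> i))) \<in> borel_measurable (nu_prod J (\<lambda>_. b))"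
      by (simp; intro measurable_compose[OF _ measurable_ennreal] borel_measurable_prod measurable_component_conf)
    have "emeasure (density (Pi\<^sub>M J (\<lambda>_. measure_pmf (nu b))) (\<lambda>\<eta>. ennreal (\<Prod>i\<in>J. lratio b (\<theta> i) (\<eta> i)))) (Pi\<^sub>E J A)
      = (\<integral>\<^sup>+\<eta>. ennreal (\<Prod>i\<in>J. lratio b (\<theta> i) (\<eta> i)) * indicator (Pi\<^sub>E J A) \<eta> \<partial>nu_prod J (\<lambda>_. b))"
      unfolding nu_prod_def[symmetric] by (rule emeasure_density) (auto intro!: sets_PiM_I_finite J)
    also have "\<dots> = (\<integral>\<^sup>+\<eta>. (\<Prod>i\<in>J. ennreal (lratio b (\<theta> i) (\<eta> i)) * indicator (A i) (\<eta> i)) \<partial>nu_prod J (\<lambda>_. b))"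
    proof (rule nn_integral_cong)
      fix \<eta> assume "\<eta> \<in> space (nu_prod J (\<lambda>_. b))"
      then have "\<eta> \<in> extensional J" by (auto simp: nu_prod_def space_PiM PiE_def)
      then have "indicator (Pi\<^sub>E J A) \<eta> = (\<Prod>i\<in>J. indicator (A i) (\<eta> i) :: ennreal)"
        using J by (auto simp: indicator_def PiE_def Pi_iff prod.If_cases intro!: prod_zero)
      then show "ennreal (\<Prod>i\<in>J. lratio b (\<theta> i) (\<eta> i)) * indicator (Pi\<^sub>E J A) \<eta> =
          (\<Prod>i\<in>J. ennreal (lratio b (\<theta> i) (\<eta> i)) * indicator (A i) (\<eta> i))"
        using nn by (simp add: prod.distrib prod_ennreal)
    qed
    also have "\<dots> = (\<Prod>i\<in>J. \<integral>\<^sup>+n. ennreal (lratio b (\<theta> i) n) * indicator (A i) n \<partial>measure_pmf (nu b))"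
      unfolding nu_prod_def by (rule Q.product_nn_integral_prod[OF J]) auto
    also have "\<dots> = (\<Prod>i\<in>J. emeasure (measure_pmf (nu (\<theta> i))) (A i))"
    proof (rule prod.cong[OF refl])
      fix i assume "i \<in> J"
      then have "0 \<le> \<theta> i" using \<theta> by (auto simp: Pi_iff)
      show "(\<integral>\<^sup>+n. ennreal (lratio b (\<theta> i) n) * indicator (A i) n \<partial>measure_pmf (nu b)) = emeasure (measure_pmf (nu (\<theta> i))) (A i)"
        by (subst measure_pmf_nu_density[OF b \<open>0 \<le> \<theta> i\<close>]) (simp add: emeasure_density)
    qed
    finally show "emeasure (density (Pi\<^sub>M J (\<lambda>_. measure_pmf (nu b))) (\<lambda>\<eta>. ennreal (\<Prod>i\<in>J. lratio b (\<theta> i) (\<eta> i)))) (Pi\<^sub>E J A)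
      = (\<Prod>i\<in>J. emeasure (measure_pmf (nu (\<theta> i))) (A i))" .
  qed
qed

text \<open>An injective choice of coordinates pushes a product law forward to the product of the
  chosen factors. Translating a window, forgetting coordinates and moving a window to
  \<open>{1..k}\<close> are all instances.\<close>

lemma
  assumes f: "inj_on f J" "f \<in> J \<rightarrow> I" and q: "q \<in> borel_measurable (conf J)"
  shows integral_nu_prod_reindex:
      "(\<integral>\<eta>. q (\<lambda>i\<in>J. \<eta> (f i)) \<partial>nu_prod I \<theta>) = (\<integral>\<eta>. (q \<eta> :: real) \<partial>nu_prod J (\<lambda>i. \<theta> (f i)))" (is ?int)
    and integrable_nu_prod_reindex:
      "integrable (nu_prod I \<theta>) (\<lambda>\<eta>. q (\<lambda>i\<in>J. \<eta> (f i))) \<longleftrightarrow> integrable (nu_prod J (\<lambda>i. \<theta> (f i))) q" (is ?intg)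
    and measurable_reindex: "(\<lambda>\<eta>. q (\<lambda>i\<in>J. \<eta> (f i))) \<in> borel_measurable (conf I)" (is ?meas)
proof -
  have eq: "nu_prod J (\<lambda>i. \<theta> (f i)) = distr (nu_prod I \<theta>) (conf J) (\<lambda>\<omega>. \<lambda>n\<in>J. \<omega> (f n))"
    unfolding nu_prod_def
    by (subst distr_PiM_reindex[symmetric, OF _ f(1,2)]) (auto intro!: distr_cong prob_space_measure_pmf sets_PiM_cong)
  have m: "(\<lambda>\<omega>. \<lambda>n\<in>J. \<omega> (f n)) \<in> measurable (conf I) (conf J)"
    using f by (intro measurable_restrict measurable_component_singleton) auto
  then have m': "(\<lambda>\<omega>. \<lambda>n\<in>J. \<omega> (f n)) \<in> measurable (nu_prod I \<theta>) (conf J)"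
    by simp
  show ?int unfolding eq by (rule integral_distr[symmetric, OF m' q])
  show ?intg unfolding eq by (rule integrable_distr_eq[symmetric, OF m' q])
  show ?meas using measurable_compose[OF m q] .
qed

lemma integrable_nu_power:
  assumes "0 \<le> \<theta>"
  shows "integrable (measure_pmf (nu \<theta>)) (\<lambda>n. (1 + real n) ^ j)"
proof -
  define x where "x = \<theta> / (1 + \<theta>)"
  have x: "0 \<le> x" "x < 1" using assms by (auto simp: x_def field_simps)
  have "summable (\<lambda>n. pmf (nu \<theta>) n * (1 + real n) ^ j)"
  proof (cases "x = 0")
    case True
    then have "summable (\<lambda>n. pmf (nu \<theta>) n * (1 + real n) ^ j)"
      by (intro summable_finite[of "{0}"]) (auto simp: pmf_nu[OF assms] x_def[symmetric])
    then show ?thesis .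
  next
    case False
    \<comment> \<open>Splitting \<open>x = y * y\<close> leaves one geometric factor to beat the
      polynomial and the other one for summability.\<close>
    define y where "y = sqrt x"
    have y: "0 < y" "y < 1" using x False by (auto simp: y_def)
    have "summable (\<lambda>n. (1 + real n) ^ j * x ^ n)"
    proof (rule summable_comparison_test_bigo)
      show "summable (\<lambda>n. norm (y ^ n))" using y by (simp add: power_abs summable_geometric)
      have "x = y * y" using x by (simp add: y_def)
      have "(\<lambda>n. (1 + real n) ^ j * y ^ n) \<in> O(\<lambda>_. 1)"
        using y by real_asymp
      then have "(\<lambda>n. (1 + real n) ^ j * y ^ n * y ^ n) \<in> O(\<lambda>n. 1 * y ^ n)"
        by (rule landau_o.big.mult) simp
      then show "(\<lambda>n. (1 + real n) ^ j * x ^ n) \<in> O(\<lambda>n. y ^ n)"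
        by (simp add: \<open>x = y * y\<close> power_mult_distrib mult.assoc)
    qed
    then show ?thesis
      using summable_mult[of "\<lambda>n. (1 + real n) ^ j * x ^ n" "1 / (1 + \<theta>)"]
      by (simp add: pmf_nu[OF assms] x_def[symmetric] ac_simps)
  qed
  then show ?thesis
    unfolding measure_pmf_eq_density
    by (subst integrable_density) (auto simp: integrable_count_space_nat_iff abs_mult)
qed

text \<open>Measurability with respect to the coordinates in \<open>A\<close>, for functions defined
  on all configurations. Invariance under \<open>restrict\<close> is demanded at every point, not
  only in the space of the product, so that the same function can be used unchanged over every
  larger index set.\<close>

definition depends_on :: "'i set \<Rightarrow> ('i \<Rightarrow> 'a measure) \<Rightarrow> (('i \<Rightarrow> 'a) \<Rightarrow> 'b::topological_space) \<Rightarrow> bool" where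
  "depends_on A M f \<longleftrightarrow> f \<in> borel_measurable (PiM A M) \<and> (\<forall>\<omega>. f (restrict \<omega> A) = f \<omega>)"

lemma depends_on_mono:
  assumes f: "depends_on A M f" and "A \<subseteq> B"
  shows "depends_on B M f"
proof -
  have eq: "f (restrict \<omega> A) = f \<omega>" for \<omega> using f by (simp add: depends_on_def)
  have "(\<lambda>\<omega>. f (restrict \<omega> A)) \<in> borel_measurable (PiM B M)"
    using f by (intro measurable_compose[OF measurable_restrict_subset[OF \<open>A \<subseteq> B\<close>]]) (simp add: depends_on_def)
  moreover have "f (restrict \<omega> B) = f \<omega>" for \<omega>
    using eq[of "restrict \<omega> B"] eq[of \<omega>] \<open>A \<subseteq> B\<close> by (simp add: Int_absorb1)
  ultimately show ?thesis by (simp add: depends_on_def eq)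
qed

lemma depends_on_measurable: "depends_on A M f \<Longrightarrow> A \<subseteq> I \<Longrightarrow> f \<in> borel_measurable (PiM I M)"
  using depends_on_mono unfolding depends_on_def by blast

lemma depends_on_mult:
  fixes f g :: "('i \<Rightarrow> 'a) \<Rightarrow> real"
  shows "depends_on A M f \<Longrightarrow> depends_on A M g \<Longrightarrow> depends_on A M (\<lambda>\<omega>. f \<omega> * g \<omega>)"
  by (auto simp: depends_on_def)

lemma depends_on_sum:
  fixes f :: "'j \<Rightarrow> ('i \<Rightarrow> 'a) \<Rightarrow> real"
  shows "(\<And>j. j \<in> S \<Longrightarrow> depends_on A M (f j)) \<Longrightarrow> depends_on A M (\<lambda>\<omega>. \<Sum>j\<in>S. f j \<omega>)"
  by (auto simp: depends_on_def intro!: borel_measurable_sum)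

lemma depends_on_compose:
  assumes "depends_on A M f" "h \<in> borel_measurable borel"
  shows "depends_on A M (\<lambda>\<omega>. h (f \<omega>))"
  using assms by (auto simp: depends_on_def intro: measurable_compose)

lemma integral_mult_depends_on:
  fixes f g :: "('i \<Rightarrow> 'a) \<Rightarrow> 'b::{real_normed_field, banach, second_countable_topology}"
  assumes "\<And>i. i \<in> I \<Longrightarrow> prob_space (M i)" "I \<noteq> {}" "A \<inter> B = {}" "A \<subseteq> I" "B \<subseteq> I"
    "depends_on A M f" "depends_on B M g" "integrable (PiM I M) f" "integrable (PiM I M) g"
  shows "(\<integral>\<omega>. f \<omega> * g \<omega> \<partial>PiM I M) = (\<integral>\<omega>. f \<omega> \<partial>PiM I M) * (\<integral>\<omega>. g \<omega> \<partial>PiM I M)"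
  using assms by (intro integral_PiM_mult[of I M A B f g]) (auto simp: depends_on_def)

text \<open>Summand \<open>n\<close> reads the coordinates \<open>n + 1, ..., n + k\<close>, so
  summands whose indices differ by at least \<open>k\<close> read disjoint blocks. The factors
  \<open>M i\<close> may differ from each other: the estimate serves both configurations with given
  parameters and, with \<open>k = 1\<close>, independent uniform variables.\<close>

lemma char_sum_PiM_approx:
  fixes X :: "nat \<Rightarrow> (nat \<Rightarrow> 'a) \<Rightarrow> real" and t K :: real
  assumes M: "\<And>i. i \<in> {1..N} \<Longrightarrow> prob_space (M i)" and k: "1 \<le> k" "k \<le> N"
    and I: "finite I" "\<And>n. n \<in> I \<Longrightarrow> n + k \<le> N"
    and X: "\<And>n. n \<in> I \<Longrightarrow> depends_on {n + 1..n + k} M (X n)"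
    and K: "1 \<le> K"
    and int3: "\<And>n. n \<in> I \<Longrightarrow> integrable (PiM {1..N} M) (\<lambda>\<omega>. \<bar>X n \<omega>\<bar> ^ 3)"
    and bound3: "\<And>n. n \<in> I \<Longrightarrow> (\<integral>\<omega>. \<bar>X n \<omega>\<bar> ^ 3 \<partial>PiM {1..N} M) \<le> K"
    and mean: "\<And>n. n \<in> I \<Longrightarrow> (\<integral>\<omega>. X n \<omega> \<partial>PiM {1..N} M) = 0"
  defines "V \<equiv> (\<Sum>n\<in>I. \<Sum>m\<in>{m\<in>I. n < m + k \<and> m < n + k}. \<integral>\<omega>. X n \<omega> * X m \<omega> \<partial>PiM {1..N} M)"
  shows "0 \<le> V"
    and "cmod ((\<integral>\<omega>. iexp (t * (\<Sum>m\<in>I. X m \<omega>)) \<partial>PiM {1..N} M) - exp (- V * t\<^sup>2 / 2))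
      \<le> card I * (18 * (4 * real k * K)\<^sup>2) * \<bar>t\<bar> ^ 3"
proof -
  let ?P = "PiM {1..N} M"
  define N1 where "N1 n = {m\<in>I. n < m + k \<and> m < n + k}" for n
  \<comment> \<open>A window that meets the window of an element of \<open>N1 n\<close> belongs to
    an index at distance less than \<open>2 * k\<close> from \<open>n\<close>.\<close>
  define N2 where "N2 n = {m\<in>I. n < m + 2 * k \<and> m < n + 2 * k}" for n
  interpret P: prob_space ?P by (rule prob_space_PiM) (use M in auto)
  have ne: "{1..N} \<noteq> {}" using k by auto
  have Xm [measurable]: "X n \<in> borel_measurable ?P" if "n \<in> I" for n
    using depends_on_measurable[OF X[OF that]] I that by auto
  have Xint: "integrable ?P (X n)" if "n \<in> I" for n
  proof (rule Bochner_Integration.integrable_bound)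
    show "integrable ?P (\<lambda>\<omega>. \<bar>X n \<omega>\<bar> ^ 3 + 2)" 

      by (intro Bochner_Integration.integrable_add P.integrable_const int3 that)
    show "AE \<omega> in ?P. norm (X n \<omega>) \<le> norm (\<bar>X n \<omega>\<bar> ^ 3 + 2)"
      by (rule AE_I2) (use abs_mult3_le[of "X n _" 1 1] in \<open>simp add: add.commute\<close>)
  qed (rule Xm[OF that])
  have Xint2: "integrable ?P (\<lambda>\<omega>. X n \<omega> * X m \<omega>)" if "n \<in> I" "m \<in> I" for n m
  proof (rule Bochner_Integration.integrable_bound)
    show "integrable ?P (\<lambda>\<omega>. \<bar>X n \<omega>\<bar> ^ 3 + \<bar>X m \<omega>\<bar> ^ 3 + 1)" 
      by (intro Bochner_Integration.integrable_add P.integrable_const int3 that)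
    show "AE \<omega> in ?P. norm (X n \<omega> * X m \<omega>) \<le> norm (\<bar>X n \<omega>\<bar> ^ 3 + \<bar>X m \<omega>\<bar> ^ 3 + 1)"
      by (rule AE_I2) (use abs_mult3_le[of "X n _" "X m _" 1] in simp)
  qed (intro borel_measurable_times Xm that)
  have far: "depends_on ({1..N} - {n + 1..n + k}) M (X m)" if "n \<in> I" "m \<in> I - N1 n" for n m
    using that I(2)[of m] by (intro depends_on_mono[OF X]) (auto simp: N1_def)
  have far2: "depends_on ({1..N} - {n + 1 - k..n + 2 * k - 1}) M (X m)" if "n \<in> I" "m \<in> I - N2 n" for n m
    using that I(2)[of m] k by (intro depends_on_mono[OF X]) (auto simp: N2_def)
  have near: "depends_on ({n + 1 - k..n + 2 * k - 1} \<inter> {1..N}) M (X m)" if "n \<in> I" "m \<in> N1 n" for n m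
    using that I(2)[of m] k by (intro depends_on_mono[OF X]) (auto simp: N1_def)
  have iexp_meas: "(\<lambda>x. iexp (s * x)) \<in> borel_measurable borel" for s by measurable
  have iexp_int: "complex_integrable ?P (\<lambda>\<omega>. iexp (s * (\<Sum>m\<in>J. X m \<omega>)))" if "J \<subseteq> I" for s J
    using that Xm by (intro P.integrable_const_bound[where B=1]) (auto simp: subset_eq)
  have L: "local_dependence ?P I X N1 N2 K (4 * k)"
  proof (unfold_locales)
    fix n assume n: "n \<in> I"
    show "N1 n \<subseteq> N2 n" "N2 n \<subseteq> I" by (auto simp: N1_def N2_def)
    have "card (N2 n) \<le> card {n + 1 - 2 * k..<n + 2 * k}"
      by (rule card_mono) (auto simp: N2_def)
    also have "\<dots> \<le> 4 * k" by simp
    finally show "real (card (N2 n)) \<le> 4 * k" by simp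
    fix s :: real
    have "(\<integral>\<omega>. complex_of_real (X n \<omega>) * iexp (s * (\<Sum>m\<in>I - N1 n. X m \<omega>)) \<partial>?P) =
      (\<integral>\<omega>. complex_of_real (X n \<omega>) \<partial>?P) * (\<integral>\<omega>. iexp (s * (\<Sum>m\<in>I - N1 n. X m \<omega>)) \<partial>?P)"
    proof (rule integral_mult_depends_on[OF M ne])
      show "depends_on {n + 1..n + k} M (\<lambda>\<omega>. complex_of_real (X n \<omega>))"
        by (rule depends_on_compose[OF X[OF n]]) simp
      show "depends_on ({1..N} - {n + 1..n + k}) M (\<lambda>\<omega>. iexp (s * (\<Sum>m\<in>I - N1 n. X m \<omega>)))"
        by (rule depends_on_compose[OF depends_on_sum iexp_meas]) (rule far[OF n])
      show "complex_integrable ?P (\<lambda>\<omega>. iexp (s * (\<Sum>m\<in>I - N1 n. X m \<omega>)))" by (rule iexp_int) auto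
    qed (use I n Xint in auto)
    then show "(\<integral>\<omega>. complex_of_real (X n \<omega>) * iexp (s * (\<Sum>m\<in>I - N1 n. X m \<omega>)) \<partial>?P) = 0"
      using mean[OF n] by simp
    fix m assume m: "m \<in> N1 n"
    then have mI: "m \<in> I" by (simp add: N1_def)
    have "n \<in> N1 n" using n k by (simp add: N1_def)
    have "(\<integral>\<omega>. complex_of_real (X n \<omega> * X m \<omega>) * iexp (s * (\<Sum>m\<in>I - N2 n. X m \<omega>)) \<partial>?P) =
      (\<integral>\<omega>. complex_of_real (X n \<omega> * X m \<omega>) \<partial>?P) * (\<integral>\<omega>. iexp (s * (\<Sum>m\<in>I - N2 n. X m \<omega>)) \<partial>?P)"
    proof (rule integral_mult_depends_on[OF M ne])
      show "depends_on ({n + 1 - k..n + 2 * k - 1} \<inter> {1..N}) M (\<lambda>\<omega>. complex_of_real (X n \<omega> * X m \<omega>))"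
        by (rule depends_on_compose[OF depends_on_mult[OF near[OF n \<open>n \<in> N1 n\<close>] near[OF n m]]]) simp
      show "depends_on ({1..N} - {n + 1 - k..n + 2 * k - 1}) M (\<lambda>\<omega>. iexp (s * (\<Sum>m\<in>I - N2 n. X m \<omega>)))"
        by (rule depends_on_compose[OF depends_on_sum iexp_meas]) (rule far2[OF n])
      show "complex_integrable ?P (\<lambda>\<omega>. iexp (s * (\<Sum>m\<in>I - N2 n. X m \<omega>)))" by (rule iexp_int) auto
      show "complex_integrable ?P (\<lambda>\<omega>. complex_of_real (X n \<omega> * X m \<omega>))"
        using Xint2[OF n mI] by (rule integrable_of_real)
    qed auto
    then show "(\<integral>\<omega>. complex_of_real (X n \<omega> * X m \<omega>) * iexp (s * (\<Sum>m\<in>I - N2 n. X m \<omega>)) \<partial>?P) =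
      complex_of_real (\<integral>\<omega>. X n \<omega> * X m \<omega> \<partial>?P) * (\<integral>\<omega>. iexp (s * (\<Sum>m\<in>I - N2 n. X m \<omega>)) \<partial>?P)"
      by (simp only: integral_complex_of_real)
  qed (use I K int3 bound3 Xm in auto)
  have V_eq: "V = (\<Sum>n\<in>I. \<Sum>m\<in>N1 n. \<integral>\<omega>. X n \<omega> * X m \<omega> \<partial>?P)"
    by (simp add: V_def N1_def)
  \<comment> \<open>Distant pairs are uncorrelated. Including them changes nothing and exhibits
    \<open>V\<close> as the second moment of the whole sum, hence as nonnegative.\<close>
  also have "\<dots> = (\<Sum>n\<in>I. \<Sum>m\<in>I. \<integral>\<omega>. X n \<omega> * X m \<omega> \<partial>?P)"
  proof (rule sum.cong[OF refl], rule sum.mono_neutral_left)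
    fix n assume n: "n \<in> I"
    show "\<forall>m\<in>I - N1 n. (\<integral>\<omega>. X n \<omega> * X m \<omega> \<partial>?P) = 0"
    proof
      fix m assume m: "m \<in> I - N1 n"
      have "(\<integral>\<omega>. X n \<omega> * X m \<omega> \<partial>?P) = (\<integral>\<omega>. X n \<omega> \<partial>?P) * (\<integral>\<omega>. X m \<omega> \<partial>?P)"
        by (rule integral_mult_depends_on[OF M ne _ _ _ X[OF n] far[OF n m]])
           (use I n m Xint in auto)
      then show "(\<integral>\<omega>. X n \<omega> * X m \<omega> \<partial>?P) = 0" using mean[OF n] by simp
    qed
  qed (use I in \<open>auto simp: N1_def\<close>)
  also have "\<dots> = (\<Sum>n\<in>I. \<integral>\<omega>. (\<Sum>m\<in>I. X n \<omega> * X m \<omega>) \<partial>?P)"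
    by (intro sum.cong refl Bochner_Integration.integral_sum[symmetric] Xint2)
  also have "\<dots> = (\<integral>\<omega>. (\<Sum>n\<in>I. \<Sum>m\<in>I. X n \<omega> * X m \<omega>) \<partial>?P)"
    by (intro Bochner_Integration.integral_sum[symmetric] Bochner_Integration.integrable_sum Xint2)
  also have "\<dots> = (\<integral>\<omega>. (\<Sum>n\<in>I. X n \<omega>)\<^sup>2 \<partial>?P)"
    unfolding power2_eq_square sum_product ..
  finally show V: "0 \<le> V" by simp
  from local_dependence.char_sum_approx[OF L, of t] V
  show "cmod ((\<integral>\<omega>. iexp (t * (\<Sum>m\<in>I. X m \<omega>)) \<partial>?P) - exp (- V * t\<^sup>2 / 2))
      \<le> card I * (18 * (4 * real k * K)\<^sup>2) * \<bar>t\<bar> ^ 3"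
    by (simp add: V_eq)
qed

section \<open>Differentiability in the parameter\<close>

lemma continuous_on_integral_dominated:
  fixes F :: "'c::metric_space \<Rightarrow> 'a \<Rightarrow> 'b::{banach,second_countable_topology}"
  assumes cont: "\<And>\<omega>. \<omega> \<in> space M \<Longrightarrow> continuous_on S (\<lambda>x. F x \<omega>)"
    and meas: "\<And>x. x \<in> S \<Longrightarrow> F x \<in> borel_measurable M"
    and bound: "\<And>x \<omega>. x \<in> S \<Longrightarrow> \<omega> \<in> space M \<Longrightarrow> norm (F x \<omega>) \<le> G \<omega>"
    and G: "integrable M G"
  shows "continuous_on S (\<lambda>x. \<integral>\<omega>. F x \<omega> \<partial>M)"
proof (rule continuous_on_sequentiallyI)
  fix u a assume u: "\<forall>n. u n \<in> S" "a \<in> S" "u \<longlonglongrightarrow> a"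
  show "(\<lambda>n. \<integral>\<omega>. F (u n) \<omega> \<partial>M) \<longlonglongrightarrow> (\<integral>\<omega>. F a \<omega> \<partial>M)"
  proof (rule integral_dominated_convergence[OF meas meas G])
    show "AE \<omega> in M. (\<lambda>n. F (u n) \<omega>) \<longlonglongrightarrow> F a \<omega>"
      using cont u by (intro AE_I2) (auto simp: continuous_on_sequentially comp_def)
  qed (use u bound in auto)
qed

text \<open>Dividing every factor by \<open>c\<close> makes all of them at most 1 in modulus, where
  differences of products telescope without loss.\<close>

lemma abs_prod_diff_le:
  fixes a b :: "'i \<Rightarrow> real"
  assumes "finite J" "1 \<le> c" "\<And>i. i \<in> J \<Longrightarrow> \<bar>a i\<bar> \<le> c" "\<And>i. i \<in> J \<Longrightarrow> \<bar>b i\<bar> \<le> c"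
  shows "\<bar>(\<Prod>i\<in>J. a i) - (\<Prod>i\<in>J. b i)\<bar> \<le> c ^ card J * (\<Sum>i\<in>J. \<bar>a i - b i\<bar>)"
proof -
  have "norm ((\<Prod>i\<in>J. a i / c) - (\<Prod>i\<in>J. b i / c)) \<le> (\<Sum>i\<in>J. norm (a i / c - b i / c))"
    using assms by (intro norm_prod_diff) (auto simp: divide_le_eq)
  also have "\<dots> \<le> (\<Sum>i\<in>J. \<bar>a i - b i\<bar>)"
    using assms by (intro sum_mono) (auto simp: divide_le_eq mult_left_le simp flip: diff_divide_distrib intro: order_trans[OF _ mult_left_mono[of 1 c]])
  finally have "\<bar>(\<Prod>i\<in>J. a i) / c ^ card J - (\<Prod>i\<in>J. b i) / c ^ card J\<bar> \<le> (\<Sum>i\<in>J. \<bar>a i - b i\<bar>)"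
    using assms(1) by (simp add: prod_dividef)
  then have "\<bar>(\<Prod>i\<in>J. a i) - (\<Prod>i\<in>J. b i)\<bar> / c ^ card J \<le> (\<Sum>i\<in>J. \<bar>a i - b i\<bar>)"
    using assms(2) by (simp flip: diff_divide_distrib add: abs_divide)
  then show ?thesis
    using assms(2) by (simp add: divide_le_eq mult.commute split: if_splits)
qed

text \<open>Square integrability under the largest parameter is what one derivative costs: it
  produces a factor \<open>1 + real (\<eta> i)\<close>, and
  \<open>\<bar>q \<eta>\<bar> * (1 + real (\<eta> i))\<close> is dominated by the sum of the two
  squares.\<close>

locale square_integrable_obs =
  fixes b :: real and J :: "nat set" and q :: "(nat \<Rightarrow> nat) \<Rightarrow> real"
  assumes b: "0 < b" and J: "finite J" and q [measurable]: "q \<in> borel_measurable (conf J)"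
    and q2: "integrable (nu_prod J (\<lambda>_. b)) (\<lambda>\<eta>. (q \<eta>)\<^sup>2)"
begin

abbreviation Q where "Q \<equiv> nu_prod J (\<lambda>_. b)"

definition weight_moment where "weight_moment = (\<integral>n. (1 + real n)\<^sup>2 \<partial>measure_pmf (nu b))"

lemma weight_component:
  assumes "i \<in> J"
  shows integrable_weight2: "integrable Q (\<lambda>\<eta>. (1 + real (\<eta> i))\<^sup>2)"
    and integral_weight2: "(\<integral>\<eta>. (1 + real (\<eta> i))\<^sup>2 \<partial>Q) = weight_moment"
proof -
  have eq: "measure_pmf (nu b) = distr Q (measure_pmf (nu b)) (\<lambda>\<omega>. \<omega> i)"
    unfolding nu_prod_def by (rule distr_PiM_component[symmetric]) (auto simp: assms prob_space_measure_pmf)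
  have m: "(\<lambda>\<omega>. \<omega> i) \<in> measurable Q (measure_pmf (nu b))"
    using assms by simp
  have "integrable (distr Q (measure_pmf (nu b)) (\<lambda>\<omega>. \<omega> i)) (\<lambda>n. (1 + real n)\<^sup>2)"
    using integrable_nu_power[of b 2] b eq by simp
  then show "integrable Q (\<lambda>\<eta>. (1 + real (\<eta> i))\<^sup>2)"
    by (subst (asm) integrable_distr_eq[OF m]) auto
  have "weight_moment = (\<integral>n. (1 + real n)\<^sup>2 \<partial>distr Q (measure_pmf (nu b)) (\<lambda>\<omega>. \<omega> i))"
    unfolding weight_moment_def using eq by simp
  also have "\<dots> = (\<integral>\<eta>. (1 + real (\<eta> i))\<^sup>2 \<partial>Q)" by (rule integral_distr[OF m]) simp
  finally show "(\<integral>\<eta>. (1 + real (\<eta> i))\<^sup>2 \<partial>Q) = weight_moment" by simp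
qed

lemma weighted:
  assumes i: "i \<in> J"
  shows integrable_weighted: "integrable Q (\<lambda>\<eta>. \<bar>q \<eta>\<bar> * (1 + real (\<eta> i)))"
    and integral_weighted_le: "(\<integral>\<eta>. \<bar>q \<eta>\<bar> * (1 + real (\<eta> i)) \<partial>Q) \<le> (\<integral>\<eta>. (q \<eta>)\<^sup>2 \<partial>Q) + weight_moment"
proof -
  have le: "\<bar>q \<eta>\<bar> * (1 + real (\<eta> i)) \<le> (q \<eta>)\<^sup>2 + (1 + real (\<eta> i))\<^sup>2" for \<eta>
  proof -
    have "0 \<le> (\<bar>q \<eta>\<bar> - (1 + real (\<eta> i)))\<^sup>2 + \<bar>q \<eta>\<bar>\<^sup>2 + (1 + real (\<eta> i))\<^sup>2" by simp
    then show ?thesis by (simp add: power2_diff)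
  qed
  have i2: "integrable Q (\<lambda>\<eta>. (q \<eta>)\<^sup>2 + (1 + real (\<eta> i))\<^sup>2)"
    using q2 integrable_weight2[OF i] by simp
  show int: "integrable Q (\<lambda>\<eta>. \<bar>q \<eta>\<bar> * (1 + real (\<eta> i)))"
  proof (rule Bochner_Integration.integrable_bound[OF i2])
    have [measurable]: "(\<lambda>\<eta>. 1 + real (\<eta> i)) \<in> borel_measurable (conf J)"
      using i by (rule measurable_component_conf)
    show "(\<lambda>\<eta>. \<bar>q \<eta>\<bar> * (1 + real (\<eta> i))) \<in> borel_measurable Q" by simp
    show "AE \<eta> in Q. norm (\<bar>q \<eta>\<bar> * (1 + real (\<eta> i))) \<le> norm ((q \<eta>)\<^sup>2 + (1 + real (\<eta> i))\<^sup>2)"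
      using le by (auto simp: abs_mult)
  qed
  have "(\<integral>\<eta>. \<bar>q \<eta>\<bar> * (1 + real (\<eta> i)) \<partial>Q) \<le> (\<integral>\<eta>. (q \<eta>)\<^sup>2 + (1 + real (\<eta> i))\<^sup>2 \<partial>Q)"
    using int i2 le by (intro integral_mono) auto
  also have "\<dots> = (\<integral>\<eta>. (q \<eta>)\<^sup>2 \<partial>Q) + weight_moment"
    using q2 integrable_weight2[OF i] integral_weight2[OF i] by simp
  finally show "(\<integral>\<eta>. \<bar>q \<eta>\<bar> * (1 + real (\<eta> i)) \<partial>Q) \<le> (\<integral>\<eta>. (q \<eta>)\<^sup>2 \<partial>Q) + weight_moment" .
qed

lemma lratio_component_measurable [measurable]:
  "i \<in> J \<Longrightarrow> (\<lambda>\<eta>. lratio b x (\<eta> i)) \<in> borel_measurable (conf J)"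
  "i \<in> J \<Longrightarrow> (\<lambda>\<eta>. lratio' b x (\<eta> i)) \<in> borel_measurable (conf J)"
  by (rule measurable_component_conf; simp)+

lemma prod_lratio_bounds:
  assumes "\<theta> \<in> J \<rightarrow> {0..b}"
  shows "0 \<le> (\<Prod>i\<in>J. lratio b (\<theta> i) (\<eta> i))" "(\<Prod>i\<in>J. lratio b (\<theta> i) (\<eta> i)) \<le> (1 + b) ^ card J"
proof -
  have *: "0 \<le> lratio b (\<theta> i) (\<eta> i)" "lratio b (\<theta> i) (\<eta> i) \<le> 1 + b" if "i \<in> J" for i
    using assms that b by (auto intro!: lratio_bounds simp: Pi_iff)
  then show "0 \<le> (\<Prod>i\<in>J. lratio b (\<theta> i) (\<eta> i))" by (intro prod_nonneg) auto
  show "(\<Prod>i\<in>J. lratio b (\<theta> i) (\<eta> i)) \<le> (1 + b) ^ card J"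
    using prod_mono[of J "\<lambda>i. lratio b (\<theta> i) (\<eta> i)" "\<lambda>_. 1 + b"] * by simp
qed

text \<open>On a finite set of coordinates the density with respect to \<open>Q\<close> lies between
  0 and \<open>(1 + b) ^ card J\<close>. Integrability and moments under \<open>b\<close> therefore
  carry over uniformly to all parameters below.\<close>

lemma change_of_measure:
  fixes w :: "(nat \<Rightarrow> nat) \<Rightarrow> real"
  assumes \<theta>: "\<theta> \<in> J \<rightarrow> {0..b}" and w: "integrable Q w"
  shows integrable_nu_prod: "integrable (nu_prod J \<theta>) w"
    and integrable_prod_lratio: "integrable Q (\<lambda>\<eta>. (\<Prod>i\<in>J. lratio b (\<theta> i) (\<eta> i)) * w \<eta>)"
    and integral_nu_prod: "(\<integral>\<eta>. w \<eta> \<partial>nu_prod J \<theta>) = (\<integral>\<eta>. (\<Prod>i\<in>J. lratio b (\<theta> i) (\<eta> i)) * w \<eta> \<partial>Q)"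
    and abs_integral_nu_prod_le: "(\<integral>\<eta>. \<bar>w \<eta>\<bar> \<partial>nu_prod J \<theta>) \<le> (1 + b) ^ card J * (\<integral>\<eta>. \<bar>w \<eta>\<bar> \<partial>Q)"
proof -
  have wm: "w \<in> borel_measurable Q" using w by auto
  have pm: "(\<lambda>\<eta>. \<Prod>i\<in>J. lratio b (\<theta> i) (\<eta> i)) \<in> borel_measurable Q" by simp
  have nn: "AE \<eta> in Q. 0 \<le> (\<Prod>i\<in>J. lratio b (\<theta> i) (\<eta> i))"
    using prod_lratio_bounds[OF \<theta>] by simp
  have i: "integrable Q (\<lambda>\<eta>. (\<Prod>i\<in>J. lratio b (\<theta> i) (\<eta> i)) * w \<eta>)" if w: "integrable Q w" for w :: "(nat \<Rightarrow> nat) \<Rightarrow> real"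
  proof (rule Bochner_Integration.integrable_bound)
    show "integrable Q (\<lambda>\<eta>. (1 + b) ^ card J * w \<eta>)" using w by simp
    show "(\<lambda>\<eta>. (\<Prod>i\<in>J. lratio b (\<theta> i) (\<eta> i)) * w \<eta>) \<in> borel_measurable Q"
      using w pm by (intro borel_measurable_times) auto
    show "AE \<eta> in Q. norm ((\<Prod>i\<in>J. lratio b (\<theta> i) (\<eta> i)) * w \<eta>) \<le> norm ((1 + b) ^ card J * w \<eta>)"
      using prod_lratio_bounds[OF \<theta>] b by (auto simp: abs_mult intro!: mult_right_mono)
  qed
  show "integrable Q (\<lambda>\<eta>. (\<Prod>i\<in>J. lratio b (\<theta> i) (\<eta> i)) * w \<eta>)" by (rule i[OF w])
  then show "integrable (nu_prod J \<theta>) w"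
    unfolding nu_prod_density[OF b J \<theta>] using integrable_density[OF wm pm nn] by simp
  show "(\<integral>\<eta>. w \<eta> \<partial>nu_prod J \<theta>) = (\<integral>\<eta>. (\<Prod>i\<in>J. lratio b (\<theta> i) (\<eta> i)) * w \<eta> \<partial>Q)"
    unfolding nu_prod_density[OF b J \<theta>] using integral_density[OF wm pm nn] by simp
  have "(\<integral>\<eta>. \<bar>w \<eta>\<bar> \<partial>nu_prod J \<theta>) = (\<integral>\<eta>. (\<Prod>i\<in>J. lratio b (\<theta> i) (\<eta> i)) * \<bar>w \<eta>\<bar> \<partial>Q)"
    unfolding nu_prod_density[OF b J \<theta>] using integral_density[OF _ pm nn, of "\<lambda>\<eta>. \<bar>w \<eta>\<bar>"] wm by simp
  also have "\<dots> \<le> (\<integral>\<eta>. (1 + b) ^ card J * \<bar>w \<eta>\<bar> \<partial>Q)"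
    using i[of "\<lambda>\<eta>. \<bar>w \<eta>\<bar>"] w prod_lratio_bounds[OF \<theta>] by (intro integral_mono) (auto intro!: mult_right_mono)
  finally show "(\<integral>\<eta>. \<bar>w \<eta>\<bar> \<partial>nu_prod J \<theta>) \<le> (1 + b) ^ card J * (\<integral>\<eta>. \<bar>w \<eta>\<bar> \<partial>Q)" by simp
qed

lemma q_integrable: "integrable Q q"
proof (rule Bochner_Integration.integrable_bound)
  interpret prob_space Q by simp
  show "integrable Q (\<lambda>\<eta>. (q \<eta>)\<^sup>2 + 1)" using q2 by (intro Bochner_Integration.integrable_add) auto
  show "AE \<eta> in Q. norm (q \<eta>) \<le> norm ((q \<eta>)\<^sup>2 + 1)"
  proof (rule AE_I2)
    fix \<eta>
    have "0 \<le> (\<bar>q \<eta>\<bar> - 1)\<^sup>2 + \<bar>q \<eta>\<bar>\<^sup>2 + 1" by simp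
    then have "\<bar>q \<eta>\<bar> \<le> (q \<eta>)\<^sup>2 + 1" by (simp add: power2_diff)
    then show "norm (q \<eta>) \<le> norm ((q \<eta>)\<^sup>2 + 1)" by simp
  qed
qed simp

text \<open>The difference of two product densities is bounded by a sum of one-coordinate
  differences, each Lipschitz with weight \<open>1 + real (\<eta> i)\<close>. The bound is linear in
  the displacements of the single parameters, which later makes the errors summable along monotone
  parameters.\<close>

lemma expectation_lipschitz:
  assumes \<theta>: "\<theta> \<in> J \<rightarrow> {0..b}" and \<theta>': "\<theta>' \<in> J \<rightarrow> {0..b}"
  shows "\<bar>(\<integral>\<eta>. q \<eta> \<partial>nu_prod J \<theta>) - (\<integral>\<eta>. q \<eta> \<partial>nu_prod J \<theta>')\<bar>
    \<le> (1 + b) ^ card J * lratio_const b * ((\<integral>\<eta>. (q \<eta>)\<^sup>2 \<partial>Q) + weight_moment) * (\<Sum>i\<in>J. \<bar>\<theta> i - \<theta>' i\<bar>)"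
proof -
  define C where "C = (1 + b) ^ card J * lratio_const b"
  have C: "0 \<le> C" using b lratio_const_nonneg[OF b] by (simp add: C_def)
  have "(\<integral>\<eta>. q \<eta> \<partial>nu_prod J \<theta>) - (\<integral>\<eta>. q \<eta> \<partial>nu_prod J \<theta>') =
      (\<integral>\<eta>. (\<Prod>i\<in>J. lratio b (\<theta> i) (\<eta> i)) * q \<eta> - (\<Prod>i\<in>J. lratio b (\<theta>' i) (\<eta> i)) * q \<eta> \<partial>Q)"
    unfolding integral_nu_prod[OF \<theta> q_integrable] integral_nu_prod[OF \<theta>' q_integrable]
    by (rule Bochner_Integration.integral_diff[symmetric]; intro integrable_prod_lratio \<theta> \<theta>' q_integrable)
  also have "norm \<dots> \<le> (\<integral>\<eta>. (\<Sum>i\<in>J. C * \<bar>\<theta> i - \<theta>' i\<bar> * (\<bar>q \<eta>\<bar> * (1 + real (\<eta> i)))) \<partial>Q)"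
  proof (rule norm_integral_le)
    show "integrable Q (\<lambda>\<eta>. \<Sum>i\<in>J. C * \<bar>\<theta> i - \<theta>' i\<bar> * (\<bar>q \<eta>\<bar> * (1 + real (\<eta> i))))"
      by (intro Bochner_Integration.integrable_sum integrable_mult_right integrable_weighted)
    fix \<eta>
    have "norm ((\<Prod>i\<in>J. lratio b (\<theta> i) (\<eta> i)) * q \<eta> - (\<Prod>i\<in>J. lratio b (\<theta>' i) (\<eta> i)) * q \<eta>) =
        \<bar>(\<Prod>i\<in>J. lratio b (\<theta> i) (\<eta> i)) - (\<Prod>i\<in>J. lratio b (\<theta>' i) (\<eta> i))\<bar> * \<bar>q \<eta>\<bar>"
      by (simp add: abs_mult flip: left_diff_distrib)
    also have "\<dots> \<le> ((1 + b) ^ card J * (\<Sum>i\<in>J. \<bar>lratio b (\<theta> i) (\<eta> i) - lratio b (\<theta>' i) (\<eta> i)\<bar>)) * \<bar>q \<eta>\<bar>"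
      using J b lratio_bounds[OF b] \<theta> \<theta>'
      by (intro mult_right_mono abs_prod_diff_le) (auto simp: Pi_iff abs_of_nonneg)
    also have "\<dots> \<le> ((1 + b) ^ card J * (\<Sum>i\<in>J. lratio_const b * (1 + real (\<eta> i)) * \<bar>\<theta> i - \<theta>' i\<bar>)) * \<bar>q \<eta>\<bar>"
      using b \<theta> \<theta>' by (intro mult_right_mono mult_left_mono sum_mono lratio_lipschitz) (auto simp: Pi_iff)
    also have "\<dots> = (\<Sum>i\<in>J. C * \<bar>\<theta> i - \<theta>' i\<bar> * (\<bar>q \<eta>\<bar> * (1 + real (\<eta> i))))"
      by (simp add: C_def sum_distrib_left sum_distrib_right ac_simps)
    finally show "norm ((\<Prod>i\<in>J. lratio b (\<theta> i) (\<eta> i)) * q \<eta> - (\<Prod>i\<in>J. lratio b (\<theta>' i) (\<eta> i)) * q \<eta>)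
      \<le> (\<Sum>i\<in>J. C * \<bar>\<theta> i - \<theta>' i\<bar> * (\<bar>q \<eta>\<bar> * (1 + real (\<eta> i))))" .
  qed
  also have "\<dots> = (\<Sum>i\<in>J. C * \<bar>\<theta> i - \<theta>' i\<bar> * (\<integral>\<eta>. \<bar>q \<eta>\<bar> * (1 + real (\<eta> i)) \<partial>Q))"
    by (subst Bochner_Integration.integral_sum) (auto intro!: integrable_mult_right integrable_weighted)
  also have "\<dots> \<le> (\<Sum>i\<in>J. C * \<bar>\<theta> i - \<theta>' i\<bar> * ((\<integral>\<eta>. (q \<eta>)\<^sup>2 \<partial>Q) + weight_moment))"
    using C by (intro sum_mono mult_left_mono integral_weighted_le) auto
  also have "\<dots> = C * ((\<integral>\<eta>. (q \<eta>)\<^sup>2 \<partial>Q) + weight_moment) * (\<Sum>i\<in>J. \<bar>\<theta> i - \<theta>' i\<bar>)"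
    by (simp add: sum_distrib_left sum_distrib_right ac_simps)
  finally show ?thesis by (simp add: C_def)
qed

text \<open>Under the fixed measure \<open>Q\<close> the parameter occurs only in the density, which
  is differentiated by the product rule. One majorant \<open>G\<close> serves twice: for
  differentiating under the integral and for continuity of the derivative.\<close>

lemma expectation_has_continuous_derivative:
  obtains D where "continuous_on {0..b} D"
    "\<And>x. x \<in> {0..b} \<Longrightarrow> ((\<lambda>x. \<integral>\<eta>. q \<eta> \<partial>nu_prod J (\<lambda>_. x)) has_real_derivative D x) (at x within {0..b})"
proof
  define F where "F x \<eta> = (\<Prod>i\<in>J. lratio b x (\<eta> i)) * q \<eta>" for x \<eta>
  define F' where "F' x \<eta> = (\<Sum>i\<in>J. lratio' b x (\<eta> i) * (\<Prod>j\<in>J - {i}. lratio b x (\<eta> j))) * q \<eta>" for x \<eta>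
  define C where "C = (1 + b) ^ card J * lratio_const b"
  define G where "G \<eta> = (\<Sum>i\<in>J. C * (\<bar>q \<eta>\<bar> * (1 + real (\<eta> i))))" for \<eta>
  define D where "D x = (\<integral>\<eta>. F' x \<eta> \<partial>Q)" for x
  have G_int: "integrable Q G"
    unfolding G_def by (intro Bochner_Integration.integrable_sum integrable_mult_right integrable_weighted)
  have F'_le: "norm (F' x \<eta>) \<le> G \<eta>" if x: "x \<in> {0..b}" for x \<eta>
  proof -
    have "norm (F' x \<eta>) \<le> (\<Sum>i\<in>J. \<bar>lratio' b x (\<eta> i)\<bar> * \<bar>\<Prod>j\<in>J - {i}. lratio b x (\<eta> j)\<bar>) * \<bar>q \<eta>\<bar>"
      unfolding F'_def by (auto simp: abs_mult intro!: mult_right_mono order_trans[OF sum_abs])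
    also have "\<dots> \<le> (\<Sum>i\<in>J. lratio_const b * (1 + real (\<eta> i)) * (1 + b) ^ card J) * \<bar>q \<eta>\<bar>"
    proof (intro mult_right_mono sum_mono mult_mono)
      fix i assume "i \<in> J"
      show "\<bar>lratio' b x (\<eta> i)\<bar> \<le> lratio_const b * (1 + real (\<eta> i))" using abs_lratio'_le[OF b] x by auto
      have "\<bar>\<Prod>j\<in>J - {i}. lratio b x (\<eta> j)\<bar> \<le> (\<Prod>j\<in>J - {i}. 1 + b)"
        unfolding abs_prod using lratio_bounds[OF b] x by (intro prod_mono) (auto simp: abs_of_nonneg)
      also have "\<dots> \<le> (1 + b) ^ card J"
        using b \<open>i \<in> J\<close> J by (auto intro!: power_increasing card_mono)
      finally show "\<bar>\<Prod>j\<in>J - {i}. lratio b x (\<eta> j)\<bar> \<le> (1 + b) ^ card J" .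
    qed (use b lratio_const_nonneg[OF b] in auto)
    also have "\<dots> = G \<eta>" by (simp add: G_def C_def sum_distrib_left sum_distrib_right ac_simps)
    finally show ?thesis .
  qed
  have F'_meas: "F' x \<in> borel_measurable (conf J)" for x
    unfolding F'_def
    by (intro borel_measurable_times borel_measurable_sum borel_measurable_prod lratio_component_measurable q) auto
  show "continuous_on {0..b} D"
    unfolding D_def
  proof (rule continuous_on_integral_dominated[OF _ _ F'_le G_int])
    fix \<eta>
    show "continuous_on {0..b} (\<lambda>x. F' x \<eta>)"
      unfolding F'_def lratio_def lratio'_def using b
      by (intro continuous_intros) auto
  qed (use F'_meas in auto)
  fix x assume x: "x \<in> {0..b}"
  have "((\<lambda>x. \<integral>\<eta>. F x \<eta> \<partial>Q) has_vector_derivative D x) (at x within {0..b})"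
    unfolding D_def
  proof (rule integral_has_vector_derivative_within[OF _ x _ _ _ F'_le G_int])
    fix y \<eta> assume y: "y \<in> {0..b}"
    then show "integrable Q (F y)" unfolding F_def by (intro integrable_prod_lratio q_integrable) auto
    have "((\<lambda>x. \<Prod>i\<in>J. lratio b x (\<eta> i)) has_derivative
        (\<lambda>h. \<Sum>i\<in>J. (lratio' b y (\<eta> i) * h) * (\<Prod>j\<in>J - {i}. lratio b y (\<eta> j)))) (at y within {0..b})"
      using y b lratio_deriv[OF b] unfolding has_field_derivative_def by (intro has_derivative_prod) auto
    then have "((\<lambda>x. \<Prod>i\<in>J. lratio b x (\<eta> i)) has_real_derivative
        (\<Sum>i\<in>J. lratio' b y (\<eta> i) * (\<Prod>j\<in>J - {i}. lratio b y (\<eta> j)))) (at y within {0..b})"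
      unfolding has_field_derivative_def
      by (rule has_derivative_eq_rhs) (simp add: fun_eq_iff sum_distrib_left sum_distrib_right ac_simps)
    from DERIV_cmult_right[OF this, of "q \<eta>"]
    show "((\<lambda>y. F y \<eta>) has_vector_derivative F' y \<eta>) (at y within {0..b})"
      unfolding F_def F'_def by (simp add: has_real_derivative_iff_has_vector_derivative)
  qed (use F'_meas in auto)
  then have "((\<lambda>x. \<integral>\<eta>. F x \<eta> \<partial>Q) has_real_derivative D x) (at x within {0..b})"
    by (simp add: has_real_derivative_iff_has_vector_derivative)
  moreover have "(\<integral>\<eta>. q \<eta> \<partial>nu_prod J (\<lambda>_. y)) = (\<integral>\<eta>. F y \<eta> \<partial>Q)" if "y \<in> {0..b}" for y
    unfolding F_def using that by (intro integral_nu_prod q_integrable) auto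
  ultimately show "((\<lambda>x. \<integral>\<eta>. q \<eta> \<partial>nu_prod J (\<lambda>_. x)) has_real_derivative D x) (at x within {0..b})"
    by (subst has_field_derivative_cong_eventually[where g="\<lambda>x. \<integral>\<eta>. F x \<eta> \<partial>Q"])
       (use x in \<open>auto simp: eventually_at_filter\<close>)
qed

end

declare One_nat_def [simp del]

section \<open>Order statistics of uniform variables\<close>

text \<open>This is \<open>N\<close> times the empirical distribution function of the sample
  \<open>u\<close>.\<close>

definition count_le :: "nat \<Rightarrow> (nat \<Rightarrow> real) \<Rightarrow> real \<Rightarrow> nat" where
  "count_le N u x = card {j \<in> {1..N}. u j \<le> x}"

text \<open>In a sorted list the entries at most \<open>x\<close> form an initial segment, so an
  entry belongs to it exactly if its position, counted from 0, is less than the length of the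
  segment.\<close>

lemma sorted_nth_le_iff:
  assumes "sorted xs" "i < length xs"
  shows "xs ! i \<le> x \<longleftrightarrow> i < length (filter (\<lambda>y. y \<le> x) xs)"
proof -
  define S where "S = {j. j < length xs \<and> xs ! j \<le> x}"
  have S: "length (filter (\<lambda>y. y \<le> x) xs) = card S" by (simp add: S_def length_filter_conv_card)
  have "finite S" by (simp add: S_def)
  show ?thesis
  proof
    assume le: "xs ! i \<le> x"
    have "{..i} \<subseteq> S"
    proof
      fix j assume "j \<in> {..i}"
      then have "xs ! j \<le> xs ! i" "j < length xs"
        using assms sorted_nth_mono[of xs j i] by auto
      then show "j \<in> S" using le by (simp add: S_def)
    qed
    then show "i < length (filter (\<lambda>y. y \<le> x) xs)"
      using card_mono[OF \<open>finite S\<close>, of "{..i}"] unfolding S by simp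
  next
    assume less: "i < length (filter (\<lambda>y. y \<le> x) xs)"
    show "xs ! i \<le> x"
    proof (rule ccontr)
      assume gt: "\<not> xs ! i \<le> x"
      have "S \<subseteq> {..<i}"
      proof
        fix j assume j: "j \<in> S"
        have "xs ! i \<le> xs ! j" if "i \<le> j"
          using that j assms sorted_nth_mono[of xs i j] by (simp add: S_def)
        then show "j \<in> {..<i}" using gt j by (auto simp: S_def not_less intro: leI)
      qed
      then have "card S \<le> i" using card_mono[of "{..<i}" S] by simp
      then show False using less S by simp
    qed
  qed
qed

text \<open>The duality between quantiles and the empirical distribution function. It trades the
  dependent order statistics for a symmetric sum of independent indicators. Positions in the sorted
  list start at 0 and order statistics at 1, so the strict inequality becomes a weak one.\<close>

lemma order_stats_le_iff:
  assumes "i \<in> {1..N}"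
  shows "order_stats N u i \<le> x \<longleftrightarrow> i \<le> count_le N u x"
proof -
  have "order_stats N u i \<le> x \<longleftrightarrow> i - 1 < length (filter (\<lambda>y. y \<le> x) (sort (map u [1..<Suc N])))"
    using assms by (auto simp: order_stats_def sorted_nth_le_iff simp del: upt_Suc)
  also have "length (filter (\<lambda>y. y \<le> x) (sort (map u [1..<Suc N]))) = card (set (filter (\<lambda>j. u j \<le> x) [1..<Suc N]))"
    by (subst distinct_card) (auto simp: filter_sort filter_map comp_def simp del: upt_Suc)
  also have "set (filter (\<lambda>j. u j \<le> x) [1..<Suc N]) = {j \<in> {1..N}. u j \<le> x}"
    by (auto simp del: upt_Suc)
  finally show ?thesis using assms by (auto simp: count_le_def)
qed

lemma order_stats_mono:
  assumes "1 \<le> i" "i \<le> j" "j \<le> N"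
  shows "order_stats N u i \<le> order_stats N u j"
  using assms sorted_nth_mono[of "sort (map u [1..<Suc N])" "i - 1" "j - 1"]
  by (auto simp: order_stats_def simp del: upt_Suc)

lemma order_stats_in:
  assumes "u \<in> {1..N} \<rightarrow> A"
  shows "order_stats N u \<in> {1..N} \<rightarrow> A"
proof
  fix i assume i: "i \<in> {1..N}"
  have "sort (map u [1..<Suc N]) ! (i - 1) \<in> set (sort (map u [1..<Suc N]))"
    using i by (intro nth_mem) auto
  then show "order_stats N u i \<in> A"
    using i assms by (auto simp: order_stats_def simp del: upt_Suc)
qed

lemma count_le_le: "count_le N u x \<le> N"
proof -
  have "count_le N u x \<le> card {1..N}" unfolding count_le_def by (rule card_mono) auto
  then show ?thesis by simp
qed

lemma count_le_eq_sum: "real (count_le N u x) = (\<Sum>j\<in>{1..N}. if u j \<le> x then 1 else 0)"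
  by (simp add: count_le_def sum.If_cases Int_def)

section \<open>Uniform laws on an interval and on the unit interval\<close>

lemma space_uniform_law [simp]: "space (uniform_law a b) = {a..b}"
  by (simp add: uniform_law_def space_restrict_space)

lemma sets_uniform_law: "sets (uniform_law a b) = sets (restrict_space borel {a..b})"
  unfolding uniform_law_def by (rule sets_restrict_space_cong) simp

lemma measurable_uniform_law_eq: "measurable (uniform_law a b) N = measurable (restrict_space borel {a..b}) N"
  by (rule measurable_cong_sets[OF sets_uniform_law refl])

lemma measurable_uniform_law_eq': "measurable N (uniform_law a b) = measurable N (restrict_space borel {a..b})"
  by (rule measurable_cong_sets[OF refl sets_uniform_law])

lemma measurable_uniform_law [measurable (raw)]:
  "f \<in> borel_measurable borel \<Longrightarrow> f \<in> borel_measurable (uniform_law a b)"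
  unfolding measurable_uniform_law_eq by (rule measurable_restrict_space1)

definition unit_law :: "real measure" where
  "unit_law = restrict_space lborel {0..1}"

lemma space_unit_law [simp]: "space unit_law = {0..1}"
  by (simp add: unit_law_def space_restrict_space)

lemma prob_space_unit_law [simp]: "prob_space unit_law"
  by standard (simp add: unit_law_def emeasure_restrict_space space_restrict_space)

lemma sets_unit_law: "sets unit_law = sets (restrict_space borel {0..1})"
  unfolding unit_law_def by (rule sets_restrict_space_cong) simp

lemma measurable_unit_law [measurable (raw)]:
  "f \<in> borel_measurable borel \<Longrightarrow> f \<in> borel_measurable unit_law"
  unfolding unit_law_def by (rule measurable_restrict_space1) simp

lemma set_lebesgue_integral_unit_law:
  fixes f :: "real \<Rightarrow> 'b::{banach, second_countable_topology}"
  shows "(LBINT s:{0..1}. f s) = (\<integral>s. f s \<partial>unit_law)"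
  unfolding unit_law_def set_lebesgue_integral_def by (subst integral_restrict_space) auto

lemma continuous_on_measurable_unit_law:
  fixes f :: "real \<Rightarrow> real"
  shows "continuous_on {0..1} f \<Longrightarrow> f \<in> borel_measurable unit_law"
  unfolding measurable_cong_sets[OF sets_unit_law refl] by (rule borel_measurable_continuous_on_restrict)

lemma continuous_on_integrable_unit_law:
  fixes f :: "real \<Rightarrow> real"
  assumes "continuous_on {0..1} f"
  shows "integrable unit_law f"
proof -
  interpret prob_space unit_law by simp
  obtain B where "\<forall>x\<in>{0..1}. norm (f x) \<le> B"
    using compact_imp_bounded[OF compact_continuous_image[OF assms compact_Icc]]
    by (auto simp: bounded_iff)
  then show ?thesis
    using continuous_on_measurable_unit_law[OF assms] by (intro integrable_const_bound[where B=B]) auto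
qed

context
  fixes a b :: real
  assumes ab: "a < b"
begin

lemma rho_measurable: "rho a b \<in> measurable unit_law (uniform_law a b)"
proof -
  have "rho a b \<in> measurable unit_law (restrict_space borel {a..b})"
  proof (rule measurable_restrict_space2)
    show "rho a b \<in> space unit_law \<rightarrow> {a..b}"
    proof
      fix x assume "x \<in> space unit_law"
      then have "0 \<le> (b - a) * x" "(b - a) * x \<le> (b - a) * 1" using ab by (auto intro: mult_left_le)
      then show "rho a b x \<in> {a..b}" by (simp add: rho_def)
    qed
    show "rho a b \<in> borel_measurable unit_law" unfolding rho_def[abs_def] by measurable
  qed
  then show ?thesis by (simp only: measurable_uniform_law_eq')
qed

text \<open>Affine substitution in Lebesgue measure; a measurable \<open>A\<close> lies in
  \<open>{a..b}\<close>, so its preimage lies in the unit interval. Expectations over one random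
  parameter thus become integrals against \<open>unit_law\<close>.\<close>

lemma uniform_law_eq_distr: "uniform_law a b = distr unit_law (uniform_law a b) (rho a b)"
proof (rule measure_eqI)
  fix A assume A: "A \<in> sets (uniform_law a b)"
  then have A': "A \<in> sets borel" "A \<subseteq> {a..b}"
    by (auto simp: sets_uniform_law sets_restrict_space)
  have "emeasure (uniform_law a b) A = emeasure lborel ({a..b} \<inter> A) / emeasure lborel {a..b}"
    using A' by (simp add: uniform_law_def emeasure_restrict_space)
  also have "{a..b} \<inter> A = A" using A' by auto
  also have "emeasure lborel A = (\<integral>\<^sup>+x. indicator A x \<partial>lborel)" using A' by simp
  also have "\<dots> = ennreal (b - a) * (\<integral>\<^sup>+x. indicator A (a + (b - a) * x) \<partial>lborel)"
    using A' ab by (subst nn_integral_real_affine[of _ "b - a" a]) auto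
  also have "(\<integral>\<^sup>+x. indicator A (a + (b - a) * x) \<partial>lborel) = (\<integral>\<^sup>+x. indicator (rho a b -` A \<inter> {0..1}) x \<partial>lborel)"
  proof (rule nn_integral_cong)
    fix x :: real
    have "x \<in> {0..1}" if "a + (b - a) * x \<in> A"
    proof -
      have "a + (b - a) * x \<in> {a..b}" using that A' by auto
      then have "0 \<le> (b - a) * x" "(b - a) * x \<le> (b - a) * 1" by auto
      then show ?thesis using ab by (auto simp: zero_le_mult_iff mult_le_cancel_left)
    qed
    then show "indicator A (a + (b - a) * x) = (indicator (rho a b -` A \<inter> {0..1}) x :: ennreal)"
      by (auto simp: indicator_def rho_def)
  qed
  also have "\<dots> = emeasure lborel (rho a b -` A \<inter> {0..1})"
  proof (rule nn_integral_indicator)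
    have "rho a b -` A \<in> sets borel"
      using measurable_sets[of "rho a b" borel borel A] A' unfolding rho_def[abs_def] by simp
    then show "rho a b -` A \<inter> {0..1} \<in> sets lborel" by auto
  qed
  also have "\<dots> = emeasure (distr unit_law (uniform_law a b) (rho a b)) A"
    using emeasure_distr[OF rho_measurable A] by (simp add: unit_law_def emeasure_restrict_space)
  also have "ennreal (b - a) * emeasure (distr unit_law (uniform_law a b) (rho a b)) A / emeasure lborel {a..b}
     = emeasure (distr unit_law (uniform_law a b) (rho a b)) A"
    using ab by (subst mult.commute) (simp add: ennreal_mult_divide_eq)
  finally show "emeasure (uniform_law a b) A = emeasure (distr unit_law (uniform_law a b) (rho a b)) A" .
qed simp

lemma prob_space_uniform_law [simp]: "prob_space (uniform_law a b)"
proof -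
  interpret prob_space unit_law by simp
  show ?thesis by (subst uniform_law_eq_distr) (rule prob_space_distr[OF rho_measurable])
qed

lemma integral_uniform_law:
  fixes f :: "real \<Rightarrow> 'b::{banach, second_countable_topology}"
  assumes "f \<in> borel_measurable (uniform_law a b)"
  shows "(\<integral>u. f u \<partial>uniform_law a b) = (\<integral>s. f (rho a b s) \<partial>unit_law)"
  by (subst uniform_law_eq_distr) (rule integral_distr[OF rho_measurable assms])

abbreviation Ulaw where "Ulaw N \<equiv> PiM {1..N::nat} (\<lambda>_. uniform_law a b)"

lemma prob_space_Ulaw [simp]: "prob_space (Ulaw N)"
  by (rule prob_space_PiM) simp

lemma Ulaw_component_measurable:
  "j \<in> {1..N} \<Longrightarrow> f \<in> borel_measurable (uniform_law a b) \<Longrightarrow> (\<lambda>u. f (u j)) \<in> borel_measurable (Ulaw N)"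
  by (rule measurable_compose[OF measurable_component_singleton])

lemma Ulaw_space: "u \<in> space (Ulaw N) \<Longrightarrow> u \<in> {1..N} \<rightarrow> {a..b}"
  by (auto simp: space_PiM)

lemma count_le_measurable: "(\<lambda>u. real (count_le N u x)) \<in> borel_measurable (Ulaw N)"
  unfolding count_le_eq_sum
  by (intro borel_measurable_sum Ulaw_component_measurable[where f="\<lambda>v. if v \<le> x then 1 else 0"]) auto

text \<open>The event that an order statistic is at most \<open>x\<close> is an event about a count,
  and a count is a sum of measurable indicators.\<close>

lemma order_stats_measurable: "order_stats N \<in> measurable (Ulaw N) (Ulaw N)"
proof -
  have "order_stats N = (\<lambda>u. \<lambda>i\<in>{1..N}. order_stats N u i)"
    by (auto simp: order_stats_def fun_eq_iff)
  moreover have "(\<lambda>u. \<lambda>i\<in>{1..N}. order_stats N u i) \<in> measurable (Ulaw N) (Ulaw N)"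
  proof (rule measurable_restrict)
    fix i assume i: "i \<in> {1..N}"
    have "(\<lambda>u. order_stats N u i) \<in> measurable (Ulaw N) (restrict_space borel {a..b})"
    proof (rule measurable_restrict_space2)
      show "(\<lambda>u. order_stats N u i) \<in> space (Ulaw N) \<rightarrow> {a..b}"
      proof
        fix u assume "u \<in> space (Ulaw N)"
        from order_stats_in[OF Ulaw_space[OF this]] i show "order_stats N u i \<in> {a..b}" by (auto simp: Pi_iff)
      qed
      show "(\<lambda>u. order_stats N u i) \<in> borel_measurable (Ulaw N)"
      proof (rule borel_measurableI_le)
        fix x
        have "{u \<in> space (Ulaw N). order_stats N u i \<le> x} = {u \<in> space (Ulaw N). real i \<le> real (count_le N u x)}"
          using order_stats_le_iff[OF i] by simp
        also have "\<dots> \<in> sets (Ulaw N)" using count_le_measurable by measurable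
        finally show "{u \<in> space (Ulaw N). order_stats N u i \<le> x} \<in> sets (Ulaw N)" .
      qed
    qed
    then show "(\<lambda>u. order_stats N u i) \<in> measurable (Ulaw N) (uniform_law a b)"
      by (simp only: measurable_uniform_law_eq')
  qed
  ultimately show ?thesis by simp
qed

section \<open>The kernel from parameters to configurations and integration against the
  mixture\<close>

context
  assumes a0: "0 \<le> a"
begin

text \<open>The probability of a set is a series of explicit functions of the parameter. Since
  \<open>a \<ge> 0\<close>, the formula for the weights is valid at every point of the underlying
  space.\<close>

lemma emeasure_nu_measurable: "(\<lambda>\<theta>. emeasure (measure_pmf (nu \<theta>)) A) \<in> borel_measurable (uniform_law a b)"
proof -
  have "(\<lambda>\<theta>. \<Sum>n. ennreal (1 / (1 + \<theta>) * (\<theta> / (1 + \<theta>)) ^ n) * indicator A n) \<in> borel_measurable (uniform_law a b)"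
    by (rule measurable_uniform_law) measurable
  also have "?this \<longleftrightarrow> ?thesis"
  proof (rule measurable_cong)
    fix \<theta> assume "\<theta> \<in> space (uniform_law a b)"
    then have \<theta>: "0 \<le> \<theta>" using a0 by auto
    have "emeasure (measure_pmf (nu \<theta>)) A = (\<integral>\<^sup>+n. indicator A n \<partial>measure_pmf (nu \<theta>))" by simp
    also have "\<dots> = (\<Sum>n. ennreal (pmf (nu \<theta>) n) * indicator A n)"
      by (simp add: nn_integral_measure_pmf nn_integral_count_space_nat del: nn_integral_indicator)
    finally show "(\<Sum>n. ennreal (1 / (1 + \<theta>) * (\<theta> / (1 + \<theta>)) ^ n) * indicator A n) = emeasure (measure_pmf (nu \<theta>)) A"
      by (simp add: pmf_nu[OF \<theta>])
  qed
  finally show ?thesis .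
qed

text \<open>Boxes are an intersection-stable generator, and the probability of a box is a finite
  product of measurable functions of single parameters.\<close>

lemma nu_prod_kernel: "nu_prod {1..N} \<in> measurable (Ulaw N) (subprob_algebra (conf {1..N}))"
proof (rule measurable_prob_algebraD, rule measurable_prob_algebra_generated)
  show "sets (conf {1..N}) = sigma_sets (\<Pi>\<^sub>E i\<in>{1..N}. space (count_space UNIV)) (prod_algebra {1..N} (\<lambda>_. count_space UNIV))"
    by (rule sets_PiM)
  show "Int_stable (prod_algebra {1..N} (\<lambda>_. count_space UNIV))" by (rule Int_stable_prod_algebra)
  show "prod_algebra {1..N} (\<lambda>_. count_space UNIV) \<subseteq> Pow (\<Pi>\<^sub>E i\<in>{1..N}. space (count_space UNIV))"
    by (rule prod_algebra_sets_into_space)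
  fix A :: "(nat \<Rightarrow> nat) set" assume "A \<in> prod_algebra {1..N} (\<lambda>_. count_space UNIV)"
  then obtain X where A: "A = Pi\<^sub>E {1..N} X" by (auto simp: prod_algebra_eq_finite)
  have eq: "emeasure (nu_prod {1..N} \<theta>) A = (\<Prod>i\<in>{1..N}. emeasure (measure_pmf (nu (\<theta> i))) (X i))" for \<theta>
  proof -
    interpret product_sigma_finite "\<lambda>i. measure_pmf (nu (\<theta> i))" by standard
    show ?thesis unfolding A nu_prod_def by (rule emeasure_PiM) auto
  qed
  show "(\<lambda>\<theta>. emeasure (nu_prod {1..N} \<theta>) A) \<in> borel_measurable (Ulaw N)"
    unfolding eq
    by (intro borel_measurable_prod_ennreal measurable_compose[OF _ emeasure_nu_measurable] measurable_component_singleton)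
qed auto

lemma expectation_measurable:
  fixes f :: "(nat \<Rightarrow> nat) \<Rightarrow> 'b::{banach, second_countable_topology}"
  assumes "f \<in> borel_measurable (conf {1..N})"
  shows "(\<lambda>u. \<integral>\<eta>. f \<eta> \<partial>nu_prod {1..N} (order_stats N u)) \<in> borel_measurable (Ulaw N)"
  by (rule measurable_compose[OF order_stats_measurable
        measurable_compose[OF nu_prod_kernel integral_measurable_subprob_algebra[OF assms]]])

lemma nu_prod_kernel_Theta: "nu_prod {1..N} \<in> measurable (Theta_law a b N) (subprob_algebra (conf {1..N}))"
  using nu_prod_kernel by (simp add: Theta_law_def)

lemma sets_config_law [simp]: "sets (config_law a b N) = sets (conf {1..N})"
proof -
  interpret prob_space "Ulaw N" by simp
  show ?thesis
    unfolding config_law_def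
    by (rule sets_bind[OF sets_kernel[OF nu_prod_kernel_Theta]])
       (use not_empty in \<open>auto simp: Theta_law_def\<close>)
qed

lemma prob_space_config_law [simp]: "prob_space (config_law a b N)"
proof -
  interpret prob_space "Ulaw N" by simp
  have "Theta_law a b N \<in> space (prob_algebra (Ulaw N))"
    using prob_space_distr[OF order_stats_measurable] by (simp add: space_prob_algebra Theta_law_def)
  moreover have "nu_prod {1..N} \<in> measurable (Ulaw N) (prob_algebra (conf {1..N}))"
    using nu_prod_kernel by (auto simp: prob_algebra_def measurable_restrict_space2_iff)
  ultimately show ?thesis
    unfolding config_law_def by (rule prob_space_bind')
qed

lemma nn_integral_config_law:
  assumes "f \<in> borel_measurable (conf {1..N})"
  shows "(\<integral>\<^sup>+\<eta>. f \<eta> \<partial>config_law a b N) = (\<integral>\<^sup>+u. \<integral>\<^sup>+\<eta>. f \<eta> \<partial>nu_prod {1..N} (order_stats N u) \<partial>Ulaw N)"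
proof -
  have m: "(\<lambda>\<theta>. \<integral>\<^sup>+\<eta>. f \<eta> \<partial>nu_prod {1..N} \<theta>) \<in> borel_measurable (Ulaw N)"
    by (rule measurable_compose[OF nu_prod_kernel nn_integral_measurable_subprob_algebra[OF assms]])
  show ?thesis
    unfolding config_law_def nn_integral_bind[OF assms nu_prod_kernel_Theta]
    unfolding Theta_law_def by (rule nn_integral_distr[OF order_stats_measurable]) (simp add: m)
qed

text \<open>For nonnegative integrands \<open>bind\<close> is an iterated integral without further
  conditions. The bound \<open>B\<close>, uniform over the parameters, makes the outer integral
  finite and so allows the passage to Bochner integrals.\<close>

lemma integral_config_law_nonneg:
  fixes f :: "(nat \<Rightarrow> nat) \<Rightarrow> real"
  assumes f: "f \<in> borel_measurable (conf {1..N})" "\<And>\<eta>. 0 \<le> f \<eta>"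
    and int: "\<And>\<theta>. \<theta> \<in> {1..N} \<rightarrow> {a..b} \<Longrightarrow> integrable (nu_prod {1..N} \<theta>) f"
    and le: "\<And>\<theta>. \<theta> \<in> {1..N} \<rightarrow> {a..b} \<Longrightarrow> (\<integral>\<eta>. f \<eta> \<partial>nu_prod {1..N} \<theta>) \<le> B"
  shows "has_bochner_integral (config_law a b N) f (\<integral>u. \<integral>\<eta>. f \<eta> \<partial>nu_prod {1..N} (order_stats N u) \<partial>Ulaw N)"
proof (rule has_bochner_integral_nn_integral)
  interpret prob_space "Ulaw N" by simp
  have os: "order_stats N u \<in> {1..N} \<rightarrow> {a..b}" if "u \<in> space (Ulaw N)" for u
    by (rule order_stats_in[OF Ulaw_space[OF that]])
  show "f \<in> borel_measurable (config_law a b N)"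
    unfolding measurable_cong_sets[OF sets_config_law refl] by (rule f(1))
  show "AE \<eta> in config_law a b N. 0 \<le> f \<eta>" using f by simp
  show "0 \<le> (\<integral>u. \<integral>\<eta>. f \<eta> \<partial>nu_prod {1..N} (order_stats N u) \<partial>Ulaw N)"
    using f by (intro Bochner_Integration.integral_nonneg) auto
  have "(\<integral>\<^sup>+\<eta>. ennreal (f \<eta>) \<partial>config_law a b N) =
      (\<integral>\<^sup>+u. \<integral>\<^sup>+\<eta>. ennreal (f \<eta>) \<partial>nu_prod {1..N} (order_stats N u) \<partial>Ulaw N)"
    using f by (intro nn_integral_config_law) auto
  also have "\<dots> = (\<integral>\<^sup>+u. ennreal (\<integral>\<eta>. f \<eta> \<partial>nu_prod {1..N} (order_stats N u)) \<partial>Ulaw N)"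
    using int os f by (intro nn_integral_cong nn_integral_eq_integral) auto
  also have "\<dots> = ennreal (\<integral>u. \<integral>\<eta>. f \<eta> \<partial>nu_prod {1..N} (order_stats N u) \<partial>Ulaw N)"
  proof (rule nn_integral_eq_integral)
    show "integrable (Ulaw N) (\<lambda>u. \<integral>\<eta>. f \<eta> \<partial>nu_prod {1..N} (order_stats N u))"
    proof (rule integrable_const_bound[where B=B])
      show "AE u in Ulaw N. norm (\<integral>\<eta>. f \<eta> \<partial>nu_prod {1..N} (order_stats N u)) \<le> B"
        using le os f by (intro AE_I2) (auto simp: abs_of_nonneg Bochner_Integration.integral_nonneg)
    qed (rule expectation_measurable[OF f(1)])
  qed (use f in \<open>auto intro!: Bochner_Integration.integral_nonneg\<close>)
  finally show "(\<integral>\<^sup>+\<eta>. ennreal (f \<eta>) \<partial>config_law a b N) =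
      ennreal (\<integral>u. \<integral>\<eta>. f \<eta> \<partial>nu_prod {1..N} (order_stats N u) \<partial>Ulaw N)" .
qed

lemma integral_config_law:
  fixes f :: "(nat \<Rightarrow> nat) \<Rightarrow> real"
  assumes f: "f \<in> borel_measurable (conf {1..N})"
    and int: "\<And>\<theta>. \<theta> \<in> {1..N} \<rightarrow> {a..b} \<Longrightarrow> integrable (nu_prod {1..N} \<theta>) f"
    and le: "\<And>\<theta>. \<theta> \<in> {1..N} \<rightarrow> {a..b} \<Longrightarrow> (\<integral>\<eta>. \<bar>f \<eta>\<bar> \<partial>nu_prod {1..N} \<theta>) \<le> B"
  shows "integrable (config_law a b N) f"
    and "(\<integral>\<eta>. f \<eta> \<partial>config_law a b N) = (\<integral>u. \<integral>\<eta>. f \<eta> \<partial>nu_prod {1..N} (order_stats N u) \<partial>Ulaw N)"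
    and "(\<integral>\<eta>. \<bar>f \<eta>\<bar> \<partial>config_law a b N) \<le> B"
proof -
  interpret prob_space "Ulaw N" by simp
  have os: "order_stats N u \<in> {1..N} \<rightarrow> {a..b}" if "u \<in> space (Ulaw N)" for u
    by (rule order_stats_in[OF Ulaw_space[OF that]])
  \<comment> \<open>Positive and negative part; each inherits integrability and the bound
    \<open>B\<close> from the absolute value.\<close>
  define p n where "p \<eta> = max (f \<eta>) 0" and "n \<eta> = max (- f \<eta>) 0" for \<eta>
  have nn: "0 \<le> p \<eta>" "0 \<le> n \<eta>" for \<eta> by (simp_all add: p_def n_def)
  have m [measurable]: "p \<in> borel_measurable (conf {1..N})" "n \<in> borel_measurable (conf {1..N})"
    unfolding p_def[abs_def] n_def[abs_def] using f by auto
  have i: "integrable (nu_prod {1..N} \<theta>) p" "integrable (nu_prod {1..N} \<theta>) n"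
    if "\<theta> \<in> {1..N} \<rightarrow> {a..b}" for \<theta>
    unfolding p_def[abs_def] n_def[abs_def] using int[OF that] by auto
  have l: "(\<integral>\<eta>. p \<eta> \<partial>nu_prod {1..N} \<theta>) \<le> B" "(\<integral>\<eta>. n \<eta> \<partial>nu_prod {1..N} \<theta>) \<le> B"
    if "\<theta> \<in> {1..N} \<rightarrow> {a..b}" for \<theta>
    using int[OF that] i[OF that]
    by (auto intro!: order_trans[OF integral_mono le[OF that]] simp: p_def n_def)
  have hp: "has_bochner_integral (config_law a b N) p (\<integral>u. \<integral>\<eta>. p \<eta> \<partial>nu_prod {1..N} (order_stats N u) \<partial>Ulaw N)"
    using m i l by (intro integral_config_law_nonneg[where B=B]) (auto simp: p_def)
  have hn: "has_bochner_integral (config_law a b N) n (\<integral>u. \<integral>\<eta>. n \<eta> \<partial>nu_prod {1..N} (order_stats N u) \<partial>Ulaw N)"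
    using m i l by (intro integral_config_law_nonneg[where B=B]) (auto simp: n_def)
  have f_eq: "f = (\<lambda>\<eta>. p \<eta> - n \<eta>)" by (auto simp: p_def n_def fun_eq_iff)
  have iU: "integrable (Ulaw N) (\<lambda>u. \<integral>\<eta>. g \<eta> \<partial>nu_prod {1..N} (order_stats N u))"
    if g: "g \<in> borel_measurable (conf {1..N})" "\<And>\<eta>. 0 \<le> g \<eta>"
      "\<And>\<theta>. \<theta> \<in> {1..N} \<rightarrow> {a..b} \<Longrightarrow> (\<integral>\<eta>. g \<eta> \<partial>nu_prod {1..N} \<theta>) \<le> B" for g :: "(nat \<Rightarrow> nat) \<Rightarrow> real"
    using g os by (intro integrable_const_bound[where B=B] expectation_measurable AE_I2)
      (auto simp: abs_of_nonneg Bochner_Integration.integral_nonneg)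
  have hf: "has_bochner_integral (config_law a b N) f
      ((\<integral>u. \<integral>\<eta>. p \<eta> \<partial>nu_prod {1..N} (order_stats N u) \<partial>Ulaw N) - (\<integral>u. \<integral>\<eta>. n \<eta> \<partial>nu_prod {1..N} (order_stats N u) \<partial>Ulaw N))"
    unfolding f_eq by (rule has_bochner_integral_diff[OF hp hn])
  then show "integrable (config_law a b N) f" by (auto simp: has_bochner_integral_iff)
  have "(\<integral>\<eta>. f \<eta> \<partial>config_law a b N) =
      (\<integral>u. (\<integral>\<eta>. p \<eta> \<partial>nu_prod {1..N} (order_stats N u)) - (\<integral>\<eta>. n \<eta> \<partial>nu_prod {1..N} (order_stats N u)) \<partial>Ulaw N)"
    unfolding has_bochner_integral_integral_eq[OF hf]
    by (rule Bochner_Integration.integral_diff[symmetric]; rule iU) (use m l nn in simp_all)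
  also have "\<dots> = (\<integral>u. \<integral>\<eta>. f \<eta> \<partial>nu_prod {1..N} (order_stats N u) \<partial>Ulaw N)"
    using os i by (intro Bochner_Integration.integral_cong) (auto simp: f_eq)
  finally show "(\<integral>\<eta>. f \<eta> \<partial>config_law a b N) = (\<integral>u. \<integral>\<eta>. f \<eta> \<partial>nu_prod {1..N} (order_stats N u) \<partial>Ulaw N)" .
  have "has_bochner_integral (config_law a b N) (\<lambda>\<eta>. \<bar>f \<eta>\<bar>) (\<integral>u. \<integral>\<eta>. \<bar>f \<eta>\<bar> \<partial>nu_prod {1..N} (order_stats N u) \<partial>Ulaw N)"
    using f int le by (intro integral_config_law_nonneg[where B=B]) auto
  then have "(\<integral>\<eta>. \<bar>f \<eta>\<bar> \<partial>config_law a b N) = (\<integral>u. \<integral>\<eta>. \<bar>f \<eta>\<bar> \<partial>nu_prod {1..N} (order_stats N u) \<partial>Ulaw N)"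
    by (rule has_bochner_integral_integral_eq)
  also have "\<dots> \<le> (\<integral>u. B \<partial>Ulaw N)"
    using f le os by (intro integral_mono iU) (auto simp: prob_space)
  finally show "(\<integral>\<eta>. \<bar>f \<eta>\<bar> \<partial>config_law a b N) \<le> B" by (simp add: prob_space)
qed

lemma integral_config_law_complex:
  fixes f :: "(nat \<Rightarrow> nat) \<Rightarrow> complex"
  assumes f: "f \<in> borel_measurable (conf {1..N})" and B: "\<And>\<eta>. cmod (f \<eta>) \<le> B"
  shows "(\<integral>\<eta>. f \<eta> \<partial>config_law a b N) = (\<integral>u. \<integral>\<eta>. f \<eta> \<partial>nu_prod {1..N} (order_stats N u) \<partial>Ulaw N)"
proof -
  have bd: "integrable (nu_prod {1..N} \<theta>) g" "(\<integral>\<eta>. \<bar>g \<eta>\<bar> \<partial>nu_prod {1..N} \<theta>) \<le> B"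
    if "g \<in> borel_measurable (conf {1..N})" "\<And>\<eta>. \<bar>g \<eta>\<bar> \<le> B" for g :: "(nat \<Rightarrow> nat) \<Rightarrow> real" and \<theta>
  proof -
    interpret prob_space "nu_prod {1..N} \<theta>" by simp
    show i: "integrable (nu_prod {1..N} \<theta>) g" using that by (intro integrable_const_bound[where B=B]) auto
    have "(\<integral>\<eta>. \<bar>g \<eta>\<bar> \<partial>nu_prod {1..N} \<theta>) \<le> (\<integral>\<eta>. B \<partial>nu_prod {1..N} \<theta>)"
      using i that by (intro integral_mono) auto
    then show "(\<integral>\<eta>. \<bar>g \<eta>\<bar> \<partial>nu_prod {1..N} \<theta>) \<le> B" by (simp add: prob_space)
  qed
  have fi: "complex_integrable (nu_prod {1..N} \<theta>) f" for \<theta>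
  proof -
    interpret prob_space "nu_prod {1..N} \<theta>" by simp
    show ?thesis using f B by (intro integrable_const_bound[where B=B]) auto
  qed
  have fc: "complex_integrable (config_law a b N) f"
  proof -
    interpret prob_space "config_law a b N" by simp
    have "f \<in> borel_measurable (config_law a b N)"
      unfolding measurable_cong_sets[OF sets_config_law refl] by (rule f)
    then show ?thesis using B by (intro integrable_const_bound[where B=B]) auto
  qed
  have fU: "complex_integrable (Ulaw N) (\<lambda>u. \<integral>\<eta>. f \<eta> \<partial>nu_prod {1..N} (order_stats N u))"
  proof -
    interpret prob_space "Ulaw N" by simp
    have "cmod (\<integral>\<eta>. f \<eta> \<partial>nu_prod {1..N} \<theta>) \<le> B" for \<theta>
    proof -
      interpret P: prob_space "nu_prod {1..N} \<theta>" by simp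
      have "cmod (\<integral>\<eta>. f \<eta> \<partial>nu_prod {1..N} \<theta>) \<le> (\<integral>\<eta>. B \<partial>nu_prod {1..N} \<theta>)"
        using B by (intro norm_integral_le) auto
      then show ?thesis by (simp add: P.prob_space)
    qed
    then show ?thesis
      by (intro integrable_const_bound[where B=B] expectation_measurable f) auto
  qed
  have Re: "(\<lambda>\<eta>. Re (f \<eta>)) \<in> borel_measurable (conf {1..N})" "\<And>\<eta>. \<bar>Re (f \<eta>)\<bar> \<le> B"
    and Im: "(\<lambda>\<eta>. Im (f \<eta>)) \<in> borel_measurable (conf {1..N})" "\<And>\<eta>. \<bar>Im (f \<eta>)\<bar> \<le> B"
    using f order_trans[OF abs_Re_le_cmod B] order_trans[OF abs_Im_le_cmod B] by auto
  show ?thesis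
  proof (rule complex_eqI)
    show "Re (\<integral>\<eta>. f \<eta> \<partial>config_law a b N) = Re (\<integral>u. \<integral>\<eta>. f \<eta> \<partial>nu_prod {1..N} (order_stats N u) \<partial>Ulaw N)"
      using integral_config_law(2)[of "\<lambda>\<eta>. Re (f \<eta>)" N B] Re bd[OF Re] fi fc fU by simp
    show "Im (\<integral>\<eta>. f \<eta> \<partial>config_law a b N) = Im (\<integral>u. \<integral>\<eta>. f \<eta> \<partial>nu_prod {1..N} (order_stats N u) \<partial>Ulaw N)"
      using integral_config_law(2)[of "\<lambda>\<eta>. Im (f \<eta>)" N B] Im bd[OF Im] fi fc fU by simp
  qed
qed

end

end

section \<open>Linear combinations of order statistics\<close>

lemma Fubini_bounded:
  fixes f :: "'a \<Rightarrow> 'b \<Rightarrow> real"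
  assumes "prob_space M1" "prob_space M2"
    and f: "case_prod f \<in> borel_measurable (M1 \<Otimes>\<^sub>M M2)"
    and B: "\<And>x y. x \<in> space M1 \<Longrightarrow> y \<in> space M2 \<Longrightarrow> \<bar>f x y\<bar> \<le> B"
  shows "(\<integral>y. \<integral>x. f x y \<partial>M1 \<partial>M2) = (\<integral>x. \<integral>y. f x y \<partial>M2 \<partial>M1)"
proof -
  interpret M1: prob_space M1 by fact
  interpret M2: prob_space M2 by fact
  interpret P: pair_prob_space M1 M2 ..
  show ?thesis
  proof (rule P.Fubini_integral)
    show "integrable (M1 \<Otimes>\<^sub>M M2) (case_prod f)"
      using f B by (intro P.integrable_const_bound[where B=B] AE_I2) (auto simp: space_pair_measure)
  qed
qed

text \<open>As a function of \<open>s\<close>, this is the empirical distribution function of the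
  single observation \<open>x\<close>. Both arguments are kept explicit because Fubini's theorem
  exchanges their roles.\<close>

definition step :: "real \<Rightarrow> real \<Rightarrow> real" where
  "step x s = (if x \<le> s then 1 else 0)"

lemma abs_step_le: "s \<in> {0..1} \<Longrightarrow> \<bar>step x s - s\<bar> \<le> 1"
  by (auto simp: step_def)

lemma id_measurable_unit_law: "(\<lambda>x. x) \<in> borel_measurable unit_law"
  by (rule measurable_unit_law) simp

lemma step_measurable_pair:
  assumes "f \<in> borel_measurable M" "g \<in> borel_measurable M"
  shows "(\<lambda>x. step (f x) (g x)) \<in> borel_measurable M"
  unfolding step_def using assms by measurable

lemma step_measurable [measurable]:
  "(\<lambda>x. step x s) \<in> borel_measurable unit_law" "step x \<in> borel_measurable unit_law"
  using step_measurable_pair[OF id_measurable_unit_law, of "\<lambda>_. s"]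
    step_measurable_pair[OF _ id_measurable_unit_law, of "\<lambda>_. x"] by simp_all

lemma measure_unit_law [simp]: "measure unit_law {0..1} = 1"
  using prob_space.prob_space[OF prob_space_unit_law] by simp

lemma integrable_unit_law_bounded:
  fixes f :: "real \<Rightarrow> real"
  assumes "f \<in> borel_measurable unit_law" "\<And>x. x \<in> {0..1} \<Longrightarrow> \<bar>f x\<bar> \<le> B"
  shows "integrable unit_law f"
proof -
  interpret prob_space unit_law by simp
  show ?thesis using assms by (intro integrable_const_bound[where B=B]) auto
qed

lemma integrable_step: "integrable unit_law (\<lambda>x. step x s)"
  by (rule integrable_unit_law_bounded[where B=1]) (auto simp: step_def)

lemma integral_step:
  assumes "s \<in> {0..1}"
  shows "(\<integral>x. step x s \<partial>unit_law) = s"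
proof -
  have "(\<integral>x. step x s \<partial>unit_law) = (\<integral>x. indicator {0..s} x \<partial>lborel)"
    unfolding set_lebesgue_integral_unit_law[symmetric] set_lebesgue_integral_def
    using assms by (intro Bochner_Integration.integral_cong) (auto simp: step_def indicator_def)
  also have "\<dots> = s" using assms by simp
  finally show ?thesis .
qed

text \<open>Two steps multiply to the step at the smaller argument. This is where the covariance of
  the Brownian bridge originates: it is that of the indicator process of one uniform
  variable.\<close>

lemma integral_bridge_kernel:
  assumes "s \<in> {0..1}" "t \<in> {0..1}"
  shows "(\<integral>x. (step x s - s) * (step x t - t) \<partial>unit_law) = min s t - s * t"
proof -
  interpret prob_space unit_law by simp
  have "(\<integral>x. (step x s - s) * (step x t - t) \<partial>unit_law) =
      (\<integral>x. step x (min s t) - t * step x s - s * step x t + s * t \<partial>unit_law)"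
    by (intro Bochner_Integration.integral_cong) (auto simp: step_def algebra_simps min_def)
  also have "\<dots> = min s t - s * t"
    using assms integrable_step by (simp add: integral_step prob_space min_def)
  finally show ?thesis .
qed

text \<open>The integral of \<open>J\<close> against the empirical bridge of a single observation \<open>x\<close>.\<close>

definition bridge_fun :: "(real \<Rightarrow> real) \<Rightarrow> real \<Rightarrow> real" where
  "bridge_fun J x = (\<integral>s. J s * (step x s - s) \<partial>unit_law)"

context
  fixes J :: "real \<Rightarrow> real" and B :: real
  assumes J [measurable]: "J \<in> borel_measurable unit_law"
    and B: "\<And>s. s \<in> {0..1} \<Longrightarrow> \<bar>J s\<bar> \<le> B"
begin

lemma bridge_bound_nonneg: "0 \<le> B"
  using B[of 0] by simp

lemma bridge_kernel_measurable:
  "(\<lambda>(x, s). J s * (step x s - s)) \<in> borel_measurable (unit_law \<Otimes>\<^sub>M unit_law)"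
proof -
  have "(\<lambda>p. fst p) \<in> borel_measurable (unit_law \<Otimes>\<^sub>M unit_law)"
    "(\<lambda>p. snd p) \<in> borel_measurable (unit_law \<Otimes>\<^sub>M unit_law)"
    by (rule measurable_compose[OF measurable_fst id_measurable_unit_law],
        rule measurable_compose[OF measurable_snd id_measurable_unit_law])
  moreover from this have "(\<lambda>p. step (fst p) (snd p)) \<in> borel_measurable (unit_law \<Otimes>\<^sub>M unit_law)"
    by (rule step_measurable_pair)
  moreover have "(\<lambda>p. J (snd p)) \<in> borel_measurable (unit_law \<Otimes>\<^sub>M unit_law)"
    by (rule measurable_compose[OF measurable_snd J])
  ultimately show ?thesis
    unfolding case_prod_unfold by (intro borel_measurable_times borel_measurable_diff)
qed

lemma bridge_integrand_le: "s \<in> {0..1} \<Longrightarrow> \<bar>J s * (step x s - s)\<bar> \<le> B"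
  using mult_mono[OF B abs_step_le bridge_bound_nonneg, of s s x] by (simp add: abs_mult)

lemma bridge_fun_measurable [measurable]: "bridge_fun J \<in> borel_measurable unit_law"
proof -
  interpret prob_space unit_law by simp
  show ?thesis
    unfolding bridge_fun_def[abs_def]
    by (rule borel_measurable_lebesgue_integral[OF bridge_kernel_measurable])
qed

lemma abs_bridge_fun_le: "\<bar>bridge_fun J x\<bar> \<le> B"
proof -
  interpret prob_space unit_law by simp
  have "norm (bridge_fun J x) \<le> (\<integral>s. B \<partial>unit_law)"
    unfolding bridge_fun_def using bridge_integrand_le by (intro norm_integral_le) auto
  then show ?thesis by (simp add: prob_space)
qed

lemma integral_bridge_fun: "(\<integral>x. bridge_fun J x \<partial>unit_law) = 0"
proof -
  interpret prob_space unit_law by simp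
  have "(\<integral>x. bridge_fun J x \<partial>unit_law) = (\<integral>s. \<integral>x. J s * (step x s - s) \<partial>unit_law \<partial>unit_law)"
    unfolding bridge_fun_def
    by (rule Fubini_bounded[symmetric, where B=B]) (use bridge_kernel_measurable bridge_integrand_le in auto)
  also have "\<dots> = (\<integral>s. 0 \<partial>unit_law)"
    using integrable_step by (intro Bochner_Integration.integral_cong) (auto simp: integral_step prob_space)
  finally show ?thesis by simp
qed

text \<open>Fubini's theorem is applied once for each of the two integrals in the square. The
  innermost integral over \<open>x\<close> is then the bridge covariance.\<close>

lemma integral_bridge_fun_square:
  "(\<integral>x. (bridge_fun J x)\<^sup>2 \<partial>unit_law) =
    (\<integral>s. \<integral>t. (min s t - s * t) * J s * J t \<partial>unit_law \<partial>unit_law)"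
proof -
  have mx: "(\<lambda>p. bridge_fun J (fst p)) \<in> borel_measurable (unit_law \<Otimes>\<^sub>M unit_law)"
    by (rule measurable_compose[OF measurable_fst bridge_fun_measurable])
  have "(\<integral>x. (bridge_fun J x)\<^sup>2 \<partial>unit_law) =
      (\<integral>x. \<integral>s. bridge_fun J x * (J s * (step x s - s)) \<partial>unit_law \<partial>unit_law)"
    by (intro Bochner_Integration.integral_cong refl) (simp add: power2_eq_square, simp add: bridge_fun_def)
  also have "\<dots> = (\<integral>s. \<integral>x. bridge_fun J x * (J s * (step x s - s)) \<partial>unit_law \<partial>unit_law)"
  proof (rule Fubini_bounded[symmetric, where B="B * B"])
    show "(\<lambda>(x, s). bridge_fun J x * (J s * (step x s - s))) \<in> borel_measurable (unit_law \<Otimes>\<^sub>M unit_law)"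
      using borel_measurable_times[OF mx bridge_kernel_measurable] by (simp add: case_prod_unfold)
    show "\<bar>bridge_fun J x * (J s * (step x s - s))\<bar> \<le> B * B"
      if "x \<in> space unit_law" "s \<in> space unit_law" for x s
      using that mult_mono[OF abs_bridge_fun_le bridge_integrand_le] bridge_bound_nonneg
      by (simp add: abs_mult)
  qed auto
  also have "\<dots> = (\<integral>s. \<integral>t. (min s t - s * t) * J s * J t \<partial>unit_law \<partial>unit_law)"
  proof (rule Bochner_Integration.integral_cong[OF refl])
    fix s assume s: "s \<in> space unit_law"
    have m2: "(\<lambda>p. step (fst p) s) \<in> borel_measurable (unit_law \<Otimes>\<^sub>M unit_law)"
      by (rule measurable_compose[OF measurable_fst step_measurable(1)])
    have "(\<integral>x. bridge_fun J x * (J s * (step x s - s)) \<partial>unit_law) =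
        (\<integral>x. \<integral>t. (J t * (step x t - t)) * (J s * (step x s - s)) \<partial>unit_law \<partial>unit_law)"
      by (intro Bochner_Integration.integral_cong refl) (simp add: bridge_fun_def)
    also have "\<dots> = (\<integral>t. \<integral>x. (J t * (step x t - t)) * (J s * (step x s - s)) \<partial>unit_law \<partial>unit_law)"
    proof (rule Fubini_bounded[symmetric, where B="B * B"])
      have "(\<lambda>p. J s * (step (fst p) s - s)) \<in> borel_measurable (unit_law \<Otimes>\<^sub>M unit_law)"
        using m2 by (intro borel_measurable_times borel_measurable_diff borel_measurable_const)
      from borel_measurable_times[OF bridge_kernel_measurable this]
      show "(\<lambda>(x, t). (J t * (step x t - t)) * (J s * (step x s - s))) \<in> borel_measurable (unit_law \<Otimes>\<^sub>M unit_law)"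
        by (simp add: case_prod_unfold)
      show "\<bar>J t * (step x t - t) * (J s * (step x s - s))\<bar> \<le> B * B"
        if "x \<in> space unit_law" "t \<in> space unit_law" for x t
        using that s mult_mono[OF bridge_integrand_le bridge_integrand_le] bridge_bound_nonneg
        by (simp add: abs_mult)
    qed auto
    also have "\<dots> = (\<integral>t. (min s t - s * t) * J s * J t \<partial>unit_law)"
    proof (rule Bochner_Integration.integral_cong[OF refl])
      fix t assume t: "t \<in> space unit_law"
      have "(\<integral>x. (J t * (step x t - t)) * (J s * (step x s - s)) \<partial>unit_law) =
          (\<integral>x. (J s * J t) * ((step x s - s) * (step x t - t)) \<partial>unit_law)"
        by (intro Bochner_Integration.integral_cong refl) (simp add: ac_simps)
      also have "\<dots> = (J s * J t) * (min s t - s * t)"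
        using s t integral_bridge_kernel[of s t] by simp
      finally show "(\<integral>x. (J t * (step x t - t)) * (J s * (step x s - s)) \<partial>unit_law) =
          (min s t - s * t) * J s * J t" by simp
    qed
    finally show "(\<integral>x. bridge_fun J x * (J s * (step x s - s)) \<partial>unit_law) =
        (\<integral>t. (min s t - s * t) * J s * J t \<partial>unit_law)" .
  qed
  finally show ?thesis .
qed

end

text \<open>The inverse of \<open>rho a b\<close>, taking a parameter to its position in the unit
  interval.\<close>

definition unit_coord :: "real \<Rightarrow> real \<Rightarrow> real \<Rightarrow> real" where
  "unit_coord a b u = (u - a) / (b - a)"

text \<open>\<open>h\<close> is evaluated at the order statistics and \<open>\<psi>\<close> supplies
  the weights. Used with \<open>h_fun g\<close> and \<open>\<phi>\<close> for the conditional mean,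
  and with \<open>V_fun k g\<close> and the square of \<open>\<phi>\<close> for the conditional
  variance. \<open>M\<close> bounds the derivative of \<open>h\<close> in the unit
  coordinate.\<close>

locale l_statistic =
  fixes a b :: real and h D :: "real \<Rightarrow> real" and \<psi> \<psi>' :: "real \<Rightarrow> real" and L B M :: real
  assumes ab: "a < b"
    and D: "continuous_on {a..b} D"
    and h: "\<And>x. x \<in> {a..b} \<Longrightarrow> (h has_real_derivative D x) (at x within {a..b})"
    and \<psi>: "\<And>s. s \<in> {0..1} \<Longrightarrow> (\<psi> has_real_derivative \<psi>' s) (at s within {0..1})"
    and L: "\<And>s. s \<in> {0..1} \<Longrightarrow> \<bar>\<psi>' s\<bar> \<le> L"
    and B: "\<And>s. s \<in> {0..1} \<Longrightarrow> \<bar>\<psi> s\<bar> \<le> B"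
    and M: "\<And>s. s \<in> {0..1} \<Longrightarrow> \<bar>(b - a) * D (rho a b s)\<bar> \<le> M"
begin

definition k' where "k' s = (b - a) * D (rho a b s)"
definition \<Psi> where "\<Psi> s = integral {0..s} \<psi>"
definition lmean where "lmean = (\<integral>s. h (rho a b s) * \<psi> s \<partial>unit_law)"

lemma nonneg: "0 \<le> L" "0 \<le> B" "0 \<le> M"
  using L[of 0] B[of 0] M[of 0] by auto

lemma rho_in: "s \<in> {0..1} \<Longrightarrow> rho a b s \<in> {a..b}"
  using measurable_space[OF rho_measurable[OF ab], of s] by simp

lemma rho_unit_coord: "rho a b (unit_coord a b u) = u"
  using ab by (simp add: rho_def unit_coord_def)

lemma unit_coord_le_iff: "unit_coord a b u \<le> s \<longleftrightarrow> u \<le> rho a b s"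
  using ab by (simp add: rho_def unit_coord_def pos_divide_le_eq algebra_simps)

lemma unit_coord_in: "u \<in> {a..b} \<Longrightarrow> unit_coord a b u \<in> {0..1}"
  using ab by (auto simp: unit_coord_def)

lemma rho_continuous: "continuous_on S (rho a b)"
  unfolding rho_def[abs_def] by (intro continuous_intros)

lemma k'_continuous: "continuous_on {0..1} k'"
  unfolding k'_def[abs_def]
  by (intro continuous_intros continuous_on_compose2[OF D rho_continuous]) (use rho_in in auto)

lemma h_continuous: "continuous_on {a..b} h"
  using h by (rule DERIV_continuous_on)

lemma hrho_continuous: "continuous_on {0..1} (\<lambda>s. h (rho a b s))"
  by (intro continuous_on_compose2[OF h_continuous rho_continuous]) (use rho_in in auto)

lemma hrho_deriv:
  assumes s: "s \<in> {0..1}"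
  shows "((\<lambda>s. h (rho a b s)) has_real_derivative k' s) (at s within {0..1})"
proof -
  have r: "(rho a b has_real_derivative (b - a)) (at s within {0..1})"
    unfolding rho_def[abs_def] by (auto intro!: derivative_eq_intros)
  have "(h has_real_derivative D (rho a b s)) (at (rho a b s) within rho a b ` {0..1})"
    by (rule DERIV_subset[OF h]) (use s rho_in in auto)
  from DERIV_image_chain[OF this r] show ?thesis
    by (simp add: k'_def comp_def mult.commute)
qed

lemma \<psi>_continuous: "continuous_on {0..1} \<psi>"
  using \<psi> by (rule DERIV_continuous_on)

lemma \<Psi>_deriv: "s \<in> {0..1} \<Longrightarrow> (\<Psi> has_real_derivative \<psi> s) (at s within {0..1})"
  unfolding \<Psi>_def[abs_def] by (rule integral_has_real_derivative[OF \<psi>_continuous])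

lemma \<Psi>_continuous: "continuous_on {0..1} \<Psi>"
  using \<Psi>_deriv by (rule DERIV_continuous_on)

lemma \<Psi>_0: "\<Psi> 0 = 0"
  by (simp add: \<Psi>_def)

lemma \<psi>_lipschitz:
  assumes "x \<in> {0..1}" "y \<in> {0..1}"
  shows "\<bar>\<psi> x - \<psi> y\<bar> \<le> L * \<bar>x - y\<bar>"
  using field_differentiable_bound[OF convex_real_interval(5) \<psi>, of L x y] assms L by auto

text \<open>The remainder is controlled by the Lipschitz constant of \<open>\<psi>\<close> through
  the mean value inequality on the segment. Its quadratic form is what matches the mean square
  discrepancy of the empirical distribution.\<close>

lemma \<Psi>_taylor:
  assumes x: "x \<in> {0..1}" and y: "y \<in> {0..1}"
  shows "\<bar>\<Psi> y - \<Psi> x - (y - x) * \<psi> x\<bar> \<le> L * (y - x)\<^sup>2"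
proof -
  have sub: "closed_segment x y \<subseteq> {0..1}"
    using x y by (simp add: closed_segment_subset)
  have "norm (\<Psi> y - \<Psi> x - (y - x) *\<^sub>R \<psi> x) \<le> norm (y - x) * (L * \<bar>y - x\<bar>)"
  proof (rule vector_differentiable_bound_linearization[where S="closed_segment x y" and f'=\<psi> and ?x0.0=x])
    fix z assume z: "z \<in> closed_segment x y"
    then have "z \<in> {0..1}" using sub by auto
    from \<Psi>_deriv[OF this] show "(\<Psi> has_vector_derivative \<psi> z) (at z within closed_segment x y)"
      unfolding has_real_derivative_iff_has_vector_derivative[symmetric]
      using sub by (rule DERIV_subset)
    have "\<bar>\<psi> z - \<psi> x\<bar> \<le> L * \<bar>z - x\<bar>" using \<open>z \<in> {0..1}\<close> x by (rule \<psi>_lipschitz)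
    also have "\<dots> \<le> L * \<bar>y - x\<bar>"
      using z nonneg by (intro mult_left_mono) (auto simp: closed_segment_eq_real_ivl split: if_splits)
    finally show "norm (\<psi> z - \<psi> x) \<le> L * \<bar>y - x\<bar>" by simp
  qed auto
  also have "norm (y - x) * (L * \<bar>y - x\<bar>) = L * (\<bar>y - x\<bar> * \<bar>y - x\<bar>)"
    by (simp only: real_norm_def mult.left_commute)
  finally show ?thesis by (simp add: power2_eq_square)
qed

text \<open>Each summand agrees with the increment of \<open>N * \<Psi>\<close> over its cell up to
  \<open>L / N\<close>, and there are at most \<open>N\<close> cells. Uniformity in \<open>m\<close>
  matters because \<open>m\<close> will be a random count.\<close>

lemma riemann_sum_bound:
  fixes N m :: nat
  assumes "1 \<le> N" "m \<le> N"
  shows "\<bar>(\<Sum>i=1..m. \<psi> (real i / N)) - N * \<Psi> (real m / N)\<bar> \<le> L"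
proof -
  have "\<bar>(\<Sum>i=1..m. \<psi> (real i / N)) - N * \<Psi> (real m / N)\<bar> \<le> real m * (L / N)"
    using assms(2)
  proof (induction m)
    case 0
    then show ?case by (simp add: \<Psi>_0)
  next
    case (Suc m)
    let ?x = "real (Suc m) / N" and ?y = "real m / N"
    have N: "0 < real N" using assms by simp
    have d: "?y - ?x = - (1 / N)" by (simp add: field_simps flip: diff_divide_distrib)
    have "\<bar>\<Psi> ?y - \<Psi> ?x - (?y - ?x) * \<psi> ?x\<bar> \<le> L * (?y - ?x)\<^sup>2"
      using Suc.prems assms by (intro \<Psi>_taylor) (auto simp: divide_le_eq)
    then have "\<bar>\<Psi> ?y - \<Psi> ?x + \<psi> ?x / N\<bar> \<le> L / (real N)\<^sup>2"
      unfolding d by (simp add: power_divide)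
    then have "N * \<bar>\<Psi> ?y - \<Psi> ?x + \<psi> ?x / N\<bar> \<le> N * (L / (real N)\<^sup>2)"
      using N by (intro mult_left_mono) auto
    then have "\<bar>N * (\<Psi> ?y - \<Psi> ?x + \<psi> ?x / N)\<bar> \<le> L / N"
      using N by (simp add: abs_mult power2_eq_square)
    then have "\<bar>\<psi> ?x - N * \<Psi> ?x + N * \<Psi> ?y\<bar> \<le> L / N"
      using N by (simp add: distrib_left right_diff_distrib algebra_simps)
    moreover have "\<bar>(\<Sum>i=1..m. \<psi> (real i / N)) - N * \<Psi> ?y\<bar> \<le> real m * (L / N)"
      using Suc by simp
    ultimately have "\<bar>((\<Sum>i=1..m. \<psi> (real i / N)) + \<psi> ?x) - N * \<Psi> ?x\<bar> \<le> real m * (L / N) + L / N"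
      by linarith
    then show ?case by (simp add: algebra_simps add_divide_distrib)
  qed
  also have "\<dots> \<le> L"
    using assms nonneg by (simp add: divide_le_eq mult.commute mult_left_mono)
  finally show ?thesis .
qed

text \<open>The step selects the points \<open>s\<close> to the right of the coordinate of
  \<open>u\<close>, so the fundamental theorem of calculus gives \<open>h b - h u\<close>. The only
  dependence on \<open>u\<close> now sits in a step, and sums of steps are counts.\<close>

lemma h_eq_integral:
  assumes u: "u \<in> {a..b}"
  shows "h u = h b - (\<integral>s. k' s * step (unit_coord a b u) s \<partial>unit_law)"
proof -
  define x where "x = unit_coord a b u"
  have x: "x \<in> {0..1}" unfolding x_def by (rule unit_coord_in[OF u])
  have "(\<integral>s. k' s * step x s \<partial>unit_law) = (\<integral>s. indicator {x..1} s *\<^sub>R k' s \<partial>lborel)"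
    unfolding set_lebesgue_integral_unit_law[symmetric] set_lebesgue_integral_def
    using x by (intro Bochner_Integration.integral_cong) (auto simp: step_def indicator_def)
  also have "\<dots> = h (rho a b 1) - h (rho a b x)"
  proof (rule integral_FTC_atLeastAtMost)
    show "continuous_on {x..1} k'" using k'_continuous x by (auto intro: continuous_on_subset)
    fix s assume "x \<le> s" "s \<le> 1"
    then have "((\<lambda>s. h (rho a b s)) has_real_derivative k' s) (at s within {x..1})"
      using x by (intro DERIV_subset[OF hrho_deriv]) auto
    then show "((\<lambda>s. h (rho a b s)) has_vector_derivative k' s) (at s within {x..1})"
      by (simp add: has_real_derivative_iff_has_vector_derivative)
  qed (use x in auto)
  also have "rho a b 1 = b" by (simp add: rho_def)
  also have "rho a b x = u" unfolding x_def by (rule rho_unit_coord)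
  finally show ?thesis by (simp add: x_def)
qed

text \<open>Integration by parts against the primitive \<open>\<Psi>\<close>, which vanishes at 0.
  It gives the candidate limit the shape that \<open>h_eq_integral\<close> gives to the L-statistic,
  so that the two can be subtracted term by term.\<close>

lemma lmean_eq: "lmean = h b * \<Psi> 1 - (\<integral>s. k' s * \<Psi> s \<partial>unit_law)"
proof -
  have "(\<integral>s. k' s * \<Psi> s + h (rho a b s) * \<psi> s \<partial>unit_law) = h (rho a b 1) * \<Psi> 1 - h (rho a b 0) * \<Psi> 0"
    unfolding set_lebesgue_integral_unit_law[symmetric] set_lebesgue_integral_def
  proof (rule integral_FTC_atLeastAtMost)
    show "continuous_on {0..1} (\<lambda>s. k' s * \<Psi> s + h (rho a b s) * \<psi> s)"
      by (intro continuous_intros k'_continuous \<Psi>_continuous hrho_continuous \<psi>_continuous)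
    fix s :: real assume "0 \<le> s" "s \<le> 1"
    then have s: "s \<in> {0..1}" by simp
    have "((\<lambda>s. h (rho a b s) * \<Psi> s) has_real_derivative k' s * \<Psi> s + h (rho a b s) * \<psi> s) (at s within {0..1})"
      by (rule DERIV_cong[OF DERIV_mult[OF hrho_deriv[OF s] \<Psi>_deriv[OF s]]]) (simp add: ac_simps)
    then show "((\<lambda>s. h (rho a b s) * \<Psi> s) has_vector_derivative k' s * \<Psi> s + h (rho a b s) * \<psi> s) (at s within {0..1})"
      by (simp add: has_real_derivative_iff_has_vector_derivative)
  qed simp
  moreover have "integrable unit_law (\<lambda>s. k' s * \<Psi> s)" "integrable unit_law (\<lambda>s. h (rho a b s) * \<psi> s)"
    by (intro continuous_on_integrable_unit_law continuous_intros k'_continuous \<Psi>_continuous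
        hrho_continuous \<psi>_continuous)+
  ultimately show ?thesis
    by (simp add: lmean_def \<Psi>_0 rho_def)
qed

end

section \<open>Sums of functions of independent uniform variables\<close>

lemma Ulaw_component:
  fixes f :: "real \<Rightarrow> 'b::{banach, second_countable_topology}"
  assumes ab: "a < b" and j: "j \<in> {1..N}" and f: "f \<in> borel_measurable (uniform_law a b)"
  shows "(\<integral>u. f (u j) \<partial>Ulaw a b N) = (\<integral>v. f v \<partial>uniform_law a b)"
proof -
  have "(\<integral>v. f v \<partial>uniform_law a b) = (\<integral>v. f v \<partial>distr (Ulaw a b N) (uniform_law a b) (\<lambda>u. u j))"
    by (subst distr_PiM_component[OF _ j]) (simp_all add: ab)
  also have "\<dots> = (\<integral>u. f (u j) \<partial>Ulaw a b N)"
    using j f by (intro integral_distr measurable_component_singleton)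
  finally show ?thesis by simp
qed

lemma Ulaw_integrable_bounded:
  fixes f :: "(nat \<Rightarrow> real) \<Rightarrow> real"
  assumes "a < b" "f \<in> borel_measurable (Ulaw a b N)" "\<And>u. u \<in> {1..N} \<rightarrow> {a..b} \<Longrightarrow> \<bar>f u\<bar> \<le> B"
  shows "integrable (Ulaw a b N) f"
proof -
  interpret prob_space "Ulaw a b N" using assms(1) by simp
  show ?thesis
    using assms by (intro integrable_const_bound[where B=B] AE_I2) (auto dest: Ulaw_space)
qed

lemma Ulaw_depends_on:
  assumes "j \<in> A" "f \<in> borel_measurable (uniform_law a b)"
  shows "depends_on A (\<lambda>_. uniform_law a b) (\<lambda>u. f (u j))"
  unfolding depends_on_def
  using assms measurable_compose[OF measurable_component_singleton[OF assms(1)] assms(2)] by auto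

text \<open>Independence and centring remove the off-diagonal terms of the squared sum.\<close>

lemma iid_sum_square:
  fixes f :: "real \<Rightarrow> real"
  assumes ab: "a < b" and f: "f \<in> borel_measurable (uniform_law a b)"
    and B: "\<And>v. v \<in> {a..b} \<Longrightarrow> \<bar>f v\<bar> \<le> B" and mean: "(\<integral>v. f v \<partial>uniform_law a b) = 0"
  shows "(\<integral>u. (\<Sum>j\<in>{1..N}. f (u j))\<^sup>2 \<partial>Ulaw a b N) = N * (\<integral>v. (f v)\<^sup>2 \<partial>uniform_law a b)"
proof -
  let ?U = "Ulaw a b N"
  have B0: "0 \<le> B" using B[of a] ab by simp
  have m: "(\<lambda>u. f (u j)) \<in> borel_measurable ?U" if "j \<in> {1..N}" for j
    using that f by (rule Ulaw_component_measurable[OF ab])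
  have i1: "integrable ?U (\<lambda>u. f (u j))" if "j \<in> {1..N}" for j
    using that B by (intro Ulaw_integrable_bounded[where B=B, OF ab m[OF that]]) (auto simp: Pi_iff)
  have i2: "integrable ?U (\<lambda>u. f (u i) * f (u j))" if "i \<in> {1..N}" "j \<in> {1..N}" for i j
  proof (rule Ulaw_integrable_bounded[OF ab])
    show "(\<lambda>u. f (u i) * f (u j)) \<in> borel_measurable ?U" using m that by (intro borel_measurable_times)
    show "\<bar>f (u i) * f (u j)\<bar> \<le> B * B" if "u \<in> {1..N} \<rightarrow> {a..b}" for u
      unfolding abs_mult using that \<open>i \<in> _\<close> \<open>j \<in> _\<close> B B0 by (intro mult_mono) (auto simp: Pi_iff)
  qed
  have "(\<integral>u. (\<Sum>j\<in>{1..N}. f (u j))\<^sup>2 \<partial>?U) = (\<Sum>i\<in>{1..N}. \<Sum>j\<in>{1..N}. \<integral>u. f (u i) * f (u j) \<partial>?U)"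
    unfolding power2_eq_square sum_product
    by (subst Bochner_Integration.integral_sum)
       (auto intro!: sum.cong Bochner_Integration.integral_sum Bochner_Integration.integrable_sum i2)
  also have "\<dots> = (\<Sum>i\<in>{1..N}. \<Sum>j\<in>{1..N}. if j = i then (\<integral>v. (f v)\<^sup>2 \<partial>uniform_law a b) else 0)"
  proof (intro sum.cong refl)
    fix i j assume i: "i \<in> {1..N}" and j: "j \<in> {1..N}"
    show "(\<integral>u. f (u i) * f (u j) \<partial>?U) = (if j = i then (\<integral>v. (f v)\<^sup>2 \<partial>uniform_law a b) else 0)"
    proof (cases "j = i")
      case True
      have "(\<lambda>v. (f v)\<^sup>2) \<in> borel_measurable (uniform_law a b)" using f by measurable
      from Ulaw_component[OF ab i this] show ?thesis
        using True by (simp add: power2_eq_square)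
    next
      case False
      have "(\<integral>u. f (u i) * f (u j) \<partial>?U) = (\<integral>u. f (u i) \<partial>?U) * (\<integral>u. f (u j) \<partial>?U)"
        by (rule integral_mult_depends_on[where A="{i}" and B="{j}"])
           (use False i j f ab i1 in \<open>auto intro!: Ulaw_depends_on\<close>)
      then show ?thesis
        using False Ulaw_component[OF ab i f] mean by simp
    qed
  qed
  also have "\<dots> = N * (\<integral>v. (f v)\<^sup>2 \<partial>uniform_law a b)" by simp
  finally show ?thesis .
qed

lemma unit_coord_measurable: "a < b \<Longrightarrow> unit_coord a b \<in> measurable (uniform_law a b) unit_law"
proof -
  assume ab: "a < b"
  have "unit_coord a b \<in> measurable (restrict_space borel {a..b}) (restrict_space borel {0..1})"
  proof (rule measurable_restrict_space3)
    show "unit_coord a b \<in> borel_measurable borel" unfolding unit_coord_def[abs_def] by measurable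
  qed (use ab in \<open>auto simp: unit_coord_def\<close>)
  then show ?thesis
    unfolding measurable_uniform_law_eq measurable_cong_sets[OF refl sets_unit_law] .
qed

lemma integral_unit_coord:
  fixes f :: "real \<Rightarrow> real"
  assumes ab: "a < b" and f: "f \<in> borel_measurable unit_law"
  shows "(\<integral>v. f (unit_coord a b v) \<partial>uniform_law a b) = (\<integral>s. f s \<partial>unit_law)"
proof -
  have "(\<integral>v. f (unit_coord a b v) \<partial>uniform_law a b) = (\<integral>s. f (unit_coord a b (rho a b s)) \<partial>unit_law)"
    by (rule integral_uniform_law[OF ab measurable_compose[OF unit_coord_measurable[OF ab] f]])
  then show ?thesis using ab by (simp add: unit_coord_def rho_def)
qed

lemma count_le_eq_sum_step:
  assumes "a < b"
  shows "real (count_le N u (rho a b s)) = (\<Sum>j\<in>{1..N}. step (unit_coord a b (u j)) s)"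
  unfolding count_le_eq_sum step_def using assms
  by (intro sum.cong refl if_cong) (simp_all add: rho_def unit_coord_def pos_divide_le_eq algebra_simps)

text \<open>For fixed \<open>s\<close> the difference is a sum of \<open>N\<close> independent
  centred variables bounded by 1, so its second moment is at most \<open>N\<close>; Fubini's theorem
  then integrates over \<open>s\<close>. The mean square in \<open>s\<close> is the form in which
  the Taylor remainder of the L-statistic presents itself.\<close>

lemma empirical_discrepancy:
  fixes a b :: real and N :: nat
  assumes ab: "a < b"
  defines "Z \<equiv> \<lambda>u. \<integral>s. (real (count_le N u (rho a b s)) - N * s)\<^sup>2 \<partial>unit_law"
  shows "integrable (Ulaw a b N) Z" "(\<integral>u. Z u \<partial>Ulaw a b N) \<le> N"
proof -
  let ?U = "Ulaw a b N"
  interpret I: prob_space unit_law by simp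
  interpret U: prob_space ?U using ab by simp
  define f where "f u s = (\<Sum>j\<in>{1..N}. step (unit_coord a b (u j)) s - s)" for u s
  have Z: "Z = (\<lambda>u. \<integral>s. (f u s)\<^sup>2 \<partial>unit_law)"
    unfolding Z_def f_def using ab by (simp add: count_le_eq_sum_step sum_subtractf)
  have f_le: "(f u s)\<^sup>2 \<le> (real N)\<^sup>2" if "s \<in> {0..1}" for u s
  proof -
    have "\<bar>f u s\<bar> \<le> (\<Sum>j\<in>{1..N}. \<bar>step (unit_coord a b (u j)) s - s\<bar>)" unfolding f_def by (rule sum_abs)
    also have "\<dots> \<le> (\<Sum>j\<in>{1..N}. 1)" using that by (intro sum_mono abs_step_le)
    finally show ?thesis by (simp add: abs_le_square_iff[symmetric])
  qed
  have id: "(\<lambda>p. snd p) \<in> borel_measurable (?U \<Otimes>\<^sub>M unit_law)"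
    by (rule measurable_compose[OF measurable_snd id_measurable_unit_law])
  have st: "(\<lambda>p. step (unit_coord a b (fst p j)) (snd p)) \<in> borel_measurable (?U \<Otimes>\<^sub>M unit_law)"
    if "j \<in> {1..N}" for j
  proof (rule step_measurable_pair[OF _ id])
    show "(\<lambda>p. unit_coord a b (fst p j)) \<in> borel_measurable (?U \<Otimes>\<^sub>M unit_law)"
      by (rule measurable_compose[OF measurable_compose[OF measurable_fst measurable_component_singleton[OF that]]
           measurable_compose[OF unit_coord_measurable[OF ab] id_measurable_unit_law]])
  qed
  have m: "(\<lambda>(u, s). (f u s)\<^sup>2) \<in> borel_measurable (?U \<Otimes>\<^sub>M unit_law)"
    unfolding f_def case_prod_unfold
    using id st by (intro borel_measurable_power borel_measurable_sum borel_measurable_diff)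
  show "integrable ?U Z"
  proof (rule Ulaw_integrable_bounded[OF ab])
    show "Z \<in> borel_measurable ?U" unfolding Z by (rule I.borel_measurable_lebesgue_integral[OF m])
    show "\<bar>Z u\<bar> \<le> (real N)\<^sup>2" for u
    proof -
      have "norm (Z u) \<le> (\<integral>s. (real N)\<^sup>2 \<partial>unit_law)"
        unfolding Z using f_le by (intro norm_integral_le) auto
      then show ?thesis by simp
    qed
  qed
  have "(\<integral>u. Z u \<partial>?U) = (\<integral>s. \<integral>u. (f u s)\<^sup>2 \<partial>?U \<partial>unit_law)"
    unfolding Z using f_le
    by (intro Fubini_bounded[symmetric, where B="(real N)\<^sup>2"] m) (auto simp: ab)
  also have "norm \<dots> \<le> (\<integral>s. real N \<partial>unit_law)"
  proof (rule norm_integral_le)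
    fix s assume s: "s \<in> space unit_law"
    have mm: "(\<lambda>v. step (unit_coord a b v) s - s) \<in> borel_measurable (uniform_law a b)"
      using measurable_compose[OF unit_coord_measurable[OF ab] step_measurable(1)[of s]] by simp
    have "(\<integral>u. (f u s)\<^sup>2 \<partial>?U) = N * (\<integral>v. (step (unit_coord a b v) s - s)\<^sup>2 \<partial>uniform_law a b)"
      unfolding f_def
    proof (rule iid_sum_square[OF ab mm])
      show "\<bar>step (unit_coord a b v) s - s\<bar> \<le> 1" for v using s by (intro abs_step_le) simp
      show "(\<integral>v. step (unit_coord a b v) s - s \<partial>uniform_law a b) = 0"
        using integral_unit_coord[OF ab, of "\<lambda>x. step x s - s"] s integrable_step[of s] by (simp add: integral_step)
    qed
    also have "\<dots> \<le> real N * 1"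
    proof (rule mult_left_mono)
      interpret prob_space "uniform_law a b" using ab by simp
      have "norm (\<integral>v. (step (unit_coord a b v) s - s)\<^sup>2 \<partial>uniform_law a b) \<le> (\<integral>v. 1 \<partial>uniform_law a b)"
        using s abs_step_le[of s] by (intro norm_integral_le) (auto simp: abs_square_le_1)
      then show "(\<integral>v. (step (unit_coord a b v) s - s)\<^sup>2 \<partial>uniform_law a b) \<le> 1"
        using prob_space by simp
    qed simp
    finally show "norm (\<integral>u. (f u s)\<^sup>2 \<partial>?U) \<le> real N" by simp
  qed simp
  finally show "(\<integral>u. Z u \<partial>?U) \<le> N" by simp
qed

section \<open>Approximation of the L-statistic by a sum of independent variables\<close>

context l_statistic
begin

definition lstat where "lstat N u = (\<Sum>i\<in>{1..N}. \<psi> (real i / real N) * h (order_stats N u i))"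
text \<open>The minus sign is inherited from \<open>h_eq_integral\<close>, where \<open>h\<close> is
  written from the right endpoint; it cancels in \<open>noise_var\<close>, where \<open>J\<close>
  occurs twice.\<close>

definition J where "J s = - (k' s * \<psi> s)"
definition noise where "noise v = bridge_fun J (unit_coord a b v)"

lemma J_measurable: "J \<in> borel_measurable unit_law"
  unfolding J_def[abs_def]
  by (intro continuous_on_measurable_unit_law continuous_intros k'_continuous \<psi>_continuous)

lemma J_le: "s \<in> {0..1} \<Longrightarrow> \<bar>J s\<bar> \<le> M * B"
  using mult_mono[OF M B] nonneg by (simp add: J_def k'_def abs_mult)

lemma noise_measurable: "noise \<in> borel_measurable (uniform_law a b)"
  unfolding noise_def[abs_def]
  by (rule measurable_compose[OF unit_coord_measurable[OF ab] bridge_fun_measurable[OF J_measurable J_le]])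

lemma abs_noise_le: "\<bar>noise v\<bar> \<le> M * B"
  unfolding noise_def by (rule abs_bridge_fun_le[OF J_measurable J_le])

lemma integral_noise: "(\<integral>v. noise v \<partial>uniform_law a b) = 0"
proof -
  have "(\<integral>v. noise v \<partial>uniform_law a b) = (\<integral>s. bridge_fun J s \<partial>unit_law)"
    unfolding noise_def by (rule integral_unit_coord[OF ab bridge_fun_measurable[OF J_measurable J_le]])
  then show ?thesis
    using integral_bridge_fun[OF J_measurable J_le] by simp
qed

definition noise_var where "noise_var = (\<integral>v. (noise v)\<^sup>2 \<partial>uniform_law a b)"

lemma noise_var_eq: "noise_var = (\<integral>s. \<integral>t. (min s t - s * t) * J s * J t \<partial>unit_law \<partial>unit_law)"
proof -
  have "(\<lambda>x. (bridge_fun J x)\<^sup>2) \<in> borel_measurable unit_law"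
    using bridge_fun_measurable[OF J_measurable J_le] by measurable
  then have "noise_var = (\<integral>x. (bridge_fun J x)\<^sup>2 \<partial>unit_law)"
    unfolding noise_var_def noise_def by (rule integral_unit_coord[OF ab])
  then show ?thesis
    using integral_bridge_fun_square[OF J_measurable J_le] by simp
qed

lemma noise_var_nonneg: "0 \<le> noise_var"
  unfolding noise_var_def by simp

text \<open>With \<open>C n = (\<Sum>i=1..n. \<psi> (i / N))\<close> and \<open>m s\<close> the number of parameters below \<open>rho a b s\<close>, writing
  \<open>h\<close> as the integral of its derivative gives \<open>lstat = h b * C N - (\<integral>s. k' s * C (m s))\<close>. Here \<open>C (m s)\<close> is
  close to \<open>N * \<Psi> (m s / N)\<close>, which is expanded around \<open>s\<close>.\<close>

lemma lstat_error:
  assumes N: "1 \<le> N" and u: "u \<in> {1..N} \<rightarrow> {a..b}"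
  shows "\<bar>lstat N u - N * lmean - (\<Sum>j\<in>{1..N}. noise (u j))\<bar>
    \<le> (\<bar>h b\<bar> + M) * L + M * L / N * (\<integral>s. (real (count_le N u (rho a b s)) - N * s)\<^sup>2 \<partial>unit_law)"
proof -
  interpret I: prob_space unit_law by simp
  have N0: "0 < real N" using N by simp
  define m where "m s = count_le N u (rho a b s)" for s
  define C where "C n = (\<Sum>i=1..n. \<psi> (real i / N))" for n :: nat
  define x where "x i = unit_coord a b (order_stats N u i)" for i
  have m_sum: "real (m s) = (\<Sum>j\<in>{1..N}. step (unit_coord a b (u j)) s)" for s
    unfolding m_def by (rule count_le_eq_sum_step[OF ab])
  have m_meas [measurable]: "(\<lambda>s. real (m s)) \<in> borel_measurable unit_law"
    unfolding m_sum by (intro borel_measurable_sum step_measurable)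
  have m_le: "m s \<le> N" for s unfolding m_def by (rule count_le_le)
  \<comment> \<open>By \<open>order_stats_le_iff\<close> exactly the first \<open>m s\<close> order
    statistics lie below \<open>rho a b s\<close>, so the steps pick out the first
    \<open>m s\<close> weights.\<close>
  have Cm: "C (m s) = (\<Sum>i\<in>{1..N}. \<psi> (real i / N) * step (x i) s)" for s
  proof -
    have "(\<Sum>i\<in>{1..N}. \<psi> (real i / N) * step (x i) s) = (\<Sum>i\<in>{1..N}. if i \<in> {1..m s} then \<psi> (real i / N) else 0)"
    proof (rule sum.cong[OF refl])
      fix i assume i: "i \<in> {1..N}"
      have "x i \<le> s \<longleftrightarrow> i \<le> m s"
        unfolding x_def m_def unit_coord_le_iff by (rule order_stats_le_iff[OF i])
      then show "\<psi> (real i / N) * step (x i) s = (if i \<in> {1..m s} then \<psi> (real i / N) else 0)"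
        using i by (simp add: step_def)
    qed
    also have "\<dots> = (\<Sum>i\<in>{1..N} \<inter> {1..m s}. \<psi> (real i / N))"
      by (rule sum.inter_restrict[symmetric]) simp
    also have "{1..N} \<inter> {1..m s} = {1..m s}" using m_le[of s] by auto
    finally show ?thesis by (simp add: C_def)
  qed
  have Cm_meas [measurable]: "(\<lambda>s. C (m s)) \<in> borel_measurable unit_law"
    unfolding Cm by (intro borel_measurable_sum borel_measurable_times step_measurable borel_measurable_const)
  have k'm [measurable]: "k' \<in> borel_measurable unit_law" and \<psi>m [measurable]: "\<psi> \<in> borel_measurable unit_law"
    and \<Psi>m [measurable]: "\<Psi> \<in> borel_measurable unit_law"
    by (intro continuous_on_measurable_unit_law k'_continuous \<psi>_continuous \<Psi>_continuous)+
  have sm [measurable]: "(\<lambda>s. s) \<in> borel_measurable unit_law" by (rule id_measurable_unit_law)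
  have k'_le: "\<bar>k' s\<bar> \<le> M" if "s \<in> {0..1}" for s using M[OF that] by (simp add: k'_def)
  have i1: "integrable unit_law (\<lambda>s. k' s * step y s)" for y
  proof (rule integrable_unit_law_bounded[where B=M])
    show "\<bar>k' s * step y s\<bar> \<le> M" if "s \<in> {0..1}" for s
      using k'_le[OF that] nonneg by (auto simp: step_def)
  qed measurable
  have i2: "integrable unit_law (\<lambda>s. k' s * \<Psi> s)"
    by (intro continuous_on_integrable_unit_law continuous_intros k'_continuous \<Psi>_continuous)
  have i3: "integrable unit_law (\<lambda>s. J s * (step y s - s))" for y
  proof (rule integrable_unit_law_bounded)
    show "(\<lambda>s. J s * (step y s - s)) \<in> borel_measurable unit_law" using J_measurable by measurable
  qed (rule bridge_integrand_le[OF J_measurable J_le])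
  have i4: "integrable unit_law (\<lambda>s. (real (m s) - N * s)\<^sup>2)"
  proof (rule integrable_unit_law_bounded[where B="(real N)\<^sup>2"])
    show "\<bar>(real (m s) - N * s)\<^sup>2\<bar> \<le> (real N)\<^sup>2" if s: "s \<in> {0..1}" for s :: real
    proof -
      have "0 \<le> N * s" "N * s \<le> N" using s by (auto simp: mult_left_le)
      then have "\<bar>real (m s) - N * s\<bar> \<le> N" using m_le[of s] by auto
      then show ?thesis by (simp add: abs_le_square_iff[symmetric])
    qed
  qed measurable
  have os: "order_stats N u i \<in> {a..b}" if "i \<in> {1..N}" for i
    using order_stats_in[OF u] that by (auto simp: Pi_iff)
  have "lstat N u = (\<Sum>i\<in>{1..N}. \<psi> (real i / N) * h b - \<psi> (real i / N) * (\<integral>s. k' s * step (x i) s \<partial>unit_law))"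
    unfolding lstat_def
  proof (rule sum.cong[OF refl])
    fix i assume "i \<in> {1..N}"
    show "\<psi> (real i / N) * h (order_stats N u i) = \<psi> (real i / N) * h b - \<psi> (real i / N) * (\<integral>s. k' s * step (x i) s \<partial>unit_law)"
      unfolding h_eq_integral[OF os[OF \<open>i \<in> {1..N}\<close>]] x_def by (simp add: right_diff_distrib)
  qed
  also have "\<dots> = h b * C N - (\<Sum>i\<in>{1..N}. \<integral>s. \<psi> (real i / N) * (k' s * step (x i) s) \<partial>unit_law)"
    by (simp add: sum_subtractf C_def sum_distrib_left mult.commute)
  also have "(\<Sum>i\<in>{1..N}. \<integral>s. \<psi> (real i / N) * (k' s * step (x i) s) \<partial>unit_law) =
      (\<integral>s. (\<Sum>i\<in>{1..N}. \<psi> (real i / N) * (k' s * step (x i) s)) \<partial>unit_law)"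
    by (rule Bochner_Integration.integral_sum[symmetric]) (intro integrable_mult_right i1)
  also have "\<dots> = (\<integral>s. k' s * C (m s) \<partial>unit_law)"
    unfolding Cm sum_distrib_left by (simp add: mult.left_commute)
  finally have T: "lstat N u = h b * C N - (\<integral>s. k' s * C (m s) \<partial>unit_law)" .
  have i5: "integrable unit_law (\<lambda>s. k' s * C (m s))"
  proof -
    have "integrable unit_law (\<lambda>s. \<Sum>i\<in>{1..N}. \<psi> (real i / N) * (k' s * step (x i) s))"
      by (intro Bochner_Integration.integrable_sum integrable_mult_right i1)
    then show ?thesis unfolding Cm sum_distrib_left by (simp add: mult.left_commute)
  qed
  have "(\<Sum>j\<in>{1..N}. noise (u j)) = (\<integral>s. (\<Sum>j\<in>{1..N}. J s * (step (unit_coord a b (u j)) s - s)) \<partial>unit_law)"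
    unfolding noise_def bridge_fun_def by (rule Bochner_Integration.integral_sum[symmetric]) (rule i3)
  also have "\<dots> = (\<integral>s. - (k' s * \<psi> s * (real (m s) - N * s)) \<partial>unit_law)"
    unfolding sum_distrib_left[symmetric] m_sum by (simp add: J_def sum_subtractf)
  finally have Y: "(\<Sum>j\<in>{1..N}. noise (u j)) = (\<integral>s. - (k' s * \<psi> s * (real (m s) - N * s)) \<partial>unit_law)" .
  have i6: "integrable unit_law (\<lambda>s. - (k' s * \<psi> s * (real (m s) - N * s)))"
  proof -
    have "integrable unit_law (\<lambda>s. \<Sum>j\<in>{1..N}. J s * (step (unit_coord a b (u j)) s - s))"
      by (intro Bochner_Integration.integrable_sum i3)
    then show ?thesis
      unfolding sum_distrib_left[symmetric] m_sum by (simp add: J_def sum_subtractf)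
  qed
  have "lstat N u - N * lmean - (\<Sum>j\<in>{1..N}. noise (u j)) =
      h b * (C N - N * \<Psi> 1) - ((\<integral>s. k' s * C (m s) \<partial>unit_law) - N * (\<integral>s. k' s * \<Psi> s \<partial>unit_law)
        + (\<integral>s. - (k' s * \<psi> s * (real (m s) - N * s)) \<partial>unit_law))"
    unfolding T Y lmean_eq by (simp add: algebra_simps)
  also have "(\<integral>s. k' s * C (m s) \<partial>unit_law) - N * (\<integral>s. k' s * \<Psi> s \<partial>unit_law)
        + (\<integral>s. - (k' s * \<psi> s * (real (m s) - N * s)) \<partial>unit_law) =
      (\<integral>s. k' s * C (m s) - N * (k' s * \<Psi> s) + - (k' s * \<psi> s * (real (m s) - N * s)) \<partial>unit_law)"
    using i5 i2 i6 by (simp only: Bochner_Integration.integral_add Bochner_Integration.integral_diff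
      Bochner_Integration.integrable_diff integral_mult_right_zero integrable_mult_right)
  finally have eq: "lstat N u - N * lmean - (\<Sum>j\<in>{1..N}. noise (u j)) = h b * (C N - N * \<Psi> 1) -
      (\<integral>s. k' s * C (m s) - N * (k' s * \<Psi> s) + - (k' s * \<psi> s * (real (m s) - N * s)) \<partial>unit_law)" .
  \<comment> \<open>The integrand splits into the Riemann sum error, at most \<open>L\<close>, and
    the Taylor remainder at \<open>m s / N\<close> around \<open>s\<close>, whose square scales to
    \<open>(m s - N * s)\<^sup>2 / N\<close>.\<close>
  have "norm (\<integral>s. k' s * C (m s) - N * (k' s * \<Psi> s) + - (k' s * \<psi> s * (real (m s) - N * s)) \<partial>unit_law)
      \<le> (\<integral>s. M * (L + L / N * (real (m s) - N * s)\<^sup>2) \<partial>unit_law)"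
  proof (rule norm_integral_le)
    show "integrable unit_law (\<lambda>s. M * (L + L / N * (real (m s) - N * s)\<^sup>2))"
      using i4 by (intro integrable_mult_right Bochner_Integration.integrable_add I.integrable_const)
    fix s assume "s \<in> space unit_law"
    then have s: "s \<in> {0..1}" by simp
    have ms: "real (m s) / N \<in> {0..1}" using m_le[of s] N0 by (simp add: divide_le_eq)
    have "\<bar>C (m s) - N * \<Psi> (real (m s) / N)\<bar> \<le> L"
      unfolding C_def by (rule riemann_sum_bound[OF N m_le])
    moreover have "\<bar>N * (\<Psi> (real (m s) / N) - \<Psi> s - (real (m s) / N - s) * \<psi> s)\<bar> \<le> N * (L * (real (m s) / N - s)\<^sup>2)"
      using \<Psi>_taylor[OF s ms] N0 by (simp only: abs_mult abs_of_nat mult_left_mono)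
    moreover have "N * (L * (real (m s) / N - s)\<^sup>2) = L / N * (real (m s) - N * s)\<^sup>2"
    proof -
      have "real (m s) / N - s = (real (m s) - N * s) / N" using N0 by (simp add: field_simps)
      then show ?thesis using N0 by (simp add: power_divide power2_eq_square)
    qed
    moreover have "N * (\<Psi> (real (m s) / N) - \<Psi> s - (real (m s) / N - s) * \<psi> s) =
        N * \<Psi> (real (m s) / N) - N * \<Psi> s - \<psi> s * (real (m s) - N * s)"
      using N0 by (simp add: field_simps)
    moreover have "\<bar>x - p\<bar> \<le> L \<Longrightarrow> \<bar>q\<bar> \<le> r \<Longrightarrow> r = r' \<Longrightarrow> q = p - y - z \<Longrightarrow> \<bar>x - y - z\<bar> \<le> L + r'" for x p q r r' y z :: real
      by linarith
    ultimately have "\<bar>C (m s) - N * \<Psi> s - \<psi> s * (real (m s) - N * s)\<bar> \<le> L + L / N * (real (m s) - N * s)\<^sup>2"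
      by blast
    then have "\<bar>k' s\<bar> * \<bar>C (m s) - N * \<Psi> s - \<psi> s * (real (m s) - N * s)\<bar> \<le> M * (L + L / N * (real (m s) - N * s)\<^sup>2)"
      using k'_le[OF s] nonneg by (intro mult_mono) auto
    then show "norm (k' s * C (m s) - N * (k' s * \<Psi> s) + - (k' s * \<psi> s * (real (m s) - N * s)))
        \<le> M * (L + L / N * (real (m s) - N * s)\<^sup>2)"
      by (simp add: algebra_simps flip: abs_mult)
  qed
  also have "\<dots> = M * L + M * L / N * (\<integral>s. (real (m s) - N * s)\<^sup>2 \<partial>unit_law)"
    using i4 by (simp add: distrib_left)
  finally have e1: "\<bar>\<integral>s. k' s * C (m s) - N * (k' s * \<Psi> s) + - (k' s * \<psi> s * (real (m s) - N * s)) \<partial>unit_law\<bar>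
     \<le> M * L + M * L / N * (\<integral>s. (real (m s) - N * s)\<^sup>2 \<partial>unit_law)" by simp
  \<comment> \<open>The Riemann sum bound at the right end, where all \<open>N\<close> weights are
    summed.\<close>
  have "\<bar>C N - N * \<Psi> 1\<bar> \<le> L"
    using riemann_sum_bound[OF N order_refl] N0 by (simp add: C_def)
  then have e2: "\<bar>h b * (C N - N * \<Psi> 1)\<bar> \<le> \<bar>h b\<bar> * L"
    by (simp add: abs_mult mult_left_mono)
  show ?thesis
    unfolding eq m_def[symmetric] using e1 e2 by (simp add: distrib_right)
qed

lemma lstat_measurable: "lstat N \<in> borel_measurable (Ulaw a b N)"
proof -
  have "h \<in> borel_measurable (uniform_law a b)"
    unfolding measurable_uniform_law_eq
    by (rule borel_measurable_continuous_on_restrict[OF h_continuous])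
  then have "(\<lambda>u. h (order_stats N u i)) \<in> borel_measurable (Ulaw a b N)" if "i \<in> {1..N}" for i
    using measurable_compose[OF order_stats_measurable[OF ab] Ulaw_component_measurable[OF ab that]] by blast
  then show ?thesis
    unfolding lstat_def[abs_def] by (intro borel_measurable_sum borel_measurable_times borel_measurable_const)
qed

lemma noise_sum_measurable: "(\<lambda>u. \<Sum>j\<in>{1..N}. noise (u j)) \<in> borel_measurable (Ulaw a b N)"
  by (intro borel_measurable_sum Ulaw_component_measurable[OF ab _ noise_measurable])

text \<open>The discrepancy has mean at most \<open>N\<close>, which cancels the factor
  \<open>1 / N\<close> of \<open>lstat_error\<close>. What remains is of order one, negligible
  against the sqrt N scale of the fluctuations.\<close>

lemma expectation_lstat_error:
  assumes N: "1 \<le> N"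
  shows "integrable (Ulaw a b N) (\<lambda>u. lstat N u - N * lmean - (\<Sum>j\<in>{1..N}. noise (u j)))"
    and "(\<integral>u. \<bar>lstat N u - N * lmean - (\<Sum>j\<in>{1..N}. noise (u j))\<bar> \<partial>Ulaw a b N) \<le> (\<bar>h b\<bar> + 2 * M) * L"
proof -
  interpret U: prob_space "Ulaw a b N" using ab by simp
  define Z where "Z u = (\<integral>s. (real (count_le N u (rho a b s)) - N * s)\<^sup>2 \<partial>unit_law)" for u
  define R where "R u = lstat N u - N * lmean - (\<Sum>j\<in>{1..N}. noise (u j))" for u
  have Z: "integrable (Ulaw a b N) Z" "(\<integral>u. Z u \<partial>Ulaw a b N) \<le> N"
    unfolding Z_def by (rule empirical_discrepancy[OF ab])+
  have R_le: "\<bar>R u\<bar> \<le> (\<bar>h b\<bar> + M) * L + M * L / N * Z u" if "u \<in> space (Ulaw a b N)" for u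
    unfolding R_def Z_def by (rule lstat_error[OF N Ulaw_space[OF ab that]])
  have bi: "integrable (Ulaw a b N) (\<lambda>u. (\<bar>h b\<bar> + M) * L + M * L / N * Z u)"
    by (intro Bochner_Integration.integrable_add U.integrable_const integrable_mult_right Z)
  have "R \<in> borel_measurable (Ulaw a b N)"
    unfolding R_def[abs_def]
    by (intro borel_measurable_diff lstat_measurable noise_sum_measurable borel_measurable_const)
  then have Ri: "integrable (Ulaw a b N) R"
    by (rule Bochner_Integration.integrable_bound[OF bi])
       (use R_le in \<open>auto intro!: AE_I2 intro: order_trans[OF _ abs_ge_self]\<close>)
  then show "integrable (Ulaw a b N) (\<lambda>u. lstat N u - N * lmean - (\<Sum>j\<in>{1..N}. noise (u j)))"
    unfolding R_def .
  have "(\<integral>u. \<bar>R u\<bar> \<partial>Ulaw a b N) \<le> (\<integral>u. (\<bar>h b\<bar> + M) * L + M * L / N * Z u \<partial>Ulaw a b N)"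
    using Ri bi R_le by (intro integral_mono integrable_abs)
  also have "\<dots> = (\<bar>h b\<bar> + M) * L + M * L / N * (\<integral>u. Z u \<partial>Ulaw a b N)"
    using Z by (simp add: U.prob_space)
  also have "\<dots> \<le> (\<bar>h b\<bar> + M) * L + M * L / N * N"
    using Z nonneg by (intro add_left_mono mult_left_mono) auto
  also have "\<dots> = (\<bar>h b\<bar> + 2 * M) * L" using N by (simp add: algebra_simps)
  finally show "(\<integral>u. \<bar>lstat N u - N * lmean - (\<Sum>j\<in>{1..N}. noise (u j))\<bar> \<partial>Ulaw a b N) \<le> (\<bar>h b\<bar> + 2 * M) * L"
    by (simp add: R_def)
qed

text \<open>Splitting at scale sqrt N,
  \<open>\<bar>S\<bar> \<le> S\<^sup>2 / sqrt N + sqrt N\<close> reduces the first absolute moment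
  to the variance. Applied to the L-statistic of \<open>V\<close>, it makes the noise negligible
  against the scale \<open>N\<close> of the conditional variance.\<close>

lemma expectation_abs_noise_sum:
  assumes N: "1 \<le> N"
  shows "integrable (Ulaw a b N) (\<lambda>u. \<Sum>j\<in>{1..N}. noise (u j))"
    and "(\<integral>u. \<bar>\<Sum>j\<in>{1..N}. noise (u j)\<bar> \<partial>Ulaw a b N) \<le> sqrt N * (noise_var + 1)"
proof -
  let ?U = "Ulaw a b N"
  interpret U: prob_space ?U using ab by simp
  define S where "S u = (\<Sum>j\<in>{1..N}. noise (u j))" for u
  have S_le: "\<bar>S u\<bar> \<le> N * (M * B)" for u
  proof -
    have "\<bar>S u\<bar> \<le> (\<Sum>j\<in>{1..N}. \<bar>noise (u j)\<bar>)" unfolding S_def by (rule sum_abs)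
    also have "\<dots> \<le> (\<Sum>j\<in>{1..N}. M * B)" by (intro sum_mono abs_noise_le)
    finally show ?thesis by simp
  qed
  have Sm: "S \<in> borel_measurable ?U" unfolding S_def[abs_def] by (rule noise_sum_measurable)
  have Si: "integrable ?U S" using S_le by (intro U.integrable_const_bound[OF _ Sm]) auto
  then show "integrable ?U (\<lambda>u. \<Sum>j\<in>{1..N}. noise (u j))" unfolding S_def .
  have Si2: "integrable ?U (\<lambda>u. (S u)\<^sup>2)"
  proof (rule U.integrable_const_bound[where B="(N * (M * B))\<^sup>2"])
    show "AE u in ?U. norm ((S u)\<^sup>2) \<le> (N * (M * B))\<^sup>2"
      using S_le nonneg by (intro AE_I2) (simp add: abs_le_square_iff[symmetric])
  qed (use Sm in measurable)
  have sq: "0 < sqrt N" using N by simp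
  have "(\<integral>u. \<bar>S u\<bar> \<partial>?U) \<le> (\<integral>u. (S u)\<^sup>2 / sqrt N + sqrt N \<partial>?U)"
  proof (rule integral_mono)
    fix u
    have "2 * (\<bar>S u\<bar> * sqrt N) \<le> (S u)\<^sup>2 + sqrt N * sqrt N"
      using zero_le_power2[of "\<bar>S u\<bar> - sqrt N"] by (simp add: power2_diff algebra_simps)
    moreover have "0 \<le> \<bar>S u\<bar> * sqrt N" by simp
    ultimately have "\<bar>S u\<bar> * sqrt N \<le> (S u)\<^sup>2 + sqrt N * sqrt N" by linarith
    then show "\<bar>S u\<bar> \<le> (S u)\<^sup>2 / sqrt N + sqrt N" using sq by (simp add: field_simps)
  qed (use Si Si2 in auto)
  also have "\<dots> = (\<integral>u. (S u)\<^sup>2 \<partial>?U) / sqrt N + sqrt N"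
    using Si2 by (simp add: U.prob_space)
  also have "(\<integral>u. (S u)\<^sup>2 \<partial>?U) = N * noise_var"
    unfolding S_def noise_var_def
    by (rule iid_sum_square[OF ab noise_measurable abs_noise_le integral_noise])
  also have "N * noise_var / sqrt N + sqrt N = sqrt N * (noise_var + 1)"
    using sq by (simp add: field_simps)
  finally show "(\<integral>u. \<bar>\<Sum>j\<in>{1..N}. noise (u j)\<bar> \<partial>?U) \<le> sqrt N * (noise_var + 1)"
    by (simp add: S_def)
qed

text \<open>The central limit theorem with a rate for independent identically distributed variables,
  as the case of blocks of length one: each summand is then its own neighbourhood and
  \<open>V\<close> reduces to \<open>N * noise_var\<close>.\<close>

lemma char_noise_sum:
  assumes N: "1 \<le> N"
  shows "cmod ((\<integral>u. iexp (t / sqrt N * (\<Sum>j\<in>{1..N}. noise (u j))) \<partial>Ulaw a b N) - exp (- noise_var * t\<^sup>2 / 2))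
    \<le> 18 * (4 * (1 + (M * B) ^ 3))\<^sup>2 * \<bar>t\<bar> ^ 3 / sqrt N"
proof -
  let ?U = "Ulaw a b N"
  interpret U: prob_space ?U using ab by simp
  define X where "X n u = noise (u (n + 1))" for n :: nat and u
  define K where "K = 1 + (M * B) ^ 3"
  have X_dep: "depends_on {n + 1..n + 1} (\<lambda>_. uniform_law a b) (X n)" for n
    unfolding X_def by (rule Ulaw_depends_on) (use noise_measurable in auto)
  have Xm: "X n \<in> borel_measurable ?U" if "n < N" for n
    using that unfolding X_def[abs_def] by (intro Ulaw_component_measurable[OF ab _ noise_measurable]) auto
  have X3: "\<bar>X n u\<bar> ^ 3 \<le> (M * B) ^ 3" for n u
    unfolding X_def by (intro power_mono abs_noise_le) simp
  have X3i: "integrable ?U (\<lambda>u. \<bar>X n u\<bar> ^ 3)" if "n < N" for n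
    using X3 Xm[OF that] by (intro U.integrable_const_bound[where B="(M * B) ^ 3"]) auto
  have sum_eq: "(\<Sum>n\<in>{0..<N}. X n u) = (\<Sum>j\<in>{1..N}. noise (u j))" for u
    unfolding X_def by (rule sum.reindex_bij_witness[of _ "\<lambda>j. j - 1" "\<lambda>n. n + 1"]) auto
  have V_eq: "(\<Sum>n\<in>{0..<N}. \<Sum>m\<in>{m\<in>{0..<N}. n < m + 1 \<and> m < n + 1}. \<integral>u. X n u * X m u \<partial>?U) = N * noise_var"
  proof -
    have "(\<Sum>n\<in>{0..<N}. \<Sum>m\<in>{m\<in>{0..<N}. n < m + 1 \<and> m < n + 1}. \<integral>u. X n u * X m u \<partial>?U) = (\<Sum>n\<in>{0..<N}. noise_var)"
    proof (rule sum.cong[OF refl])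
      fix n assume n: "n \<in> {0..<N}"
      have "{m\<in>{0..<N}. n < m + 1 \<and> m < n + 1} = {n}" using n by auto
      moreover have "(\<lambda>v. (noise v)\<^sup>2) \<in> borel_measurable (uniform_law a b)" using noise_measurable by measurable
      ultimately show "(\<Sum>m\<in>{m\<in>{0..<N}. n < m + 1 \<and> m < n + 1}. \<integral>u. X n u * X m u \<partial>?U) = noise_var"
        using Ulaw_component[OF ab, of "n + 1" N "\<lambda>v. (noise v)\<^sup>2"] n
        by (simp add: X_def noise_var_def power2_eq_square)
    qed
    then show ?thesis by simp
  qed
  have "cmod ((\<integral>u. iexp (t / sqrt N * (\<Sum>n\<in>{0..<N}. X n u)) \<partial>?U) -
      exp (- (\<Sum>n\<in>{0..<N}. \<Sum>m\<in>{m\<in>{0..<N}. n < m + 1 \<and> m < n + 1}. \<integral>u. X n u * X m u \<partial>?U) * (t / sqrt N)\<^sup>2 / 2))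
    \<le> card {0..<N} * (18 * (4 * real 1 * K)\<^sup>2) * \<bar>t / sqrt N\<bar> ^ 3"
  proof (rule char_sum_PiM_approx(2))
    fix n assume n: "n \<in> {0..<N}"
    show "integrable ?U (\<lambda>u. \<bar>X n u\<bar> ^ 3)" using X3i n by simp
    have "(\<integral>u. \<bar>X n u\<bar> ^ 3 \<partial>?U) \<le> (\<integral>u. K \<partial>?U)"
      using X3 X3i n by (intro integral_mono) (auto simp: K_def intro!: order_trans[OF X3])
    then show "(\<integral>u. \<bar>X n u\<bar> ^ 3 \<partial>?U) \<le> K" by (simp add: U.prob_space)
    show "(\<integral>u. X n u \<partial>?U) = 0"
      using Ulaw_component[OF ab, of "n + 1" N noise] n noise_measurable integral_noise by (simp add: X_def)
    show "depends_on {n + 1..n + 1} (\<lambda>_. uniform_law a b) (X n)" by (rule X_dep)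
  qed (use N ab nonneg in \<open>auto simp: K_def\<close>)
  also have "N * noise_var * (t / sqrt N)\<^sup>2 = noise_var * t\<^sup>2" if "N > 0"
    using N by (simp add: power_divide)
  have "card {0..<N} * (18 * (4 * real 1 * K)\<^sup>2) * \<bar>t / sqrt N\<bar> ^ 3 = 18 * (4 * K)\<^sup>2 * \<bar>t\<bar> ^ 3 / sqrt N"
  proof -
    \<comment> \<open>There are \<open>N\<close> summands, each contributing an error of order
      \<open>N\<close> to the power -3/2.\<close>
    have "real N / sqrt N ^ 3 = 1 / sqrt N" using N by (simp add: power3_eq_cube field_simps)
    then have "real N * (\<bar>t\<bar> ^ 3 / sqrt N ^ 3) = \<bar>t\<bar> ^ 3 / sqrt N"
      by (metis (no_types, lifting) mult.commute mult.left_neutral times_divide_eq_left times_divide_eq_right)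
    then have "(18 * (4 * K)\<^sup>2) * (real N * (\<bar>t\<bar> ^ 3 / sqrt N ^ 3)) = (18 * (4 * K)\<^sup>2) * (\<bar>t\<bar> ^ 3 / sqrt N)" by simp
    then show ?thesis by (simp add: power_divide ac_simps)
  qed
  finally show ?thesis
    unfolding V_eq sum_eq K_def using N by (simp add: power_divide)
qed

end

section \<open>Configuration functions that read a given set of coordinates\<close>

abbreviation depends_conf :: "nat set \<Rightarrow> ((nat \<Rightarrow> nat) \<Rightarrow> real) \<Rightarrow> bool" where
  "depends_conf J q \<equiv> depends_on J (\<lambda>_. count_space UNIV) q"

lemma depends_conf_nu_prod:
  "depends_conf J q \<Longrightarrow> depends_on J (\<lambda>i. measure_pmf (nu (\<theta> i))) q"
  unfolding depends_on_def nu_prod_def[symmetric] measurable_nu_prod by simp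

lemma
  assumes q: "depends_conf J q" and J: "J \<subseteq> I"
  shows integral_nu_prod_restrict: "(\<integral>\<eta>. q \<eta> \<partial>nu_prod I \<theta>) = (\<integral>\<eta>. q \<eta> \<partial>nu_prod J \<theta>)"
    and integrable_nu_prod_restrict: "integrable (nu_prod I \<theta>) q \<longleftrightarrow> integrable (nu_prod J \<theta>) q"
proof -
  have qm: "q \<in> borel_measurable (conf J)" and qr: "q (restrict \<omega> J) = q \<omega>" for \<omega>
    using q by (auto simp: depends_on_def)
  have f: "inj_on (\<lambda>i. i) J" "(\<lambda>i. i) \<in> J \<rightarrow> I" using J by auto
  show "(\<integral>\<eta>. q \<eta> \<partial>nu_prod I \<theta>) = (\<integral>\<eta>. q \<eta> \<partial>nu_prod J \<theta>)"
    using integral_nu_prod_reindex[OF f qm, of \<theta>] by (simp add: qr)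
  show "integrable (nu_prod I \<theta>) q \<longleftrightarrow> integrable (nu_prod J \<theta>) q"
    using integrable_nu_prod_reindex[OF f qm, of \<theta>] by (simp add: qr)
qed

section \<open>Local functions\<close>

lemma two_abs_le_square: "2 * \<bar>x\<bar> \<le> x\<^sup>2 + 1" for x :: real
  using zero_le_power2[of "\<bar>x\<bar> - 1"] by (simp add: power2_diff)

lemma two_square_le_pow4: "2 * x\<^sup>2 \<le> x ^ 4 + 1" for x :: real
  using two_abs_le_square[of "x\<^sup>2"] by simp

lemma square_le_1_pow4: "x\<^sup>2 \<le> 1 + x ^ 4" for x :: real
  using two_square_le_pow4[of x] zero_le_power2[of x] by linarith

lemma abs_le_1_pow4: "\<bar>x\<bar> \<le> 1 + x ^ 4" for x :: real
proof -
  have "0 \<le> x ^ 4" by simp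
  then show ?thesis using two_abs_le_square[of x] square_le_1_pow4[of x] by linarith
qed

lemma abs_cube_le_1_pow4: "\<bar>x\<bar> ^ 3 \<le> 1 + x ^ 4" for x :: real
proof (cases "\<bar>x\<bar> \<le> 1")
  case True
  then have "\<bar>x\<bar> ^ 3 \<le> 1" by (intro power_le_one) auto
  then show ?thesis by (simp add: add_increasing2)
next
  case False
  then have "\<bar>x\<bar> ^ 3 \<le> \<bar>x\<bar> ^ 4" by (intro power_increasing) auto
  then show ?thesis by simp
qed

lemma diff_pow4_le: "(x - y) ^ 4 \<le> 8 * (x ^ 4 + y ^ 4)" for x y :: real
proof -
  have s: "(u - v)\<^sup>2 \<le> 2 * (u\<^sup>2 + v\<^sup>2)" for u v :: real
    using zero_le_power2[of "u + v"] by (simp add: power2_diff power2_sum)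
  have s': "(u + v)\<^sup>2 \<le> 2 * (u\<^sup>2 + v\<^sup>2)" for u v :: real
    using zero_le_power2[of "u - v"] by (simp add: power2_diff power2_sum)
  have "(x - y) ^ 4 = ((x - y)\<^sup>2)\<^sup>2" by simp
  also have "\<dots> \<le> (2 * (x\<^sup>2 + y\<^sup>2))\<^sup>2" by (intro power_mono s) simp
  also have "\<dots> = 4 * (x\<^sup>2 + y\<^sup>2)\<^sup>2"
    by (simp only: power_mult_distrib) simp
  also have "\<dots> \<le> 4 * (2 * ((x\<^sup>2)\<^sup>2 + (y\<^sup>2)\<^sup>2))" by (intro mult_left_mono s') simp
  finally show ?thesis by simp
qed

lemma mult_pow2_le: "(x * y)\<^sup>2 \<le> x ^ 4 + y ^ 4" for x y :: real
proof -
  have "2 * (x\<^sup>2 * y\<^sup>2) \<le> x ^ 4 + y ^ 4"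
    using zero_le_power2[of "x\<^sup>2 - y\<^sup>2"] by (simp add: power2_diff)
  moreover have "0 \<le> x\<^sup>2 * y\<^sup>2" by simp
  ultimately have "x\<^sup>2 * y\<^sup>2 \<le> x ^ 4 + y ^ 4" by linarith
  then show ?thesis by (simp only: power_mult_distrib)
qed

lemma abs_mult_le_pow4: "\<bar>x * y\<bar> \<le> 2 + x ^ 4 + y ^ 4" for x y :: real
proof -
  have "2 * (\<bar>x\<bar> * \<bar>y\<bar>) \<le> x\<^sup>2 + y\<^sup>2"
    using zero_le_power2[of "\<bar>x\<bar> - \<bar>y\<bar>"] by (simp add: power2_diff)
  moreover have "0 \<le> \<bar>x\<bar> * \<bar>y\<bar>" by simp
  ultimately show ?thesis
    using square_le_1_pow4[of x] square_le_1_pow4[of y] unfolding abs_mult by linarith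
qed

text \<open>The fourth moment is assumed at the largest parameter \<open>b\<close> only as a
  starting point: bounded densities spread it to every parameter vector with entries in
  \<open>{0..b}\<close>.\<close>

locale local_obs =
  fixes a b :: real and k :: nat and g :: "(nat \<Rightarrow> nat) \<Rightarrow> real"
  assumes a0: "0 \<le> a" and ab: "a < b" and k: "1 \<le> k" and loc: "local_function k g"
    and g_meas: "g \<in> borel_measurable (conf {1..k})"
    and g4: "integrable (nu_prod {1..k} (\<lambda>_. b)) (\<lambda>\<eta>. g \<eta> ^ 4)"
begin

lemma b0: "0 < b" using a0 ab by simp

text \<open>The coordinates read by \<open>shift n g\<close>.\<close>

definition win where "win n = {n + 1..n + k}"

lemma shift_reindex: "shift n g \<eta> = g (\<lambda>i\<in>{1..k}. \<eta> (n + i))"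
  unfolding shift_def by (rule loc[unfolded local_function_def, rule_format]) auto

lemma win_inj: "inj_on (\<lambda>i. n + i) {1..k}" "(\<lambda>i. n + i) \<in> {1..k} \<rightarrow> win n"
  by (auto simp: win_def)

lemma shift_depends: "depends_conf (win n) (shift n g)"
  unfolding depends_on_def
proof
  show "shift n g \<in> borel_measurable (conf (win n))"
    unfolding shift_reindex[abs_def] by (rule measurable_reindex[OF win_inj g_meas])
  show "\<forall>\<omega>. shift n g (restrict \<omega> (win n)) = shift n g \<omega>"
  proof
    fix \<omega> :: "nat \<Rightarrow> nat"
    show "shift n g (restrict \<omega> (win n)) = shift n g \<omega>"
      unfolding shift_reindex by (rule arg_cong[of _ _ g]) (auto simp: win_def fun_eq_iff)
  qed
qed

lemma expectation_shift:
  fixes F :: "real \<Rightarrow> real"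
  assumes F: "F \<in> borel_measurable borel" and I: "win n \<subseteq> I"
  shows "(\<integral>\<eta>. F (shift n g \<eta>) \<partial>nu_prod I \<theta>) = (\<integral>\<eta>. F (g \<eta>) \<partial>nu_prod {1..k} (\<lambda>i. \<theta> (n + i)))"
    and "integrable (nu_prod I \<theta>) (\<lambda>\<eta>. F (shift n g \<eta>)) \<longleftrightarrow>
      integrable (nu_prod {1..k} (\<lambda>i. \<theta> (n + i))) (\<lambda>\<eta>. F (g \<eta>))"
proof -
  have Fg: "(\<lambda>\<eta>. F (g \<eta>)) \<in> borel_measurable (conf {1..k})" using measurable_compose[OF g_meas F] .
  have f: "inj_on (\<lambda>i. n + i) {1..k}" "(\<lambda>i. n + i) \<in> {1..k} \<rightarrow> I"
    using win_inj[of n] I by (auto simp: win_def)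
  show "(\<integral>\<eta>. F (shift n g \<eta>) \<partial>nu_prod I \<theta>) = (\<integral>\<eta>. F (g \<eta>) \<partial>nu_prod {1..k} (\<lambda>i. \<theta> (n + i)))"
    unfolding shift_reindex by (rule integral_nu_prod_reindex[OF f Fg])
  show "integrable (nu_prod I \<theta>) (\<lambda>\<eta>. F (shift n g \<eta>)) \<longleftrightarrow>
      integrable (nu_prod {1..k} (\<lambda>i. \<theta> (n + i))) (\<lambda>\<eta>. F (g \<eta>))"
    unfolding shift_reindex by (rule integrable_nu_prod_reindex[OF f Fg])
qed

lemma g2: "integrable (nu_prod {1..k} (\<lambda>_. b)) (\<lambda>\<eta>. (g \<eta>)\<^sup>2)"
proof (rule Bochner_Integration.integrable_bound)
  interpret prob_space "nu_prod {1..k} (\<lambda>_. b)" by simp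
  show "integrable (nu_prod {1..k} (\<lambda>_. b)) (\<lambda>\<eta>. 1 + g \<eta> ^ 4)"
    by (intro Bochner_Integration.integrable_add g4 integrable_const)
  show "(\<lambda>\<eta>. (g \<eta>)\<^sup>2) \<in> borel_measurable (nu_prod {1..k} (\<lambda>_. b))"
    using g_meas by simp
qed (use square_le_1_pow4 in \<open>auto intro!: AE_I2\<close>)

sublocale G: square_integrable_obs b "{1..k}" g
  by standard (simp_all add: b0 g_meas g2)

definition G4 where "G4 = (\<integral>\<eta>. g \<eta> ^ 4 \<partial>nu_prod {1..k} (\<lambda>_. b))"
text \<open>The factor \<open>(1 + b) ^ k\<close> bounds the density on a window of \<open>k\<close>
  coordinates, so this bounds the fourth moment of every shift under all admissible
  parameters.\<close>

definition M4 where "M4 = (1 + b) ^ k * G4"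

lemma G4_nonneg: "0 \<le> G4" unfolding G4_def by simp
lemma M4_nonneg: "0 \<le> M4" unfolding M4_def using b0 G4_nonneg by simp

lemma shift4:
  assumes I: "win n \<subseteq> I" and \<theta>: "\<theta> \<in> I \<rightarrow> {0..b}"
  shows integrable_shift4: "integrable (nu_prod I \<theta>) (\<lambda>\<eta>. shift n g \<eta> ^ 4)"
    and expectation_shift4_le: "(\<integral>\<eta>. shift n g \<eta> ^ 4 \<partial>nu_prod I \<theta>) \<le> M4"
proof -
  have \<theta>': "(\<lambda>i. \<theta> (n + i)) \<in> {1..k} \<rightarrow> {0..b}"
  proof
    fix i assume "i \<in> {1..k}"
    then have "n + i \<in> I" using I by (auto simp: win_def)
    then show "\<theta> (n + i) \<in> {0..b}" using \<theta> by (auto simp: Pi_iff)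
  qed
  have F: "(\<lambda>x::real. x ^ 4) \<in> borel_measurable borel" by measurable
  show "integrable (nu_prod I \<theta>) (\<lambda>\<eta>. shift n g \<eta> ^ 4)"
    unfolding expectation_shift(2)[OF F I] by (rule G.integrable_nu_prod[OF \<theta>' g4])
  show "(\<integral>\<eta>. shift n g \<eta> ^ 4 \<partial>nu_prod I \<theta>) \<le> M4"
    unfolding expectation_shift(1)[OF F I] M4_def G4_def
    using G.abs_integral_nu_prod_le[OF \<theta>' g4] by simp
qed

lemma shift_measurable: "win n \<subseteq> I \<Longrightarrow> shift n g \<in> borel_measurable (conf I)"
  by (rule depends_on_measurable[OF shift_depends])

lemma shift1:
  assumes I: "win n \<subseteq> I" and \<theta>: "\<theta> \<in> I \<rightarrow> {0..b}"
  shows integrable_shift: "integrable (nu_prod I \<theta>) (shift n g)"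
    and expectation_abs_shift_le: "(\<integral>\<eta>. \<bar>shift n g \<eta>\<bar> \<partial>nu_prod I \<theta>) \<le> 1 + M4"
    and abs_expectation_shift_le: "\<bar>\<integral>\<eta>. shift n g \<eta> \<partial>nu_prod I \<theta>\<bar> \<le> 1 + M4"
proof -
  interpret prob_space "nu_prod I \<theta>" by simp
  have i: "integrable (nu_prod I \<theta>) (\<lambda>\<eta>. 1 + shift n g \<eta> ^ 4)"
    by (intro Bochner_Integration.integrable_add integrable_shift4[OF I \<theta>] integrable_const)
  show i1: "integrable (nu_prod I \<theta>) (shift n g)"
    by (rule Bochner_Integration.integrable_bound[OF i])
       (use shift_measurable[OF I] abs_le_1_pow4 in \<open>auto intro!: AE_I2\<close>)
  have "(\<integral>\<eta>. \<bar>shift n g \<eta>\<bar> \<partial>nu_prod I \<theta>) \<le> (\<integral>\<eta>. 1 + shift n g \<eta> ^ 4 \<partial>nu_prod I \<theta>)"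
    using i1 i abs_le_1_pow4 by (intro integral_mono integrable_abs) auto
  also have "\<dots> \<le> 1 + M4"
    using integrable_shift4[OF I \<theta>] expectation_shift4_le[OF I \<theta>] by (simp add: prob_space)
  finally show le: "(\<integral>\<eta>. \<bar>shift n g \<eta>\<bar> \<partial>nu_prod I \<theta>) \<le> 1 + M4" .
  show "\<bar>\<integral>\<eta>. shift n g \<eta> \<partial>nu_prod I \<theta>\<bar> \<le> 1 + M4"
    by (rule order_trans[OF integral_abs_bound le])
qed

lemma shift_mult_depends: "depends_conf (win n \<union> win m) (\<lambda>\<eta>. shift n g \<eta> * shift m g \<eta>)"
  by (intro depends_on_mult depends_on_mono[OF shift_depends]) auto

lemma shift_mult:
  assumes I: "win n \<subseteq> I" "win m \<subseteq> I" and \<theta>: "\<theta> \<in> I \<rightarrow> {0..b}"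
  shows integrable_shift_mult: "integrable (nu_prod I \<theta>) (\<lambda>\<eta>. shift n g \<eta> * shift m g \<eta>)"
    and abs_expectation_shift_mult_le: "\<bar>\<integral>\<eta>. shift n g \<eta> * shift m g \<eta> \<partial>nu_prod I \<theta>\<bar> \<le> 2 + 2 * M4"
proof -
  interpret prob_space "nu_prod I \<theta>" by simp
  have i: "integrable (nu_prod I \<theta>) (\<lambda>\<eta>. 2 + shift n g \<eta> ^ 4 + shift m g \<eta> ^ 4)"
    by (intro Bochner_Integration.integrable_add integrable_shift4 I \<theta> integrable_const)
  show i1: "integrable (nu_prod I \<theta>) (\<lambda>\<eta>. shift n g \<eta> * shift m g \<eta>)"
  proof (rule Bochner_Integration.integrable_bound[OF i])
    show "(\<lambda>\<eta>. shift n g \<eta> * shift m g \<eta>) \<in> borel_measurable (nu_prod I \<theta>)"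
      using shift_measurable I by simp
    show "AE \<eta> in nu_prod I \<theta>. norm (shift n g \<eta> * shift m g \<eta>) \<le> norm (2 + shift n g \<eta> ^ 4 + shift m g \<eta> ^ 4)"
      using abs_mult_le_pow4 by (intro AE_I2) (auto intro: order_trans[OF _ abs_ge_self])
  qed
  have "norm (\<integral>\<eta>. shift n g \<eta> * shift m g \<eta> \<partial>nu_prod I \<theta>) \<le> (\<integral>\<eta>. 2 + shift n g \<eta> ^ 4 + shift m g \<eta> ^ 4 \<partial>nu_prod I \<theta>)"
    using abs_mult_le_pow4 by (intro norm_integral_le i) simp
  also have "\<dots> \<le> 2 + 2 * M4"
    using integrable_shift4[OF I(1) \<theta>] expectation_shift4_le[OF I(1) \<theta>]
      integrable_shift4[OF I(2) \<theta>] expectation_shift4_le[OF I(2) \<theta>] by (simp add: prob_space)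
  finally show "\<bar>\<integral>\<eta>. shift n g \<eta> * shift m g \<eta> \<partial>nu_prod I \<theta>\<bar> \<le> 2 + 2 * M4" by simp
qed

lemma finite_win: "finite (win n)" and card_win: "card (win n) = k"
  by (simp_all add: win_def)

lemma shift4_base:
  "integrable (nu_prod I (\<lambda>_. b)) (\<lambda>\<eta>. shift n g \<eta> ^ 4)"
  "(\<integral>\<eta>. shift n g \<eta> ^ 4 \<partial>nu_prod I (\<lambda>_. b)) = G4" if "win n \<subseteq> I"
proof -
  have F: "(\<lambda>x::real. x ^ 4) \<in> borel_measurable borel" by measurable
  show "integrable (nu_prod I (\<lambda>_. b)) (\<lambda>\<eta>. shift n g \<eta> ^ 4)"
    by (rule integrable_shift4[OF that]) (use b0 in auto)
  show "(\<integral>\<eta>. shift n g \<eta> ^ 4 \<partial>nu_prod I (\<lambda>_. b)) = G4"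
    unfolding expectation_shift(1)[OF F that] G4_def ..
qed

text \<open>The proof gives \<open>1 + G4\<close>; the weaker \<open>1 + 2 * G4\<close> is shared
  with products of two shifts, so that one Lipschitz constant serves both.\<close>

lemma shift_obs: "square_integrable_obs b (win n) (shift n g)"
  and shift_square_le: "(\<integral>\<eta>. (shift n g \<eta>)\<^sup>2 \<partial>nu_prod (win n) (\<lambda>_. b)) \<le> 1 + 2 * G4"
proof -
  interpret prob_space "nu_prod (win n) (\<lambda>_. b)" by simp
  have i: "integrable (nu_prod (win n) (\<lambda>_. b)) (\<lambda>\<eta>. 1 + shift n g \<eta> ^ 4)"
    by (intro Bochner_Integration.integrable_add shift4_base integrable_const order_refl)
  have m: "shift n g \<in> borel_measurable (conf (win n))" by (rule shift_measurable) simp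
  have i2: "integrable (nu_prod (win n) (\<lambda>_. b)) (\<lambda>\<eta>. (shift n g \<eta>)\<^sup>2)"
    by (rule Bochner_Integration.integrable_bound[OF i]) (use m square_le_1_pow4 in \<open>auto intro!: AE_I2\<close>)
  show "square_integrable_obs b (win n) (shift n g)"
    by standard (use b0 finite_win m i2 in auto)
  have "(\<integral>\<eta>. (shift n g \<eta>)\<^sup>2 \<partial>nu_prod (win n) (\<lambda>_. b)) \<le> (\<integral>\<eta>. 1 + shift n g \<eta> ^ 4 \<partial>nu_prod (win n) (\<lambda>_. b))"
    using i2 i square_le_1_pow4 by (intro integral_mono) auto
  also have "\<dots> = 1 + G4" using shift4_base[of n "win n"] by (simp add: prob_space)
  finally show "(\<integral>\<eta>. (shift n g \<eta>)\<^sup>2 \<partial>nu_prod (win n) (\<lambda>_. b)) \<le> 1 + 2 * G4"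
    using G4_nonneg by simp
qed

text \<open>The square of a product is at most the sum of the fourth powers. This is where a fourth
  moment of \<open>g\<close> becomes a second moment of an observable.\<close>

lemma shift_mult_obs: "square_integrable_obs b (win n \<union> win m) (\<lambda>\<eta>. shift n g \<eta> * shift m g \<eta>)"
  and shift_mult_square_le:
    "(\<integral>\<eta>. (shift n g \<eta> * shift m g \<eta>)\<^sup>2 \<partial>nu_prod (win n \<union> win m) (\<lambda>_. b)) \<le> 1 + 2 * G4"
proof -
  let ?Q = "nu_prod (win n \<union> win m) (\<lambda>_. b)"
  have i: "integrable ?Q (\<lambda>\<eta>. shift n g \<eta> ^ 4 + shift m g \<eta> ^ 4)"
    by (intro Bochner_Integration.integrable_add shift4_base) auto
  have m: "(\<lambda>\<eta>. shift n g \<eta> * shift m g \<eta>) \<in> borel_measurable (conf (win n \<union> win m))"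
    using shift_mult_depends by (simp add: depends_on_def)
  have i2: "integrable ?Q (\<lambda>\<eta>. (shift n g \<eta> * shift m g \<eta>)\<^sup>2)"
    by (rule Bochner_Integration.integrable_bound[OF i]) (use m mult_pow2_le in \<open>auto intro!: AE_I2\<close>)
  show "square_integrable_obs b (win n \<union> win m) (\<lambda>\<eta>. shift n g \<eta> * shift m g \<eta>)"
    by standard (use b0 finite_win m i2 in auto)
  have "(\<integral>\<eta>. (shift n g \<eta> * shift m g \<eta>)\<^sup>2 \<partial>?Q) \<le> (\<integral>\<eta>. shift n g \<eta> ^ 4 + shift m g \<eta> ^ 4 \<partial>?Q)"
    using i2 i mult_pow2_le by (intro integral_mono) auto
  also have "\<dots> = G4 + G4"
    using shift4_base[of n "win n \<union> win m"] shift4_base[of m "win n \<union> win m"] by simp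
  finally show "(\<integral>\<eta>. (shift n g \<eta> * shift m g \<eta>)\<^sup>2 \<partial>?Q) \<le> 1 + 2 * G4" by simp
qed

text \<open>The exponent \<open>2 * k\<close> covers the union of two windows; the last factor is
  the bound for observable and weight in \<open>expectation_lipschitz\<close>.\<close>

definition lip0 where "lip0 = (1 + b) ^ (2 * k) * lratio_const b * (1 + 2 * G4 + G.weight_moment)"

lemma obs_lipschitz:
  assumes obs: "square_integrable_obs b J q" and J: "card J \<le> 2 * k"
    and le: "(\<integral>\<eta>. (q \<eta>)\<^sup>2 \<partial>nu_prod J (\<lambda>_. b)) \<le> 1 + 2 * G4"
    and \<theta>: "\<theta> \<in> J \<rightarrow> {0..b}" "\<theta>' \<in> J \<rightarrow> {0..b}"
  shows "\<bar>(\<integral>\<eta>. q \<eta> \<partial>nu_prod J \<theta>) - (\<integral>\<eta>. q \<eta> \<partial>nu_prod J \<theta>')\<bar> \<le> lip0 * (\<Sum>i\<in>J. \<bar>\<theta> i - \<theta>' i\<bar>)"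
proof -
  interpret O: square_integrable_obs b J q by fact
  have wm: "0 \<le> G.weight_moment" by (simp add: G.weight_moment_def)
  have "(1 + b) ^ card J * lratio_const b * ((\<integral>\<eta>. (q \<eta>)\<^sup>2 \<partial>nu_prod J (\<lambda>_. b)) + G.weight_moment) \<le> lip0"
    unfolding lip0_def
  proof (rule mult_mono)
    have "(1 + b) ^ card J \<le> (1 + b) ^ (2 * k)" using b0 by (intro power_increasing[OF J]) simp
    then show "(1 + b) ^ card J * lratio_const b \<le> (1 + b) ^ (2 * k) * lratio_const b"
      by (rule mult_right_mono) (rule lratio_const_nonneg[OF b0])
    show "(\<integral>\<eta>. (q \<eta>)\<^sup>2 \<partial>nu_prod J (\<lambda>_. b)) + G.weight_moment \<le> 1 + 2 * G4 + G.weight_moment"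
      using le by simp
    show "0 \<le> (1 + b) ^ (2 * k) * lratio_const b" using b0 lratio_const_nonneg[OF b0] by simp
    show "0 \<le> (\<integral>\<eta>. (q \<eta>)\<^sup>2 \<partial>nu_prod J (\<lambda>_. b)) + G.weight_moment" using wm by simp
  qed
  then show ?thesis
    by (rule order_trans[OF O.expectation_lipschitz[OF \<theta>] mult_right_mono]) (rule sum_nonneg, simp)
qed

text \<open>Covariance as mixed moment minus product of means: Lipschitz bounds and derivatives in
  the parameters are available for each of these expectations separately.\<close>

definition cov where "cov I \<theta> n m = (\<integral>\<eta>. shift n g \<eta> * shift m g \<eta> \<partial>nu_prod I \<theta>)
  - (\<integral>\<eta>. shift n g \<eta> \<partial>nu_prod I \<theta>) * (\<integral>\<eta>. shift m g \<eta> \<partial>nu_prod I \<theta>)"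

lemma Cov_eq_cov:
  assumes I: "win n \<subseteq> I" "win m \<subseteq> I" and \<theta>: "\<theta> \<in> I \<rightarrow> {0..b}"
  shows "Cov (nu_prod I \<theta>) (shift n g) (shift m g) = cov I \<theta> n m"
proof -
  interpret P: prob_space "nu_prod I \<theta>" by simp
  note i = integrable_shift[OF I(1) \<theta>] integrable_shift[OF I(2) \<theta>] integrable_shift_mult[OF I \<theta>]
  define x y where "x = (\<integral>\<eta>. shift n g \<eta> \<partial>nu_prod I \<theta>)" and "y = (\<integral>\<eta>. shift m g \<eta> \<partial>nu_prod I \<theta>)"
  have "Cov (nu_prod I \<theta>) (shift n g) (shift m g) =
      (\<integral>\<eta>. shift n g \<eta> * shift m g \<eta> - y * shift n g \<eta> - x * shift m g \<eta> + x * y \<partial>nu_prod I \<theta>)"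
    unfolding Cov_def x_def y_def by (intro Bochner_Integration.integral_cong) (auto simp: algebra_simps)
  also have "\<dots> = cov I \<theta> n m"
    using i by (simp add: cov_def P.prob_space flip: x_def y_def)
  finally show ?thesis .
qed

lemma expectation_shift_lipschitz:
  assumes I: "win n \<subseteq> I" and \<theta>: "\<theta> \<in> I \<rightarrow> {0..b}" "\<theta>' \<in> I \<rightarrow> {0..b}"
  shows "\<bar>(\<integral>\<eta>. shift n g \<eta> \<partial>nu_prod I \<theta>) - (\<integral>\<eta>. shift n g \<eta> \<partial>nu_prod I \<theta>')\<bar>
    \<le> lip0 * (\<Sum>i\<in>win n. \<bar>\<theta> i - \<theta>' i\<bar>)"
  unfolding integral_nu_prod_restrict[OF shift_depends I]
  by (rule obs_lipschitz[OF shift_obs _ shift_square_le]) (use I \<theta> card_win in auto)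

lemma expectation_shift_mult_lipschitz:
  assumes I: "win n \<subseteq> I" "win m \<subseteq> I" and \<theta>: "\<theta> \<in> I \<rightarrow> {0..b}" "\<theta>' \<in> I \<rightarrow> {0..b}"
  shows "\<bar>(\<integral>\<eta>. shift n g \<eta> * shift m g \<eta> \<partial>nu_prod I \<theta>) - (\<integral>\<eta>. shift n g \<eta> * shift m g \<eta> \<partial>nu_prod I \<theta>')\<bar>
    \<le> lip0 * (\<Sum>i\<in>win n \<union> win m. \<bar>\<theta> i - \<theta>' i\<bar>)"
proof -
  have sub: "win n \<union> win m \<subseteq> I" using I by auto
  have "card (win n \<union> win m) \<le> 2 * k" using card_Un_le[of "win n" "win m"] by (simp add: card_win)
  then show ?thesis
    unfolding integral_nu_prod_restrict[OF shift_mult_depends sub]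
    by (rule obs_lipschitz[OF shift_mult_obs _ shift_mult_square_le]) (use sub \<theta> in auto)
qed

text \<open>One \<open>lip0\<close> stems from the mixed moment; \<open>2 + 2 * M4\<close> stems
  from the product of two means, each at most \<open>1 + M4\<close> in modulus.\<close>

definition lip where "lip = lip0 * (3 + 2 * M4)"

lemma lip0_nonneg: "0 \<le> lip0"
  unfolding lip0_def using b0 lratio_const_nonneg[OF b0] G4_nonneg
  by (intro mult_nonneg_nonneg add_nonneg_nonneg) (auto simp: G.weight_moment_def)

lemma lip_nonneg: "0 \<le> lip"
  using lip0_nonneg M4_nonneg by (simp add: lip_def)

lemma cov_lipschitz:
  assumes I: "win n \<subseteq> I" "win m \<subseteq> I" and \<theta>: "\<theta> \<in> I \<rightarrow> {0..b}" "\<theta>' \<in> I \<rightarrow> {0..b}"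
  shows "\<bar>cov I \<theta> n m - cov I \<theta>' n m\<bar> \<le> lip * (\<Sum>i\<in>win n \<union> win m. \<bar>\<theta> i - \<theta>' i\<bar>)"
proof -
  define s where "s = (\<Sum>i\<in>win n \<union> win m. \<bar>\<theta> i - \<theta>' i\<bar>)"
  define e where "e \<theta> n = (\<integral>\<eta>. shift n g \<eta> \<partial>nu_prod I \<theta>)" for \<theta> n
  have s0: "0 \<le> lip0 * s" unfolding s_def by (intro mult_nonneg_nonneg lip0_nonneg sum_nonneg) simp
  have sub: "lip0 * (\<Sum>i\<in>win j. \<bar>\<theta> i - \<theta>' i\<bar>) \<le> lip0 * s" if "j = n \<or> j = m" for j
    unfolding s_def using that finite_win by (intro mult_left_mono[OF _ lip0_nonneg] sum_mono2) auto
  have dn: "\<bar>e \<theta> n - e \<theta>' n\<bar> \<le> lip0 * s" "\<bar>e \<theta> m - e \<theta>' m\<bar> \<le> lip0 * s"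
    unfolding e_def
    by (rule order_trans[OF expectation_shift_lipschitz[OF I(1) \<theta>] sub], simp)
       (rule order_trans[OF expectation_shift_lipschitz[OF I(2) \<theta>] sub], simp)
  have bd: "\<bar>e \<theta> m\<bar> \<le> 1 + M4" "\<bar>e \<theta>' n\<bar> \<le> 1 + M4"
    unfolding e_def using I \<theta> by (auto intro!: abs_expectation_shift_le)
  have "e \<theta> n * e \<theta> m - e \<theta>' n * e \<theta>' m = (e \<theta> n - e \<theta>' n) * e \<theta> m + e \<theta>' n * (e \<theta> m - e \<theta>' m)"
    by (simp add: algebra_simps)
  moreover have "\<bar>(e \<theta> n - e \<theta>' n) * e \<theta> m\<bar> \<le> lip0 * s * (1 + M4)"
    unfolding abs_mult by (rule mult_mono[OF dn(1) bd(1) s0 abs_ge_zero])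
  moreover have "\<bar>e \<theta>' n * (e \<theta> m - e \<theta>' m)\<bar> \<le> (1 + M4) * (lip0 * s)"
    unfolding abs_mult using M4_nonneg by (intro mult_mono[OF bd(2) dn(2) _ abs_ge_zero]) simp
  ultimately have "\<bar>e \<theta> n * e \<theta> m - e \<theta>' n * e \<theta>' m\<bar> \<le> lip0 * s * (1 + M4) + (1 + M4) * (lip0 * s)"
    by linarith
  also have "\<dots> = lip0 * s * (2 + 2 * M4)" by (simp add: algebra_simps)
  finally have "\<bar>e \<theta> n * e \<theta> m - e \<theta>' n * e \<theta>' m\<bar> \<le> lip0 * s * (2 + 2 * M4)" .
  moreover have "\<bar>(\<integral>\<eta>. shift n g \<eta> * shift m g \<eta> \<partial>nu_prod I \<theta>) - (\<integral>\<eta>. shift n g \<eta> * shift m g \<eta> \<partial>nu_prod I \<theta>')\<bar> \<le> lip0 * s"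
    unfolding s_def by (rule expectation_shift_mult_lipschitz[OF I \<theta>])
  ultimately have "\<bar>cov I \<theta> n m - cov I \<theta>' n m\<bar> \<le> lip0 * s + lip0 * s * (2 + 2 * M4)"
    unfolding cov_def e_def[symmetric] by linarith
  then show ?thesis by (simp add: lip_def s_def algebra_simps)
qed

definition cov_bound where "cov_bound = (2 + 2 * M4) + (1 + M4) * (1 + M4)"

lemma cov_bound_nonneg: "0 \<le> cov_bound"
  using M4_nonneg by (simp add: cov_bound_def)

lemma abs_cov_le:
  assumes I: "win n \<subseteq> I" "win m \<subseteq> I" and \<theta>: "\<theta> \<in> I \<rightarrow> {0..b}"
  shows "\<bar>cov I \<theta> n m\<bar> \<le> cov_bound"
proof -
  have "\<bar>(\<integral>\<eta>. shift n g \<eta> \<partial>nu_prod I \<theta>) * (\<integral>\<eta>. shift m g \<eta> \<partial>nu_prod I \<theta>)\<bar> \<le> (1 + M4) * (1 + M4)"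
    unfolding abs_mult using I \<theta> M4_nonneg by (intro mult_mono abs_expectation_shift_le) auto
  with abs_expectation_shift_mult_le[OF I \<theta>] show ?thesis
    unfolding cov_def cov_bound_def by linarith
qed

lemma cov_const_cong:
  assumes "win n \<subseteq> I" "win m \<subseteq> I" "win n \<subseteq> I'" "win m \<subseteq> I'"
  shows "cov I \<theta> n m = cov I' \<theta> n m"
proof -
  have sub: "win n \<union> win m \<subseteq> I" "win n \<union> win m \<subseteq> I'" using assms by auto
  show ?thesis
    unfolding cov_def integral_nu_prod_restrict[OF shift_mult_depends sub(1)]
      integral_nu_prod_restrict[OF shift_mult_depends sub(2)]
      integral_nu_prod_restrict[OF shift_depends assms(1)] integral_nu_prod_restrict[OF shift_depends assms(2)]
      integral_nu_prod_restrict[OF shift_depends assms(3)] integral_nu_prod_restrict[OF shift_depends assms(4)] ..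
qed

lemma win_subset: "win n \<subseteq> {1..}" "n + k \<le> N \<Longrightarrow> win n \<subseteq> {1..N}"
  by (auto simp: win_def)

text \<open>With a constant parameter the coordinates are identically distributed, and the
  translated coordinates have the same joint law.\<close>

lemma cov_translate: "cov {1..} (\<lambda>_. x) (n + d) (m + d) = cov {1..} (\<lambda>_. x) n m"
proof -
  have f: "inj_on (\<lambda>i. i + d) {1..}" "(\<lambda>i. i + d) \<in> {1..} \<rightarrow> {1..}" by auto
  have eq: "shift (n + d) g \<eta> = shift n g (\<lambda>i\<in>{1..}. \<eta> (i + d))" for n \<eta>
    unfolding shift_reindex by (rule arg_cong[of _ _ g]) (auto simp: fun_eq_iff ac_simps)
  have m: "shift n g \<in> borel_measurable (conf {1..})" for n by (rule shift_measurable[OF win_subset(1)])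
  have mm: "(\<lambda>\<eta>. shift n g \<eta> * shift m g \<eta>) \<in> borel_measurable (conf {1..})" using m by simp
  show ?thesis
    unfolding cov_def eq using integral_nu_prod_reindex[OF f m, of "\<lambda>_. x"] integral_nu_prod_reindex[OF f mm, of "\<lambda>_. x"]
    by simp
qed

lemma V_fun_eq:
  assumes "x \<in> {0..b}"
  shows "V_fun k g x = (\<Sum>m = 1..2 * k - 1. cov {1..} (\<lambda>_. x) (k - 1) (m - 1))"
  unfolding V_fun_def using assms by (intro sum.cong refl Cov_eq_cov win_subset) auto

lemma abs_V_fun_le:
  assumes "x \<in> {0..b}"
  shows "\<bar>V_fun k g x\<bar> \<le> 2 * k * cov_bound"
proof -
  have "\<bar>V_fun k g x\<bar> \<le> (\<Sum>m = 1..2 * k - 1. \<bar>cov {1..} (\<lambda>_. x) (k - 1) (m - 1)\<bar>)"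
    unfolding V_fun_eq[OF assms] by (rule sum_abs)
  also have "\<dots> \<le> (\<Sum>m = 1..2 * k - 1. cov_bound)"
    using assms by (intro sum_mono abs_cov_le win_subset) auto
  also have "\<dots> = real (2 * k - 1) * cov_bound" by simp
  also have "\<dots> \<le> real (2 * k) * cov_bound" using cov_bound_nonneg by (intro mult_right_mono) auto
  finally show ?thesis by simp
qed

text \<open>Away from both ends of the configuration an index has all its \<open>2 * k - 1\<close>
  neighbours, and translating them to the reference window gives the sum that defines
  \<open>V\<close>.\<close>

lemma near_cov_sum_eq_V_fun:
  assumes n: "k \<le> n + 1" "n + 2 * k \<le> N + 1" and x: "x \<in> {0..b}"
  shows "(\<Sum>m\<in>{m\<in>{0..N - k}. n < m + k \<and> m < n + k}. cov {1..} (\<lambda>_. x) n m) = V_fun k g x"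
proof -
  have "(\<Sum>m\<in>{m\<in>{0..N - k}. n < m + k \<and> m < n + k}. cov {1..} (\<lambda>_. x) n m) =
      (\<Sum>m = 1..2 * k - 1. cov {1..} (\<lambda>_. x) (k - 1) (m - 1))"
  \<comment> \<open>The translation by \<open>n + 1 - k\<close> carries the pair
    \<open>k - 1\<close>, \<open>j - 1\<close> to \<open>n\<close>, \<open>m\<close>; the label
    \<open>j\<close> counts from 1 whereas shifts count from 0.\<close>
  proof (rule sum.reindex_bij_witness[of _ "\<lambda>j. n + j - k" "\<lambda>m. m + k - n"])
    fix j assume "j \<in> {1..2 * k - 1}"
    then have j: "1 \<le> j" "j + 1 \<le> 2 * k" by auto
    show "n + j - k + k - n = j" using n j by simp
    show "n + j - k \<in> {m\<in>{0..N - k}. n < m + k \<and> m < n + k}" using n j by auto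
  next
    fix m assume m: "m \<in> {m\<in>{0..N - k}. n < m + k \<and> m < n + k}"
    show "n + (m + k - n) - k = m" using m by auto
    show "m + k - n \<in> {1..2 * k - 1}" using m by auto
  next
    fix m assume m: "m \<in> {m\<in>{0..N - k}. n < m + k \<and> m < n + k}"
    have "cov {1..} (\<lambda>_. x) ((k - 1) + (n + 1 - k)) ((m + k - n - 1) + (n + 1 - k)) =
        cov {1..} (\<lambda>_. x) (k - 1) (m + k - n - 1)"
      by (rule cov_translate)
    moreover have "(k - 1) + (n + 1 - k) = n" "(m + k - n - 1) + (n + 1 - k) = m"
      using m n k by auto
    ultimately show "cov {1..} (\<lambda>_. x) (k - 1) (m + k - n - 1) = cov {1..} (\<lambda>_. x) n m" by simp
  qed
  then show ?thesis by (simp only: V_fun_eq[OF x])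
qed

lemma h_fun_eq:
  assumes "win n \<subseteq> I"
  shows "(\<integral>\<eta>. shift n g \<eta> \<partial>nu_prod I (\<lambda>_. x)) = h_fun g x"
proof -
  have "shift 0 g = g" by (simp add: shift_def fun_eq_iff)
  then show ?thesis
    using expectation_shift(1)[of "\<lambda>x. x" n I "\<lambda>_. x"] expectation_shift(1)[of "\<lambda>x. x" 0 "{1..}" "\<lambda>_. x"]
      assms win_subset(1)[of 0]
    by (simp add: h_fun_def)
qed

lemma h_fun_C1:
  obtains D where "continuous_on {a..b} D"
    "\<And>x. x \<in> {a..b} \<Longrightarrow> (h_fun g has_real_derivative D x) (at x within {a..b})"
proof -
  obtain D where D: "continuous_on {0..b} D"
    "\<And>x. x \<in> {0..b} \<Longrightarrow> ((\<lambda>x. \<integral>\<eta>. g \<eta> \<partial>nu_prod {1..k} (\<lambda>_. x)) has_real_derivative D x) (at x within {0..b})"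
    using G.expectation_has_continuous_derivative by blast
  have "(\<lambda>x. \<integral>\<eta>. g \<eta> \<partial>nu_prod {1..k} (\<lambda>_. x)) = h_fun g"
    using h_fun_eq[of 0 "{1..k}"] win_subset(2)[of 0 k] by (simp add: shift_def fun_eq_iff)
  then have D': "x \<in> {0..b} \<Longrightarrow> (h_fun g has_real_derivative D x) (at x within {0..b})" for x
    using D(2)[of x] by simp
  have sub: "{a..b} \<subseteq> {0..b}" using a0 by auto
  show ?thesis
  proof (rule that)
    show "continuous_on {a..b} D" using D(1) sub by (rule continuous_on_subset)
    show "(h_fun g has_real_derivative D x) (at x within {a..b})" if "x \<in> {a..b}" for x
      using sub that by (intro DERIV_subset[OF D' sub]) auto
  qed
qed

lemma abs_h_fun_le: "x \<in> {0..b} \<Longrightarrow> \<bar>h_fun g x\<bar> \<le> 1 + M4"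
  using abs_expectation_shift_le[of 0 "{1..k}" "\<lambda>_. x"] win_subset(2)[of 0 k] by (simp add: h_fun_eq)

text \<open>On \<open>{a..b}\<close> the function is a finite sum of expectations of products minus
  the square of \<open>h_fun g\<close>. Each product is a square integrable observable on the union
  of two windows, to which the general differentiability result applies.\<close>

lemma V_fun_C1:
  obtains D where "continuous_on {a..b} D"
    "\<And>x. x \<in> {a..b} \<Longrightarrow> (V_fun k g has_real_derivative D x) (at x within {a..b})"
proof -
  obtain D1 where D1: "continuous_on {a..b} D1"
    "\<And>x. x \<in> {a..b} \<Longrightarrow> (h_fun g has_real_derivative D1 x) (at x within {a..b})"
    using h_fun_C1 by blast
  have "\<exists>D. continuous_on {a..b} D \<and> (\<forall>x\<in>{a..b}.
      ((\<lambda>x. \<integral>\<eta>. shift (k - 1) g \<eta> * shift (m - 1) g \<eta> \<partial>nu_prod (win (k - 1) \<union> win (m - 1)) (\<lambda>_. x))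
        has_real_derivative D x) (at x within {a..b}))" for m
  proof -
    interpret O: square_integrable_obs b "win (k - 1) \<union> win (m - 1)" "\<lambda>\<eta>. shift (k - 1) g \<eta> * shift (m - 1) g \<eta>"
      by (rule shift_mult_obs)
    obtain D where D: "continuous_on {0..b} D"
      "\<And>x. x \<in> {0..b} \<Longrightarrow> ((\<lambda>x. \<integral>\<eta>. shift (k - 1) g \<eta> * shift (m - 1) g \<eta> \<partial>nu_prod (win (k - 1) \<union> win (m - 1)) (\<lambda>_. x))
        has_real_derivative D x) (at x within {0..b})"
      using O.expectation_has_continuous_derivative by blast
    have sub: "{a..b} \<subseteq> {0..b}" using a0 by auto
    show ?thesis
    proof (intro exI[of _ D] conjI ballI)
      show "continuous_on {a..b} D" using D(1) sub by (rule continuous_on_subset)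
      show "((\<lambda>x. \<integral>\<eta>. shift (k - 1) g \<eta> * shift (m - 1) g \<eta> \<partial>nu_prod (win (k - 1) \<union> win (m - 1)) (\<lambda>_. x))
          has_real_derivative D x) (at x within {a..b})" if "x \<in> {a..b}" for x
        using sub that by (intro DERIV_subset[OF D(2) sub]) auto
    qed
  qed
  from choice[OF allI[OF this]] obtain D2 where D2': "\<forall>m. continuous_on {a..b} (D2 m) \<and> (\<forall>x\<in>{a..b}.
      ((\<lambda>x. \<integral>\<eta>. shift (k - 1) g \<eta> * shift (m - 1) g \<eta> \<partial>nu_prod (win (k - 1) \<union> win (m - 1)) (\<lambda>_. x))
        has_real_derivative D2 m x) (at x within {a..b}))" ..
  have D2: "continuous_on {a..b} (D2 m)"
    "x \<in> {a..b} \<Longrightarrow>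
      ((\<lambda>x. \<integral>\<eta>. shift (k - 1) g \<eta> * shift (m - 1) g \<eta> \<partial>nu_prod (win (k - 1) \<union> win (m - 1)) (\<lambda>_. x))
        has_real_derivative D2 m x) (at x within {a..b})" for m x
    using D2'[rule_format, of m] by simp_all
  have eq: "V_fun k g x = (\<Sum>m = 1..2 * k - 1.
      (\<integral>\<eta>. shift (k - 1) g \<eta> * shift (m - 1) g \<eta> \<partial>nu_prod (win (k - 1) \<union> win (m - 1)) (\<lambda>_. x)) - h_fun g x * h_fun g x)"
    if "x \<in> {a..b}" for x
  proof -
    have sub: "win (k - 1) \<union> win (m - 1) \<subseteq> {1..}" for m using win_subset(1) by auto
    have "x \<in> {0..b}" using that a0 by auto
    then show ?thesis
      by (simp only: V_fun_eq cov_def h_fun_eq[OF win_subset(1)] integral_nu_prod_restrict[OF shift_mult_depends sub])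
  qed
  have "((\<lambda>x. \<Sum>m = 1..2 * k - 1.
      (\<integral>\<eta>. shift (k - 1) g \<eta> * shift (m - 1) g \<eta> \<partial>nu_prod (win (k - 1) \<union> win (m - 1)) (\<lambda>_. x)) - h_fun g x * h_fun g x)
      has_real_derivative (\<Sum>m = 1..2 * k - 1. D2 m x - (D1 x * h_fun g x + D1 x * h_fun g x))) (at x within {a..b})"
    if x: "x \<in> {a..b}" for x
    by (intro DERIV_sum DERIV_diff D2(2)[OF x] DERIV_mult D1(2)[OF x])
  then have "(V_fun k g has_real_derivative (\<Sum>m = 1..2 * k - 1. D2 m x - (D1 x * h_fun g x + D1 x * h_fun g x))) (at x within {a..b})"
    if x: "x \<in> {a..b}" for x
    using x eq by (subst has_field_derivative_cong_eventually) (auto simp: eventually_at_filter)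
  moreover have "continuous_on {a..b} (\<lambda>x. \<Sum>m = 1..2 * k - 1. D2 m x - (D1 x * h_fun g x + D1 x * h_fun g x))"
    by (intro continuous_intros D2(1) D1(1) DERIV_continuous_on[OF D1(2)])
  ultimately show ?thesis by (intro that)
qed

end

text \<open>The raw fourth moment is recovered from one centred at any constant \<open>c\<close>, by
  writing \<open>g\<close> as \<open>(g - c) - (- c)\<close>. Measurability of \<open>g\<close> is
  extracted from its integrability.\<close>

lemma local_obsI:
  assumes "0 \<le> a" "a < b" "1 \<le> k" "local_function k g"
    and int: "integrable (nu_prod {1..k} (\<lambda>_. b)) g"
    and int4: "integrable (nu_prod {1..k} (\<lambda>_. b)) (\<lambda>\<eta>. (g \<eta> - c) ^ 4)"
  shows "local_obs a b k g"
proof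
  have m: "g \<in> borel_measurable (conf {1..k})"
    using borel_measurable_integrable[OF int] by simp
  then show "g \<in> borel_measurable (conf {1..k})" .
  interpret prob_space "nu_prod {1..k} (\<lambda>_. b)" by simp
  show "integrable (nu_prod {1..k} (\<lambda>_. b)) (\<lambda>\<eta>. g \<eta> ^ 4)"
  proof (rule Bochner_Integration.integrable_bound)
    show "integrable (nu_prod {1..k} (\<lambda>_. b)) (\<lambda>\<eta>. 8 * ((g \<eta> - c) ^ 4 + (- c) ^ 4))"
      by (intro integrable_mult_right Bochner_Integration.integrable_add int4 integrable_const)
    show "AE \<eta> in nu_prod {1..k} (\<lambda>_. b). norm (g \<eta> ^ 4) \<le> norm (8 * ((g \<eta> - c) ^ 4 + (- c) ^ 4))"
      using diff_pow4_le[of "g _ - c" "- c"] by (intro AE_I2) simp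
  qed (use m in simp)
qed (use assms in auto)

section \<open>Replacing neighbouring parameters by a common one\<close>

text \<open>Raising \<open>d\<close> by one adds the increments from \<open>n + d\<close> to
  \<open>n + d + 1\<close>, which telescope over \<open>n\<close> to a single difference inside
  \<open>{a..b}\<close>.\<close>

lemma sum_increments_le:
  fixes F :: "nat \<Rightarrow> real"
  assumes "\<And>n. F n \<in> {a..b}"
  shows "(\<Sum>n<N. F (n + d) - F n) \<le> d * (b - a)"
proof (induction d)
  case (Suc d)
  have "(\<Sum>n<N. F (n + Suc d) - F n) = (\<Sum>n<N. F (n + d) - F n) + (\<Sum>n<N. F (Suc n + d) - F (n + d))"
    by (simp flip: sum.distrib)
  also have "(\<Sum>n<N. F (Suc n + d) - F (n + d)) = F (N + d) - F d"
    by (subst sum_lessThan_telescope[of "\<lambda>n. F (n + d)"]) simp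
  also have "\<dots> \<le> b - a" using assms[of "N + d"] assms[of d] by auto
  finally show ?case using Suc by (simp add: algebra_simps)
qed simp

locale sorted_params =
  fixes a b :: real and N k :: nat and \<theta> :: "nat \<Rightarrow> real"
  assumes N: "1 \<le> N" and k1: "1 \<le> k"
    and mono: "\<And>i j. 1 \<le> i \<Longrightarrow> i \<le> j \<Longrightarrow> j \<le> N \<Longrightarrow> \<theta> i \<le> \<theta> j"
    and range: "\<theta> \<in> {1..N} \<rightarrow> {a..b}"
begin

text \<open>\<open>spread n\<close> bounds the oscillation of \<open>\<theta>\<close> near \<open>n\<close>. As \<open>\<theta>\<close> is monotone, these oscillations sum to
  a constant multiple of \<open>b - a\<close>, independent of \<open>N\<close>. Clamping the index avoids boundary cases.\<close>

definition clamp where "clamp i = \<theta> (max 1 (min i N))"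

definition spread where "spread n = clamp (n + 3 * k + 2 - k) - clamp (n + 2 - k)"

lemma clamp_mono: "i \<le> j \<Longrightarrow> clamp i \<le> clamp j"
  unfolding clamp_def using N by (intro mono) auto

lemma clamp_eq: "i \<in> {1..N} \<Longrightarrow> clamp i = \<theta> i"
  by (simp add: clamp_def max_absorb2 min_absorb1)

lemma clamp_range: "clamp i \<in> {a..b}"
  using range N by (auto simp: clamp_def Pi_iff)

lemma spread_nonneg: "0 \<le> spread n"
  unfolding spread_def using clamp_mono[of "n + 2 - k" "n + 3 * k + 2 - k"] by simp

text \<open>The index range covers the window of \<open>n\<close> and those of all its neighbours: a
  neighbour is at least \<open>n - k + 1\<close>, so its window starts no earlier than
  \<open>n - k + 2\<close>, and at most \<open>n + k - 1\<close>, so its window ends no later than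
  \<open>n + 2 * k - 1\<close>.\<close>

lemma window_le:
  assumes "n < N" "i \<in> {1..N}" "n + 2 \<le> i + k" "i \<le> n + 2 * k"
  shows "\<bar>\<theta> i - \<theta> (n + 1)\<bar> \<le> spread n"
proof -
  have "clamp (n + 2 - k) \<le> clamp j \<and> clamp j \<le> clamp (n + 3 * k + 2 - k)" if "j = i \<or> j = n + 1" for j
    using that assms k1 by (intro conjI clamp_mono) auto
  then have "clamp (n + 2 - k) \<le> clamp i" "clamp i \<le> clamp (n + 3 * k + 2 - k)"
    "clamp (n + 2 - k) \<le> clamp (n + 1)" "clamp (n + 1) \<le> clamp (n + 3 * k + 2 - k)" by auto
  moreover have "clamp i = \<theta> i" "clamp (n + 1) = \<theta> (n + 1)"
    using assms by (auto intro!: clamp_eq)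
  ultimately show ?thesis unfolding spread_def by auto
qed

lemma sum_spread_le: "(\<Sum>n<N. spread n) \<le> 3 * k * (b - a)"
proof -
  have "(\<Sum>n<N. spread n) = (\<Sum>n<N. clamp (n + 3 * k + 2 - k) - clamp (n + 2 - k))"
    by (simp add: spread_def)
  also have "\<dots> \<le> real (3 * k) * (b - a)"
    \<comment> \<open>Both arguments belong to the one sequence \<open>clamp (n + 2 - k)\<close>,
      displaced by \<open>3 * k\<close>. This is why \<open>spread\<close> has the unsimplified
      index \<open>n + 3 * k + 2 - k\<close>.\<close>
    by (rule sum_increments_le[of "\<lambda>n. clamp (n + 2 - k)"]) (rule clamp_range)
  finally show ?thesis by simp
qed

text \<open>Per index there are three kinds of error: the oscillation of the parameters, a
  contribution of order \<open>1 / N\<close> from the weights, and a contribution of order one at a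
  bounded number of boundary indices. Each kind adds up to a constant independent of
  \<open>N\<close>.\<close>

lemma sum_error_le:
  fixes x :: "nat \<Rightarrow> real"
  assumes le: "\<And>n. n < N \<Longrightarrow> \<bar>x n\<bar> \<le> A * spread n + B / N + (if P n then D else 0)"
    and nn: "0 \<le> A" "0 \<le> D" and card: "card {n. n < N \<and> P n} \<le> c"
  shows "\<bar>\<Sum>n<N. x n\<bar> \<le> A * (3 * k * (b - a)) + B + c * D"
proof -
  have "\<bar>\<Sum>n<N. x n\<bar> \<le> (\<Sum>n<N. \<bar>x n\<bar>)" by (rule sum_abs)
  also have "\<dots> \<le> (\<Sum>n<N. A * spread n + B / N + (if P n then D else 0))"
    using le by (intro sum_mono) auto
  also have "\<dots> = A * (\<Sum>n<N. spread n) + B + card {n. n < N \<and> P n} * D"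
  proof -
    have "(\<Sum>n<N. if P n then D else 0) = card {n. n < N \<and> P n} * D"
      by (simp add: sum.If_cases Int_def)
    moreover have "(\<Sum>n<N. B / N) = B" using N by simp
    ultimately show ?thesis by (simp add: sum.distrib sum_distrib_left)
  qed
  also have "\<dots> \<le> A * (3 * k * (b - a)) + B + c * D"
  proof -
    have "A * (\<Sum>n<N. spread n) \<le> A * (3 * k * (b - a))"
      by (rule mult_left_mono[OF sum_spread_le nn(1)])
    moreover have "card {n. n < N \<and> P n} * D \<le> c * D"
      using card nn by (intro mult_right_mono) auto
    ultimately show ?thesis by linarith
  qed
  finally show ?thesis .
qed

end

lemma sorted_params_order_stats:
  assumes "1 \<le> N" "1 \<le> k" "u \<in> {1..N} \<rightarrow> {a..b}"
  shows "sorted_params a b N k (order_stats N u)"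
  by standard (use assms order_stats_mono order_stats_in[OF assms(3)] in auto)

text \<open>The weights \<open>w N n\<close> stand for \<open>\<phi> (n / (N + 1))\<close> or \<open>\<phi> ((n + 1) / (N + 1))\<close>; the point
  \<open>(n + 1) / N\<close> is the one that occurs in the L-statistic.\<close>

locale weighted_obs = local_obs +
  fixes \<phi> \<phi>' :: "real \<Rightarrow> real" and w :: "nat \<Rightarrow> nat \<Rightarrow> real" and L W Cw :: real
  assumes \<phi>: "\<And>s. s \<in> {0..1} \<Longrightarrow> (\<phi> has_real_derivative \<phi>' s) (at s within {0..1})"
    and \<phi>'_le: "\<And>s. s \<in> {0..1} \<Longrightarrow> \<bar>\<phi>' s\<bar> \<le> L"
    and \<phi>_le: "\<And>s. s \<in> {0..1} \<Longrightarrow> \<bar>\<phi> s\<bar> \<le> W"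
    and w_le: "\<And>N n. n + k \<le> N \<Longrightarrow> \<bar>w N n\<bar> \<le> W"
    and w_close: "\<And>N n. n + k \<le> N \<Longrightarrow> \<bar>w N n - \<phi> (real (n + 1) / N)\<bar> \<le> Cw / N"
    and Cw: "0 \<le> Cw"
begin

lemma W0: "0 \<le> W" and L0: "0 \<le> L"
  using \<phi>_le[of 0] \<phi>'_le[of 0] by auto

lemma \<phi>_lipschitz:
  assumes "x \<in> {0..1}" "y \<in> {0..1}"
  shows "\<bar>\<phi> x - \<phi> y\<bar> \<le> L * \<bar>x - y\<bar>"
  using field_differentiable_bound[OF convex_real_interval(5) \<phi>, of L x y] assms \<phi>'_le by auto

text \<open>The summands account for unequal parameters within a window, for the mismatch of the
  weights, and for the indices near the right end at which no window fits.\<close>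

definition drift_const where
  "drift_const = W * (lip0 * k) * (3 * k * (b - a)) + Cw * (1 + M4) + k * (W * (1 + M4))"

lemma in_range_0b: "\<theta> \<in> I \<rightarrow> {a..b} \<Longrightarrow> \<theta> \<in> I \<rightarrow> {0..b}"
  using a0 by (fastforce simp: Pi_iff)

text \<open>If all parameters in window \<open>n\<close> are replaced by
  \<open>\<theta> (n + 1)\<close>, the expectation becomes
  \<open>h_fun g (\<theta> (n + 1))\<close>. Windows count from 0 and parameters from 1, hence the
  index \<open>n + 1\<close>.\<close>

lemma drift_error:
  assumes N: "k \<le> N" and S: "sorted_params a b N k \<theta>"
  shows "\<bar>(\<Sum>n = 0..N - k. w N n * (\<integral>\<eta>. shift n g \<eta> \<partial>nu_prod {1..N} \<theta>))
      - (\<Sum>i\<in>{1..N}. \<phi> (real i / N) * h_fun g (\<theta> i))\<bar> \<le> drift_const"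
proof -
  interpret S: sorted_params a b N k \<theta> by fact
  define e where "e n = (\<integral>\<eta>. shift n g \<eta> \<partial>nu_prod {1..N} \<theta>)" for n
  have \<theta>: "\<theta> \<in> {1..N} \<rightarrow> {0..b}" by (rule in_range_0b[OF S.range])
  have \<theta>n: "\<theta> (n + 1) \<in> {0..b}" if "n < N" for n
    using \<theta> that by (auto simp: Pi_iff)
  define x where "x n = (if n \<le> N - k then w N n * e n else 0) - \<phi> (real (n + 1) / N) * h_fun g (\<theta> (n + 1))" for n
  have s1: "(\<Sum>n = 0..N - k. w N n * e n) = (\<Sum>n<N. if n \<le> N - k then w N n * e n else 0)"
    using N k by (intro sum.mono_neutral_cong_left) auto
  have s2: "(\<Sum>i\<in>{1..N}. \<phi> (real i / N) * h_fun g (\<theta> i)) = (\<Sum>n<N. \<phi> (real (n + 1) / N) * h_fun g (\<theta> (n + 1)))"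
    by (rule sum.reindex_bij_witness[of _ "\<lambda>n. n + 1" "\<lambda>i. i - 1"]) auto
  have "\<bar>\<Sum>n<N. x n\<bar> \<le> W * (lip0 * k) * (3 * k * (b - a)) + Cw * (1 + M4) + real k * (W * (1 + M4))"
  proof (rule S.sum_error_le)
    show "0 \<le> W * (lip0 * k)" "0 \<le> W * (1 + M4)" using W0 lip0_nonneg M4_nonneg by simp_all
    \<comment> \<open>Indices that occur in the L-statistic but whose window would leave the
      configuration.\<close>
    have "{n. n < N \<and> \<not> n \<le> N - k} \<subseteq> {N - k + 1..<N}" by auto
    from card_mono[OF _ this] show "card {n. n < N \<and> \<not> n \<le> N - k} \<le> k" using N by simp
    fix n assume n: "n < N"
    have pt: "real (n + 1) / N \<in> {0..1}" using n by simp
    have hb: "\<bar>h_fun g (\<theta> (n + 1))\<bar> \<le> 1 + M4" by (rule abs_h_fun_le[OF \<theta>n[OF n]])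
    show "\<bar>x n\<bar> \<le> W * (lip0 * k) * S.spread n + Cw * (1 + M4) / N + (if \<not> n \<le> N - k then W * (1 + M4) else 0)"
    proof (cases "n \<le> N - k")
      case True
      then have nk: "n + k \<le> N" using N by simp
      have "e n - h_fun g (\<theta> (n + 1)) = e n - (\<integral>\<eta>. shift n g \<eta> \<partial>nu_prod {1..N} (\<lambda>_. \<theta> (n + 1)))"
        by (simp only: h_fun_eq[OF win_subset(2)[OF nk]])
      also have "\<bar>\<dots>\<bar> \<le> lip0 * (\<Sum>i\<in>win n. \<bar>\<theta> i - \<theta> (n + 1)\<bar>)"
        unfolding e_def by (rule expectation_shift_lipschitz[OF win_subset(2)[OF nk] \<theta>]) (use \<theta>n[OF n] in auto)
      also have "\<dots> \<le> lip0 * (\<Sum>i\<in>win n. S.spread n)"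
        using n nk k by (intro mult_left_mono sum_mono S.window_le lip0_nonneg) (auto simp: win_def)
      finally have d1: "\<bar>e n - h_fun g (\<theta> (n + 1))\<bar> \<le> lip0 * k * S.spread n"
        by (simp add: card_win)
      have "x n = w N n * (e n - h_fun g (\<theta> (n + 1))) + (w N n - \<phi> (real (n + 1) / N)) * h_fun g (\<theta> (n + 1))"
        using True by (simp add: x_def algebra_simps)
      moreover have "\<bar>w N n * (e n - h_fun g (\<theta> (n + 1)))\<bar> \<le> W * (lip0 * k * S.spread n)"
        unfolding abs_mult by (rule mult_mono[OF w_le[OF nk] d1 W0]) simp
      moreover have "\<bar>(w N n - \<phi> (real (n + 1) / N)) * h_fun g (\<theta> (n + 1))\<bar> \<le> Cw / N * (1 + M4)"
        unfolding abs_mult using Cw by (intro mult_mono[OF w_close[OF nk] hb]) auto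
      ultimately show ?thesis using True by (simp add: mult.assoc)
    next
      case False
      have "\<bar>x n\<bar> \<le> W * (1 + M4)"
        using False unfolding x_def by (simp add: abs_mult) (rule mult_mono[OF \<phi>_le[OF pt, simplified] hb[simplified] W0 abs_ge_zero])
      moreover have "0 \<le> W * (lip0 * k) * S.spread n" "0 \<le> Cw * (1 + M4) / N"
        using W0 lip0_nonneg S.spread_nonneg Cw M4_nonneg by simp_all
      ultimately show ?thesis using False by simp
    qed
  qed
  then show ?thesis
    unfolding e_def[symmetric] s1 s2 drift_const_def by (simp add: x_def sum_subtractf)
qed

text \<open>As in \<open>drift_const\<close>, each index now with at most \<open>2 * k\<close>
  neighbours and at most \<open>3 * k\<close> boundary indices, at which both compared terms are
  estimated crudely.\<close>

definition var_const where
  "var_const = (2 * k * (W * W * (lip * (2 * k)))) * (3 * k * (b - a))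
     + 2 * k * (W * (2 * Cw + L * k) * cov_bound) + (3 * k) * (2 * k * (2 * (W * W * cov_bound)))"

definition near where "near N n = {m\<in>{0..N - k}. n < m + k \<and> m < n + k}"

lemma card_near: "real (card (near N n)) \<le> 2 * k"
proof -
  have "near N n \<subseteq> {n + 1 - k..<n + k}" by (auto simp: near_def)
  from card_mono[OF _ this] have "card (near N n) \<le> 2 * k" by simp
  then show ?thesis by simp
qed

text \<open>At an interior index, freezing the parameters at \<open>\<theta> (n + 1)\<close> and
  both weights at the same point turns the sum over the neighbours into the squared weight times
  \<open>V_fun k g (\<theta> (n + 1))\<close>.\<close>

lemma variance_error:
  assumes N: "k \<le> N" and S: "sorted_params a b N k \<theta>"
  shows "\<bar>(\<Sum>n = 0..N - k. \<Sum>m\<in>near N n. w N n * w N m * cov {1..N} \<theta> n m)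
      - (\<Sum>i\<in>{1..N}. (\<phi> (real i / N))\<^sup>2 * V_fun k g (\<theta> i))\<bar> \<le> var_const"
proof -
  interpret S: sorted_params a b N k \<theta> by fact
  have N1: "0 < real N" using N k by simp
  have \<theta>: "\<theta> \<in> {1..N} \<rightarrow> {0..b}" by (rule in_range_0b[OF S.range])
  have \<theta>n: "\<theta> (n + 1) \<in> {0..b}" if "n < N" for n
    using \<theta> that by (auto simp: Pi_iff)
  define T where "T n = (\<Sum>m\<in>near N n. w N n * w N m * cov {1..N} \<theta> n m)" for n
  define p where "p n = \<phi> (real (n + 1) / N)" for n
  define x where "x n = (if n \<le> N - k then T n else 0) - (p n)\<^sup>2 * V_fun k g (\<theta> (n + 1))" for n
  define E where "E = W * (2 * Cw + L * k) / N * cov_bound"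
  have s1: "(\<Sum>n = 0..N - k. T n) = (\<Sum>n<N. if n \<le> N - k then T n else 0)"
    using N k by (intro sum.mono_neutral_cong_left) auto
  have s2: "(\<Sum>i\<in>{1..N}. (\<phi> (real i / N))\<^sup>2 * V_fun k g (\<theta> i)) = (\<Sum>n<N. (p n)\<^sup>2 * V_fun k g (\<theta> (n + 1)))"
    unfolding p_def by (rule sum.reindex_bij_witness[of _ "\<lambda>n. n + 1" "\<lambda>i. i - 1"]) auto
  have nearD: "m + k \<le> N" "n < m + k" "m < n + k" if "m \<in> near N n" for m n
    using that N by (auto simp: near_def)
  have p_le: "\<bar>p n\<bar> \<le> W" if "n < N" for n
    unfolding p_def using that by (intro \<phi>_le) simp
  have "\<bar>\<Sum>n<N. x n\<bar> \<le> (2 * k * (W * W * (lip * (2 * k)))) * (3 * k * (b - a))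
     + 2 * k * (W * (2 * Cw + L * k) * cov_bound) + real (3 * k) * (2 * k * (2 * (W * W * cov_bound)))"
  proof (rule S.sum_error_le)
    show "0 \<le> 2 * k * (W * W * (lip * (2 * k)))" "0 \<le> 2 * k * (2 * (W * W * cov_bound))"
      using W0 lip_nonneg cov_bound_nonneg by simp_all
    \<comment> \<open>The left edge needs \<open>k\<close> indices; the right edge needs
      \<open>2 * k\<close>, since the windows of all neighbours must fit there.\<close>
    have "{n. n < N \<and> \<not> (k \<le> n + 1 \<and> n + 2 * k \<le> N + 1)} \<subseteq> {0..<k} \<union> {N - 2 * k..<N}" by auto
    from card_mono[OF _ this] show "card {n. n < N \<and> \<not> (k \<le> n + 1 \<and> n + 2 * k \<le> N + 1)} \<le> 3 * k"
      using card_Un_le[of "{0..<k}" "{N - 2 * k..<N}"] by simp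
    fix n assume n: "n < N"
    have E0: "0 \<le> E" unfolding E_def using W0 Cw L0 cov_bound_nonneg by simp
    have sp0: "0 \<le> 2 * k * (W * W * (lip * (2 * k))) * S.spread n"
      using W0 lip_nonneg S.spread_nonneg by simp
    have E_eq: "2 * k * (W * (2 * Cw + L * k) * cov_bound) / N = 2 * k * E" by (simp add: E_def)
    show "\<bar>x n\<bar> \<le> 2 * k * (W * W * (lip * (2 * k))) * S.spread n
      + 2 * k * (W * (2 * Cw + L * k) * cov_bound) / N
      + (if \<not> (k \<le> n + 1 \<and> n + 2 * k \<le> N + 1) then 2 * k * (2 * (W * W * cov_bound)) else 0)"
    proof (cases "k \<le> n + 1 \<and> n + 2 * k \<le> N + 1")
      case True
      then have nk: "n + k \<le> N" using k by auto
      have wn: "\<bar>w N n - p n\<bar> \<le> Cw / N" unfolding p_def by (rule w_close[OF nk])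
      have summand: "\<bar>w N n * w N m * cov {1..N} \<theta> n m - (p n)\<^sup>2 * cov {1..} (\<lambda>_. \<theta> (n + 1)) n m\<bar>
          \<le> W * W * (lip * (2 * k) * S.spread n) + E" if m: "m \<in> near N n" for m
      proof -
        note mD = nearD[OF m]
        define \<gamma> where "\<gamma> = cov {1..} (\<lambda>_. \<theta> (n + 1)) n m"
        have \<gamma>: "\<gamma> = cov {1..N} (\<lambda>_. \<theta> (n + 1)) n m"
          unfolding \<gamma>_def by (rule cov_const_cong) (intro win_subset nk mD)+
        have \<gamma>_le: "\<bar>\<gamma>\<bar> \<le> cov_bound"
          unfolding \<gamma>_def by (rule abs_cov_le) (use win_subset(1) \<theta>n[OF n] in auto)
        have "\<bar>cov {1..N} \<theta> n m - \<gamma>\<bar> \<le> lip * (\<Sum>i\<in>win n \<union> win m. \<bar>\<theta> i - \<theta> (n + 1)\<bar>)"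
          unfolding \<gamma> by (rule cov_lipschitz[OF win_subset(2)[OF nk] win_subset(2)[OF mD(1)] \<theta>]) (use \<theta>n[OF n] in auto)
        also have "\<dots> \<le> lip * (\<Sum>i\<in>win n \<union> win m. S.spread n)"
          using n nk k mD by (intro mult_left_mono sum_mono S.window_le lip_nonneg) (auto simp: win_def)
        also have "\<dots> \<le> lip * (2 * k * S.spread n)"
        proof -
          have "card (win n \<union> win m) \<le> 2 * k" using card_Un_le[of "win n" "win m"] by (simp add: card_win)
          then have "real (card (win n \<union> win m)) * S.spread n \<le> real (2 * k) * S.spread n"
            using S.spread_nonneg by (intro mult_right_mono) auto
          then show ?thesis using lip_nonneg by (simp add: mult_left_mono)
        qed
        finally have d1: "\<bar>cov {1..N} \<theta> n m - \<gamma>\<bar> \<le> lip * (2 * k) * S.spread n" by simp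
        have d2: "\<bar>w N m - p n\<bar> \<le> Cw / N + L * k / N"
        proof -
          have "\<bar>w N m - p m\<bar> \<le> Cw / N" unfolding p_def by (rule w_close[OF mD(1)])
          moreover have "\<bar>p m - p n\<bar> \<le> L * \<bar>real (m + 1) / N - real (n + 1) / N\<bar>"
            unfolding p_def using n mD k by (intro \<phi>_lipschitz) auto
          moreover have "L * \<bar>real (m + 1) / N - real (n + 1) / N\<bar> \<le> L * (k / N)"
          proof (rule mult_left_mono[OF _ L0])
            have "\<bar>real (m + 1) - real (n + 1)\<bar> \<le> k" using mD by auto
            then have "\<bar>real (m + 1) - real (n + 1)\<bar> / N \<le> k / N" using N1 by (intro divide_right_mono) auto
            then show "\<bar>real (m + 1) / N - real (n + 1) / N\<bar> \<le> k / N"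
              using N1 by (simp add: abs_divide flip: diff_divide_distrib)
          qed
          ultimately show ?thesis by simp
        qed
        have "w N n * w N m * cov {1..N} \<theta> n m - (p n)\<^sup>2 * \<gamma> =
            w N n * w N m * (cov {1..N} \<theta> n m - \<gamma>) + (w N n * (w N m - p n) + p n * (w N n - p n)) * \<gamma>"
          by (simp add: algebra_simps power2_eq_square)
        moreover have "\<bar>w N n * w N m * (cov {1..N} \<theta> n m - \<gamma>)\<bar> \<le> W * W * (lip * (2 * k) * S.spread n)"
          unfolding abs_mult[of "w N n * w N m"] abs_mult[of "w N n" "w N m"]
          using W0 by (intro mult_mono w_le nk mD d1) auto
        moreover have "\<bar>(w N n * (w N m - p n) + p n * (w N n - p n)) * \<gamma>\<bar> \<le> (W * (2 * Cw + L * k) / N) * cov_bound"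
        proof -
          have "\<bar>w N n * (w N m - p n)\<bar> \<le> W * (Cw / N + L * k / N)"
            unfolding abs_mult by (rule mult_mono[OF w_le[OF nk] d2 W0]) simp
          moreover have "\<bar>p n * (w N n - p n)\<bar> \<le> W * (Cw / N)"
            unfolding abs_mult by (rule mult_mono[OF p_le[OF n] wn W0]) simp
          ultimately have "\<bar>w N n * (w N m - p n) + p n * (w N n - p n)\<bar> \<le> W * (Cw / N + L * k / N) + W * (Cw / N)"
            by linarith
          also have "\<dots> = W * (2 * Cw + L * k) / N" by (simp add: add_divide_distrib distrib_left)
          finally show ?thesis
            unfolding abs_mult[of _ \<gamma>] using \<gamma>_le W0 Cw L0 by (intro mult_mono) auto
        qed
        ultimately show ?thesis unfolding E_def \<gamma>_def[symmetric] by linarith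
      qed
      have x_eq: "x n = (\<Sum>m\<in>near N n. w N n * w N m * cov {1..N} \<theta> n m - (p n)\<^sup>2 * cov {1..} (\<lambda>_. \<theta> (n + 1)) n m)"
      proof -
        have "V_fun k g (\<theta> (n + 1)) = (\<Sum>m\<in>near N n. cov {1..} (\<lambda>_. \<theta> (n + 1)) n m)"
          unfolding near_def using True \<theta>n[OF n] by (intro near_cov_sum_eq_V_fun[symmetric]) auto
        moreover have "n \<le> N - k" using nk by simp
        ultimately show ?thesis by (simp add: x_def T_def sum_subtractf sum_distrib_left)
      qed
      have "\<bar>x n\<bar> \<le> (\<Sum>m\<in>near N n. \<bar>w N n * w N m * cov {1..N} \<theta> n m - (p n)\<^sup>2 * cov {1..} (\<lambda>_. \<theta> (n + 1)) n m\<bar>)"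
        unfolding x_eq by (rule sum_abs)
      also have "\<dots> \<le> (\<Sum>m\<in>near N n. W * W * (lip * (2 * k) * S.spread n) + E)"
        by (rule sum_mono) (rule summand)
      also have "\<dots> = real (card (near N n)) * (W * W * (lip * (2 * k) * S.spread n) + E)" by simp
      also have "\<dots> \<le> real (2 * k) * (W * W * (lip * (2 * k) * S.spread n) + E)"
      proof (rule mult_right_mono)
        show "real (card (near N n)) \<le> real (2 * k)" using card_near[of N n] by simp
        show "0 \<le> W * W * (lip * (2 * k) * S.spread n) + E"
          using W0 lip_nonneg S.spread_nonneg E0 by (intro add_nonneg_nonneg mult_nonneg_nonneg) auto
      qed
      also have "\<dots> = 2 * k * (W * W * (lip * (2 * k))) * S.spread n + 2 * k * E" by (simp add: algebra_simps)
      finally have "\<bar>x n\<bar> \<le> 2 * k * (W * W * (lip * (2 * k))) * S.spread n + 2 * k * E" .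
      then show ?thesis unfolding E_eq using True by simp
    next
      case False
      have c0: "0 \<le> W * W * cov_bound" using W0 cov_bound_nonneg by simp
      have "\<bar>if n \<le> N - k then T n else 0\<bar> \<le> 2 * k * (W * W * cov_bound)"
      proof (cases "n \<le> N - k")
        case True
        then have nk: "n + k \<le> N" using N by simp
        have "\<bar>T n\<bar> \<le> (\<Sum>m\<in>near N n. \<bar>w N n * w N m * cov {1..N} \<theta> n m\<bar>)"
          unfolding T_def by (rule sum_abs)
        also have "\<dots> \<le> (\<Sum>m\<in>near N n. W * W * cov_bound)"
        proof (rule sum_mono)
          fix m assume m: "m \<in> near N n"
          note mD = nearD[OF m]
          show "\<bar>w N n * w N m * cov {1..N} \<theta> n m\<bar> \<le> W * W * cov_bound"
            unfolding abs_mult using W0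
            by (intro mult_mono w_le nk mD abs_cov_le win_subset \<theta>) auto
        qed
        also have "\<dots> \<le> 2 * k * (W * W * cov_bound)"
          using card_near[of N n] c0 by (simp add: mult_right_mono)
        finally show ?thesis using True by simp
      qed (use c0 in simp)
      moreover have "\<bar>(p n)\<^sup>2 * V_fun k g (\<theta> (n + 1))\<bar> \<le> W * W * (2 * k * cov_bound)"
        unfolding power2_eq_square abs_mult using W0
        by (intro mult_mono p_le n abs_V_fun_le \<theta>n) auto
      ultimately have "\<bar>x n\<bar> \<le> 2 * k * (W * W * cov_bound) + W * W * (2 * k * cov_bound)"
        unfolding x_def by linarith
      also have "\<dots> = 2 * k * (2 * (W * W * cov_bound))" by (simp add: algebra_simps)
      finally have xb: "\<bar>x n\<bar> \<le> 2 * k * (2 * (W * W * cov_bound))" .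
      have c: "(if \<not> (k \<le> n + 1 \<and> n + 2 * k \<le> N + 1) then 2 * k * (2 * (W * W * cov_bound)) else 0) =
          2 * k * (2 * (W * W * cov_bound))" using False by (rule if_P)
      have "0 \<le> 2 * real k * E" using E0 by simp
      then show ?thesis unfolding E_eq c using xb sp0 by linarith
    qed
  qed
  then show ?thesis
    unfolding T_def[symmetric] s1 s2 var_const_def by (simp add: x_def sum_subtractf)
qed

end

section \<open>Characteristic functions of the fluctuations\<close>

lemma abs_exp_minus_diff_le:
  fixes x y :: real
  assumes "0 \<le> x" "0 \<le> y"
  shows "\<bar>exp (- x) - exp (- y)\<bar> \<le> \<bar>x - y\<bar>"
proof -
  have *: "exp (- u) - exp (- v) \<le> v - u" if "0 \<le> u" "u \<le> v" for u v :: real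
  proof -
    have "exp (- v) = exp (- u) * exp (- (v - u))" by (simp flip: exp_add)
    then have "exp (- u) - exp (- v) = exp (- u) * (1 - exp (- (v - u)))" by (simp add: right_diff_distrib)
    also have "\<dots> \<le> 1 * (v - u)"
    proof (rule mult_mono)
      show "1 - exp (- (v - u)) \<le> v - u" using exp_ge_add_one_self[of "- (v - u)"] by linarith
    qed (use that in auto)
    finally show ?thesis by simp
  qed
  show ?thesis
  proof (cases "x \<le> y")
    case True
    then show ?thesis using *[of x y] assms by simp
  next
    case False
    then show ?thesis using *[of y x] assms by simp
  qed
qed

lemma continuous_on_Icc_bounded:
  fixes D :: "real \<Rightarrow> real"
  assumes "continuous_on {a..b} D"
  obtains M where "\<And>x. x \<in> {a..b} \<Longrightarrow> \<bar>D x\<bar> \<le> M"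
proof -
  obtain M where "\<forall>y\<in>D ` {a..b}. norm y \<le> M"
    using compact_imp_bounded[OF compact_continuous_image[OF assms compact_Icc]] by (auto simp: bounded_iff)
  then show thesis by (intro that[of M]) auto
qed

context weighted_obs
begin

definition cond_mean where
  "cond_mean N u n = (\<integral>\<eta>. shift n g \<eta> \<partial>nu_prod {1..N} (order_stats N u))"

definition mean where "mean N n = (\<integral>\<eta>. shift n g \<eta> \<partial>config_law a b N)"

definition wsum where "wsum N \<eta> = (\<Sum>n = 0..N - k. (shift n g \<eta> - mean N n) * w N n)"

definition cond_var where
  "cond_var N u = (\<Sum>n = 0..N - k. \<Sum>m\<in>near N n. w N n * w N m * cov {1..N} (order_stats N u) n m)"

definition cond_drift where
  "cond_drift N u = (\<Sum>n = 0..N - k. w N n * cond_mean N u n)"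

text \<open>A bound for third absolute moments of the centred weighted summands: the cube is at most
  1 plus the fourth power, 8 comes from \<open>diff_pow4_le\<close>, and \<open>1 + M4\<close>
  bounds the conditional mean.\<close>

definition moment_const where "moment_const = 1 + W ^ 4 * (8 * (M4 + (1 + M4) ^ 4))"

lemma os_range: "u \<in> space (Ulaw a b N) \<Longrightarrow> order_stats N u \<in> {1..N} \<rightarrow> {0..b}"
  by (rule in_range_0b[OF order_stats_in[OF Ulaw_space[OF ab]]])

lemma moment_const_ge: "1 \<le> moment_const"
  using W0 M4_nonneg by (simp add: moment_const_def)

text \<open>The estimate for locally dependent sums, given the parameters. Its bound does not
  involve \<open>\<theta>\<close>, so it survives integration over the order statistics.\<close>

lemma cond_char_error:
  assumes N: "k \<le> N" and \<theta>: "\<theta> \<in> {1..N} \<rightarrow> {0..b}"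
  defines "e \<equiv> \<lambda>n. \<integral>\<eta>. shift n g \<eta> \<partial>nu_prod {1..N} \<theta>"
  defines "V \<equiv> \<Sum>n = 0..N - k. \<Sum>m\<in>near N n. w N n * w N m * cov {1..N} \<theta> n m"
  shows "0 \<le> V"
    and "cmod ((\<integral>\<eta>. iexp (s * (\<Sum>n = 0..N - k. w N n * (shift n g \<eta> - e n))) \<partial>nu_prod {1..N} \<theta>) - complex_of_real (exp (- V * s\<^sup>2 / 2)))
      \<le> N * (18 * (4 * real k * moment_const)\<^sup>2) * \<bar>s\<bar> ^ 3"
proof -
  let ?P = "nu_prod {1..N} \<theta>"
  interpret P: prob_space ?P by simp
  define X where "X n \<eta> = w N n * (shift n g \<eta> - e n)" for n \<eta>
  have nk: "n + k \<le> N" if "n \<in> {0..N - k}" for n using that N by simp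
  have ws: "win n \<subseteq> {1..N}" if "n \<in> {0..N - k}" for n by (rule win_subset(2)[OF nk[OF that]])
  have si: "integrable ?P (shift n g)" if "n \<in> {0..N - k}" for n by (rule integrable_shift[OF ws[OF that] \<theta>])
  have e_le: "\<bar>e n\<bar> \<le> 1 + M4" if "n \<in> {0..N - k}" for n
    unfolding e_def by (rule abs_expectation_shift_le[OF ws[OF that] \<theta>])
  have X_conf: "depends_conf (win n) (X n)" for n
  proof -
    have "X n = (\<lambda>\<eta>. (\<lambda>x. w N n * (x - e n)) (shift n g \<eta>))" by (simp add: X_def fun_eq_iff)
    then show ?thesis by (simp only:) (rule depends_on_compose[OF shift_depends], measurable)
  qed
  have X3: "integrable ?P (\<lambda>\<eta>. \<bar>X n \<eta>\<bar> ^ 3) \<and> (\<integral>\<eta>. \<bar>X n \<eta>\<bar> ^ 3 \<partial>?P) \<le> moment_const" if n: "n \<in> {0..N - k}" for n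
  proof -
    have i4: "integrable ?P (\<lambda>\<eta>. 1 + W ^ 4 * (8 * (shift n g \<eta> ^ 4 + (1 + M4) ^ 4)))"
      by (intro Bochner_Integration.integrable_add integrable_mult_right P.integrable_const integrable_shift4[OF ws[OF n] \<theta>])
    have le: "\<bar>X n \<eta>\<bar> ^ 3 \<le> 1 + W ^ 4 * (8 * (shift n g \<eta> ^ 4 + (1 + M4) ^ 4))" for \<eta>
    proof -
      have "\<bar>X n \<eta>\<bar> ^ 3 \<le> 1 + X n \<eta> ^ 4" by (rule abs_cube_le_1_pow4)
      also have "X n \<eta> ^ 4 = \<bar>w N n\<bar> ^ 4 * (shift n g \<eta> - e n) ^ 4" by (simp add: X_def power_mult_distrib)
      also have "\<dots> \<le> W ^ 4 * (8 * (shift n g \<eta> ^ 4 + (1 + M4) ^ 4))"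
      proof (rule mult_mono)
        show "\<bar>w N n\<bar> ^ 4 \<le> W ^ 4" by (rule power_mono[OF w_le[OF nk[OF n]]]) simp
        have "\<bar>e n\<bar> ^ 4 \<le> (1 + M4) ^ 4" by (rule power_mono[OF e_le[OF n]]) simp
        then show "(shift n g \<eta> - e n) ^ 4 \<le> 8 * (shift n g \<eta> ^ 4 + (1 + M4) ^ 4)"
          using diff_pow4_le[of "shift n g \<eta>" "e n"] by simp
      qed (use W0 in simp_all)
      finally show ?thesis by simp
    qed
    have Xm: "X n \<in> borel_measurable ?P"
      using depends_on_measurable[OF X_conf ws[OF n]] by simp
    have i3: "integrable ?P (\<lambda>\<eta>. \<bar>X n \<eta>\<bar> ^ 3)"
    proof (rule Bochner_Integration.integrable_bound[OF i4])
      show "(\<lambda>\<eta>. \<bar>X n \<eta>\<bar> ^ 3) \<in> borel_measurable ?P" using Xm by measurable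
      show "AE \<eta> in ?P. norm (\<bar>X n \<eta>\<bar> ^ 3) \<le> norm (1 + W ^ 4 * (8 * (shift n g \<eta> ^ 4 + (1 + M4) ^ 4)))"
        using le by (intro AE_I2) (smt (verit) real_norm_def zero_le_power abs_ge_zero)
    qed
    have "(\<integral>\<eta>. \<bar>X n \<eta>\<bar> ^ 3 \<partial>?P) \<le> (\<integral>\<eta>. 1 + W ^ 4 * (8 * (shift n g \<eta> ^ 4 + (1 + M4) ^ 4)) \<partial>?P)"
      by (rule integral_mono[OF i3 i4 le])
    also have "\<dots> = 1 + W ^ 4 * (8 * ((\<integral>\<eta>. shift n g \<eta> ^ 4 \<partial>?P) + (1 + M4) ^ 4))"
      using integrable_shift4[OF ws[OF n] \<theta>] by (simp add: P.prob_space)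
    also have "\<dots> \<le> moment_const"
      unfolding moment_const_def using expectation_shift4_le[OF ws[OF n] \<theta>] W0
      by (intro add_left_mono mult_left_mono) auto
    finally show ?thesis using i3 by simp
  qed
  have EX: "(\<integral>\<eta>. X n \<eta> \<partial>?P) = 0" if "n \<in> {0..N - k}" for n
    using si[OF that] by (simp add: X_def e_def P.prob_space)
  have EXX: "(\<integral>\<eta>. X n \<eta> * X m \<eta> \<partial>?P) = w N n * w N m * cov {1..N} \<theta> n m"
    if "n \<in> {0..N - k}" "m \<in> {0..N - k}" for n m
  proof -
    have sm: "integrable ?P (\<lambda>\<eta>. shift n g \<eta> * shift m g \<eta>)" by (rule integrable_shift_mult[OF ws ws \<theta>]) fact+
    have "(\<integral>\<eta>. X n \<eta> * X m \<eta> \<partial>?P) = (\<integral>\<eta>. w N n * w N m * (shift n g \<eta> * shift m g \<eta> - e m * shift n g \<eta> - e n * shift m g \<eta> + e n * e m) \<partial>?P)"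
      by (intro Bochner_Integration.integral_cong) (auto simp: X_def algebra_simps)
    also have "\<dots> = w N n * w N m * ((\<integral>\<eta>. shift n g \<eta> * shift m g \<eta> \<partial>?P) - e m * e n - e n * e m + e n * e m)"
      using si that sm by (simp add: P.prob_space e_def)
    finally show ?thesis by (simp add: cov_def e_def)
  qed
  have V_eq: "V = (\<Sum>n\<in>{0..N - k}. \<Sum>m\<in>{m\<in>{0..N - k}. n < m + k \<and> m < n + k}. \<integral>\<eta>. X n \<eta> * X m \<eta> \<partial>?P)"
    unfolding V_def near_def by (intro sum.cong refl) (simp add: EXX)
  note CH = char_sum_PiM_approx[where M="\<lambda>i. measure_pmf (nu (\<theta> i))" and N=N and k=k and I="{0..N - k}" and X=X
      and K=moment_const, folded nu_prod_def]
  show "0 \<le> V"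
    unfolding V_eq
  proof (rule CH(1))
    show "depends_on {n + 1..n + k} (\<lambda>i. measure_pmf (nu (\<theta> i))) (X n)" for n
      using depends_conf_nu_prod[OF X_conf] by (simp add: win_def)
  qed (use X3 EX k N nk moment_const_ge in \<open>auto intro: prob_space_measure_pmf\<close>)
  have "cmod ((\<integral>\<eta>. iexp (s * (\<Sum>n\<in>{0..N - k}. X n \<eta>)) \<partial>?P) - complex_of_real (exp (- V * s\<^sup>2 / 2)))
      \<le> card {0..N - k} * (18 * (4 * real k * moment_const)\<^sup>2) * \<bar>s\<bar> ^ 3"
    unfolding V_eq
  proof (rule CH(2))
    show "depends_on {n + 1..n + k} (\<lambda>i. measure_pmf (nu (\<theta> i))) (X n)" for n
      using depends_conf_nu_prod[OF X_conf] by (simp add: win_def)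
  qed (use X3 EX k N nk moment_const_ge in \<open>auto intro: prob_space_measure_pmf\<close>)
  also have "\<dots> \<le> N * (18 * (4 * real k * moment_const)\<^sup>2) * \<bar>s\<bar> ^ 3"
  proof -
    have "real (card {0..N - k}) \<le> real N" using N k by simp
    then have "real (card {0..N - k}) * (18 * (4 * real k * moment_const)\<^sup>2) \<le> N * (18 * (4 * real k * moment_const)\<^sup>2)"
      by (rule mult_right_mono) simp
    then show ?thesis by (rule mult_right_mono) simp
  qed
  finally show "cmod ((\<integral>\<eta>. iexp (s * (\<Sum>n = 0..N - k. w N n * (shift n g \<eta> - e n))) \<partial>?P) - complex_of_real (exp (- V * s\<^sup>2 / 2)))
      \<le> N * (18 * (4 * real k * moment_const)\<^sup>2) * \<bar>s\<bar> ^ 3"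
    by (simp only: X_def)
qed

lemma mean_eq:
  assumes "n + k \<le> N"
  shows "mean N n = (\<integral>u. cond_mean N u n \<partial>Ulaw a b N)"
  unfolding mean_def cond_mean_def
proof (rule integral_config_law(2)[OF ab a0 shift_measurable[OF win_subset(2)[OF assms]]])
  fix \<theta> assume "\<theta> \<in> {1..N} \<rightarrow> {a..b}"
  then have \<theta>: "\<theta> \<in> {1..N} \<rightarrow> {0..b}" by (rule in_range_0b)
  show "integrable (nu_prod {1..N} \<theta>) (shift n g)" by (rule integrable_shift[OF win_subset(2)[OF assms] \<theta>])
  show "(\<integral>\<eta>. \<bar>shift n g \<eta>\<bar> \<partial>nu_prod {1..N} \<theta>) \<le> 1 + M4"
    by (rule expectation_abs_shift_le[OF win_subset(2)[OF assms] \<theta>])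
qed

lemma cond_mean_measurable: "n + k \<le> N \<Longrightarrow> (\<lambda>u. cond_mean N u n) \<in> borel_measurable (Ulaw a b N)"
  unfolding cond_mean_def by (rule expectation_measurable[OF ab a0 shift_measurable[OF win_subset(2)]])

lemma abs_cond_mean_le: "n + k \<le> N \<Longrightarrow> u \<in> space (Ulaw a b N) \<Longrightarrow> \<bar>cond_mean N u n\<bar> \<le> 1 + M4"
  unfolding cond_mean_def by (rule abs_expectation_shift_le[OF win_subset(2) os_range])

lemma cond_mean_integrable: "n + k \<le> N \<Longrightarrow> integrable (Ulaw a b N) (\<lambda>u. cond_mean N u n)"
proof -
  assume n: "n + k \<le> N"
  interpret U: prob_space "Ulaw a b N" using ab by simp
  show ?thesis
    using abs_cond_mean_le[OF n] by (intro U.integrable_const_bound[OF _ cond_mean_measurable[OF n]] AE_I2) simp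
qed

lemma cond_drift_integrable: "k \<le> N \<Longrightarrow> integrable (Ulaw a b N) (cond_drift N)"
  unfolding cond_drift_def[abs_def]
  by (intro Bochner_Integration.integrable_sum integrable_mult_right cond_mean_integrable) auto

lemma cond_var_measurable: "k \<le> N \<Longrightarrow> cond_var N \<in> borel_measurable (Ulaw a b N)"
  unfolding cond_var_def[abs_def] cov_def
  by (intro borel_measurable_sum borel_measurable_times borel_measurable_diff borel_measurable_const
      expectation_measurable[OF ab a0] shift_measurable win_subset(2)) (auto simp: near_def)

lemma wsum_measurable: "k \<le> N \<Longrightarrow> wsum N \<in> borel_measurable (conf {1..N})"
  unfolding wsum_def[abs_def]
  by (intro borel_measurable_sum borel_measurable_times borel_measurable_diff borel_measurable_const
      shift_measurable win_subset(2)) auto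

text \<open>The conditional means are added and subtracted, so the identity holds for every pair of
  \<open>\<eta>\<close> and \<open>u\<close>. In the use below \<open>u\<close> is the sample on
  which \<open>\<eta>\<close> is conditioned.\<close>

lemma wsum_decomp:
  assumes "k \<le> N"
  shows "wsum N \<eta> = (\<Sum>n = 0..N - k. w N n * (shift n g \<eta> - cond_mean N u n))
    + (cond_drift N u - (\<integral>u. cond_drift N u \<partial>Ulaw a b N))"
proof -
  have "(\<integral>u. cond_drift N u \<partial>Ulaw a b N) = (\<Sum>n = 0..N - k. w N n * mean N n)"
    unfolding cond_drift_def using assms cond_mean_integrable
    by (subst Bochner_Integration.integral_sum) (auto simp: mean_eq intro!: integrable_mult_right)
  then show ?thesis
    by (simp add: wsum_def cond_drift_def algebra_simps sum_subtractf sum.distrib)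
qed

text \<open>Given \<open>u\<close>, the drift only contributes a phase and the rest is nearly
  Gaussian with a nearly deterministic variance; then the drift is replaced by the sum of the
  noises. Nonnegativity of both variances is delivered along the way.\<close>

lemma char_error:
  assumes HS: "l_statistic a b (h_fun g) D1 \<phi> \<phi>' L W M1"
    and VS: "l_statistic a b (V_fun k g) D2 (\<lambda>s. (\<phi> s)\<^sup>2) (\<lambda>s. 2 * \<phi> s * \<phi>' s) (2 * W * L) (W * W) M2"
  defines "\<sigma>T \<equiv> l_statistic.noise_var a b D1 \<phi>"
    and "\<sigma>E \<equiv> l_statistic.lmean a b (V_fun k g) (\<lambda>s. (\<phi> s)\<^sup>2)"
  obtains C where "0 \<le> \<sigma>T" "0 \<le> \<sigma>E"
    "\<And>N. k \<le> N \<Longrightarrow> cmod ((\<integral>\<eta>. iexp (t * (wsum N \<eta> / sqrt N)) \<partial>config_law a b N)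
       - complex_of_real (exp (- (\<sigma>T + \<sigma>E) * t\<^sup>2 / 2))) \<le> C / sqrt N"
proof -
  interpret H: l_statistic a b "h_fun g" D1 \<phi> \<phi>' L W M1 by (rule HS)
  interpret V: l_statistic a b "V_fun k g" D2 "\<lambda>s. (\<phi> s)\<^sup>2" "\<lambda>s. 2 * \<phi> s * \<phi>' s" "2 * W * L" "W * W" M2 by (rule VS)
  define cV where "cV = var_const + (\<bar>V_fun k g b\<bar> + 2 * M2) * (2 * W * L) + (V.noise_var + 1)"
  define cH where "cH = drift_const + (\<bar>h_fun g b\<bar> + 2 * M1) * L"
  have SP: "sorted_params a b N k (order_stats N u)" if "k \<le> N" "u \<in> space (Ulaw a b N)" for N u
    using that k by (intro sorted_params_order_stats Ulaw_space[OF ab]) auto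
  have var0: "0 \<le> cond_var N u" if "k \<le> N" "u \<in> space (Ulaw a b N)" for N u
    unfolding cond_var_def by (rule cond_char_error(1)[OF that(1) os_range[OF that(2)]])
  \<comment> \<open>A law of large numbers in L1, with rate, for the conditional variance: a bounded
    window error, an L-statistic error with bounded mean and a noise sum of order sqrt N, all
    divided by \<open>N\<close>.\<close>
  have var_L1: "integrable (Ulaw a b N) (\<lambda>u. cond_var N u / N - \<sigma>E) \<and>
      (\<integral>u. \<bar>cond_var N u / N - \<sigma>E\<bar> \<partial>Ulaw a b N) \<le> cV / sqrt N" if N: "k \<le> N" for N
  proof -
    have N1: "1 \<le> N" using N k by simp
    interpret U: prob_space "Ulaw a b N" using ab by simp
    define R where "R u = V.lstat N u - N * V.lmean - (\<Sum>j\<in>{1..N}. V.noise (u j))" for u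
    define S where "S u = (\<Sum>j\<in>{1..N}. V.noise (u j))" for u
    have R: "integrable (Ulaw a b N) R" "(\<integral>u. \<bar>R u\<bar> \<partial>Ulaw a b N) \<le> (\<bar>V_fun k g b\<bar> + 2 * M2) * (2 * W * L)"
      unfolding R_def using V.expectation_lstat_error[OF N1] by auto
    have S: "integrable (Ulaw a b N) S" "(\<integral>u. \<bar>S u\<bar> \<partial>Ulaw a b N) \<le> sqrt N * (V.noise_var + 1)"
      unfolding S_def using V.expectation_abs_noise_sum[OF N1] by auto
    have le: "\<bar>cond_var N u / N - \<sigma>E\<bar> \<le> (var_const + \<bar>R u\<bar> + \<bar>S u\<bar>) / N" if u: "u \<in> space (Ulaw a b N)" for u
    proof -
      have "\<bar>cond_var N u - V.lstat N u\<bar> \<le> var_const"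
        unfolding cond_var_def V.lstat_def by (rule variance_error[OF N SP[OF N u]])
      moreover have "V.lstat N u = N * V.lmean + S u + R u" by (simp add: R_def S_def)
      ultimately have "\<bar>cond_var N u - N * V.lmean\<bar> \<le> var_const + \<bar>R u\<bar> + \<bar>S u\<bar>" by linarith
      then have "\<bar>cond_var N u - N * V.lmean\<bar> / N \<le> (var_const + \<bar>R u\<bar> + \<bar>S u\<bar>) / N"
        by (rule divide_right_mono) simp
      also have "\<bar>cond_var N u - N * V.lmean\<bar> / N = \<bar>cond_var N u / N - \<sigma>E\<bar>"
      proof -
        have "cond_var N u / N - \<sigma>E = (cond_var N u - N * V.lmean) / N"
          using N1 by (simp add: \<sigma>E_def diff_divide_distrib)
        then show ?thesis by (simp add: abs_divide)
      qed
      finally show ?thesis .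
    qed
    have bi: "integrable (Ulaw a b N) (\<lambda>u. (var_const + \<bar>R u\<bar> + \<bar>S u\<bar>) / N)"
      using R S by (intro integrable_divide Bochner_Integration.integrable_add integrable_abs U.integrable_const)
    have i: "integrable (Ulaw a b N) (\<lambda>u. cond_var N u / N - \<sigma>E)"
    proof (rule Bochner_Integration.integrable_bound[OF bi])
      show "(\<lambda>u. cond_var N u / N - \<sigma>E) \<in> borel_measurable (Ulaw a b N)"
        using cond_var_measurable[OF N] by measurable
      show "AE u in Ulaw a b N. norm (cond_var N u / N - \<sigma>E) \<le> norm ((var_const + \<bar>R u\<bar> + \<bar>S u\<bar>) / N)"
        unfolding real_norm_def by (intro AE_I2 order_trans[OF le abs_ge_self])
    qed
    have "(\<integral>u. \<bar>cond_var N u / N - \<sigma>E\<bar> \<partial>Ulaw a b N) \<le> (\<integral>u. (var_const + \<bar>R u\<bar> + \<bar>S u\<bar>) / N \<partial>Ulaw a b N)"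
      by (rule integral_mono[OF integrable_abs[OF i] bi le])
    also have "\<dots> = (var_const + (\<integral>u. \<bar>R u\<bar> \<partial>Ulaw a b N) + (\<integral>u. \<bar>S u\<bar> \<partial>Ulaw a b N)) / N"
      using R S by (simp add: U.prob_space)
    also have "\<dots> \<le> (var_const + (\<bar>V_fun k g b\<bar> + 2 * M2) * (2 * W * L) + sqrt N * (V.noise_var + 1)) / N"
      using R S by (intro divide_right_mono add_mono) auto
    also have "\<dots> \<le> (sqrt N * cV) / N"
    proof (rule divide_right_mono)
      have "0 \<le> var_const" unfolding var_const_def
        using W0 L0 Cw cov_bound_nonneg lip_nonneg ab by (intro add_nonneg_nonneg mult_nonneg_nonneg) auto
      moreover have "0 \<le> (\<bar>V_fun k g b\<bar> + 2 * M2) * (2 * W * L)" using V.nonneg W0 L0 by (intro mult_nonneg_nonneg) auto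
      ultimately have "1 * (var_const + (\<bar>V_fun k g b\<bar> + 2 * M2) * (2 * W * L)) \<le>
          sqrt N * (var_const + (\<bar>V_fun k g b\<bar> + 2 * M2) * (2 * W * L))"
        using N1 by (intro mult_right_mono) auto
      then show "var_const + (\<bar>V_fun k g b\<bar> + 2 * M2) * (2 * W * L) + sqrt N * (V.noise_var + 1) \<le> sqrt N * cV"
        unfolding cV_def by (simp add: distrib_left)
    qed simp
    also have "\<dots> = cV / sqrt N" using N1 by (simp add: field_simps)
    finally show ?thesis using i by simp
  qed
  have sT: "0 \<le> \<sigma>T" unfolding \<sigma>T_def by (rule H.noise_var_nonneg)
  \<comment> \<open>Conditional variances are nonnegative, and L1 convergence passes the sign on to
    the limit.\<close>
  have sE: "0 \<le> \<sigma>E"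
  proof (rule LIMSEQ_le_const2)
    show "(\<lambda>N. - (cV / sqrt (real N))) \<longlonglongrightarrow> 0" by real_asymp
    have "- (cV / sqrt (real N)) \<le> \<sigma>E" if N: "k \<le> N" for N
    proof -
      interpret U: prob_space "Ulaw a b N" using ab by simp
      have "- \<sigma>E = (\<integral>u. - \<sigma>E \<partial>Ulaw a b N)" by (simp add: U.prob_space)
      also have "\<dots> \<le> (\<integral>u. \<bar>cond_var N u / N - \<sigma>E\<bar> \<partial>Ulaw a b N)"
      proof (rule integral_mono)
        fix u assume "u \<in> space (Ulaw a b N)"
        then have "0 \<le> cond_var N u / N" using var0[OF N] by simp
        then show "- \<sigma>E \<le> \<bar>cond_var N u / N - \<sigma>E\<bar>" by linarith
      qed (use var_L1[OF N] in auto)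
      also have "\<dots> \<le> cV / sqrt N" using var_L1[OF N] by simp
      finally show ?thesis by simp
    qed
    then show "\<exists>M. \<forall>N\<ge>M. - (cV / sqrt (real N)) \<le> \<sigma>E" by blast
  qed
  define C where "C = t\<^sup>2 / 2 * cV + 18 * (4 * real k * moment_const)\<^sup>2 * \<bar>t\<bar> ^ 3 + \<bar>t\<bar> * (2 * cH)
      + 18 * (4 * (1 + (M1 * W) ^ 3))\<^sup>2 * \<bar>t\<bar> ^ 3"
  show thesis
  proof (rule that[of C])
    show "0 \<le> \<sigma>T" "0 \<le> \<sigma>E" by fact+
    fix N assume N: "k \<le> N"
    then have N1: "1 \<le> N" using k by simp
    then have N0: "0 < real N" by simp
    let ?U = "Ulaw a b N"
    interpret U: prob_space ?U using ab by simp
    define s where "s = t / sqrt N"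
    have s2: "s\<^sup>2 = t\<^sup>2 / N" using N0 by (simp add: s_def power_divide)
    have s3: "N * \<bar>s\<bar> ^ 3 = \<bar>t\<bar> ^ 3 / sqrt N"
      using N0 by (simp add: s_def power_divide power3_eq_cube field_simps)
    define f where "f \<eta> = iexp (t * (wsum N \<eta> / sqrt N))" for \<eta>
    have fm: "f \<in> borel_measurable (conf {1..N})"
      unfolding f_def[abs_def] using wsum_measurable[OF N] by measurable
    define h where "h u = (\<integral>\<eta>. f \<eta> \<partial>nu_prod {1..N} (order_stats N u))" for u
    have hm: "h \<in> borel_measurable ?U"
      unfolding h_def[abs_def] by (rule expectation_measurable[OF ab a0 fm])
    have h_le: "cmod (h u) \<le> 1" for u
    proof -
      interpret P: prob_space "nu_prod {1..N} (order_stats N u)" by simp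
      have "cmod (h u) \<le> (\<integral>\<eta>. 1 \<partial>nu_prod {1..N} (order_stats N u))"
        unfolding h_def by (rule norm_integral_le) (simp_all add: f_def)
      then show ?thesis by (simp add: P.prob_space)
    qed
    have config: "(\<integral>\<eta>. f \<eta> \<partial>config_law a b N) = (\<integral>u. h u \<partial>?U)"
      unfolding h_def by (rule integral_config_law_complex[OF ab a0 fm, where B=1]) (simp add: f_def)
    define EG where "EG = (\<integral>u. cond_drift N u \<partial>?U)"
    define Bu where "Bu u = cond_drift N u - EG" for u
    define S where "S u = (\<Sum>j\<in>{1..N}. H.noise (u j))" for u
    define q where "q = exp (- (\<sigma>E * t\<^sup>2 / 2))"
    have q01: "0 \<le> q" "q \<le> 1" unfolding q_def using sE by (simp_all add: mult_nonneg_nonneg)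
    have Bum: "Bu \<in> borel_measurable ?U"
      unfolding Bu_def[abs_def] using borel_measurable_integrable[OF cond_drift_integrable[OF N]] by measurable
    have Sm: "S \<in> borel_measurable ?U" unfolding S_def[abs_def] by (rule H.noise_sum_measurable)
    have int_iexp: "complex_integrable ?U (\<lambda>u. iexp (s * F u))" if "F \<in> borel_measurable ?U" for F
      using that by (intro U.integrable_const_bound[where B=1]) auto
    have h_int: "complex_integrable ?U h"
      using hm h_le by (intro U.integrable_const_bound[where B=1]) auto
    note vi = var_L1[OF N]
    \<comment> \<open>The drift \<open>Bu u\<close> is constant in \<open>\<eta>\<close> and leaves
      the inner integral as a factor of modulus 1. The remaining characteristic function is compared
      with that of variance \<open>cond_var N u / N\<close>, and this variance with
      \<open>\<sigma>E\<close>.\<close>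
    have h_err: "cmod (h u - iexp (s * Bu u) * q) \<le>
        18 * (4 * real k * moment_const)\<^sup>2 * (\<bar>t\<bar> ^ 3 / sqrt N) + t\<^sup>2 / 2 * \<bar>cond_var N u / N - \<sigma>E\<bar>"
      if u: "u \<in> space ?U" for u
    proof -
      define A where "A \<eta> = (\<Sum>n = 0..N - k. w N n * (shift n g \<eta> - cond_mean N u n))" for \<eta>
      define c where "c = (\<integral>\<eta>. iexp (s * A \<eta>) \<partial>nu_prod {1..N} (order_stats N u))"
      have f_eq: "f \<eta> = iexp (s * Bu u) * iexp (s * A \<eta>)" for \<eta>
      proof -
        have "t * (wsum N \<eta> / sqrt N) = s * Bu u + s * A \<eta>"
          unfolding wsum_decomp[OF N, of \<eta> u] A_def[symmetric] EG_def[symmetric] Bu_def[symmetric] s_def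
          by (simp add: add_divide_distrib distrib_left)
        then show ?thesis unfolding f_def by (simp add: exp_add distrib_left)
      qed
      have "h u = (\<integral>\<eta>. iexp (s * Bu u) * iexp (s * A \<eta>) \<partial>nu_prod {1..N} (order_stats N u))"
        unfolding h_def by (intro Bochner_Integration.integral_cong refl f_eq)
      also have "\<dots> = iexp (s * Bu u) * c" unfolding c_def by (rule integral_mult_right_zero)
      finally have hc: "h u = iexp (s * Bu u) * c" .
      have e1: "cmod (c - complex_of_real (exp (- cond_var N u * s\<^sup>2 / 2))) \<le> N * (18 * (4 * real k * moment_const)\<^sup>2) * \<bar>s\<bar> ^ 3"
        unfolding c_def A_def cond_mean_def cond_var_def
        by (rule cond_char_error(2)[OF N os_range[OF u]])
      also have "\<dots> = 18 * (4 * real k * moment_const)\<^sup>2 * (N * \<bar>s\<bar> ^ 3)" by simp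
      finally have e1: "cmod (c - complex_of_real (exp (- cond_var N u * s\<^sup>2 / 2))) \<le> 18 * (4 * real k * moment_const)\<^sup>2 * (\<bar>t\<bar> ^ 3 / sqrt N)"
        unfolding s3 .
      have "\<bar>exp (- (cond_var N u * s\<^sup>2 / 2)) - q\<bar> \<le> \<bar>cond_var N u * s\<^sup>2 / 2 - \<sigma>E * t\<^sup>2 / 2\<bar>"
        unfolding q_def using var0[OF N u] sE by (intro abs_exp_minus_diff_le) simp_all
      also have "cond_var N u * s\<^sup>2 / 2 - \<sigma>E * t\<^sup>2 / 2 = t\<^sup>2 / 2 * (cond_var N u / N - \<sigma>E)"
        unfolding s2 by (simp add: field_simps)
      also have "\<bar>t\<^sup>2 / 2 * (cond_var N u / N - \<sigma>E)\<bar> = t\<^sup>2 / 2 * \<bar>cond_var N u / N - \<sigma>E\<bar>"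
        by (simp add: abs_mult)
      finally have e2: "cmod (complex_of_real (exp (- cond_var N u * s\<^sup>2 / 2)) - complex_of_real q) \<le> t\<^sup>2 / 2 * \<bar>cond_var N u / N - \<sigma>E\<bar>"
        by (simp flip: of_real_diff)
      have "h u - iexp (s * Bu u) * q = iexp (s * Bu u) * (c - q)" by (simp add: hc right_diff_distrib)
      then have "cmod (h u - iexp (s * Bu u) * q) = cmod (c - q)" by (simp add: norm_mult)
      also have "\<dots> \<le> cmod (c - complex_of_real (exp (- cond_var N u * s\<^sup>2 / 2))) + cmod (complex_of_real (exp (- cond_var N u * s\<^sup>2 / 2)) - complex_of_real q)"
        using norm_triangle_ineq[of "c - complex_of_real (exp (- cond_var N u * s\<^sup>2 / 2))" "complex_of_real (exp (- cond_var N u * s\<^sup>2 / 2)) - complex_of_real q"]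
        by simp
      finally show ?thesis using e1 e2 by linarith
    qed
    have bd1: "integrable ?U (\<lambda>u. 18 * (4 * real k * moment_const)\<^sup>2 * (\<bar>t\<bar> ^ 3 / sqrt N) + t\<^sup>2 / 2 * \<bar>cond_var N u / N - \<sigma>E\<bar>)"
      using vi by (intro Bochner_Integration.integrable_add U.integrable_const integrable_mult_right integrable_abs) auto
    have E1: "cmod (\<integral>u. h u - iexp (s * Bu u) * q \<partial>?U) \<le>
        18 * (4 * real k * moment_const)\<^sup>2 * (\<bar>t\<bar> ^ 3 / sqrt N) + t\<^sup>2 / 2 * (cV / sqrt N)"
    proof -
      have "cmod (\<integral>u. h u - iexp (s * Bu u) * q \<partial>?U) \<le>
          (\<integral>u. 18 * (4 * real k * moment_const)\<^sup>2 * (\<bar>t\<bar> ^ 3 / sqrt N) + t\<^sup>2 / 2 * \<bar>cond_var N u / N - \<sigma>E\<bar> \<partial>?U)"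
        by (rule norm_integral_le[OF bd1 h_err])
      also have "\<dots> = 18 * (4 * real k * moment_const)\<^sup>2 * (\<bar>t\<bar> ^ 3 / sqrt N) + t\<^sup>2 / 2 * (\<integral>u. \<bar>cond_var N u / N - \<sigma>E\<bar> \<partial>?U)"
        using vi by (simp add: U.prob_space)
      also have "\<dots> \<le> 18 * (4 * real k * moment_const)\<^sup>2 * (\<bar>t\<bar> ^ 3 / sqrt N) + t\<^sup>2 / 2 * (cV / sqrt N)"
        using vi by (intro add_left_mono mult_left_mono) auto
      finally show ?thesis .
    qed
    define R where "R u = cond_drift N u - N * H.lmean - S u" for u
    have Si: "integrable ?U S" unfolding S_def[abs_def] using H.expectation_abs_noise_sum(1)[OF N1] .
    have ES: "(\<integral>u. S u \<partial>?U) = 0"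
    proof -
      have "integrable ?U (\<lambda>u. H.noise (u j))" if "j \<in> {1..N}" for j
        using H.abs_noise_le Ulaw_component_measurable[OF ab that H.noise_measurable]
        by (intro U.integrable_const_bound[where B="M1 * W"]) auto
      then have "(\<integral>u. S u \<partial>?U) = (\<Sum>j\<in>{1..N}. \<integral>u. H.noise (u j) \<partial>?U)"
        unfolding S_def by (rule Bochner_Integration.integral_sum)
      also have "\<dots> = (\<Sum>j\<in>{1..N}. 0)"
        by (intro sum.cong refl) (simp add: Ulaw_component[OF ab _ H.noise_measurable] H.integral_noise)
      finally show ?thesis by simp
    qed
    have Ri: "integrable ?U R"
      unfolding R_def[abs_def]
      by (intro Bochner_Integration.integrable_diff cond_drift_integrable[OF N] U.integrable_const Si)
    have R_L1: "(\<integral>u. \<bar>R u\<bar> \<partial>?U) \<le> cH"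
    proof -
      define R0 where "R0 u = H.lstat N u - N * H.lmean - S u" for u
      have R0: "integrable ?U R0" "(\<integral>u. \<bar>R0 u\<bar> \<partial>?U) \<le> (\<bar>h_fun g b\<bar> + 2 * M1) * L"
        unfolding R0_def S_def using H.expectation_lstat_error[OF N1] by auto
      have "(\<integral>u. \<bar>R u\<bar> \<partial>?U) \<le> (\<integral>u. drift_const + \<bar>R0 u\<bar> \<partial>?U)"
      proof (rule integral_mono)
        fix u assume u: "u \<in> space ?U"
        have "\<bar>cond_drift N u - H.lstat N u\<bar> \<le> drift_const"
          unfolding cond_drift_def cond_mean_def H.lstat_def by (rule drift_error[OF N SP[OF N u]])
        then show "\<bar>R u\<bar> \<le> drift_const + \<bar>R0 u\<bar>" unfolding R_def R0_def by linarith
      qed (use Ri R0 in auto)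
      also have "\<dots> = drift_const + (\<integral>u. \<bar>R0 u\<bar> \<partial>?U)" using R0 by (simp add: U.prob_space)
      finally show ?thesis using R0 by (simp add: cH_def)
    qed
    \<comment> \<open>The noise sum has mean 0, so centring the drift is the same as centring the
      error \<open>R\<close>. The mean of \<open>R\<close> costs as much as \<open>R\<close> itself,
      whence \<open>2 * cH\<close>.\<close>
    have BS: "Bu u - S u = R u - (\<integral>u. R u \<partial>?U)" for u
    proof -
      have "(\<integral>u. R u \<partial>?U) = EG - N * H.lmean"
        unfolding R_def EG_def using cond_drift_integrable[OF N] Si ES by (simp add: U.prob_space)
      then show ?thesis by (simp add: Bu_def R_def)
    qed
    have E2: "cmod (\<integral>u. iexp (s * Bu u) - iexp (s * S u) \<partial>?U) \<le> \<bar>s\<bar> * (2 * cH)"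
    proof -
      have "cmod (\<integral>u. iexp (s * Bu u) - iexp (s * S u) \<partial>?U) \<le> (\<integral>u. \<bar>s\<bar> * (\<bar>R u\<bar> + \<bar>\<integral>u. R u \<partial>?U\<bar>) \<partial>?U)"
      proof (rule norm_integral_le)
        show "integrable ?U (\<lambda>u. \<bar>s\<bar> * (\<bar>R u\<bar> + \<bar>\<integral>u. R u \<partial>?U\<bar>))"
          by (intro integrable_mult_right Bochner_Integration.integrable_add integrable_abs Ri U.integrable_const)
        fix u
        have "cmod (iexp (s * Bu u) - iexp (s * S u)) \<le> \<bar>s * Bu u - s * S u\<bar>" by (rule cmod_iexp_diff_le)
        also have "\<dots> = \<bar>s\<bar> * \<bar>Bu u - S u\<bar>" by (simp add: abs_mult flip: right_diff_distrib)
        also have "\<dots> \<le> \<bar>s\<bar> * (\<bar>R u\<bar> + \<bar>\<integral>u. R u \<partial>?U\<bar>)"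
          unfolding BS by (intro mult_left_mono abs_triangle_ineq4) simp
        finally show "cmod (iexp (s * Bu u) - iexp (s * S u)) \<le> \<bar>s\<bar> * (\<bar>R u\<bar> + \<bar>\<integral>u. R u \<partial>?U\<bar>)" .
      qed
      also have "\<dots> = \<bar>s\<bar> * ((\<integral>u. \<bar>R u\<bar> \<partial>?U) + \<bar>\<integral>u. R u \<partial>?U\<bar>)"
        using Ri by (simp add: U.prob_space)
      also have "\<dots> \<le> \<bar>s\<bar> * (2 * cH)"
      proof (rule mult_left_mono)
        have "\<bar>\<integral>u. R u \<partial>?U\<bar> \<le> (\<integral>u. \<bar>R u\<bar> \<partial>?U)" by (rule integral_abs_bound)
        then show "(\<integral>u. \<bar>R u\<bar> \<partial>?U) + \<bar>\<integral>u. R u \<partial>?U\<bar> \<le> 2 * cH" using R_L1 by linarith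
      qed simp
      finally show ?thesis .
    qed
    have E3: "cmod ((\<integral>u. iexp (s * S u) \<partial>?U) - exp (- \<sigma>T * t\<^sup>2 / 2)) \<le> 18 * (4 * (1 + (M1 * W) ^ 3))\<^sup>2 * \<bar>t\<bar> ^ 3 / sqrt N"
      unfolding s_def S_def \<sigma>T_def by (rule H.char_noise_sum[OF N1])
    define T where "T = complex_of_real (exp (- \<sigma>T * t\<^sup>2 / 2))"
    have Tq: "complex_of_real (exp (- (\<sigma>T + \<sigma>E) * t\<^sup>2 / 2)) = T * q"
    proof -
      have "exp (- (\<sigma>T + \<sigma>E) * t\<^sup>2 / 2) = exp (- \<sigma>T * t\<^sup>2 / 2) * q"
      proof -
        have "- (\<sigma>T + \<sigma>E) * t\<^sup>2 / 2 = - \<sigma>T * t\<^sup>2 / 2 + - (\<sigma>E * t\<^sup>2 / 2)"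
          by (simp add: field_simps)
        then show ?thesis unfolding q_def by (simp only: exp_add)
      qed
      then show ?thesis by (simp only: T_def of_real_mult)
    qed
    have iB: "complex_integrable ?U (\<lambda>u. iexp (s * Bu u))" and iS: "complex_integrable ?U (\<lambda>u. iexp (s * S u))"
      by (rule int_iexp[OF Bum], rule int_iexp[OF Sm])
    \<comment> \<open>Three errors: the inner characteristic function, the linearisation of the
      drift, and the central limit theorem for the noise. The factor \<open>q\<close> in front of
      the last two is at most 1.\<close>
    have dec: "(\<integral>u. h u \<partial>?U) - T * q = (\<integral>u. h u - iexp (s * Bu u) * q \<partial>?U)
        + q * (\<integral>u. iexp (s * Bu u) - iexp (s * S u) \<partial>?U) + q * ((\<integral>u. iexp (s * S u) \<partial>?U) - T)"
    proof -
      have "(\<integral>u. h u - iexp (s * Bu u) * q \<partial>?U) = (\<integral>u. h u \<partial>?U) - (\<integral>u. iexp (s * Bu u) \<partial>?U) * q"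
        using h_int iB by (subst Bochner_Integration.integral_diff) auto
      moreover have "(\<integral>u. iexp (s * Bu u) - iexp (s * S u) \<partial>?U) = (\<integral>u. iexp (s * Bu u) \<partial>?U) - (\<integral>u. iexp (s * S u) \<partial>?U)"
        using iB iS by (rule Bochner_Integration.integral_diff)
      ultimately show ?thesis by (simp only:) (simp add: algebra_simps)
    qed
    have tri: "cmod (x + y + z) \<le> cmod x + cmod y + cmod z" for x y z
      using norm_triangle_ineq[of "x + y" z] norm_triangle_ineq[of x y] by linarith
    have "cmod ((\<integral>u. h u \<partial>?U) - T * q) \<le> cmod (\<integral>u. h u - iexp (s * Bu u) * q \<partial>?U)
        + cmod (q * (\<integral>u. iexp (s * Bu u) - iexp (s * S u) \<partial>?U)) + cmod (q * ((\<integral>u. iexp (s * S u) \<partial>?U) - T))"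
      unfolding dec by (rule tri)
    also have "\<dots> \<le> (18 * (4 * real k * moment_const)\<^sup>2 * (\<bar>t\<bar> ^ 3 / sqrt N) + t\<^sup>2 / 2 * (cV / sqrt N))
        + \<bar>s\<bar> * (2 * cH) + 18 * (4 * (1 + (M1 * W) ^ 3))\<^sup>2 * \<bar>t\<bar> ^ 3 / sqrt N"
    proof (intro add_mono E1)
      have qle: "cmod (complex_of_real q * z) \<le> cmod z" for z
        using q01 by (simp add: norm_mult mult_left_le_one_le)
      show "cmod (q * (\<integral>u. iexp (s * Bu u) - iexp (s * S u) \<partial>?U)) \<le> \<bar>s\<bar> * (2 * cH)"
        by (rule order_trans[OF qle E2])
      show "cmod (q * ((\<integral>u. iexp (s * S u) \<partial>?U) - T)) \<le> 18 * (4 * (1 + (M1 * W) ^ 3))\<^sup>2 * \<bar>t\<bar> ^ 3 / sqrt N"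
        unfolding T_def by (rule order_trans[OF qle E3])
    qed
    also have "\<dots> = C / sqrt N"
      using N0 by (simp add: C_def s_def add_divide_distrib abs_divide)
    finally show "cmod ((\<integral>\<eta>. iexp (t * (wsum N \<eta> / sqrt N)) \<partial>config_law a b N)
       - complex_of_real (exp (- (\<sigma>T + \<sigma>E) * t\<^sup>2 / 2))) \<le> C / sqrt N"
      unfolding Tq config[unfolded f_def] .
  qed
qed

end

section \<open>Convergence to the normal law\<close>

text \<open>\<open>sqrt\<close> is an odd function on the reals and the density sees only its
  square, so a negative argument yields variance \<open>\<bar>v\<bar>\<close>. Law and
  characteristic function are thus available for every \<open>v\<close>, whether or not a covariance
  is already known to be nonnegative.\<close>

lemma normal_law_eq:
  assumes "v \<noteq> 0"
  shows "normal_law v = density lborel (normal_density 0 (sqrt \<bar>v\<bar>))"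
proof -
  have "(sqrt v)\<^sup>2 = (sqrt \<bar>v\<bar>)\<^sup>2"
    by (simp add: abs_if real_sqrt_minus del: real_sqrt_pow2)
  then have "normal_density 0 (sqrt v) = normal_density 0 (sqrt \<bar>v\<bar>)"
    unfolding normal_density_def by (simp only:)
  then show ?thesis using assms by (simp add: normal_law_def)
qed

lemma real_distribution_normal_law: "real_distribution (normal_law v)"
proof (cases "v = 0")
  case True
  then show ?thesis
    by (auto simp: normal_law_def real_distribution_def real_distribution_axioms_def prob_space_return)
next
  case False
  then show ?thesis
    unfolding normal_law_eq[OF False]
    using prob_space_normal_density[of "sqrt \<bar>v\<bar>" 0]
    by (auto simp: real_distribution_def real_distribution_axioms_def)
qed

lemma char_normal_law: "char (normal_law v) t = complex_of_real (exp (- \<bar>v\<bar> * t\<^sup>2 / 2))"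
proof (cases "v = 0")
  case True
  have "char (return borel 0) t = iexp (t * 0)"
    unfolding char_def by (rule integral_return) auto
  then show ?thesis using True by (simp add: normal_law_def)
next
  case False
  define \<sigma> where "\<sigma> = sqrt \<bar>v\<bar>"
  have \<sigma>: "0 < \<sigma>" "\<sigma>\<^sup>2 = \<bar>v\<bar>" using False by (auto simp: \<sigma>_def)
  define M where "M = density lborel (normal_density 0 \<sigma>)"
  interpret M: prob_space M unfolding M_def by (rule prob_space_normal_density[OF \<sigma>(1)])
  have "distributed M lborel (\<lambda>x. x) (normal_density 0 \<sigma>)"
    unfolding distributed_def M_def by (auto simp: distr_id2)
  then have "distributed M lborel (\<lambda>x. (x - 0) / \<sigma>) std_normal_density"
    using M.normal_standard_normal_convert[OF \<sigma>(1), of "\<lambda>x. x" 0] by simp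
  then have d: "distr M lborel (\<lambda>x. x / \<sigma>) = std_normal_distribution"
    by (simp add: distributed_def)
  have "char M t = (\<integral>x. iexp ((t * \<sigma>) * (x / \<sigma>)) \<partial>M)"
    unfolding char_def using \<sigma> by (intro Bochner_Integration.integral_cong) auto
  also have "\<dots> = (\<integral>y. iexp ((t * \<sigma>) * y) \<partial>distr M lborel (\<lambda>x. x / \<sigma>))"
    by (rule integral_distr[symmetric]) (auto simp: M_def)
  also have "\<dots> = char std_normal_distribution (t * \<sigma>)" unfolding d char_def ..
  also have "\<dots> = complex_of_real (exp (- (t * \<sigma>)\<^sup>2 / 2))" by (simp add: char_std_normal_distribution)
  also have "(t * \<sigma>)\<^sup>2 = \<bar>v\<bar> * t\<^sup>2" by (simp add: power_mult_distrib \<sigma>)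
  finally show ?thesis
    unfolding normal_law_eq[OF False] M_def \<sigma>_def by (simp only: mult_minus_left)
qed

text \<open>For \<open>N < k\<close> the summand reads coordinates outside \<open>{1..N}\<close>, so
  measurability is available from \<open>N = k\<close> on; Levy's theorem is applied to the sequence
  started there.\<close>

lemma weak_conv_m_offset:
  assumes "weak_conv_m (\<lambda>n. M (n + k)) M'"
  shows "weak_conv_m M M'"
  unfolding weak_conv_m_def weak_conv_def
proof (intro allI impI)
  fix x assume "isCont (cdf M') x"
  with assms have "(\<lambda>n. cdf (M (n + k)) x) \<longlonglongrightarrow> cdf M' x"
    by (simp add: weak_conv_m_def weak_conv_def)
  then show "(\<lambda>n. cdf (M n) x) \<longlonglongrightarrow> cdf M' x"
    by (rule LIMSEQ_offset)
qed

section \<open>The limit theorem with its variance identified\<close>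

context weighted_obs
begin

lemma wsum_clt:
  "weak_conv_m (\<lambda>N. distr (config_law a b N) borel (\<lambda>\<eta>. wsum N \<eta> / sqrt N))
     (normal_law (sigma_T2 a b \<phi> g + sigma_E2 a b \<phi> k g))"
  and sigma_T2_nonneg: "0 \<le> sigma_T2 a b \<phi> g"
  and sigma_E2_nonneg: "0 \<le> sigma_E2 a b \<phi> k g"
proof -
  obtain D1 where D1: "continuous_on {a..b} D1"
    "\<And>x. x \<in> {a..b} \<Longrightarrow> (h_fun g has_real_derivative D1 x) (at x within {a..b})"
    using h_fun_C1 by blast
  obtain D2 where D2: "continuous_on {a..b} D2"
    "\<And>x. x \<in> {a..b} \<Longrightarrow> (V_fun k g has_real_derivative D2 x) (at x within {a..b})"
    using V_fun_C1 by blast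
  have rho_in: "rho a b s \<in> {a..b}" if "s \<in> {0..1}" for s
    using measurable_space[OF rho_measurable[OF ab], of s] that by simp
  obtain M1 where M1: "\<And>x. x \<in> {a..b} \<Longrightarrow> \<bar>D1 x\<bar> \<le> M1" using continuous_on_Icc_bounded[OF D1(1)] by blast
  obtain M2 where M2: "\<And>x. x \<in> {a..b} \<Longrightarrow> \<bar>D2 x\<bar> \<le> M2" using continuous_on_Icc_bounded[OF D2(1)] by blast
  have HS: "l_statistic a b (h_fun g) D1 \<phi> \<phi>' L W ((b - a) * M1)"
  proof
    show "\<bar>(b - a) * D1 (rho a b s)\<bar> \<le> (b - a) * M1" if "s \<in> {0..1}" for s
      using M1[OF rho_in[OF that]] ab by (simp add: abs_mult mult_left_mono)
  qed (fact ab D1 \<phi> \<phi>'_le \<phi>_le)+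
  have VS: "l_statistic a b (V_fun k g) D2 (\<lambda>s. (\<phi> s)\<^sup>2) (\<lambda>s. 2 * \<phi> s * \<phi>' s) (2 * W * L) (W * W) ((b - a) * M2)"
  proof
    show "\<bar>(b - a) * D2 (rho a b s)\<bar> \<le> (b - a) * M2" if "s \<in> {0..1}" for s
      using M2[OF rho_in[OF that]] ab by (simp add: abs_mult mult_left_mono)
    show "((\<lambda>s. (\<phi> s)\<^sup>2) has_real_derivative 2 * \<phi> s * \<phi>' s) (at s within {0..1})" if "s \<in> {0..1}" for s
      using DERIV_power[OF \<phi>[OF that], of 2] by (simp add: ac_simps)
    show "\<bar>2 * \<phi> s * \<phi>' s\<bar> \<le> 2 * W * L" if "s \<in> {0..1}" for s
      using mult_mono[OF \<phi>_le[OF that] \<phi>'_le[OF that] W0] by (simp add: abs_mult)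
    show "\<bar>(\<phi> s)\<^sup>2\<bar> \<le> W * W" if "s \<in> {0..1}" for s
      using mult_mono[OF \<phi>_le[OF that] \<phi>_le[OF that] W0] by (simp add: abs_mult power2_eq_square)
  qed (fact ab D2)+
  interpret H: l_statistic a b "h_fun g" D1 \<phi> \<phi>' L W "(b - a) * M1" by (rule HS)
  interpret V: l_statistic a b "V_fun k g" D2 "\<lambda>s. (\<phi> s)\<^sup>2" "\<lambda>s. 2 * \<phi> s * \<phi>' s" "2 * W * L" "W * W" "(b - a) * M2" by (rule VS)
  \<comment> \<open>On a nondegenerate closed interval the vector derivative is unique, also at the
    endpoints, so it is the continuous \<open>D1\<close>. The factor \<open>b - a\<close> of the two
    \<open>k'\<close> yields the square in \<open>sigma_T2\<close>.\<close>
  have T: "H.noise_var = sigma_T2 a b \<phi> g"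
  proof -
    have vd: "vector_derivative (h_fun g) (at x within {a..b}) = D1 x" if "x \<in> {a..b}" for x
      using ab that D1(2)[OF that]
      by (intro vector_derivative_within_closed_interval) (simp_all add: has_real_derivative_iff_has_vector_derivative)
    have "sigma_T2 a b \<phi> g = (b - a)\<^sup>2 * (\<integral>s. \<integral>t. (min s t - s * t) * \<phi> s * \<phi> t * D1 (rho a b s) * D1 (rho a b t) \<partial>unit_law \<partial>unit_law)"
      unfolding sigma_T2_def Let_def set_lebesgue_integral_unit_law
      by (intro arg_cong2[where f="(*)"] refl Bochner_Integration.integral_cong)
         (simp_all only: space_unit_law vd rho_in)
    also have "\<dots> = (\<integral>s. \<integral>t. (b - a)\<^sup>2 * ((min s t - s * t) * \<phi> s * \<phi> t * D1 (rho a b s) * D1 (rho a b t)) \<partial>unit_law \<partial>unit_law)"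
      by simp
    also have "\<dots> = H.noise_var"
      unfolding H.noise_var_eq H.J_def H.k'_def
      by (intro Bochner_Integration.integral_cong refl) (simp add: power2_eq_square ac_simps)
    finally show ?thesis by simp
  qed
  have E: "V.lmean = sigma_E2 a b \<phi> k g"
    by (simp add: V.lmean_def sigma_E2_def set_lebesgue_integral_unit_law)
  show T0: "0 \<le> sigma_T2 a b \<phi> g" using H.noise_var_nonneg T by simp
  \<comment> \<open>Nonnegativity does not involve the argument of the characteristic function; 0 is
    an arbitrary choice.\<close>
  obtain C where E0: "0 \<le> V.lmean" by (rule char_error[OF HS VS, of 0]) blast
  then show E0': "0 \<le> sigma_E2 a b \<phi> k g" using E by simp
  define v where "v = sigma_T2 a b \<phi> g + sigma_E2 a b \<phi> k g"
  have v0: "0 \<le> v" using T0 E0' by (simp add: v_def)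
  define M where "M N = distr (config_law a b N) borel (\<lambda>\<eta>. wsum N \<eta> / sqrt N)" for N
  have m: "(\<lambda>\<eta>. wsum N \<eta> / sqrt N) \<in> borel_measurable (config_law a b N)" if "k \<le> N" for N
    unfolding measurable_cong_sets[OF sets_config_law[OF ab a0] refl] using wsum_measurable[OF that] by measurable
  have "weak_conv_m M (normal_law v)"
  proof (rule weak_conv_m_offset[of M k], rule levy_continuity)
    show "real_distribution (M (n + k))" for n
    proof -
      interpret prob_space "config_law a b (n + k)" using ab a0 by simp
      show ?thesis unfolding M_def by (rule real_distribution_distr[OF m]) simp
    qed
    show "real_distribution (normal_law v)" by (rule real_distribution_normal_law)
    fix t
    obtain C where C: "\<And>N. k \<le> N \<Longrightarrow> cmod ((\<integral>\<eta>. iexp (t * (wsum N \<eta> / sqrt N)) \<partial>config_law a b N)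
       - complex_of_real (exp (- (H.noise_var + V.lmean) * t\<^sup>2 / 2))) \<le> C / sqrt N"
      by (rule char_error[OF HS VS, of t]) blast
    have chM: "char (M N) t = (\<integral>\<eta>. iexp (t * (wsum N \<eta> / sqrt N)) \<partial>config_law a b N)" if "k \<le> N" for N
      unfolding char_def M_def by (rule integral_distr[OF m[OF that]]) simp
    have chv: "char (normal_law v) t = complex_of_real (exp (- (H.noise_var + V.lmean) * t\<^sup>2 / 2))"
      unfolding char_normal_law T E v_def[symmetric] using v0 by simp
    show "(\<lambda>n. char (M (n + k)) t) \<longlonglongrightarrow> char (normal_law v) t"
    proof (rule LIM_zero_cancel, rule Lim_null_comparison)
      show "\<forall>\<^sub>F n in sequentially. cmod (char (M (n + k)) t - char (normal_law v) t) \<le> C / sqrt (real (n + k))"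
        unfolding chM[OF le_add2] chv by (intro always_eventually allI C[OF le_add2])
      have "(\<lambda>n. C / sqrt (real n)) \<longlonglongrightarrow> 0" by real_asymp
      then show "(\<lambda>n. C / sqrt (real (n + k))) \<longlonglongrightarrow> 0" by (rule LIMSEQ_ignore_initial_segment)
    qed
  qed
  then show "weak_conv_m (\<lambda>N. distr (config_law a b N) borel (\<lambda>\<eta>. wsum N \<eta> / sqrt N))
     (normal_law (sigma_T2 a b \<phi> g + sigma_E2 a b \<phi> k g))"
    unfolding M_def v_def .
qed

end

lemma smooth_on_unit_C1:
  assumes "smooth_on_unit \<phi>"
  obtains \<phi>' L W where "\<And>s. s \<in> {0..1} \<Longrightarrow> (\<phi> has_real_derivative \<phi>' s) (at s within {0..1})"
    "\<And>s. s \<in> {0..1} \<Longrightarrow> \<bar>\<phi>' s\<bar> \<le> L" "\<And>s. s \<in> {0..1} \<Longrightarrow> \<bar>\<phi> s\<bar> \<le> W"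
proof -
  from assms obtain D where D: "\<And>x. x \<in> {0..1} \<Longrightarrow> D 0 x = \<phi> x"
    "\<And>n x. x \<in> {0..1} \<Longrightarrow> (D n has_real_derivative D (Suc n) x) (at x within {0..1})"
    unfolding smooth_on_unit_def by blast
  have d: "(\<phi> has_real_derivative D 1 s) (at s within {0..1})" if "s \<in> {0..1}" for s
    using D(2)[OF that, of 0] D(1) that
    by (subst has_field_derivative_cong_eventually[where g="D 0"]) (auto simp: eventually_at_filter One_nat_def)
  have c1: "continuous_on {0..1} (D 1)" by (rule DERIV_continuous_on[OF D(2)])
  have c0: "continuous_on {0..1} \<phi>" by (rule DERIV_continuous_on[OF d])
  obtain L where L: "\<And>x. x \<in> {0..1} \<Longrightarrow> \<bar>D 1 x\<bar> \<le> L" using continuous_on_Icc_bounded[OF c1] by blast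
  obtain W where W: "\<And>x. x \<in> {0..1} \<Longrightarrow> \<bar>\<phi> x\<bar> \<le> W" using continuous_on_Icc_bounded[OF c0] by blast
  show thesis by (rule that[OF d L W])
qed

text \<open>\<open>d = 0\<close> gives the weights of the general sum, which starts at 0, and
  \<open>d = 1\<close> those of the coordinate sum, which starts at 1.\<close>

lemma weighted_obsI:
  assumes G: "local_obs a b k g" and d: "d \<le> 1"
    and \<phi>: "\<And>s. s \<in> {0..1} \<Longrightarrow> (\<phi> has_real_derivative \<phi>' s) (at s within {0..1})"
    and L: "\<And>s. s \<in> {0..1} \<Longrightarrow> \<bar>\<phi>' s\<bar> \<le> L" and W: "\<And>s. s \<in> {0..1} \<Longrightarrow> \<bar>\<phi> s\<bar> \<le> W"
  shows "weighted_obs a b k g \<phi> \<phi>' (\<lambda>N n. \<phi> (real (n + d) / real (N + 1))) L W (2 * L)"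
proof -
  interpret local_obs a b k g by (rule G)
  have L0: "0 \<le> L" using L[of 0] by simp
  show ?thesis
  proof
    fix N n assume nk: "n + k \<le> N"
    then have N: "0 < real N" "n + 1 \<le> N" using k by auto
    have p: "real (n + d) / real (N + 1) \<in> {0..1}" "real (n + 1) / real N \<in> {0..1}"
      using N d by auto
    show "\<bar>\<phi> (real (n + d) / real (N + 1))\<bar> \<le> W" by (rule W[OF p(1)])
    have "\<bar>\<phi> (real (n + d) / real (N + 1)) - \<phi> (real (n + 1) / N)\<bar> \<le> L * \<bar>real (n + d) / real (N + 1) - real (n + 1) / N\<bar>"
      using field_differentiable_bound[OF convex_real_interval(5) \<phi>, of L _ "real (n + 1) / real N"] p L by auto
    also have "\<dots> \<le> L * (2 / N)"
    proof (rule mult_left_mono[OF _ L0])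
      \<comment> \<open>The evaluation point lies between \<open>n / (N + 1)\<close> and
        \<open>(n + 1) / N\<close>, whose distance is at most \<open>2 / N\<close>.\<close>
      have lo: "real n / real (N + 1) \<le> real (n + d) / real (N + 1)" by (intro divide_right_mono) auto
      have up: "real (n + d) / real (N + 1) \<le> real (n + 1) / real N"
        using d N by (intro frac_le) auto
      have "real (n + 1) / real N - real n / real (N + 1) = (real n + real N + 1) / (real N * (real N + 1))"
        using N by (simp add: field_simps)
      also have "\<dots> \<le> (2 * (real N + 1)) / (real N * (real N + 1))"
        using N by (intro divide_right_mono) auto
      also have "\<dots> = 2 / N" by (rule mult_divide_mult_cancel_right) simp
      finally show "\<bar>real (n + d) / real (N + 1) - real (n + 1) / N\<bar> \<le> 2 / N"
        using lo up by linarith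
    qed
    finally show "\<bar>\<phi> (real (n + d) / real (N + 1)) - \<phi> (real (n + 1) / N)\<bar> \<le> 2 * L / N"
      by (simp only: times_divide_eq_right mult.commute[of L 2])
  qed (use \<phi> L W L0 in auto)
qed

lemma fluctuation_clt:
  assumes "0 \<le> a" "a < b" "smooth_on_unit \<phi>" "1 \<le> k" "local_function k g"
    and int: "integrable (nu_prod {1..k} (\<lambda>_. b)) g"
    and int4: "integrable (nu_prod {1..k} (\<lambda>_. b)) (\<lambda>\<eta>. (g \<eta> - c) ^ 4)"
  shows "weak_conv_m (\<lambda>N. distr (config_law a b N) borel (fluctuation a b \<phi> k g N))
    (normal_law (sigma_T2 a b \<phi> g + sigma_E2 a b \<phi> k g))"
proof -
  obtain \<phi>' L W where \<phi>: "\<And>s. s \<in> {0..1} \<Longrightarrow> (\<phi> has_real_derivative \<phi>' s) (at s within {0..1})"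
    "\<And>s. s \<in> {0..1} \<Longrightarrow> \<bar>\<phi>' s\<bar> \<le> L" "\<And>s. s \<in> {0..1} \<Longrightarrow> \<bar>\<phi> s\<bar> \<le> W"
    using smooth_on_unit_C1[OF assms(3)] by blast
  interpret weighted_obs a b k g \<phi> \<phi>' "\<lambda>N n. \<phi> (real (n + 0) / real (N + 1))" L W "2 * L"
    by (rule weighted_obsI[OF local_obsI[OF assms(1,2,4,5) int int4] _ \<phi>]) simp_all
  have "fluctuation a b \<phi> k g N \<eta> = wsum N \<eta> / sqrt N" for N \<eta>
    unfolding fluctuation_def wsum_def mean_def
    by (simp only: add_0_right times_divide_eq_left mult_1_left)
  then have eq: "fluctuation a b \<phi> k g N = (\<lambda>\<eta>. wsum N \<eta> / sqrt N)" for N by (intro ext)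
  show ?thesis unfolding eq by (rule wsum_clt)
qed

section \<open>The Brownian bridge and the white noise\<close>

text \<open>By the mean value theorem for the primitive, the integral over each cell equals its
  length times a value of \<open>f\<close> inside the cell. Only the oscillation over one cell is
  lost.\<close>

lemma riemann_sum_error:
  fixes f :: "real \<Rightarrow> real"
  assumes cont: "continuous_on {0..1} f" and n: "0 < n"
    and osc: "\<And>x y. x \<in> {0..1} \<Longrightarrow> y \<in> {0..1} \<Longrightarrow> \<bar>x - y\<bar> \<le> 1 / real n \<Longrightarrow> \<bar>f x - f y\<bar> \<le> e"
  shows "\<bar>(\<Sum>i<n. f (real i / real n) / real n) - (\<integral>s. f s \<partial>unit_law)\<bar> \<le> e"
proof -
  define F where "F x = integral {0..x} f" for x
  have dF: "(F has_real_derivative f x) (at x within {0..1})" if "x \<in> {0..1}" for x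
    unfolding F_def by (rule integral_has_real_derivative[OF cont that])
  have int: "(\<integral>s. f s \<partial>unit_law) = F 1"
  proof -
    have "set_integrable lborel {0..1} f" by (rule borel_integrable_atLeastAtMost'[OF cont])
    then show ?thesis
      unfolding set_lebesgue_integral_unit_law[symmetric] F_def by (rule set_borel_integral_eq_integral)
  qed
  have step_le: "\<bar>f (real i / real n) / real n - (F (real (i + 1) / real n) - F (real i / real n))\<bar> \<le> e / real n"
    if i: "i < n" for i
  proof -
    define x y where "x = real i / real n" and "y = real (i + 1) / real n"
    have xy: "x < y" "x \<in> {0..1}" "y \<in> {0..1}" "y - x = 1 / real n"
      using i n by (auto simp: x_def y_def divide_simps)
    have sub: "{x..y} \<subseteq> {0..1}" using xy by auto
    have "\<exists>z\<in>{x<..<y}. F y - F x = (y - x) * f z"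
    proof (rule mvt_simple[OF xy(1), of F "\<lambda>z d. d * f z"])
      fix z assume "x \<le> z" "z \<le> y"
      then have "(F has_real_derivative f z) (at z within {x..y})"
        using sub by (intro DERIV_subset[OF dF sub]) auto
      then show "(F has_derivative (\<lambda>d. d * f z)) (at z within {x..y})"
        by (simp add: has_field_derivative_def mult.commute[of _ "f z"])
    qed
    then obtain z where z: "x < z" "z < y" "F y - F x = f z / real n" using xy by auto
    have "\<bar>f x - f z\<bar> \<le> e" using z xy by (intro osc) auto
    then have "\<bar>f x - f z\<bar> / real n \<le> e / real n" by (rule divide_right_mono) simp
    then show ?thesis
      unfolding x_def[symmetric] y_def[symmetric] z(3)
      by (simp add: abs_divide flip: diff_divide_distrib)
  qed
  have "F 1 = (\<Sum>i<n. F (real (i + 1) / real n) - F (real i / real n))"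
    using n sum_lessThan_telescope[of "\<lambda>i. F (real i / real n)" n] by (simp add: F_def ac_simps)
  then have "\<bar>(\<Sum>i<n. f (real i / real n) / real n) - F 1\<bar> =
      \<bar>\<Sum>i<n. f (real i / real n) / real n - (F (real (i + 1) / real n) - F (real i / real n))\<bar>"
    by (simp add: sum_subtractf)
  also have "\<dots> \<le> (\<Sum>i<n. e / real n)"
    by (rule order_trans[OF sum_abs sum_mono]) (use step_le in auto)
  also have "\<dots> = e" using n by simp
  finally show ?thesis unfolding int .
qed

lemma riemann_sum_tendsto:
  fixes f :: "real \<Rightarrow> real"
  assumes cont: "continuous_on {0..1} f"
  shows "(\<lambda>n. \<Sum>i<n. f (real i / real n) / real n) \<longlonglongrightarrow> (\<integral>s. f s \<partial>unit_law)"
proof (rule LIMSEQ_I)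
  fix e :: real assume e: "0 < e"
  have "uniformly_continuous_on {0..1} f" by (rule compact_uniformly_continuous[OF cont]) simp
  then obtain d where d: "0 < d" "\<And>x y. x \<in> {0..1} \<Longrightarrow> y \<in> {0..1} \<Longrightarrow> dist y x < d \<Longrightarrow> dist (f y) (f x) < e / 2"
    using e unfolding uniformly_continuous_on_def by (metis half_gt_zero)
  obtain n0 :: nat where n0: "1 / d < real n0" using reals_Archimedean2 by blast
  show "\<exists>no. \<forall>n\<ge>no. norm ((\<Sum>i<n. f (real i / real n) / real n) - (\<integral>s. f s \<partial>unit_law)) < e"
  proof (intro exI allI impI)
    fix n assume n: "n0 \<le> n"
    have "1 / d < real n" using n0 n by linarith
    moreover have "0 < 1 / d" using d(1) by simp
    ultimately have n1: "0 < real n" and d1: "1 / d < real n" by linarith+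
    have n2: "1 / real n < d" using d1 n1 d(1) by (simp add: field_simps)
    have "\<bar>(\<Sum>i<n. f (real i / real n) / real n) - (\<integral>s. f s \<partial>unit_law)\<bar> \<le> e / 2"
    proof (rule riemann_sum_error[OF cont])
      fix x y :: real assume "x \<in> {0..1}" "y \<in> {0..1}" "\<bar>x - y\<bar> \<le> 1 / real n"
      then show "\<bar>f x - f y\<bar> \<le> e / 2" using d(2)[of y x] n2 by (auto simp: dist_real_def)
    qed (use n1 in simp)
    then show "norm ((\<Sum>i<n. f (real i / real n) / real n) - (\<integral>s. f s \<partial>unit_law)) < e" using e by simp
  qed
qed

text \<open>The one-dimensional estimate is used for each section of \<open>K\<close> and then for
  the inner integral \<open>G\<close>, whose oscillation is controlled by that of \<open>K\<close>
  uniformly in the other variable.\<close>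

lemma riemann_sum2_tendsto:
  fixes K :: "real \<Rightarrow> real \<Rightarrow> real"
  assumes cont: "continuous_on ({0..1} \<times> {0..1}) (\<lambda>(s, t). K s t)"
  shows "(\<lambda>n. \<Sum>i<n. (\<Sum>j<n. K (real i / real n) (real j / real n) / real n) / real n)
    \<longlonglongrightarrow> (\<integral>s. \<integral>t. K s t \<partial>unit_law \<partial>unit_law)"
proof (rule LIMSEQ_I)
  fix e :: real assume e: "0 < e"
  interpret U: prob_space unit_law by simp
  have "uniformly_continuous_on ({0..1} \<times> {0..1}) (\<lambda>(s, t). K s t)"
    by (rule compact_uniformly_continuous[OF cont]) (simp add: compact_Times)
  then have uc: "\<exists>d>0. \<forall>p\<in>{0..1} \<times> {0..1}. \<forall>q\<in>{0..1} \<times> {0..1}. dist q p < d \<longrightarrow>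
      dist ((\<lambda>(s, t). K s t) q) ((\<lambda>(s, t). K s t) p) < r" if "0 < r" for r
    using that unfolding uniformly_continuous_on_def by blast
  have cs: "continuous_on {0..1} (K s)" if "s \<in> {0..1}" for s
  proof -
    have "continuous_on {0..1} ((\<lambda>(s, t). K s t) \<circ> (\<lambda>t. (s, t)))"
      by (rule continuous_on_compose) (auto intro!: continuous_intros continuous_on_subset[OF cont] that)
    then show ?thesis by (simp add: comp_def)
  qed
  define G where "G s = (\<integral>t. K s t \<partial>unit_law)" for s
  have Gosc: "\<bar>G s - G s'\<bar> \<le> r" if "s \<in> {0..1}" "s' \<in> {0..1}" and le: "\<And>t. t \<in> {0..1} \<Longrightarrow> \<bar>K s t - K s' t\<bar> \<le> r" for s s' r
  proof -
    have "G s - G s' = (\<integral>t. K s t - K s' t \<partial>unit_law)"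
      unfolding G_def using that cs by (intro Bochner_Integration.integral_diff[symmetric] continuous_on_integrable_unit_law) auto
    moreover have "norm (\<integral>t. K s t - K s' t \<partial>unit_law) \<le> (\<integral>t. r \<partial>unit_law)"
      by (rule norm_integral_le) (use le in auto)
    ultimately show ?thesis by (simp add: U.prob_space)
  qed
  have contG: "continuous_on {0..1} G"
  proof (rule uniformly_continuous_imp_continuous, unfold uniformly_continuous_on_def, intro allI impI)
    fix r :: real assume r: "0 < r"
    obtain d where d: "0 < d" "\<forall>p\<in>{0..1} \<times> {0..1}. \<forall>q\<in>{0..1} \<times> {0..1}. dist q p < d \<longrightarrow>
      dist ((\<lambda>(s, t). K s t) q) ((\<lambda>(s, t). K s t) p) < r / 2" using uc[of "r / 2"] r by auto
    show "\<exists>d>0. \<forall>x\<in>{0..1}. \<forall>x'\<in>{0..1}. dist x' x < d \<longrightarrow> dist (G x') (G x) < r"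
    proof (intro exI[of _ d] conjI ballI impI)
      fix x x' :: real assume x: "x \<in> {0..1}" "x' \<in> {0..1}" "dist x' x < d"
      have "\<bar>G x' - G x\<bar> \<le> r / 2"
      proof (rule Gosc[OF x(2,1)])
        fix t :: real assume t: "t \<in> {0..1}"
        have "dist ((\<lambda>(s, t). K s t) (x', t)) ((\<lambda>(s, t). K s t) (x, t)) < r / 2"
          using x t by (intro d(2)[rule_format]) (auto simp: dist_Pair_Pair)
        then show "\<bar>K x' t - K x t\<bar> \<le> r / 2" by (simp add: dist_real_def)
      qed
      then show "dist (G x') (G x) < r" using r by (simp add: dist_real_def)
    qed (use d in simp)
  qed
  obtain d where d: "0 < d" "\<forall>p\<in>{0..1} \<times> {0..1}. \<forall>q\<in>{0..1} \<times> {0..1}. dist q p < d \<longrightarrow>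
    dist ((\<lambda>(s, t). K s t) q) ((\<lambda>(s, t). K s t) p) < e / 4" using uc[of "e / 4"] e by auto
  obtain n0 :: nat where n0: "1 / d < real n0" using reals_Archimedean2 by blast
  show "\<exists>no. \<forall>n\<ge>no. norm ((\<Sum>i<n. (\<Sum>j<n. K (real i / real n) (real j / real n) / real n) / real n)
      - (\<integral>s. \<integral>t. K s t \<partial>unit_law \<partial>unit_law)) < e"
  proof (intro exI allI impI)
    fix n assume n: "n0 \<le> n"
    have "1 / d < real n" using n0 n by linarith
    moreover have "0 < 1 / d" using d(1) by simp
    ultimately have n1: "0 < real n" and d1: "1 / d < real n" by linarith+
    have n2: "1 / real n < d" using d1 n1 d(1) by (simp add: field_simps)
    have close: "\<bar>K s t - K s' t'\<bar> \<le> e / 4"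
      if "s \<in> {0..1}" "t \<in> {0..1}" "s' \<in> {0..1}" "t' \<in> {0..1}" "dist (s, t) (s', t') \<le> 1 / real n" for s t s' t'
      using that n2 d(2)[rule_format, of "(s', t')" "(s, t)"] by (auto simp: dist_real_def)
    have outer: "\<bar>(\<Sum>i<n. G (real i / real n) / real n) - (\<integral>s. G s \<partial>unit_law)\<bar> \<le> e / 4"
    proof (rule riemann_sum_error[OF contG])
      fix x y :: real assume xy: "x \<in> {0..1}" "y \<in> {0..1}" "\<bar>x - y\<bar> \<le> 1 / real n"
      show "\<bar>G x - G y\<bar> \<le> e / 4"
        by (rule Gosc[OF xy(1,2)]) (intro close, use xy in \<open>auto simp: dist_Pair_Pair dist_real_def\<close>)
    qed (use n1 in simp)
    have inner: "\<bar>(\<Sum>j<n. K s (real j / real n) / real n) - G s\<bar> \<le> e / 4" if "s \<in> {0..1}" for s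
      unfolding G_def
    proof (rule riemann_sum_error[OF cs[OF that]])
      fix x y :: real assume xy: "x \<in> {0..1}" "y \<in> {0..1}" "\<bar>x - y\<bar> \<le> 1 / real n"
      show "\<bar>K s x - K s y\<bar> \<le> e / 4"
        by (intro close that xy) (use xy in \<open>simp add: dist_Pair_Pair dist_real_def\<close>)
    qed (use n1 in simp)
    have "\<bar>(\<Sum>i<n. (\<Sum>j<n. K (real i / real n) (real j / real n) / real n) / real n) - (\<Sum>i<n. G (real i / real n) / real n)\<bar>
        = \<bar>\<Sum>i<n. ((\<Sum>j<n. K (real i / real n) (real j / real n) / real n) - G (real i / real n)) / real n\<bar>"
      by (simp add: sum_subtractf diff_divide_distrib)
    also have "\<dots> \<le> (\<Sum>i<n. e / 4 / real n)"
    proof (rule order_trans[OF sum_abs sum_mono])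
      fix i assume "i \<in> {..<n}"
      then have "real i / real n \<in> {0..1}" by simp
      from divide_right_mono[OF inner[OF this], of "real n"]
      show "\<bar>((\<Sum>j<n. K (real i / real n) (real j / real n) / real n) - G (real i / real n)) / real n\<bar> \<le> e / 4 / real n"
        by (simp add: abs_divide)
    qed
    also have "\<dots> = e / 4" using n1 by simp
    finally show "norm ((\<Sum>i<n. (\<Sum>j<n. K (real i / real n) (real j / real n) / real n) / real n)
      - (\<integral>s. \<integral>t. K s t \<partial>unit_law \<partial>unit_law)) < e"
      using outer e unfolding G_def real_norm_def by linarith
  qed
qed

lemma char_distr_eq:
  assumes "X \<in> borel_measurable M"
  shows "char (distr M borel X) t = (\<integral>\<omega>. iexp (t * X \<omega>) \<partial>M)"
  unfolding char_def by (rule integral_distr[OF assms]) simp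

text \<open>By continuity of the paths the integral is a pointwise limit of Riemann sums. These are
  finite linear combinations of the process, so their laws are Gaussian by definition; the variances
  converge as double Riemann sums and the characteristic functions by dominated convergence.\<close>

lemma bridge_integral:
  fixes P :: "'b measure"
  assumes B: "brownian_bridge P B" and \<phi>: "continuous_on {0..1} \<phi>"
  defines "T \<equiv> \<lambda>\<omega>. LBINT s:{0..1}. \<phi> s * B s \<omega>"
    and "v \<equiv> \<integral>s. \<integral>t. (min s t - s * t) * \<phi> s * \<phi> t \<partial>unit_law \<partial>unit_law"
  shows bridge_integral_measurable_vimage:
      "T \<in> borel_measurable (vimage_algebra (space P) (\<lambda>\<omega>. \<lambda>i\<in>{0..1}. B i \<omega>) (\<Pi>\<^sub>M i\<in>{0..1}. borel))"
    and bridge_integral_measurable: "T \<in> borel_measurable P"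
    and char_bridge_integral: "char (distr P borel T) t = complex_of_real (exp (- \<bar>v\<bar> * t\<^sup>2 / 2))"
proof -
  have G: "centered_gaussian_process P {0..1} (\<lambda>s t. min s t - s * t) B"
    and path: "\<And>\<omega>. \<omega> \<in> space P \<Longrightarrow> continuous_on {0..1} (\<lambda>s. B s \<omega>)"
    using B by (auto simp: brownian_bridge_def)
  then have Bm: "\<And>s. s \<in> {0..1} \<Longrightarrow> B s \<in> borel_measurable P" and "prob_space P"
    and law: "\<And>F a. finite F \<Longrightarrow> F \<subseteq> {0..1} \<Longrightarrow> distr P borel (\<lambda>\<omega>. \<Sum>i\<in>F. a i * B i \<omega>) =
        normal_law (\<Sum>i\<in>F. \<Sum>j\<in>F. a i * a j * (min i j - i * j))"
    by (auto simp: centered_gaussian_process_def)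
  interpret prob_space P by fact
  \<comment> \<open>The sigma-algebra generated by the bridge. Measurability of \<open>T\<close>
    with respect to it, and not just with respect to \<open>P\<close>, is what independence from the
    noise will be applied to.\<close>
  define V where "V = vimage_algebra (space P) (\<lambda>\<omega>. \<lambda>i\<in>{0..1}. B i \<omega>) (\<Pi>\<^sub>M i\<in>{0..1::real}. borel :: real measure)"
  have spV: "space V = space P" by (simp add: V_def)
  define Tn where "Tn n \<omega> = (\<Sum>i<n. \<phi> (real i / real n) / real n * B (real i / real n) \<omega>)" for n :: nat and \<omega>
  have lim: "(\<lambda>n. Tn n \<omega>) \<longlonglongrightarrow> T \<omega>" if "\<omega> \<in> space P" for \<omega>
  proof -
    have "continuous_on {0..1} (\<lambda>s. \<phi> s * B s \<omega>)" by (intro continuous_intros \<phi> path[OF that])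
    from riemann_sum_tendsto[OF this] show ?thesis
      unfolding T_def set_lebesgue_integral_unit_law Tn_def by simp
  qed
  have pt: "real i / real n \<in> {0..1}" if "i < n" for i n :: nat using that by simp
  have BV: "B s \<in> borel_measurable V" if s: "s \<in> {0..1}" for s
  proof -
    have "(\<lambda>\<omega>. \<lambda>i\<in>{0..1}. B i \<omega>) \<in> V \<rightarrow>\<^sub>M (\<Pi>\<^sub>M i\<in>{0..1}. borel)"
      unfolding V_def by (rule measurable_vimage_algebra1) (auto simp: space_PiM)
    from measurable_compose[OF this measurable_component_singleton[OF s]] s show ?thesis by simp
  qed
  have TnV: "Tn n \<in> borel_measurable V" for n
    unfolding Tn_def by (intro borel_measurable_sum borel_measurable_times borel_measurable_const BV pt) simp
  have TnP: "Tn n \<in> borel_measurable P" for n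
    unfolding Tn_def by (intro borel_measurable_sum borel_measurable_times borel_measurable_const Bm pt) simp
  show "T \<in> borel_measurable (vimage_algebra (space P) (\<lambda>\<omega>. \<lambda>i\<in>{0..1}. B i \<omega>) (\<Pi>\<^sub>M i\<in>{0..1}. borel))"
    using borel_measurable_LIMSEQ_real[OF lim TnV] by (simp add: spV V_def)
  show TP: "T \<in> borel_measurable P"
    by (rule borel_measurable_LIMSEQ_real[OF lim TnP])
  define K where "K s t = (min s t - s * t) * \<phi> s * \<phi> t" for s t :: real
  define vn where "vn n = (\<Sum>i<n. (\<Sum>j<n. K (real i / real n) (real j / real n) / real n) / real n)" for n
  have "continuous_on ({0..1} \<times> {0..1}) (\<lambda>(s, t). K s t)"
    unfolding K_def split_def
    by (intro continuous_intros continuous_on_compose2[OF \<phi>]) auto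
  then have vlim: "vn \<longlonglongrightarrow> v"
    unfolding vn_def v_def K_def[symmetric] by (rule riemann_sum2_tendsto)
  have "distr P borel (Tn n) = normal_law (vn n)" for n
  proof -
    \<comment> \<open>The sample points are distinct, so the Riemann sum can be indexed by the
      points themselves, as the definition of a Gaussian process demands.\<close>
    define F where "F = (\<lambda>i. real i / real n) ` {..<n}"
    have inj: "inj_on (\<lambda>i. real i / real n) {..<n}" by (auto simp: inj_on_def)
    have "Tn n = (\<lambda>\<omega>. \<Sum>s\<in>F. \<phi> s / real n * B s \<omega>)"
      unfolding F_def sum.reindex[OF inj] Tn_def by (simp add: comp_def fun_eq_iff)
    moreover have "(\<Sum>s\<in>F. \<Sum>t\<in>F. \<phi> s / real n * (\<phi> t / real n) * (min s t - s * t)) = vn n"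
      unfolding F_def sum.reindex[OF inj] vn_def K_def comp_def sum_divide_distrib
      by (intro sum.cong refl) simp
    moreover have "finite F" "F \<subseteq> {0..1}" by (auto simp: F_def)
    ultimately show ?thesis using law[of F "\<lambda>s. \<phi> s / real n"] by simp
  qed
  then have chn: "(\<integral>\<omega>. iexp (t * Tn n \<omega>) \<partial>P) = complex_of_real (exp (- \<bar>vn n\<bar> * t\<^sup>2 / 2))" for n
    using char_distr_eq[OF TnP, of n t] char_normal_law[of "vn n" t] by simp
  have "(\<lambda>n. \<integral>\<omega>. iexp (t * Tn n \<omega>) \<partial>P) \<longlonglongrightarrow> (\<integral>\<omega>. iexp (t * T \<omega>) \<partial>P)"
  proof (rule integral_dominated_convergence[where w="\<lambda>_. 1"])
    show "AE \<omega> in P. (\<lambda>n. iexp (t * Tn n \<omega>)) \<longlonglongrightarrow> iexp (t * T \<omega>)"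
      by (intro AE_I2 tendsto_intros lim)
  qed (use TP TnP in auto)
  moreover have "(\<lambda>n. complex_of_real (exp (- \<bar>vn n\<bar> * t\<^sup>2 / 2))) \<longlonglongrightarrow> complex_of_real (exp (- \<bar>v\<bar> * t\<^sup>2 / 2))"
    by (intro tendsto_intros vlim) simp
  ultimately show "char (distr P borel T) t = complex_of_real (exp (- \<bar>v\<bar> * t\<^sup>2 / 2))"
    unfolding char_distr_eq[OF TP] chn by (rule LIMSEQ_unique)
qed

text \<open>By independence the characteristic functions of bridge integral and noise multiply, and
  Levy's uniqueness theorem identifies the law of the sum. The absolute values are those of
  \<open>char_normal_law\<close>.\<close>

lemma law_bridge_plus_noise:
  fixes P :: "'b measure"
  assumes B: "brownian_bridge P B" and W: "white_noise P f W"
    and ind: "independent_processes P {0..1} B (Collect smooth_on_unit) W"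
    and \<phi>: "smooth_on_unit \<phi>" "continuous_on {0..1} \<phi>"
  defines "v \<equiv> \<integral>s. \<integral>t. (min s t - s * t) * \<phi> s * \<phi> t \<partial>unit_law \<partial>unit_law"
    and "w \<equiv> LBINT x:{0..1}. f x * (\<phi> x * \<phi> x)"
  shows "distr P borel (\<lambda>\<omega>. c * (LBINT s:{0..1}. \<phi> s * B s \<omega>) + W \<phi> \<omega>) = normal_law (c\<^sup>2 * \<bar>v\<bar> + \<bar>w\<bar>)"
proof -
  define T where "T \<omega> = (LBINT s:{0..1}. \<phi> s * B s \<omega>)" for \<omega>
  note T = bridge_integral_measurable_vimage[OF B \<phi>(2), folded T_def]
    bridge_integral_measurable[OF B \<phi>(2), folded T_def] char_bridge_integral[OF B \<phi>(2), folded T_def v_def]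
  have Wm: "W \<phi> \<in> borel_measurable P" and "prob_space P"
    and "\<And>F a. finite F \<Longrightarrow> F \<subseteq> Collect smooth_on_unit \<Longrightarrow> distr P borel (\<lambda>\<omega>. \<Sum>i\<in>F. a i * W i \<omega>) =
        normal_law (\<Sum>i\<in>F. \<Sum>j\<in>F. a i * a j * (LBINT x:{0..1}. f x * (i x * j x)))"
    using W \<phi>(1) by (auto simp: white_noise_def centered_gaussian_process_def)
  from this(3)[of "{\<phi>}" "\<lambda>_. 1"] have lawW: "distr P borel (W \<phi>) = normal_law w"
    using \<phi>(1) by (simp add: w_def)
  interpret prob_space P by fact
  define mB where "mB = vimage_algebra (space P) (\<lambda>\<omega>. \<lambda>i\<in>{0..1}. B i \<omega>) (\<Pi>\<^sub>M i\<in>{0..1::real}. borel :: real measure)"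
  define mW where "mW = vimage_algebra (space P) (\<lambda>\<omega>. \<lambda>i\<in>Collect smooth_on_unit. W i \<omega>) (\<Pi>\<^sub>M i\<in>Collect smooth_on_unit. borel :: real measure)"
  have sp: "space mB = space P" "space mW = space P" by (simp_all add: mB_def mW_def)
  have TB: "(\<lambda>\<omega>. c * T \<omega>) \<in> borel_measurable mB" unfolding mB_def by (intro borel_measurable_times borel_measurable_const T)
  have WW: "W \<phi> \<in> borel_measurable mW"
  proof -
    have "(\<lambda>\<omega>. \<lambda>i\<in>Collect smooth_on_unit. W i \<omega>) \<in> mW \<rightarrow>\<^sub>M (\<Pi>\<^sub>M i\<in>Collect smooth_on_unit. borel)"
      unfolding mW_def by (rule measurable_vimage_algebra1) (auto simp: space_PiM)
    from measurable_compose[OF this measurable_component_singleton[of \<phi>]] \<phi>(1) show ?thesis by simp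
  qed
  have sub: "sigma_sets (space P) {X -` A \<inter> space P |A. A \<in> sets borel} \<subseteq> sets M"
    if "X \<in> borel_measurable M" "space M = space P" for X :: "'b \<Rightarrow> real" and M
  proof -
    have "{X -` A \<inter> space P |A. A \<in> sets borel} \<subseteq> sets M"
      using measurable_sets[OF that(1)] that(2) by auto
    from sets.sigma_sets_subset[OF this] that(2) show ?thesis by simp
  qed
  have "indep_set (sets mB) (sets mW)"
    using ind by (simp add: independent_processes_def mB_def mW_def)
  \<comment> \<open>Independence passes from the sigma-algebras of the two processes to the smaller
    ones generated by one random variable each.\<close>
  then have "indep_set (sigma_sets (space P) {(\<lambda>\<omega>. c * T \<omega>) -` A \<inter> space P |A. A \<in> sets borel})
      (sigma_sets (space P) {W \<phi> -` A \<inter> space P |A. A \<in> sets borel})"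
    unfolding indep_sets2_eq using sub[OF TB sp(1)] sub[OF WW sp(2)] by blast
  then have "indep_var borel (\<lambda>\<omega>. c * T \<omega>) borel (W \<phi>)"
    unfolding indep_var_eq using T(2) Wm by simp
  then have "char (distr P borel (\<lambda>\<omega>. c * T \<omega> + W \<phi> \<omega>)) t =
      char (distr P borel (\<lambda>\<omega>. c * T \<omega>)) t * char (distr P borel (W \<phi>)) t" for t
    by (rule char_distr_add)
  moreover have "char (distr P borel (\<lambda>\<omega>. c * T \<omega>)) t = char (distr P borel T) (t * c)" for t
    using T(2) by (simp add: char_distr_eq mult.assoc)
  ultimately have "char (distr P borel (\<lambda>\<omega>. c * T \<omega> + W \<phi> \<omega>)) t = char (normal_law (c\<^sup>2 * \<bar>v\<bar> + \<bar>w\<bar>)) t" for t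
    by (simp add: T(3) lawW char_normal_law power_mult_distrib flip: of_real_mult exp_add)
       (simp add: abs_mult algebra_simps add_divide_distrib)
  then have "char (distr P borel (\<lambda>\<omega>. c * T \<omega> + W \<phi> \<omega>)) = char (normal_law (c\<^sup>2 * \<bar>v\<bar> + \<bar>w\<bar>))" by (rule ext)
  moreover have "real_distribution (distr P borel (\<lambda>\<omega>. c * T \<omega> + W \<phi> \<omega>))"
    using T(2) Wm by (intro real_distribution_distr) measurable
  ultimately show ?thesis
    unfolding T_def[symmetric] using Levy_uniqueness real_distribution_normal_law by blast
qed

section \<open>The observable that reads a single coordinate\<close>

lemma
  fixes f :: "nat \<Rightarrow> real"
  assumes i: "i \<in> I"
  shows integral_nu_prod_component: "(\<integral>\<eta>. f (\<eta> i) \<partial>nu_prod I \<theta>) = measure_pmf.expectation (nu (\<theta> i)) f"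
    and integrable_nu_prod_component:
      "integrable (nu_prod I \<theta>) (\<lambda>\<eta>. f (\<eta> i)) \<longleftrightarrow> integrable (measure_pmf (nu (\<theta> i))) f"
proof -
  have eq: "measure_pmf (nu (\<theta> i)) = distr (nu_prod I \<theta>) (measure_pmf (nu (\<theta> i))) (\<lambda>\<eta>. \<eta> i)"
    unfolding nu_prod_def by (rule distr_PiM_component[symmetric]) (auto simp: i prob_space_measure_pmf)
  have m: "(\<lambda>\<eta>. \<eta> i) \<in> measurable (nu_prod I \<theta>) (measure_pmf (nu (\<theta> i)))"
    unfolding nu_prod_def by (rule measurable_component_singleton[OF i])
  show "(\<integral>\<eta>. f (\<eta> i) \<partial>nu_prod I \<theta>) = measure_pmf.expectation (nu (\<theta> i)) f"
    by (subst eq) (rule integral_distr[OF m, symmetric], simp)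
  show "integrable (nu_prod I \<theta>) (\<lambda>\<eta>. f (\<eta> i)) \<longleftrightarrow> integrable (measure_pmf (nu (\<theta> i))) f"
    using integrable_distr_eq[OF m, of f] by (simp add: eq[symmetric])
qed

lemma expectation_nu: "0 \<le> x \<Longrightarrow> measure_pmf.expectation (nu x) real = x"
  unfolding nu_def by (subst expectation_geometric_pmf) (auto simp: field_simps)

lemma h_fun_first: "0 \<le> x \<Longrightarrow> h_fun (\<lambda>\<eta>. real (\<eta> 1)) x = x"
  unfolding h_fun_def using integral_nu_prod_component[where i = 1 and I = "{1..}" and f = real and \<theta> = "\<lambda>_. x"] expectation_nu[of x] by simp

text \<open>For \<open>k = 1\<close> the sum has the single term \<open>m = 1\<close>, the
  covariance of the coordinate with itself.\<close>

lemma V_fun_first: "V_fun 1 (\<lambda>\<eta>. real (\<eta> 1)) x = measure_pmf.variance (nu x) real"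
proof -
  have one: "(1::nat) \<in> {1..}" by simp
  have "shift 0 (\<lambda>\<eta>. real (\<eta> 1)) = (\<lambda>\<eta>. real (\<eta> 1))" by (simp add: shift_def fun_eq_iff)
  then show ?thesis
    using integral_nu_prod_component[OF one, where f = real and \<theta> = "\<lambda>_. x"]
      integral_nu_prod_component[OF one, where f = "\<lambda>n. (real n - measure_pmf.expectation (nu x) real)\<^sup>2" and \<theta> = "\<lambda>_. x"]
    by (simp add: V_fun_def Cov_def power2_eq_square)
qed

text \<open>\<open>nu\<close> is parametrised by its mean, so \<open>h_fun\<close> is the identity
  on \<open>{a..b}\<close> and both derivative factors are 1.\<close>

lemma sigma_T2_first:
  assumes "0 \<le> a" "a < b"
  shows "sigma_T2 a b \<phi> (\<lambda>\<eta>. real (\<eta> 1)) =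
    (b - a)\<^sup>2 * (\<integral>s. \<integral>t. (min s t - s * t) * \<phi> s * \<phi> t \<partial>unit_law \<partial>unit_law)"
proof -
  have vd: "vector_derivative (h_fun (\<lambda>\<eta>. real (\<eta> 1))) (at (rho a b s) within {a..b}) = 1" if s: "s \<in> {0..1}" for s
  proof (rule vector_derivative_within_closed_interval[OF assms(2)])
    show r: "rho a b s \<in> {a..b}"
      using measurable_space[OF rho_measurable[OF assms(2)], of s] s by simp
    have "(h_fun (\<lambda>\<eta>. real (\<eta> 1)) has_real_derivative 1) (at (rho a b s) within {a..b})"
      using r assms by (subst has_field_derivative_cong_eventually[where g="\<lambda>x. x"])
        (auto simp: eventually_at_filter h_fun_first)
    then show "(h_fun (\<lambda>\<eta>. real (\<eta> 1)) has_vector_derivative 1) (at (rho a b s) within {a..b})"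
      by (simp add: has_real_derivative_iff_has_vector_derivative)
  qed
  show ?thesis
    unfolding sigma_T2_def Let_def set_lebesgue_integral_unit_law
    by (intro arg_cong[where f="(*) ((b - a)\<^sup>2)"] Bochner_Integration.integral_cong refl)
       (simp_all only: space_unit_law vd mult_1_right)
qed

text \<open>The limit is stated with absolute values to match \<open>law_bridge_plus_noise\<close>
  literally; both integrals are nonnegative because they come from variances of the limit
  theorem.\<close>

lemma coordinate_clt:
  assumes a0: "0 \<le> a" and ab: "a < b" and smooth: "smooth_on_unit \<phi>"
  defines "v \<equiv> \<integral>s. \<integral>t. (min s t - s * t) * \<phi> s * \<phi> t \<partial>unit_law \<partial>unit_law"
    and "w \<equiv> LBINT x:{0..1}. measure_pmf.variance (nu (rho a b x)) real * (\<phi> x * \<phi> x)"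
  shows "weak_conv_m (\<lambda>N. distr (config_law a b N) borel
      (\<lambda>\<eta>. 1 / sqrt (real N) * (\<Sum>n = 1..N. (real (\<eta> n) - (\<integral>\<zeta>. real (\<zeta> n) \<partial>config_law a b N)) * \<phi> (real n / real (N + 1)))))
    (normal_law ((b - a)\<^sup>2 * \<bar>v\<bar> + \<bar>w\<bar>))"
proof -
  obtain \<phi>' L W where \<phi>: "\<And>s. s \<in> {0..1} \<Longrightarrow> (\<phi> has_real_derivative \<phi>' s) (at s within {0..1})"
    "\<And>s. s \<in> {0..1} \<Longrightarrow> \<bar>\<phi>' s\<bar> \<le> L" "\<And>s. s \<in> {0..1} \<Longrightarrow> \<bar>\<phi> s\<bar> \<le> W"
    using smooth_on_unit_C1[OF smooth] by blast
  define g :: "(nat \<Rightarrow> nat) \<Rightarrow> real" where "g \<eta> = real (\<eta> 1)" for \<eta>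
  have g_eq: "g = (\<lambda>\<eta>. real (\<eta> 1))" by (simp add: g_def fun_eq_iff)
  have "local_obs a b 1 g"
  proof
    have i1: "(1::nat) \<in> {1..1}" by simp
    show "local_function 1 g" by (simp add: local_function_def g_def)
    show "g \<in> borel_measurable (conf {1..1})" unfolding g_def by (rule measurable_component_conf) simp
    have "integrable (measure_pmf (nu b)) (\<lambda>n. real n ^ 4)"
      by (rule Bochner_Integration.integrable_bound[OF integrable_nu_power[of b 4]])
        (use a0 ab in \<open>auto intro!: AE_I2 power_mono\<close>)
    then show "integrable (nu_prod {1..1} (\<lambda>_. b)) (\<lambda>\<eta>. g \<eta> ^ 4)"
      unfolding g_def using integrable_nu_prod_component[OF i1, of "\<lambda>_. b" "\<lambda>n. real n ^ 4"] by simp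
  qed (use a0 ab in auto)
  \<comment> \<open>\<open>shift n g\<close> reads coordinate \<open>n + 1\<close>, whose weight is
    taken at \<open>(n + 1) / (N + 1)\<close>; hence \<open>d = 1\<close>.\<close>
  from weighted_obsI[OF this _ \<phi>, of 1]
  interpret weighted_obs a b 1 g \<phi> \<phi>' "\<lambda>N n. \<phi> (real (n + 1) / real (N + 1))" L W "2 * L" by simp
  have sT: "sigma_T2 a b \<phi> g = (b - a)\<^sup>2 * v" unfolding g_eq v_def by (rule sigma_T2_first[OF a0 ab])
  have sE: "sigma_E2 a b \<phi> 1 g = w" unfolding sigma_E2_def g_eq V_fun_first w_def power2_eq_square ..
  \<comment> \<open>The factor \<open>(b - a)\<^sup>2\<close> is strictly positive, so the sign of
    \<open>sigma_T2\<close> is that of \<open>v\<close>.\<close>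
  have "0 \<le> v" using sigma_T2_nonneg ab unfolding sT by (simp add: zero_le_mult_iff)
  moreover have "0 \<le> w" using sigma_E2_nonneg unfolding sE .
  ultimately have var: "sigma_T2 a b \<phi> g + sigma_E2 a b \<phi> 1 g = (b - a)\<^sup>2 * \<bar>v\<bar> + \<bar>w\<bar>"
    unfolding sT sE by simp
  have sum: "1 / sqrt (real N) * (\<Sum>n = 1..N. (real (\<eta> n) - (\<integral>\<zeta>. real (\<zeta> n) \<partial>config_law a b N)) * \<phi> (real n / real (N + 1)))
      = wsum N \<eta> / sqrt N" for N \<eta>
  \<comment> \<open>For \<open>N = 0\<close> both sides are 0, as division by \<open>sqrt 0\<close>
    gives 0. Otherwise the index is lowered by one, and the new upper end \<open>N - 1\<close> is
    \<open>N - k\<close> for \<open>k = 1\<close>.\<close>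
  proof (cases "N = 0")
    case False
    have "(\<Sum>n = 1..N. (real (\<eta> n) - (\<integral>\<zeta>. real (\<zeta> n) \<partial>config_law a b N)) * \<phi> (real n / real (N + 1))) =
        (\<Sum>n = 0..N - 1. (real (\<eta> (n + 1)) - (\<integral>\<zeta>. real (\<zeta> (n + 1)) \<partial>config_law a b N)) * \<phi> (real (n + 1) / real (N + 1)))"
      using False by (intro sum.reindex_bij_witness[of _ "\<lambda>n. n + 1" "\<lambda>n. n - 1"]) auto
    also have "\<dots> = wsum N \<eta>"
      unfolding wsum_def mean_def shift_def g_def ..
    finally have eq: "(\<Sum>n = 1..N. (real (\<eta> n) - (\<integral>\<zeta>. real (\<zeta> n) \<partial>config_law a b N)) * \<phi> (real n / real (N + 1))) = wsum N \<eta>" .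
    show ?thesis unfolding eq by simp
  qed simp
  show ?thesis unfolding sum var[symmetric] by (rule wsum_clt)
qed

theorem theorem6p1:
  fixes \<theta>L \<theta>R :: real and \<phi> :: "real \<Rightarrow> real"
  assumes "0 \<le> \<theta>L" and "\<theta>L < \<theta>R"
    and "smooth_on_unit \<phi>"
  shows
    "(\<forall>(k :: nat) (g :: (nat \<Rightarrow> nat) \<Rightarrow> real).
        k \<ge> 1 \<longrightarrow> local_function k g \<longrightarrow>
        (\<forall>N\<ge>k. \<forall>n\<in>{0..N - k}. \<forall>m\<in>{0..N - k}. \<forall>\<theta>\<in>{1..N} \<rightarrow> {\<theta>L..\<theta>R}.
           let P = nu_prod {1..N} \<theta>;
               X = (\<lambda>n \<eta>. shift n g \<eta> - (\<integral>\<zeta>. shift n g \<zeta> \<partial>P))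
           in integrable P (shift n g) \<and>
              integrable P (\<lambda>\<eta>. X n \<eta> ^ 4) \<and>
              finite_Cov P (X n) (X m)) \<longrightarrow>
        weak_conv_m
          (\<lambda>N. distr (config_law \<theta>L \<theta>R N) borel (fluctuation \<theta>L \<theta>R \<phi> k g N))
          (normal_law (sigma_T2 \<theta>L \<theta>R \<phi> g + sigma_E2 \<theta>L \<theta>R \<phi> k g)))
     \<and>
     (\<forall>(P :: 'b measure) (B :: real \<Rightarrow> 'b \<Rightarrow> real) (W :: (real \<Rightarrow> real) \<Rightarrow> 'b \<Rightarrow> real).
        brownian_bridge P B \<longrightarrow>
        white_noise P (\<lambda>x. measure_pmf.variance (nu (rho \<theta>L \<theta>R x)) real) W \<longrightarrow>
        independent_processes P {0..1} B (Collect smooth_on_unit) W \<longrightarrow>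
        weak_conv_m
          (\<lambda>N. distr (config_law \<theta>L \<theta>R N) borel
            (\<lambda>\<eta>. 1 / sqrt (real N) * (\<Sum>n = 1..N.
               (real (\<eta> n) - (\<integral>\<zeta>. real (\<zeta> n) \<partial>config_law \<theta>L \<theta>R N))
                 * \<phi> (real n / real (N + 1)))))
          (distr P borel
            (\<lambda>\<omega>. (\<theta>R - \<theta>L) * (LBINT s:{0..1}. \<phi> s * B s \<omega>) + W \<phi> \<omega>)))"
proof (intro conjI allI impI)
  fix k :: nat and g :: "(nat \<Rightarrow> nat) \<Rightarrow> real"
  assume k: "1 \<le> k" and g: "local_function k g"
    and H: "\<forall>N\<ge>k. \<forall>n\<in>{0..N - k}. \<forall>m\<in>{0..N - k}. \<forall>\<theta>\<in>{1..N} \<rightarrow> {\<theta>L..\<theta>R}.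
           let P = nu_prod {1..N} \<theta>;
               X = (\<lambda>n \<eta>. shift n g \<eta> - (\<integral>\<zeta>. shift n g \<zeta> \<partial>P))
           in integrable P (shift n g) \<and>
              integrable P (\<lambda>\<eta>. X n \<eta> ^ 4) \<and>
              finite_Cov P (X n) (X m)"
  \<comment> \<open>The moment condition is read off at \<open>N = k\<close> for the first window
    and the constant parameter \<open>\<theta>R\<close>, whose product law dominates all others with
    bounded density.\<close>
  have z: "(0::nat) \<in> {0..k - k}" and \<theta>: "(\<lambda>_. \<theta>R) \<in> {1..k} \<rightarrow> {\<theta>L..\<theta>R}" using assms by auto
  have s: "shift 0 g = g" by (simp add: shift_def fun_eq_iff)
  note * = H[unfolded Let_def, rule_format, OF order_refl z z \<theta>, unfolded s]
  show "weak_conv_m (\<lambda>N. distr (config_law \<theta>L \<theta>R N) borel (fluctuation \<theta>L \<theta>R \<phi> k g N))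
      (normal_law (sigma_T2 \<theta>L \<theta>R \<phi> g + sigma_E2 \<theta>L \<theta>R \<phi> k g))"
    by (rule fluctuation_clt[OF assms k g conjunct1[OF *] conjunct1[OF conjunct2[OF *]]])
next
  fix P :: "'b measure" and B W
  assume *: "brownian_bridge P B" "white_noise P (\<lambda>x. measure_pmf.variance (nu (rho \<theta>L \<theta>R x)) real) W"
    "independent_processes P {0..1} B (Collect smooth_on_unit) W"
  obtain \<phi>' L C where "\<And>s. s \<in> {0..1} \<Longrightarrow> (\<phi> has_real_derivative \<phi>' s) (at s within {0..1})"
    "\<And>s. s \<in> {0..1} \<Longrightarrow> \<bar>\<phi>' s\<bar> \<le> L" "\<And>s. s \<in> {0..1} \<Longrightarrow> \<bar>\<phi> s\<bar> \<le> C"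
    using smooth_on_unit_C1[OF assms(3)] by blast
  then have cont: "continuous_on {0..1} \<phi>" by (intro DERIV_continuous_on)
  show "weak_conv_m
          (\<lambda>N. distr (config_law \<theta>L \<theta>R N) borel
            (\<lambda>\<eta>. 1 / sqrt (real N) * (\<Sum>n = 1..N.
               (real (\<eta> n) - (\<integral>\<zeta>. real (\<zeta> n) \<partial>config_law \<theta>L \<theta>R N))
                 * \<phi> (real n / real (N + 1)))))
          (distr P borel
            (\<lambda>\<omega>. (\<theta>R - \<theta>L) * (LBINT s:{0..1}. \<phi> s * B s \<omega>) + W \<phi> \<omega>))"
    \<comment> \<open>The law of bridge integral plus noise is rewritten as the normal law that the
      coordinate sums converge to.\<close>
    unfolding law_bridge_plus_noise[OF * assms(3) cont] by (rule coordinate_clt[OF assms])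
qed

end
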